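(* Let $S\subset\mathbb{N}^d$ be the semigroup generated by nonzero vectors $\mathbf{m}_1,\dots,\mathbf{m}_n\in\mathbb{N}^d$, and let $V_{S_{\ell,\mathbf{m}}}\subset\mathbb{A}^{n+1}$ be an extension of $V_S\subset\mathbb{A}^n$ with $\ell\le\Delta(\mathbf{m})$. If $V_S$ has a Cohen-Macaulay (respectively Gorenstein) tangent cone at $0$, then so has $V_{S_{\ell,\mathbf{m}}}$.
   Context: $K$ is an algebraically closed field of any characteristic and $\mathbb{N}$ denotes the non-negative integers. For a semigroup $S\subset\mathbb{N}^d$ generated by $\mathbf{m}_1,\dots,\mathbf{m}_n$, set $\deg_S(x_1^{b_1}\cdots x_n^{b_n})=b_1\mathbf{m}_1+\cdots+b_n\mathbf{m}_n$. The toric ideal $I_S\subset K[x_1,\dots,x_n]$ is the ideal generated by all binomials $\mathbf{x}^{\mathbf{a}}-\mathbf{x}^{\mathbf{b}}$ with $\deg_S(\mathbf{x}^{\mathbf{a}})=\deg_S(\mathbf{x}^{\mathbf{b}})$, and $V_S\subset\mathbb{A}^n$ is its zero set. For a positive integer $\ell$ and $\mathbf{m}\in\mathbb{N}^d$, $S_{\ell,\mathbf{m}}$ denotes the semigroup generated by $\ell\mathbf{m}_1,\dots,\ell\mathbf{m}_n,\mathbf{m}$ (in this order, so that $I_{S_{\ell,\mathbf{m}}}\subset K[x_1,\dots,x_{n+1}]$). $V_{S_{\ell,\mathbf{m}}}\subset\mathbb{A}^{n+1}$ is an extension of $V_S\subset\mathbb{A}^n$ if $\mathbf{m}\in S$ and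 $\ell$ is a positive integer relatively prime to a component of $\mathbf{m}$. For $\mathbf{m}\in S$, $\Delta(\mathbf{m})$ is the maximum of all sums $s_1+\cdots+s_n$ over non-negative integers $s_1,\dots,s_n$ with $\mathbf{m}=s_1\mathbf{m}_1+\cdots+s_n\mathbf{m}_n$. For a nonzero polynomial $f$, $f^*$ is its homogeneous summand of smallest degree. $I_S^*$ is the ideal generated by all $f^*$ with $0\ne f\in I_S$; it is the ideal of the tangent cone of $V_S$ at the origin, and $K[x_1,\dots,x_n]/I_S^*$ is isomorphic to the associated graded ring of the local ring of $V_S$ at the origin. The tangent cone of $V_S$ at $0$ is Cohen-Macaulay (Gorenstein) if $K[x_1,\dots,x_n]/I_S^*$ is Cohen-Macaulay (Gorenstein); likewise for $V_{S_{\ell,\mathbf{m}}}$ with $K[x_1,\dots,x_{n+1}]/I_{S_{\ell,\mathbf{m}}}^*$. *)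

theory Defs
  imports
    "HOL-Library.Poly_Mapping"
    "HOL-Library.Extended_Nat"
    "HOL-Computational_Algebra.Polynomial"
    "HOL-Analysis.Finite_Cartesian_Product"
    "HOL-Algebra.QuotRing"
    "HOL-Algebra.Ring_Divisibility"
    "HOL-Algebra.Module"
begin

section \<open>Polynomial rings in finitely many variables\<close>

text \<open>
  A monomial is its exponent vector, a finitely supported function \<^typ>\<open>nat \<Rightarrow>\<^sub>0 nat\<close>, and a
  polynomial maps monomials to coefficients.  The variables of \<open>K[x\<^sub>1, \<dots>, x\<^sub>n]\<close> are numbered
  \<open>0, \<dots>, n - 1\<close>, so that \<open>K[x\<^sub>1, \<dots>, x\<^sub>n]\<close> and \<open>K[x\<^sub>1, \<dots>, x\<^sub>n\<^sub>+\<^sub>1]\<close> are subrings of one type.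
\<close>

type_synonym 'k mpoly = "(nat \<Rightarrow>\<^sub>0 nat) \<Rightarrow>\<^sub>0 'k"

definition monomials :: "nat \<Rightarrow> (nat \<Rightarrow>\<^sub>0 nat) set"
  where "monomials n = {a. Poly_Mapping.keys a \<subseteq> {..<n}}"

definition mpoly_ring :: "nat \<Rightarrow> 'k::comm_ring_1 mpoly ring"
  where "mpoly_ring n =
    \<lparr>carrier = {p. Poly_Mapping.keys p \<subseteq> monomials n}, mult = (*), one = 1, zero = 0, add = (+)\<rparr>"

definition total_deg :: "(nat \<Rightarrow>\<^sub>0 nat) \<Rightarrow> nat"
  where "total_deg a = (\<Sum>i\<in>Poly_Mapping.keys a. Poly_Mapping.lookup a i)"

text \<open>The summand \<open>f\<^sup>*\<close> of smallest degree; meaningful only for \<open>f \<noteq> 0\<close>.\<close>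

definition initial_form :: "'k::comm_ring_1 mpoly \<Rightarrow> 'k mpoly"
  where "initial_form f =
    (\<Sum>a\<in>{a \<in> Poly_Mapping.keys f. total_deg a = Min (total_deg ` Poly_Mapping.keys f)}.
      Poly_Mapping.single a (Poly_Mapping.lookup f a))"


section \<open>Toric ideals, tangent cones and extensions\<close>

text \<open>A semigroup in \<open>\<nat>\<^sup>d\<close> is given by the list of its generators \<open>m\<^sub>1, \<dots>, m\<^sub>n\<close>.\<close>

definition semigroup_deg :: "(nat ^ 'd) list \<Rightarrow> (nat \<Rightarrow>\<^sub>0 nat) \<Rightarrow> nat ^ 'd"
  where "semigroup_deg ms b = (\<Sum>i<length ms. Poly_Mapping.lookup b i *s ms ! i)"

definition affine_semigroup :: "(nat ^ 'd) list \<Rightarrow> (nat ^ 'd) set"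
  where "affine_semigroup ms = semigroup_deg ms ` monomials (length ms)"

definition toric_ideal :: "(nat ^ 'd) list \<Rightarrow> 'k::comm_ring_1 mpoly set"
  where "toric_ideal ms = Idl\<^bsub>mpoly_ring (length ms)\<^esub>
    {Poly_Mapping.single a 1 - Poly_Mapping.single b 1 | a b.
      a \<in> monomials (length ms) \<and> b \<in> monomials (length ms) \<and>
      semigroup_deg ms a = semigroup_deg ms b}"

definition tangent_cone_ideal :: "(nat ^ 'd) list \<Rightarrow> 'k::comm_ring_1 mpoly set"
  where "tangent_cone_ideal ms = Idl\<^bsub>mpoly_ring (length ms)\<^esub>
    {initial_form f | f. f \<in> toric_ideal ms \<and> f \<noteq> 0}"

definition tangent_cone_ring :: "(nat ^ 'd) list \<Rightarrow> 'k::comm_ring_1 mpoly set ring"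
  where "tangent_cone_ring ms = mpoly_ring (length ms) Quot tangent_cone_ideal ms"

definition extension_gens :: "nat \<Rightarrow> nat ^ 'd \<Rightarrow> (nat ^ 'd) list \<Rightarrow> (nat ^ 'd) list"
  where "extension_gens l m ms = map (\<lambda>v. l *s v) ms @ [m]"

definition is_extension :: "nat \<Rightarrow> nat ^ 'd \<Rightarrow> (nat ^ 'd) list \<Rightarrow> bool"
  where "is_extension l m ms \<longleftrightarrow>
    m \<in> affine_semigroup ms \<and> l > 0 \<and> (\<exists>j. coprime l (m $ j))"

text \<open>The set is finite and nonempty when all generators are nonzero and \<open>m\<close> is in the semigroup.\<close>

definition max_length :: "(nat ^ 'd) list \<Rightarrow> nat ^ 'd \<Rightarrow> nat"
  where "max_length ms m =
    Max {total_deg s | s. s \<in> monomials (length ms) \<and> semigroup_deg ms s = m}"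


section \<open>Localization of a commutative ring at a prime ideal\<close>

definition fraction_rel :: "'a ring \<Rightarrow> 'a set \<Rightarrow> (('a \<times> 'a) \<times> ('a \<times> 'a)) set"
  where "fraction_rel R P = {((a, s), (b, t)).
    a \<in> carrier R \<and> b \<in> carrier R \<and> s \<in> carrier R - P \<and> t \<in> carrier R - P \<and>
    (\<exists>u \<in> carrier R - P. u \<otimes>\<^bsub>R\<^esub> (a \<otimes>\<^bsub>R\<^esub> t) = u \<otimes>\<^bsub>R\<^esub> (b \<otimes>\<^bsub>R\<^esub> s))}"

definition fraction :: "'a ring \<Rightarrow> 'a set \<Rightarrow> 'a \<Rightarrow> 'a \<Rightarrow> ('a \<times> 'a) set"
  where "fraction R P a s = fraction_rel R P `` {(a, s)}"

definition localization :: "'a ring \<Rightarrow> 'a set \<Rightarrow> ('a \<times> 'a) set ring"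
  where "localization R P =
    \<lparr>carrier = (carrier R \<times> (carrier R - P)) // fraction_rel R P,
     mult = (\<lambda>X Y. \<Union>(a, s)\<in>X. \<Union>(b, t)\<in>Y. fraction R P (a \<otimes>\<^bsub>R\<^esub> b) (s \<otimes>\<^bsub>R\<^esub> t)),
     one = fraction R P \<one>\<^bsub>R\<^esub> \<one>\<^bsub>R\<^esub>,
     zero = fraction R P \<zero>\<^bsub>R\<^esub> \<one>\<^bsub>R\<^esub>,
     add = (\<lambda>X Y. \<Union>(a, s)\<in>X. \<Union>(b, t)\<in>Y.
       fraction R P (a \<otimes>\<^bsub>R\<^esub> t \<oplus>\<^bsub>R\<^esub> b \<otimes>\<^bsub>R\<^esub> s) (s \<otimes>\<^bsub>R\<^esub> t))\<rparr>"


section \<open>Cohen-Macaulay rings\<close>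

definition krull_dim :: "'a ring \<Rightarrow> enat"
  where "krull_dim R = Sup {enat n | n. \<exists>P :: nat \<Rightarrow> 'a set.
    (\<forall>i\<le>n. primeideal (P i) R) \<and> (\<forall>i<n. P i \<subset> P (Suc i))}"

definition regular_sequence :: "'a ring \<Rightarrow> 'a list \<Rightarrow> bool"
  where "regular_sequence R xs \<longleftrightarrow>
    set xs \<subseteq> carrier R \<and> Idl\<^bsub>R\<^esub> (set xs) \<noteq> carrier R \<and>
    (\<forall>i<length xs. \<forall>a \<in> carrier R.
      xs ! i \<otimes>\<^bsub>R\<^esub> a \<in> Idl\<^bsub>R\<^esub> (set (take i xs)) \<longrightarrow> a \<in> Idl\<^bsub>R\<^esub> (set (take i xs)))"

definition depth :: "'a ring \<Rightarrow> 'a set \<Rightarrow> enat"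
  where "depth R M = Sup {enat (length xs) | xs. regular_sequence R xs \<and> set xs \<subseteq> M}"

definition cohen_macaulay_local :: "'a ring \<Rightarrow> bool"
  where "cohen_macaulay_local R \<longleftrightarrow> cring R \<and> noetherian_ring R \<and>
    (\<exists>M. {J. maximalideal J R} = {M} \<and> depth R M = krull_dim R)"

definition cohen_macaulay :: "'a ring \<Rightarrow> bool"
  where "cohen_macaulay R \<longleftrightarrow> cring R \<and> noetherian_ring R \<and>
    (\<forall>M. maximalideal M R \<longrightarrow> cohen_macaulay_local (localization R M))"


section \<open>Gorenstein rings\<close>

definition module_hom :: "'a ring \<Rightarrow> ('a, 'b) module \<Rightarrow> ('a, 'c) module \<Rightarrow> ('b \<Rightarrow> 'c) set"
  where "module_hom R M N = {h \<in> hom (add_monoid M) (add_monoid N).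
    \<forall>r \<in> carrier R. \<forall>x \<in> carrier M. h (r \<odot>\<^bsub>M\<^esub> x) = r \<odot>\<^bsub>N\<^esub> h x}"

definition self_module :: "'a ring \<Rightarrow> ('a, 'a) module"
  where "self_module R = \<lparr>carrier = carrier R, mult = mult R, one = one R, zero = zero R, add = add R,
    smult = mult R\<rparr>"

text \<open>
  The test modules \<open>N\<close> and \<open>N'\<close> have the carrier type of \<open>E\<close>.  By Baer's criterion this is the
  usual notion as soon as that type is large enough to hold a copy of \<open>R\<close>.
\<close>

definition injective_module :: "'a ring \<Rightarrow> ('a, 'b) module \<Rightarrow> bool"
  where "injective_module R E \<longleftrightarrow> Module.module R E \<and>
    (\<forall>(N :: ('a, 'b) module) (N' :: ('a, 'b) module) i f.
      Module.module R N \<and> Module.module R N' \<and>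
      i \<in> module_hom R N N' \<and> inj_on i (carrier N) \<and> f \<in> module_hom R N E \<longrightarrow>
      (\<exists>g \<in> module_hom R N' E. \<forall>x \<in> carrier N. g (i x) = f x))"

text \<open>
  There is an exact sequence \<open>0 \<rightarrow> M \<rightarrow> E\<^sub>0 \<rightarrow> E\<^sub>1 \<rightarrow> \<dots>\<close> with all \<open>E\<^sub>i\<close> injective and
  \<open>E\<^sub>i = 0\<close> for \<open>i > r\<close>.  The modules live in the type \<^typ>\<open>nat \<Rightarrow> 'a\<close>, where \<^typ>\<open>'a\<close> is the type
  of the ring elements.  For \<open>R\<close> noetherian and \<open>M\<close> finitely generated this is no restriction: the
  minimal injective resolution of \<open>M\<close> consists of modules with at most \<open>max |R| \<aleph>\<^sub>0\<close> elements.
\<close>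

definition finite_injective_dim :: "'a ring \<Rightarrow> ('a, 'b) module \<Rightarrow> bool"
  where "finite_injective_dim R M \<longleftrightarrow>
    (\<exists>(E :: nat \<Rightarrow> ('a, nat \<Rightarrow> 'a) module) \<epsilon> d r.
      (\<forall>i. injective_module R (E i)) \<and>
      \<epsilon> \<in> module_hom R M (E 0) \<and> inj_on \<epsilon> (carrier M) \<and>
      (\<forall>i. d i \<in> module_hom R (E i) (E (Suc i))) \<and>
      \<epsilon> ` carrier M = a_kernel (E 0) (E 1) (d 0) \<and>
      (\<forall>i. d i ` carrier (E i) = a_kernel (E (Suc i)) (E (Suc (Suc i))) (d (Suc i))) \<and>
      (\<forall>i>r. carrier (E i) = {\<zero>\<^bsub>E i\<^esub>}))"

definition gorenstein_local :: "'a ring \<Rightarrow> bool"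
  where "gorenstein_local R \<longleftrightarrow> cring R \<and> noetherian_ring R \<and>
    (\<exists>M. {J. maximalideal J R} = {M}) \<and> finite_injective_dim R (self_module R)"

definition gorenstein :: "'a ring \<Rightarrow> bool"
  where "gorenstein R \<longleftrightarrow> cring R \<and> noetherian_ring R \<and>
    (\<forall>M. maximalideal M R \<longrightarrow> gorenstein_local (localization R M))"

end

theory Submission
  imports Defs "HOL-Library.Nat_Bijection" "HOL-Number_Theory.Cong"
begin

text \<open>
  Choose \<open>s\<close> with \<open>m = s\<^sub>1 m\<^sub>1 + \<dots> + s\<^sub>n m\<^sub>n\<close> and \<open>l \<le> |s|\<close>.  Coprimality makes the toric ideal of the
  extension equal to \<open>I\<^sub>S + (y\<^sup>l - x\<^sup>s)\<close>, and because \<open>l \<le> |s|\<close> division by the monic \<open>y\<^sup>l - x\<^sup>s\<close> never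
  lowers degrees, so its tangent cone ideal is \<open>I\<^sub>S\<^sup>* + (y\<^sup>l - a)\<close> with \<open>a = x\<^sup>s\<close> if \<open>l = |s|\<close> and \<open>a = 0\<close>
  otherwise.  Hence the new coordinate ring is \<open>B = A[y]/(y\<^sup>l - a)\<close> over the old one \<open>A\<close>: a finite free
  extension on which the coefficient of \<open>y\<^sup>l\<^sup>-\<^sup>1\<close> is a Frobenius functional, that is, \<open>Hom\<^sub>A(B, A) \<cong> B\<close>.

  For \<open>N\<close> maximal in \<open>B\<close> over \<open>M\<close> in \<open>A\<close>, regular sequences of \<open>A\<^sub>M\<close> stay regular in \<open>B\<^sub>N\<close> and
  \<open>dim B\<^sub>N \<le> dim A\<^sub>M\<close> by incomparability, which gives the Cohen-Macaulay part.  An injective resolution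
  of \<open>A\<^sub>M\<close> becomes one of \<open>B\<^sub>N\<close> by applying \<open>Hom\<^sub>A(B, -)\<close> and localizing at \<open>N\<close>, and over a noetherian
  ring localization preserves injectivity.
\<close>

section \<open>Localization at a prime ideal\<close>

text \<open>The statement fixes carrier types: \<open>injective_module\<close> tests only modules of
  the type of E, and \<open>finite_injective_dim\<close> wants modules in
  \<open>nat \<Rightarrow> 'a\<close>. Hence the work is done with Baer's condition, which
  quantifies over ideals alone, and structures change type only at the two ends. Coinduced modules
  consist of functions on B; they fit because a homomorphism out of B is determined by its values on
  finitely many u_i. Hom_A(B, A_M) is a localization of B that may still have several maximal
  ideals, one for each maximal ideal of B over M. Coinduction is therefore followed by localization
  at N, and injectives must survive it. This is where the Noetherian property enters: stable
  annihilators give divisibility modulo torsion, and finitely generated ideals allow maps to be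
  extended with one common denominator. The functional reads off y^(l-1) because multiplication by
  y^(l-1-i) moves the coefficient of y^i to that place without reaching y^l; so the y^(l-1-i) are
  dual to the y^i whatever a is.\<close>

lemma (in cring) cring_idealI:
  assumes "J \<subseteq> carrier R" "\<zero> \<in> J" "\<And>x y. x \<in> J \<Longrightarrow> y \<in> J \<Longrightarrow> x \<oplus> y \<in> J"
    and mult: "\<And>r x. r \<in> carrier R \<Longrightarrow> x \<in> J \<Longrightarrow> r \<otimes> x \<in> J"
  shows "ideal J R"
proof (rule idealI)
  show "subgroup J (add_monoid R)"
  proof (rule add.subgroupI)
    fix x assume x: "x \<in> J"
    then have "(\<ominus> \<one>) \<otimes> x \<in> J" by (intro mult) auto
    then show "\<ominus> x \<in> J" using x assms(1) by (simp add: l_minus subset_eq)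
  qed (use assms in auto)
  fix x r assume "x \<in> J" "r \<in> carrier R"
  then show "r \<otimes> x \<in> J" "x \<otimes> r \<in> J"
    using mult[of r x] assms(1) by (auto simp: m_comm)
qed (rule ring_axioms)

locale prime_localization = primeideal I R for I and R :: "'a ring" (structure)
begin

lemma one_notin [simp]: "\<one> \<notin> I"
  using I_notcarr one_imp_carrier by auto

lemma one_compl: "\<one> \<in> carrier R - I"
  by simp

lemma mult_compl: "s \<in> carrier R - I \<Longrightarrow> t \<in> carrier R - I \<Longrightarrow> s \<otimes> t \<in> carrier R - I"
  using I_prime by auto

lemma equiv_fraction_rel: "equiv (carrier R \<times> (carrier R - I)) (fraction_rel R I)"
proof (rule equivI)
  show "fraction_rel R I \<subseteq> (carrier R \<times> (carrier R - I)) \<times> (carrier R \<times> (carrier R - I))"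
    by (auto simp: fraction_rel_def)
  show "refl_on (carrier R \<times> (carrier R - I)) (fraction_rel R I)"
    by (rule refl_onI) (use one_compl in \<open>auto simp: fraction_rel_def\<close>)
  show "sym (fraction_rel R I)"
  proof (rule symI, clarify)
    fix a s b t
    assume "((a, s), (b, t)) \<in> fraction_rel R I"
    then show "((b, t), (a, s)) \<in> fraction_rel R I"
      unfolding fraction_rel_def by simp (metis (no_types))
  qed
  show "trans (fraction_rel R I)"
  proof (rule transI, clarify)
    fix a s b t c r
    assume *: "((a, s), (b, t)) \<in> fraction_rel R I" "((b, t), (c, r)) \<in> fraction_rel R I"
    then have C: "a \<in> carrier R" "b \<in> carrier R" "c \<in> carrier R"
      "s \<in> carrier R - I" "t \<in> carrier R - I" "r \<in> carrier R - I"
      by (auto simp: fraction_rel_def)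
    obtain u v where uv: "u \<in> carrier R - I" "v \<in> carrier R - I"
      and 1: "u \<otimes> (a \<otimes> t) = u \<otimes> (b \<otimes> s)" and 2: "v \<otimes> (b \<otimes> r) = v \<otimes> (c \<otimes> t)"
      using * by (auto simp: fraction_rel_def)
    note C' = C uv C(4-6)[THEN DiffD1] uv[THEN DiffD1]
    \<comment> \<open>The given equations compare a t with b s and b r with c t, so a r can be
      reached only with the middle denominator t as an extra factor of the witness.\<close>
    have "(u \<otimes> v \<otimes> t) \<otimes> (a \<otimes> r) = v \<otimes> r \<otimes> (u \<otimes> (a \<otimes> t))"
      using C' by (simp add: m_ac)
    also have "\<dots> = u \<otimes> s \<otimes> (v \<otimes> (b \<otimes> r))"
      unfolding 1 using C' by (simp add: m_ac)
    also have "\<dots> = (u \<otimes> v \<otimes> t) \<otimes> (c \<otimes> s)"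
      unfolding 2 using C' by (simp add: m_ac)
    finally show "((a, s), (c, r)) \<in> fraction_rel R I"
      using C uv mult_compl by (auto simp: fraction_rel_def)
  qed
qed

lemma fraction_eq_iff:
  assumes "a \<in> carrier R" "b \<in> carrier R" "s \<in> carrier R - I" "t \<in> carrier R - I"
  shows "fraction R I a s = fraction R I b t \<longleftrightarrow>
    (\<exists>u \<in> carrier R - I. u \<otimes> (a \<otimes> t) = u \<otimes> (b \<otimes> s))"
  unfolding fraction_def
  using eq_equiv_class_iff[OF equiv_fraction_rel, of "(a, s)" "(b, t)"] assms
  by (auto simp: fraction_rel_def)

lemma fraction_eqI:
  assumes "u \<in> carrier R - I" "a \<in> carrier R" "b \<in> carrier R" "s \<in> carrier R - I"
    "t \<in> carrier R - I" "u \<otimes> (a \<otimes> t) = u \<otimes> (b \<otimes> s)"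
  shows "fraction R I a s = fraction R I b t"
  using assms fraction_eq_iff by blast

lemma fraction_cancel:
  assumes "a \<in> carrier R" "s \<in> carrier R - I" "t \<in> carrier R - I"
  shows "fraction R I (t \<otimes> a) (t \<otimes> s) = fraction R I a s"
  by (rule fraction_eqI[OF one_compl])
    (use assms mult_compl[OF assms(3,2)] in \<open>simp_all add: m_ac\<close>)

lemma fraction_cases:
  assumes "X \<in> carrier (localization R I)"
  obtains a s where "a \<in> carrier R" "s \<in> carrier R - I" "X = fraction R I a s"
  using assms by (auto simp: localization_def fraction_def elim!: quotientE)

lemma fraction_closed [simp]:
  "a \<in> carrier R \<Longrightarrow> s \<in> carrier R - I \<Longrightarrow> fraction R I a s \<in> carrier (localization R I)"
  by (auto simp: localization_def fraction_def intro: quotientI)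

lemma mem_fraction:
  assumes "(b, t) \<in> fraction R I a s"
  shows "b \<in> carrier R" "t \<in> carrier R - I" "fraction R I b t = fraction R I a s"
proof -
  have *: "((a, s), (b, t)) \<in> fraction_rel R I"
    using assms by (simp add: fraction_def)
  then show "b \<in> carrier R" "t \<in> carrier R - I"
    by (simp_all add: fraction_rel_def)
  show "fraction R I b t = fraction R I a s"
    unfolding fraction_def using equiv_class_eq[OF equiv_fraction_rel *] by (rule sym)
qed

lemma fraction_self: "a \<in> carrier R \<Longrightarrow> s \<in> carrier R - I \<Longrightarrow> (a, s) \<in> fraction R I a s"
  using equiv_class_self[OF equiv_fraction_rel, of "(a, s)"] by (auto simp: fraction_def)

text \<open>The operations of \<open>localization\<close> are unions over all pairs of
  representatives. Once an expression is constant on representatives, the union collapses to a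
  single value.\<close>

lemma fraction_UN:
  assumes "a \<in> carrier R" "b \<in> carrier R" "s \<in> carrier R - I" "t \<in> carrier R - I"
    and "\<And>a' s' b' t'. a' \<in> carrier R \<Longrightarrow> b' \<in> carrier R \<Longrightarrow> s' \<in> carrier R - I \<Longrightarrow>
      t' \<in> carrier R - I \<Longrightarrow> fraction R I a' s' = fraction R I a s \<Longrightarrow>
      fraction R I b' t' = fraction R I b t \<Longrightarrow> F a' s' b' t' = F a s b t"
  shows "(\<Union>(a', s')\<in>fraction R I a s. \<Union>(b', t')\<in>fraction R I b t. F a' s' b' t') = F a s b t"
proof -
  have "F a' s' b' t' = F a s b t"
    if "(a', s') \<in> fraction R I a s" "(b', t') \<in> fraction R I b t" for a' s' b' t'
    using mem_fraction[OF that(1)] mem_fraction[OF that(2)] by (intro assms(5)) simp_all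
  moreover have "(a, s) \<in> fraction R I a s" "(b, t) \<in> fraction R I b t"
    using assms by (auto intro: fraction_self)
  ultimately show ?thesis by blast
qed

lemma fraction_mult:
  assumes "a \<in> carrier R" "b \<in> carrier R" "s \<in> carrier R - I" "t \<in> carrier R - I"
  shows "fraction R I a s \<otimes>\<^bsub>localization R I\<^esub> fraction R I b t = fraction R I (a \<otimes> b) (s \<otimes> t)"
proof -
  have "fraction R I (a' \<otimes> b') (s' \<otimes> t') = fraction R I (a \<otimes> b) (s \<otimes> t)"
    if C: "a' \<in> carrier R" "b' \<in> carrier R" "s' \<in> carrier R - I" "t' \<in> carrier R - I"
      and e: "fraction R I a' s' = fraction R I a s" "fraction R I b' t' = fraction R I b t"
    for a' s' b' t'
  proof -
    obtain u v where uv: "u \<in> carrier R - I" "v \<in> carrier R - I"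
      and 1: "u \<otimes> (a' \<otimes> s) = u \<otimes> (a \<otimes> s')" and 2: "v \<otimes> (b' \<otimes> t) = v \<otimes> (b \<otimes> t')"
      using e C assms by (auto simp: fraction_eq_iff)
    have "(u \<otimes> v) \<otimes> ((a' \<otimes> b') \<otimes> (s \<otimes> t)) = (u \<otimes> (a' \<otimes> s)) \<otimes> (v \<otimes> (b' \<otimes> t))"
      using C assms uv by (simp add: m_ac)
    also have "\<dots> = (u \<otimes> v) \<otimes> ((a \<otimes> b) \<otimes> (s' \<otimes> t'))"
      unfolding 1 2 using C assms uv by (simp add: m_ac)
    finally show ?thesis
      by (rule fraction_eqI[rotated 5])
        (use C assms mult_compl[OF uv] mult_compl[OF C(3,4)] mult_compl[OF assms(3,4)] in simp_all)
  qed
  then show ?thesis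
    unfolding localization_def ring_record_simps by (rule fraction_UN[OF assms])
qed

lemma fraction_add:
  assumes "a \<in> carrier R" "b \<in> carrier R" "s \<in> carrier R - I" "t \<in> carrier R - I"
  shows "fraction R I a s \<oplus>\<^bsub>localization R I\<^esub> fraction R I b t =
    fraction R I (a \<otimes> t \<oplus> b \<otimes> s) (s \<otimes> t)"
proof -
  have "fraction R I (a' \<otimes> t' \<oplus> b' \<otimes> s') (s' \<otimes> t') = fraction R I (a \<otimes> t \<oplus> b \<otimes> s) (s \<otimes> t)"
    if C: "a' \<in> carrier R" "b' \<in> carrier R" "s' \<in> carrier R - I" "t' \<in> carrier R - I"
      and e: "fraction R I a' s' = fraction R I a s" "fraction R I b' t' = fraction R I b t"
    for a' s' b' t'
  proof -
    obtain u v where uv: "u \<in> carrier R - I" "v \<in> carrier R - I"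
      and 1: "u \<otimes> (a' \<otimes> s) = u \<otimes> (a \<otimes> s')" and 2: "v \<otimes> (b' \<otimes> t) = v \<otimes> (b \<otimes> t')"
      using e C assms by (auto simp: fraction_eq_iff)
    have "(u \<otimes> v) \<otimes> ((a' \<otimes> t' \<oplus> b' \<otimes> s') \<otimes> (s \<otimes> t)) =
        v \<otimes> t' \<otimes> t \<otimes> (u \<otimes> (a' \<otimes> s)) \<oplus> u \<otimes> s' \<otimes> s \<otimes> (v \<otimes> (b' \<otimes> t))"
      using C assms uv by (simp add: m_ac r_distr l_distr)
    also have "\<dots> = (u \<otimes> v) \<otimes> ((a \<otimes> t \<oplus> b \<otimes> s) \<otimes> (s' \<otimes> t'))"
      unfolding 1 2 using C assms uv by (simp add: m_ac r_distr l_distr)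
    finally show ?thesis
      by (rule fraction_eqI[rotated 5])
        (use C assms mult_compl[OF uv] mult_compl[OF C(3,4)] mult_compl[OF assms(3,4)] in simp_all)
  qed
  then show ?thesis
    unfolding localization_def ring_record_simps by (rule fraction_UN[OF assms])
qed

lemma localization_one: "\<one>\<^bsub>localization R I\<^esub> = fraction R I \<one> \<one>"
  and localization_zero: "\<zero>\<^bsub>localization R I\<^esub> = fraction R I \<zero> \<one>"
  by (simp_all add: localization_def)

lemma fraction_cases3:
  assumes "x \<in> carrier (localization R I)" "y \<in> carrier (localization R I)"
    "z \<in> carrier (localization R I)"
  obtains a s b t c r where "a \<in> carrier R" "s \<in> carrier R - I" "b \<in> carrier R"
    "t \<in> carrier R - I" "c \<in> carrier R" "r \<in> carrier R - I"
    "x = fraction R I a s" "y = fraction R I b t" "z = fraction R I c r"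
  by (rule fraction_cases[OF assms(1)], rule fraction_cases[OF assms(2)],
      rule fraction_cases[OF assms(3)]) (rule that)

lemma cring_localization: "cring (localization R I)"
proof (rule cringI)
  let ?L = "localization R I"
  note [simp] = fraction_mult fraction_add localization_one localization_zero mult_compl
  \<comment> \<open>All laws are stated in the same three variables, so that one choice of
    representatives serves for all of them; surplus variables are instantiated by zero when the
    axioms are assembled.\<close>
  have main: "x \<oplus>\<^bsub>?L\<^esub> y \<in> carrier ?L" "x \<oplus>\<^bsub>?L\<^esub> y = y \<oplus>\<^bsub>?L\<^esub> x"
      "x \<oplus>\<^bsub>?L\<^esub> y \<oplus>\<^bsub>?L\<^esub> z = x \<oplus>\<^bsub>?L\<^esub> (y \<oplus>\<^bsub>?L\<^esub> z)"
      "\<zero>\<^bsub>?L\<^esub> \<oplus>\<^bsub>?L\<^esub> x = x" "\<exists>y \<in> carrier ?L. y \<oplus>\<^bsub>?L\<^esub> x = \<zero>\<^bsub>?L\<^esub>"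
      "x \<otimes>\<^bsub>?L\<^esub> y \<in> carrier ?L" "x \<otimes>\<^bsub>?L\<^esub> y = y \<otimes>\<^bsub>?L\<^esub> x"
      "x \<otimes>\<^bsub>?L\<^esub> y \<otimes>\<^bsub>?L\<^esub> z = x \<otimes>\<^bsub>?L\<^esub> (y \<otimes>\<^bsub>?L\<^esub> z)" "\<one>\<^bsub>?L\<^esub> \<otimes>\<^bsub>?L\<^esub> x = x"
      "(x \<oplus>\<^bsub>?L\<^esub> y) \<otimes>\<^bsub>?L\<^esub> z = x \<otimes>\<^bsub>?L\<^esub> z \<oplus>\<^bsub>?L\<^esub> y \<otimes>\<^bsub>?L\<^esub> z"
    if "x \<in> carrier ?L" "y \<in> carrier ?L" "z \<in> carrier ?L" for x y z
  proof -
    from that obtain a s b t c r where *: "a \<in> carrier R" "s \<in> carrier R - I" "b \<in> carrier R"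
      "t \<in> carrier R - I" "c \<in> carrier R" "r \<in> carrier R - I"
      and xyz: "x = fraction R I a s" "y = fraction R I b t" "z = fraction R I c r"
      by (rule fraction_cases3)
    note ** = * *(2,4,6)[THEN DiffD1] mult_compl[OF *(2,4)] mult_compl[OF *(4,6)] mult_compl[OF *(2,6)]
      mult_compl[OF *(2,2)] mult_compl[OF mult_compl[OF *(2,4)] *(6)]
    show "x \<oplus>\<^bsub>?L\<^esub> y \<in> carrier ?L" "x \<oplus>\<^bsub>?L\<^esub> y = y \<oplus>\<^bsub>?L\<^esub> x"
      unfolding xyz using ** by (simp_all add: m_comm a_comm)
    show "x \<oplus>\<^bsub>?L\<^esub> y \<oplus>\<^bsub>?L\<^esub> z = x \<oplus>\<^bsub>?L\<^esub> (y \<oplus>\<^bsub>?L\<^esub> z)"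
      unfolding xyz using ** by (simp add: m_ac a_ac l_distr r_distr)
    show "\<zero>\<^bsub>?L\<^esub> \<oplus>\<^bsub>?L\<^esub> x = x" "\<one>\<^bsub>?L\<^esub> \<otimes>\<^bsub>?L\<^esub> x = x" "x \<otimes>\<^bsub>?L\<^esub> y \<in> carrier ?L"
       "x \<otimes>\<^bsub>?L\<^esub> y = y \<otimes>\<^bsub>?L\<^esub> x"
      unfolding xyz using ** by (simp_all add: m_comm)
    show "x \<otimes>\<^bsub>?L\<^esub> y \<otimes>\<^bsub>?L\<^esub> z = x \<otimes>\<^bsub>?L\<^esub> (y \<otimes>\<^bsub>?L\<^esub> z)"
      unfolding xyz using ** by (simp add: m_assoc)
    have "fraction R I (\<ominus> a \<otimes> s \<oplus> a \<otimes> s) (s \<otimes> s) = fraction R I \<zero> \<one>"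
      using ** by (subst fraction_eq_iff) (auto simp: l_minus l_neg)
    then show "\<exists>y \<in> carrier ?L. y \<oplus>\<^bsub>?L\<^esub> x = \<zero>\<^bsub>?L\<^esub>"
      unfolding xyz using ** by (intro bexI[of _ "fraction R I (\<ominus> a) s"]) simp_all
    \<comment> \<open>The two sides of distributivity have denominators s t r and s r t r; the left
      side is expanded by r to match.\<close>
    have "fraction R I ((a \<otimes> t \<oplus> b \<otimes> s) \<otimes> c) (s \<otimes> t \<otimes> r) =
        fraction R I (r \<otimes> ((a \<otimes> t \<oplus> b \<otimes> s) \<otimes> c)) (r \<otimes> (s \<otimes> t \<otimes> r))"
      using ** by (intro fraction_cancel[symmetric]) simp_all
    then show "(x \<oplus>\<^bsub>?L\<^esub> y) \<otimes>\<^bsub>?L\<^esub> z = x \<otimes>\<^bsub>?L\<^esub> z \<oplus>\<^bsub>?L\<^esub> y \<otimes>\<^bsub>?L\<^esub> z"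
      unfolding xyz using ** by (simp add: m_ac l_distr r_distr)
  qed
  have zc: "\<zero>\<^bsub>?L\<^esub> \<in> carrier ?L" "\<one>\<^bsub>?L\<^esub> \<in> carrier ?L"
    by simp_all
  show "abelian_group ?L"
    by (rule abelian_groupI) (assumption | rule zc main(1,2)[OF _ _ zc(1)] main(3)
      main(4,5)[OF _ zc(1) zc(1)])+
  show "comm_monoid ?L"
    by (rule comm_monoidI) (assumption | rule zc main(6,7)[OF _ _ zc(1)] main(8)
      main(9)[OF _ zc(1) zc(1)])+
  show "(x \<oplus>\<^bsub>?L\<^esub> y) \<otimes>\<^bsub>?L\<^esub> z = x \<otimes>\<^bsub>?L\<^esub> z \<oplus>\<^bsub>?L\<^esub> y \<otimes>\<^bsub>?L\<^esub> z"
    if "x \<in> carrier ?L" "y \<in> carrier ?L" "z \<in> carrier ?L" for x y z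
    using that by (rule main(10))
qed

lemma fraction_hom: "ring_hom_cring R (localization R I) (\<lambda>a. fraction R I a \<one>)"
  using cring_localization
  by (intro ring_hom_cring.intro ring_hom_cring_axioms.intro ring_hom_memI is_cring)
    (simp_all add: fraction_mult fraction_add localization_one)

lemma fraction_eq_mult:
  assumes "a \<in> carrier R" "s \<in> carrier R - I"
  shows "fraction R I a s = fraction R I a \<one> \<otimes>\<^bsub>localization R I\<^esub> fraction R I \<one> s"
  using assms by (simp add: fraction_mult)

lemma fraction_inverse:
  assumes "s \<in> carrier R - I"
  shows "fraction R I s \<one> \<otimes>\<^bsub>localization R I\<^esub> fraction R I \<one> s = \<one>\<^bsub>localization R I\<^esub>"
  using assms fraction_cancel[of \<one> \<one> s] one_compl
  by (simp add: fraction_mult localization_one)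

lemma fraction_eq_zero_iff:
  assumes "a \<in> carrier R" "s \<in> carrier R - I"
  shows "fraction R I a s = \<zero>\<^bsub>localization R I\<^esub> \<longleftrightarrow> (\<exists>u \<in> carrier R - I. u \<otimes> a = \<zero>)"
  using assms one_compl unfolding localization_zero
  by (subst fraction_eq_iff) (auto simp: Bex_def)

text \<open>a/s and a/1 differ by the unit s/1. Ideals of the localization are thus determined by
  their numerators, which is how they are pulled back to R below.\<close>

lemma fraction_mem_ideal_iff:
  assumes "ideal J (localization R I)" "a \<in> carrier R" "s \<in> carrier R - I"
  shows "fraction R I a s \<in> J \<longleftrightarrow> fraction R I a \<one> \<in> J"
proof -
  interpret L: cring "localization R I" by (rule cring_localization)
  interpret J: ideal J "localization R I" by fact
  have "fraction R I a s \<otimes>\<^bsub>localization R I\<^esub> fraction R I s \<one> = fraction R I a \<one>"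
    using assms fraction_cancel[of a \<one> s] by (simp add: fraction_mult m_comm)
  moreover have "fraction R I s \<one> \<in> carrier (localization R I)"
    "fraction R I \<one> s \<in> carrier (localization R I)"
    using assms by simp_all
  ultimately show ?thesis
    using fraction_eq_mult[OF assms(2,3)] J.I_r_closed by metis
qed

definition loc_max :: "('a \<times> 'a) set set"
  where "loc_max = {fraction R I a s | a s. a \<in> I \<and> s \<in> carrier R - I}"

text \<open>Primality makes this independent of the representative: if u a t = u b s lies in I with
  u and t outside I, then a is in I.\<close>

lemma fraction_mem_loc_max:
  assumes "a \<in> carrier R" "s \<in> carrier R - I"
  shows "fraction R I a s \<in> loc_max \<longleftrightarrow> a \<in> I"
proof
  assume "fraction R I a s \<in> loc_max"
  then obtain b t where b: "b \<in> I" "t \<in> carrier R - I" "fraction R I a s = fraction R I b t"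
    by (auto simp: loc_max_def)
  then obtain u where u: "u \<in> carrier R - I" "u \<otimes> (a \<otimes> t) = u \<otimes> (b \<otimes> s)"
    using assms fraction_eq_iff[of a b s t] by auto
  have "u \<otimes> (b \<otimes> s) \<in> I"
    using u b assms by (auto intro: I_l_closed I_r_closed)
  then show "a \<in> I"
    using u b assms I_prime[of u "a \<otimes> t"] I_prime[of a t] by auto
qed (use assms in \<open>auto simp: loc_max_def\<close>)

lemma ideal_loc_max: "ideal loc_max (localization R I)"
proof -
  interpret L: cring "localization R I" by (rule cring_localization)
  have sub: "\<exists>a s. x = fraction R I a s \<and> a \<in> I \<and> a \<in> carrier R \<and> s \<in> carrier R \<and> s \<notin> I"
    if "x \<in> loc_max" for x
    using that a_subset by (fastforce simp: loc_max_def)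
  show ?thesis
  proof (rule L.cring_idealI)
    show "loc_max \<subseteq> carrier (localization R I)"
      using sub by (force intro: fraction_closed)
    show "\<zero>\<^bsub>localization R I\<^esub> \<in> loc_max"
      by (simp add: fraction_mem_loc_max localization_zero)
  next
    fix x y assume "x \<in> loc_max" "y \<in> loc_max"
    then obtain a s b t where *: "x = fraction R I a s" "a \<in> I" "a \<in> carrier R" "s \<in> carrier R" "s \<notin> I"
      "y = fraction R I b t" "b \<in> I" "b \<in> carrier R" "t \<in> carrier R" "t \<notin> I"
      using sub by metis
    then show "x \<oplus>\<^bsub>localization R I\<^esub> y \<in> loc_max"
      using mult_compl[of s t] by (simp add: fraction_add fraction_mem_loc_max I_r_closed)
  next
    fix x y assume "x \<in> loc_max" "y \<in> carrier (localization R I)"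
    obtain a s where *: "x = fraction R I a s" "a \<in> I" "a \<in> carrier R" "s \<in> carrier R" "s \<notin> I"
      using sub \<open>x \<in> loc_max\<close> by metis
    obtain b t where "b \<in> carrier R" "t \<in> carrier R - I" "y = fraction R I b t"
      using \<open>y \<in> _\<close> by (rule fraction_cases)
    then have "y \<otimes>\<^bsub>localization R I\<^esub> x = fraction R I (b \<otimes> a) (t \<otimes> s)" "b \<otimes> a \<in> I"
        "t \<otimes> s \<in> carrier R - I"
      using * mult_compl[of t s] I_l_closed[of a b] by (simp_all add: fraction_mult)
    then show "y \<otimes>\<^bsub>localization R I\<^esub> x \<in> loc_max"
      by (auto simp: loc_max_def)
  qed
qed

text \<open>A fraction whose numerator is outside I is a unit, so a proper ideal contains only
  fractions from \<open>loc_max\<close>.\<close>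

lemma maximalideal_localization: "{J. maximalideal J (localization R I)} = {loc_max}"
proof -
  interpret L: cring "localization R I" by (rule cring_localization)
  have proper: "carrier (localization R I) \<noteq> loc_max"
  proof
    assume "carrier (localization R I) = loc_max"
    then have "fraction R I \<one> \<one> \<in> loc_max"
      using fraction_closed[OF one_closed one_compl] by simp
    then show False
      using fraction_mem_loc_max[OF one_closed one_compl] by simp
  qed
  have sub: "J \<subseteq> loc_max" if J: "ideal J (localization R I)" "J \<noteq> carrier (localization R I)" for J
  proof
    interpret J: ideal J "localization R I" by (rule J)
    fix x assume "x \<in> J"
    then obtain a s where x: "a \<in> carrier R" "s \<in> carrier R - I" "x = fraction R I a s"
      by (meson J.Icarr fraction_cases)
    have "fraction R I a \<one> \<in> J"
      using x \<open>x \<in> J\<close> fraction_mem_ideal_iff[OF J(1), of a s] by simp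
    moreover have "\<one>\<^bsub>localization R I\<^esub> \<notin> J"
      using J(2) J.one_imp_carrier by auto
    ultimately show "x \<in> loc_max"
    proof (rule_tac ccontr)
      assume "x \<notin> loc_max"
      then have "a \<in> carrier R - I"
        using x fraction_mem_loc_max by simp
      from fraction_inverse[OF this] show False
        using J.I_r_closed[OF \<open>fraction R I a \<one> \<in> J\<close>, of "fraction R I \<one> a"] \<open>a \<in> carrier R - I\<close>
          \<open>\<one>\<^bsub>localization R I\<^esub> \<notin> J\<close> by simp
    qed
  qed
  have "maximalideal loc_max (localization R I)"
    by (rule maximalidealI) (use ideal_loc_max proper sub in auto)
  moreover have "J = loc_max" if "maximalideal J (localization R I)" for J
  proof -
    interpret J: maximalideal J "localization R I" by fact
    show ?thesis
      using J.I_maximal[OF ideal_loc_max sub[OF J.is_ideal J.I_notcarr[symmetric]]] proper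
        additive_subgroup.a_subset[OF ideal.axioms(1)[OF ideal_loc_max]] by (metis (no_types))
  qed
  ultimately show ?thesis by blast
qed

text \<open>The elements of R that become members of J form an ideal. The images of finitely many
  generators of it generate J, since J is determined by its numerators.\<close>

lemma noetherian_localization:
  assumes "noetherian_ring R"
  shows "noetherian_ring (localization R I)"
proof -
  interpret L: cring "localization R I" by (rule cring_localization)
  interpret R: noetherian_ring R by fact
  interpret h: ring_hom_cring R "localization R I" "\<lambda>a. fraction R I a \<one>" by (rule fraction_hom)
  show ?thesis
  proof (rule L.noetherian_ringI)
    fix J assume J: "ideal J (localization R I)"
    interpret J: ideal J "localization R I" by (rule J)
    let ?h = "\<lambda>a. fraction R I a \<one>"
    obtain A where A: "A \<subseteq> carrier R" "finite A" "{a \<in> carrier R. ?h a \<in> J} = Idl A"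
      using R.finetely_gen[OF h.ring.ideal_vimage[OF J]] by blast
    have hA: "?h ` A \<subseteq> carrier (localization R I)" using A(1) by auto
    let ?K = "Idl\<^bsub>localization R I\<^esub> (?h ` A)"
    interpret K: ideal ?K "localization R I" by (rule L.genideal_ideal[OF hA])
    have "Idl A \<subseteq> {a \<in> carrier R. ?h a \<in> ?K}"
      using h.ring.ideal_vimage[OF K.is_ideal] L.genideal_self[OF hA] A(1)
      by (intro genideal_minimal) auto
    then have *: "?h a \<in> ?K" if "a \<in> carrier R" "?h a \<in> J" for a
      using A(3) that by blast
    have "J \<subseteq> ?K"
    proof
      fix x assume x: "x \<in> J"
      obtain a s where "a \<in> carrier R" "s \<in> carrier R - I" "x = fraction R I a s"
        using J.Icarr[OF x] by (rule fraction_cases)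
      then show "x \<in> ?K"
        using x * fraction_mem_ideal_iff[OF J, of a s] fraction_mem_ideal_iff[OF K.is_ideal, of a s]
        by simp
    qed
    moreover have "?K \<subseteq> J"
      using A genideal_self[OF A(1)] by (intro L.genideal_minimal[OF J]) auto
    ultimately show "\<exists>A \<subseteq> carrier (localization R I). finite A \<and> J = Idl\<^bsub>localization R I\<^esub> A"
      using hA A(2) by blast
  qed
qed

end

section \<open>Depth is at most dimension\<close>

text \<open>An explicit form of P + (a). Its elements are decomposed again when maximality is
  exploited and when maps are extended one generator at a time; p and r need not be unique.\<close>

lemma (in cring) ideal_adjoin:
  assumes "ideal P R" "a \<in> carrier R"
  shows "ideal {p \<oplus> r \<otimes> a | p r. p \<in> P \<and> r \<in> carrier R} R"
proof -
  interpret P: ideal P R by fact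
  show ?thesis
  proof (rule cring_idealI)
    show "{p \<oplus> r \<otimes> a | p r. p \<in> P \<and> r \<in> carrier R} \<subseteq> carrier R"
      using assms(2) P.Icarr by auto
    show "\<zero> \<in> {p \<oplus> r \<otimes> a | p r. p \<in> P \<and> r \<in> carrier R}"
      using assms(2) P.zero_closed by (force intro: exI[of _ \<zero>])
  next
    fix x y
    assume "x \<in> {p \<oplus> r \<otimes> a | p r. p \<in> P \<and> r \<in> carrier R}"
      "y \<in> {p \<oplus> r \<otimes> a | p r. p \<in> P \<and> r \<in> carrier R}"
    then obtain p r q s where *: "p \<in> P" "q \<in> P" "r \<in> carrier R" "s \<in> carrier R"
      "x = p \<oplus> r \<otimes> a" "y = q \<oplus> s \<otimes> a" by auto
    have "x \<oplus> y = (p \<oplus> q) \<oplus> (r \<oplus> s) \<otimes> a"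
      using * assms(2) P.Icarr[OF *(1)] P.Icarr[OF *(2)] by (simp add: l_distr a_ac)
    then show "x \<oplus> y \<in> {p \<oplus> r \<otimes> a | p r. p \<in> P \<and> r \<in> carrier R}"
      using * P.a_closed[of p q] by blast
  next
    fix t x
    assume t: "t \<in> carrier R" and "x \<in> {p \<oplus> r \<otimes> a | p r. p \<in> P \<and> r \<in> carrier R}"
    then obtain p r where *: "p \<in> P" "r \<in> carrier R" "x = p \<oplus> r \<otimes> a" by auto
    have "t \<otimes> x = t \<otimes> p \<oplus> (t \<otimes> r) \<otimes> a"
      using * t assms(2) P.Icarr[OF *(1)] by (simp add: r_distr m_assoc)
    then show "t \<otimes> x \<in> {p \<oplus> r \<otimes> a | p r. p \<in> P \<and> r \<in> carrier R}"
      using * t P.I_l_closed[of p t] by blast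
  qed
qed

text \<open>Krull's argument: Zorn's lemma gives an ideal P maximal among those that contain J and
  avoid S. If a and b are outside P, then P + (a) and P + (b) both meet S; were a b in P, the
  product of the two elements found would lie in P as well as in S.\<close>

lemma (in cring) exists_prime_avoiding:
  assumes J: "ideal J R" and S: "S \<subseteq> carrier R" "S \<noteq> {}" "\<And>s t. s \<in> S \<Longrightarrow> t \<in> S \<Longrightarrow> s \<otimes> t \<in> S"
    and disj: "J \<inter> S = {}"
  obtains P where "primeideal P R" "J \<subseteq> P" "P \<inter> S = {}"
proof -
  let ?A = "{K. ideal K R \<and> J \<subseteq> K \<and> K \<inter> S = {}}"
  have "\<exists>U\<in>?A. \<forall>X\<in>C. X \<subseteq> U" if C: "subset.chain ?A C" for C
  proof (cases "C = {}")
    case True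
    then show ?thesis using J disj by auto
  next
    case False
    have CA: "X \<in> C \<Longrightarrow> ideal X R \<and> J \<subseteq> X \<and> X \<inter> S = {}" for X
      using C by (auto simp: subset_chain_def)
    have "ideal (\<Union>C) R"
    proof (rule cring_idealI)
      show "\<Union>C \<subseteq> carrier R"
        using CA ideal.Icarr by (metis Sup_le_iff subsetI)
      show "\<zero> \<in> \<Union>C"
      proof -
        obtain X where "X \<in> C" using False by blast
        then interpret X: ideal X R using CA by blast
        show ?thesis using X.zero_closed \<open>X \<in> C\<close> by blast
      qed
    next
      fix x y assume "x \<in> \<Union>C" "y \<in> \<Union>C"
      then obtain X Y where XY: "X \<in> C" "Y \<in> C" "x \<in> X" "y \<in> Y" by blast
      then have "X \<subseteq> Y \<or> Y \<subseteq> X"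
        using C by (auto simp: subset_chain_def)
      then obtain Z where "Z \<in> C" "x \<in> Z" "y \<in> Z"
        using XY by (meson subsetD)
      then interpret Z: ideal Z R using CA by blast
      show "x \<oplus> y \<in> \<Union>C"
        using Z.a_closed \<open>x \<in> Z\<close> \<open>y \<in> Z\<close> \<open>Z \<in> C\<close> by blast
    next
      fix r x assume "r \<in> carrier R" "x \<in> \<Union>C"
      then obtain X where X: "X \<in> C" "x \<in> X" by blast
      then interpret X: ideal X R using CA by blast
      show "r \<otimes> x \<in> \<Union>C"
        using X.I_l_closed[OF X(2) \<open>r \<in> carrier R\<close>] X(1) by blast
    qed
    then show ?thesis using CA False by (intro bexI[of _ "\<Union>C"]) auto
  qed
  from subset_Zorn[OF this] obtain P where P: "P \<in> ?A"
    and max': "\<forall>X\<in>?A. P \<subseteq> X \<longrightarrow> X = P" ..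
  have max: "X = P" if "X \<in> ?A" "P \<subseteq> X" for X
    using bspec[OF max' that(1)] that(2) by (rule mp)
  interpret P: ideal P R using P by simp
  have meet: "\<exists>p r. p \<in> P \<and> r \<in> carrier R \<and> p \<oplus> r \<otimes> a \<in> S"
    if a: "a \<in> carrier R" "a \<notin> P" for a
  proof (rule ccontr)
    assume no: "\<not> ?thesis"
    let ?K = "{p \<oplus> r \<otimes> a | p r. p \<in> P \<and> r \<in> carrier R}"
    have 1: "P \<subseteq> ?K"
    proof
      fix p assume "p \<in> P"
      moreover from this have "p = p \<oplus> \<zero> \<otimes> a" using a P.Icarr by simp
      ultimately show "p \<in> ?K" by blast
    qed
    have "a = \<zero> \<oplus> \<one> \<otimes> a" using a by simp
    then have 2: "a \<in> ?K" using P.zero_closed by blast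
    have "?K \<in> ?A"
      using ideal_adjoin[OF P.is_ideal a(1)] no 1 P by blast
    then show False using max[OF _ 1] 2 a(2) by blast
  qed
  have "primeideal P R"
  proof (rule primeidealI[OF P.is_ideal is_cring])
    show "carrier R \<noteq> P" using P S by blast
    fix a b assume ab: "a \<in> carrier R" "b \<in> carrier R" "a \<otimes> b \<in> P"
    show "a \<in> P \<or> b \<in> P"
    proof (rule ccontr)
      assume "\<not> (a \<in> P \<or> b \<in> P)"
      then obtain p r q s where *: "p \<in> P" "r \<in> carrier R" "p \<oplus> r \<otimes> a \<in> S"
        "q \<in> P" "s \<in> carrier R" "q \<oplus> s \<otimes> b \<in> S"
        using meet[of a] meet[of b] ab by blast
      have "(p \<oplus> r \<otimes> a) \<otimes> (q \<oplus> s \<otimes> b) = (p \<otimes> (q \<oplus> s \<otimes> b)) \<oplus> ((r \<otimes> a) \<otimes> q \<oplus> (r \<otimes> s) \<otimes> (a \<otimes> b))"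
        using * ab P.Icarr[OF *(1)] P.Icarr[OF *(4)] by (simp add: l_distr r_distr m_ac a_ac)
      moreover have "p \<otimes> (q \<oplus> s \<otimes> b) \<in> P" "(r \<otimes> a) \<otimes> q \<in> P" "(r \<otimes> s) \<otimes> (a \<otimes> b) \<in> P"
        using * ab P.Icarr[OF *(4)] P.I_r_closed[OF *(1), of "q \<oplus> s \<otimes> b"]
          P.I_l_closed[OF *(4), of "r \<otimes> a"] P.I_l_closed[OF ab(3), of "r \<otimes> s"] by simp_all
      ultimately have "(p \<oplus> r \<otimes> a) \<otimes> (q \<oplus> s \<otimes> b) \<in> P"
        by simp
      moreover have "(p \<oplus> r \<otimes> a) \<otimes> (q \<oplus> s \<otimes> b) \<in> S"
        using S(3) * by blast
      ultimately show False using P by blast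
    qed
  qed
  then show ?thesis using that P by blast
qed

text \<open>An element of a minimal prime over \<open>J\<close> is a zero divisor modulo \<open>J\<close>: the multiplicative set
  \<open>{x\<^sup>k s | s \<notin> P}\<close> must meet \<open>J\<close>.\<close>

lemma (in cring) exists_smaller_prime:
  assumes P: "primeideal P R" and J: "ideal J R" "J \<subseteq> P" and x: "x \<in> P"
    and reg: "\<And>a. a \<in> carrier R \<Longrightarrow> x \<otimes> a \<in> J \<Longrightarrow> a \<in> J"
  obtains P' where "primeideal P' R" "J \<subseteq> P'" "P' \<subset> P"
proof -
  interpret P: primeideal P R by fact
  have xc: "x \<in> carrier R" using x P.Icarr by simp
  have oneP: "\<one> \<notin> P" using P.one_imp_carrier P.I_notcarr by auto
  let ?S = "{x [^] (k::nat) \<otimes> s | k s. s \<in> carrier R - P}"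
  have pow: "a \<in> J" if "a \<in> carrier R" "x [^] (k::nat) \<otimes> a \<in> J" for k a
    using that
  proof (induction k)
    case 0
    then show ?case by (simp only: nat_pow_0 l_one)
  next
    case (Suc k)
    have "x [^] Suc k \<otimes> a = x \<otimes> (x [^] k \<otimes> a)" using Suc.prems xc by (simp add: m_ac)
    then have "x [^] k \<otimes> a \<in> J" using Suc.prems xc by - (rule reg, simp_all)
    then show ?case by (rule Suc.IH[OF Suc.prems(1)])
  qed
  have S1: "?S \<subseteq> carrier R" using xc by auto
  have memS: "x [^] (k::nat) \<otimes> s \<in> ?S" if "s \<in> carrier R" "s \<notin> P" for k s
    using that by blast
  have S2: "?S \<noteq> {}" using memS[of \<one> 0] oneP by blast
  have S3: "a \<otimes> b \<in> ?S" if ab: "a \<in> ?S" "b \<in> ?S" for a b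
  proof -
    obtain k s j t where *: "a = x [^] (k::nat) \<otimes> s" "s \<in> carrier R" "s \<notin> P"
      "b = x [^] (j::nat) \<otimes> t" "t \<in> carrier R" "t \<notin> P"
      using ab by blast
    have "a \<otimes> b = x [^] (k + j) \<otimes> (s \<otimes> t)"
      using * xc by (simp add: m_ac flip: nat_pow_mult)
    moreover have "s \<otimes> t \<in> carrier R" "s \<otimes> t \<notin> P" using * P.I_prime by auto
    ultimately show ?thesis using memS by simp
  qed
  \<comment> \<open>If \<open>x [^] k \<otimes> s\<close> were in J, regularity would put s into J
    and hence into P.\<close>
  have "J \<inter> ?S = {}" using pow J(2) by auto
  from exists_prime_avoiding[OF J(1) S1 S2 S3 this]
  obtain P' where P': "primeideal P' R" "J \<subseteq> P'" "P' \<inter> ?S = {}" by blast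
  interpret P': primeideal P' R by fact
  have "P' \<subseteq> P"
  proof
    fix s assume s: "s \<in> P'"
    show "s \<in> P"
      using memS[of s 0] P'.Icarr[OF s] s P'(3) by auto
  qed
  moreover have "x \<notin> P'"
    using memS[of \<one> 1] oneP P'(3) xc by auto
  ultimately show ?thesis using that[OF P'(1,2)] x by blast
qed

text \<open>The chain of primes is built from the top. It starts with a prime over the ideal of the
  whole sequence; the last remaining element is regular modulo its predecessors, so dropping it
  permits a descent to a strictly smaller prime that still contains the predecessors.\<close>

lemma regular_sequence_le_krull_dim:
  fixes R :: "'a ring" (structure)
  assumes "cring R" "regular_sequence R xs"
  shows "enat (length xs) \<le> krull_dim R"
proof -
  interpret cring R by fact
  have xs: "set xs \<subseteq> carrier R" and proper: "Idl (set xs) \<noteq> carrier R"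
    and reg: "\<And>i a. i < length xs \<Longrightarrow> a \<in> carrier R \<Longrightarrow> xs ! i \<otimes> a \<in> Idl (set (take i xs)) \<Longrightarrow>
      a \<in> Idl (set (take i xs))"
    using assms(2) by (auto simp: regular_sequence_def)
  have tk: "set (take i xs) \<subseteq> carrier R" for i
    using xs set_take_subset[of i xs] by blast
  have "\<exists>P :: nat \<Rightarrow> 'a set. (\<forall>i\<le>j. primeideal (P i) R) \<and> (\<forall>i<j. P i \<subset> P (Suc i)) \<and>
      Idl (set (take (length xs - j) xs)) \<subseteq> P 0" if "j \<le> length xs" for j
    using that
  proof (induction j)
    case 0
    have "\<one> \<notin> Idl (set xs)"
      using ideal.one_imp_carrier[OF genideal_ideal[OF xs]] proper by auto
    then obtain P where "primeideal P R" "Idl (set xs) \<subseteq> P"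
      using exists_prime_avoiding[OF genideal_ideal[OF xs], of "{\<one>}"] by force
    then show ?case by (intro exI[of _ "\<lambda>_. P"]) auto
  next
    case (Suc j)
    then obtain P :: "nat \<Rightarrow> 'a set" where P: "\<forall>i\<le>j. primeideal (P i) R" "\<forall>i<j. P i \<subset> P (Suc i)"
      "Idl (set (take (length xs - j) xs)) \<subseteq> P 0" by auto
    define i where "i = length xs - Suc j"
    have i: "length xs - j = Suc i" "i < length xs" using Suc.prems by (auto simp: i_def)
    have sub: "set (take (Suc i) xs) \<subseteq> P 0"
      using P(3) genideal_self[OF tk, of "Suc i"] i by auto
    have PI: "Idl (set (take i xs)) \<subseteq> P 0"
      by (rule genideal_minimal)
        (use P(1) sub set_take_subset_set_take[of i "Suc i" xs] in \<open>auto simp: primeideal.axioms\<close>)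
    have xP: "xs ! i \<in> P 0"
      using sub i by (auto simp: take_Suc_conv_app_nth)
    have P0: "primeideal (P 0) R" using P(1) by simp
    obtain P' where P': "primeideal P' R" "Idl (set (take i xs)) \<subseteq> P'" "P' \<subset> P 0"
      by (rule exists_smaller_prime[OF P0 genideal_ideal[OF tk] PI xP reg[OF i(2)]])
    show ?case
    proof (intro exI conjI allI impI)
      let ?Q = "\<lambda>k. case k of 0 \<Rightarrow> P' | Suc k \<Rightarrow> P k"
      show "primeideal (?Q k) R" if "k \<le> Suc j" for k
        using that P P' by (auto split: nat.split)
      show "?Q k \<subset> ?Q (Suc k)" if "k < Suc j" for k
        using that P P' by (auto split: nat.split)
      show "Idl (set (take (length xs - Suc j) xs)) \<subseteq> ?Q 0"
        using P'(2) by (simp add: i_def)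
    qed
  qed
  from this[of "length xs"] show ?thesis
    unfolding krull_dim_def by (intro Sup_upper CollectI exI[of _ "length xs"]) auto
qed

lemma depth_le_krull_dim: "cring R \<Longrightarrow> depth R M \<le> krull_dim R"
  unfolding depth_def by (rule Sup_least) (use regular_sequence_le_krull_dim in auto)

section \<open>Injective modules and Baer's criterion\<close>

text \<open>The condition speaks of ideals of R only, so it is meaningful for a module over any
  carrier type and does not change when the module is copied to another type. All constructions
  below preserve this property rather than \<open>injective_module\<close>.\<close>

definition baer :: "'a ring \<Rightarrow> ('a, 'b) module \<Rightarrow> bool"
  where "baer R E \<longleftrightarrow> Module.module R E \<and> (\<forall>I f. ideal I R \<and> f \<in> I \<rightarrow> carrier E \<and>
    (\<forall>x\<in>I. \<forall>y\<in>I. f (x \<oplus>\<^bsub>R\<^esub> y) = f x \<oplus>\<^bsub>E\<^esub> f y) \<and>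
    (\<forall>r\<in>carrier R. \<forall>x\<in>I. f (r \<otimes>\<^bsub>R\<^esub> x) = r \<odot>\<^bsub>E\<^esub> f x) \<longrightarrow>
    (\<exists>e\<in>carrier E. \<forall>x\<in>I. f x = x \<odot>\<^bsub>E\<^esub> e))"

lemma baerD:
  assumes "baer R E" "ideal I R" "\<And>x. x \<in> I \<Longrightarrow> f x \<in> carrier E"
    "\<And>x y. x \<in> I \<Longrightarrow> y \<in> I \<Longrightarrow> f (x \<oplus>\<^bsub>R\<^esub> y) = f x \<oplus>\<^bsub>E\<^esub> f y"
    "\<And>r x. r \<in> carrier R \<Longrightarrow> x \<in> I \<Longrightarrow> f (r \<otimes>\<^bsub>R\<^esub> x) = r \<odot>\<^bsub>E\<^esub> f x"
  shows "\<exists>e\<in>carrier E. \<forall>x\<in>I. f x = x \<odot>\<^bsub>E\<^esub> e"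
proof -
  have f: "f \<in> I \<rightarrow> carrier E" "\<forall>x\<in>I. \<forall>y\<in>I. f (x \<oplus>\<^bsub>R\<^esub> y) = f x \<oplus>\<^bsub>E\<^esub> f y"
    "\<forall>r\<in>carrier R. \<forall>x\<in>I. f (r \<otimes>\<^bsub>R\<^esub> x) = r \<odot>\<^bsub>E\<^esub> f x"
    using assms(3-5) by auto
  show ?thesis
    by (rule assms(1)[unfolded baer_def, THEN conjunct2, THEN spec, THEN spec, THEN mp,
      OF conjI[OF assms(2) conjI[OF f(1) conjI[OF f(2,3)]]]])
qed

lemma module_homI:
  assumes "\<And>x. x \<in> carrier M \<Longrightarrow> h x \<in> carrier N"
    "\<And>x y. x \<in> carrier M \<Longrightarrow> y \<in> carrier M \<Longrightarrow> h (x \<oplus>\<^bsub>M\<^esub> y) = h x \<oplus>\<^bsub>N\<^esub> h y"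
    "\<And>r x. r \<in> carrier R \<Longrightarrow> x \<in> carrier M \<Longrightarrow> h (r \<odot>\<^bsub>M\<^esub> x) = r \<odot>\<^bsub>N\<^esub> h x"
  shows "h \<in> module_hom R M N"
  using assms by (auto simp: module_hom_def hom_def)

lemma module_homD:
  assumes "h \<in> module_hom R M N"
  shows "x \<in> carrier M \<Longrightarrow> h x \<in> carrier N"
    "x \<in> carrier M \<Longrightarrow> y \<in> carrier M \<Longrightarrow> h (x \<oplus>\<^bsub>M\<^esub> y) = h x \<oplus>\<^bsub>N\<^esub> h y"
    "r \<in> carrier R \<Longrightarrow> x \<in> carrier M \<Longrightarrow> h (r \<odot>\<^bsub>M\<^esub> x) = r \<odot>\<^bsub>N\<^esub> h x"
  using assms by (auto simp: module_hom_def hom_def)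

lemma module_hom_zero:
  assumes "h \<in> module_hom R M N" "Module.module R M" "Module.module R N"
  shows "h \<zero>\<^bsub>M\<^esub> = \<zero>\<^bsub>N\<^esub>"
proof -
  interpret M: Module.module R M by fact
  interpret N: Module.module R N by fact
  have "h (\<zero>\<^bsub>R\<^esub> \<odot>\<^bsub>M\<^esub> \<zero>\<^bsub>M\<^esub>) = \<zero>\<^bsub>R\<^esub> \<odot>\<^bsub>N\<^esub> h \<zero>\<^bsub>M\<^esub>"
    by (rule module_homD(3)[OF assms(1)]) auto
  then show ?thesis using module_homD(1)[OF assms(1)] by simp
qed

text \<open>Zorn's lemma is applied to the submodules of \<open>N \<times> E\<close> that are graphs of partial extensions.\<close>

lemma baer_extend:
  assumes E: "baer R E" and N: "Module.module R N"
    and X: "X \<subseteq> carrier N" "\<zero>\<^bsub>N\<^esub> \<in> X" "\<And>x y. x \<in> X \<Longrightarrow> y \<in> X \<Longrightarrow> x \<oplus>\<^bsub>N\<^esub> y \<in> X"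
      "\<And>r x. r \<in> carrier R \<Longrightarrow> x \<in> X \<Longrightarrow> r \<odot>\<^bsub>N\<^esub> x \<in> X"
    and f: "\<And>x. x \<in> X \<Longrightarrow> f x \<in> carrier E"
      "\<And>x y. x \<in> X \<Longrightarrow> y \<in> X \<Longrightarrow> f (x \<oplus>\<^bsub>N\<^esub> y) = f x \<oplus>\<^bsub>E\<^esub> f y"
      "\<And>r x. r \<in> carrier R \<Longrightarrow> x \<in> X \<Longrightarrow> f (r \<odot>\<^bsub>N\<^esub> x) = r \<odot>\<^bsub>E\<^esub> f x"
  shows "\<exists>g\<in>module_hom R N E. \<forall>x\<in>X. g x = f x"
proof -
  interpret N: Module.module R N by fact
  interpret E: Module.module R E using E by (simp add: baer_def)
  define good where "good G \<longleftrightarrow> G \<subseteq> carrier N \<times> carrier E \<and> (\<lambda>x. (x, f x)) ` X \<subseteq> G \<and>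
    (\<forall>x y u v. (x, u) \<in> G \<longrightarrow> (y, v) \<in> G \<longrightarrow> (x \<oplus>\<^bsub>N\<^esub> y, u \<oplus>\<^bsub>E\<^esub> v) \<in> G) \<and>
    (\<forall>r x u. r \<in> carrier R \<longrightarrow> (x, u) \<in> G \<longrightarrow> (r \<odot>\<^bsub>N\<^esub> x, r \<odot>\<^bsub>E\<^esub> u) \<in> G) \<and>
    (\<forall>x u v. (x, u) \<in> G \<longrightarrow> (x, v) \<in> G \<longrightarrow> u = v)" for G
  have goodD: "x \<in> carrier N" "u \<in> carrier E" if "good G" "(x, u) \<in> G" for G x u
    using that(1)[unfolded good_def, THEN conjunct1] that(2) by auto
  have good_add: "(x \<oplus>\<^bsub>N\<^esub> y, u \<oplus>\<^bsub>E\<^esub> v) \<in> G" if "good G" "(x, u) \<in> G" "(y, v) \<in> G" for G x y u v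
    using that unfolding good_def by blast
  have good_smult: "(r \<odot>\<^bsub>N\<^esub> x, r \<odot>\<^bsub>E\<^esub> u) \<in> G" if "good G" "r \<in> carrier R" "(x, u) \<in> G" for G r x u
    using that unfolding good_def by blast
  have good_fun: "u = v" if "good G" "(x, u) \<in> G" "(x, v) \<in> G" for G x u v
    using that unfolding good_def by blast
  have good_base: "(x, f x) \<in> G" if "good G" "x \<in> X" for G x
    using that unfolding good_def by blast
  have base: "good ((\<lambda>x. (x, f x)) ` X)"
    unfolding good_def using X f by auto
  have "\<exists>U\<in>Collect good. \<forall>G\<in>C. G \<subseteq> U" if C: "subset.chain (Collect good) C" for C
  proof (cases "C = {}")
    case True
    then show ?thesis using base by auto
  next
    case False
    have CA: "G \<in> C \<Longrightarrow> good G" for G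
      using C by (auto simp: subset_chain_def)
    have two: "\<exists>G\<in>C. p \<in> G \<and> q \<in> G" if pq: "p \<in> \<Union>C" "q \<in> \<Union>C" for p q
    proof -
      obtain G H where GH: "G \<in> C" "H \<in> C" "p \<in> G" "q \<in> H" using pq by blast
      then have "G \<subseteq> H \<or> H \<subseteq> G" using C by (auto simp: subset_chain_def)
      then show ?thesis using GH by blast
    qed
    have "good (\<Union>C)"
      unfolding good_def
    proof (intro conjI allI impI)
      show "\<Union>C \<subseteq> carrier N \<times> carrier E"
        using goodD[OF CA] by auto
      show "(\<lambda>x. (x, f x)) ` X \<subseteq> \<Union>C"
      proof -
        obtain G where "G \<in> C" using False by blast
        then show ?thesis using good_base[OF CA[of G]] by auto
      qed
      fix x y u v assume "(x, u) \<in> \<Union>C" "(y, v) \<in> \<Union>C"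
      then obtain G where "G \<in> C" "(x, u) \<in> G" "(y, v) \<in> G" using two by meson
      then show "(x \<oplus>\<^bsub>N\<^esub> y, u \<oplus>\<^bsub>E\<^esub> v) \<in> \<Union>C" using good_add[OF CA] by (meson UnionI)
    next
      fix r x u assume "r \<in> carrier R" "(x, u) \<in> \<Union>C"
      then show "(r \<odot>\<^bsub>N\<^esub> x, r \<odot>\<^bsub>E\<^esub> u) \<in> \<Union>C" using good_smult[OF CA] by (meson UnionE UnionI)
    next
      fix x u v assume "(x, u) \<in> \<Union>C" "(x, v) \<in> \<Union>C"
      then obtain G where "G \<in> C" "(x, u) \<in> G" "(x, v) \<in> G" using two by meson
      then show "u = v" using good_fun[OF CA] by meson
    qed
    then show ?thesis by (intro bexI[of _ "\<Union>C"]) auto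
  qed
  from subset_Zorn[OF this] obtain G where "G \<in> Collect good"
    and max': "\<forall>H\<in>Collect good. G \<subseteq> H \<longrightarrow> H = G" ..
  then have G: "good G" by simp
  have zero: "(\<zero>\<^bsub>N\<^esub>, \<zero>\<^bsub>E\<^esub>) \<in> G"
    using good_smult[OF G N.R.zero_closed good_base[OF G X(2)]] X f by auto
  have total: "\<exists>u. (z, u) \<in> G" if z: "z \<in> carrier N" for z
  proof -
    \<comment> \<open>The conductor of z into the domain of G. The value of G at r z is linear in r
      on this ideal, so Baer's condition represents it by an element e.\<close>
    let ?I = "{r \<in> carrier R. \<exists>u. (r \<odot>\<^bsub>N\<^esub> z, u) \<in> G}"
    have ex: "(r \<odot>\<^bsub>N\<^esub> z, SOME u. (r \<odot>\<^bsub>N\<^esub> z, u) \<in> G) \<in> G" if "r \<in> ?I" for r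
      using that by (auto intro: someI)
    have GI_add: "((r \<oplus>\<^bsub>R\<^esub> s) \<odot>\<^bsub>N\<^esub> z, u \<oplus>\<^bsub>E\<^esub> v) \<in> G"
      if "r \<in> carrier R" "s \<in> carrier R" "(r \<odot>\<^bsub>N\<^esub> z, u) \<in> G" "(s \<odot>\<^bsub>N\<^esub> z, v) \<in> G" for r s u v
      using good_add[OF G that(3,4)] that(1,2) z by (simp only: N.smult_l_distr)
    have GI_mult: "((r \<otimes>\<^bsub>R\<^esub> s) \<odot>\<^bsub>N\<^esub> z, r \<odot>\<^bsub>E\<^esub> u) \<in> G"
      if "r \<in> carrier R" "s \<in> carrier R" "(s \<odot>\<^bsub>N\<^esub> z, u) \<in> G" for r s u
      using good_smult[OF G that(1,3)] that(1,2) z by (simp only: N.smult_assoc1)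
    have I: "ideal ?I R"
    proof (rule N.R.cring_idealI)
      show "\<zero>\<^bsub>R\<^esub> \<in> ?I" using z zero by auto
    next
      fix r s assume rs: "r \<in> ?I" "s \<in> ?I"
      then show "r \<oplus>\<^bsub>R\<^esub> s \<in> ?I"
        using GI_add[OF _ _ ex[OF rs(1)] ex[OF rs(2)]] by blast
    next
      fix r s assume rs: "r \<in> carrier R" "s \<in> ?I"
      then show "r \<otimes>\<^bsub>R\<^esub> s \<in> ?I"
        using GI_mult[OF rs(1) _ ex[OF rs(2)]] by blast
    qed auto
    have "\<exists>e\<in>carrier E. \<forall>r\<in>?I. (SOME u. (r \<odot>\<^bsub>N\<^esub> z, u) \<in> G) = r \<odot>\<^bsub>E\<^esub> e"
    proof (rule baerD[OF E I, of "\<lambda>r. SOME u. (r \<odot>\<^bsub>N\<^esub> z, u) \<in> G"])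
      fix r assume "r \<in> ?I"
      from goodD(2)[OF G ex[OF this]] show "(SOME u. (r \<odot>\<^bsub>N\<^esub> z, u) \<in> G) \<in> carrier E" .
    next
      fix r s assume rs: "r \<in> ?I" "s \<in> ?I"
      have "((r \<oplus>\<^bsub>R\<^esub> s) \<odot>\<^bsub>N\<^esub> z, (SOME u. (r \<odot>\<^bsub>N\<^esub> z, u) \<in> G) \<oplus>\<^bsub>E\<^esub> (SOME u. (s \<odot>\<^bsub>N\<^esub> z, u) \<in> G)) \<in> G"
        using rs by (intro GI_add ex) blast+
      then show "(SOME u. ((r \<oplus>\<^bsub>R\<^esub> s) \<odot>\<^bsub>N\<^esub> z, u) \<in> G) =
          (SOME u. (r \<odot>\<^bsub>N\<^esub> z, u) \<in> G) \<oplus>\<^bsub>E\<^esub> (SOME u. (s \<odot>\<^bsub>N\<^esub> z, u) \<in> G)"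
        by (rule good_fun[OF G ex[OF additive_subgroup.a_closed[OF ideal.axioms(1)[OF I] rs]]])
    next
      fix r s assume rs: "r \<in> carrier R" "s \<in> ?I"
      have "((r \<otimes>\<^bsub>R\<^esub> s) \<odot>\<^bsub>N\<^esub> z, r \<odot>\<^bsub>E\<^esub> (SOME u. (s \<odot>\<^bsub>N\<^esub> z, u) \<in> G)) \<in> G"
        using rs by (intro GI_mult ex) blast+
      then show "(SOME u. ((r \<otimes>\<^bsub>R\<^esub> s) \<odot>\<^bsub>N\<^esub> z, u) \<in> G) = r \<odot>\<^bsub>E\<^esub> (SOME u. (s \<odot>\<^bsub>N\<^esub> z, u) \<in> G)"
        by (rule good_fun[OF G ex[OF ideal.I_l_closed[OF I rs(2,1)]]])
    qed
    then obtain e where e: "e \<in> carrier E"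
      and e': "\<forall>r\<in>?I. (SOME u. (r \<odot>\<^bsub>N\<^esub> z, u) \<in> G) = r \<odot>\<^bsub>E\<^esub> e" ..
    have e2: "(r \<odot>\<^bsub>N\<^esub> z, r \<odot>\<^bsub>E\<^esub> e) \<in> G" if "r \<in> ?I" for r
      using ex[OF that] bspec[OF e' that] by simp
    \<comment> \<open>The extension of G that sends z to e. Maximality of G makes it equal to G, so
      z already belongs to the domain.\<close>
    let ?H = "{(x \<oplus>\<^bsub>N\<^esub> r \<odot>\<^bsub>N\<^esub> z, u \<oplus>\<^bsub>E\<^esub> r \<odot>\<^bsub>E\<^esub> e) | x u r. (x, u) \<in> G \<and> r \<in> carrier R}"
    have memH: "(x \<oplus>\<^bsub>N\<^esub> r \<odot>\<^bsub>N\<^esub> z, u \<oplus>\<^bsub>E\<^esub> r \<odot>\<^bsub>E\<^esub> e) \<in> ?H"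
      if "(x, u) \<in> G" "r \<in> carrier R" for x u r
      using that by blast
    have GH: "G \<subseteq> ?H"
    proof clarify
      fix x u assume xu: "(x, u) \<in> G"
      have "x = x \<oplus>\<^bsub>N\<^esub> \<zero>\<^bsub>R\<^esub> \<odot>\<^bsub>N\<^esub> z" "u = u \<oplus>\<^bsub>E\<^esub> \<zero>\<^bsub>R\<^esub> \<odot>\<^bsub>E\<^esub> e"
        using goodD[OF G xu] z e by simp_all
      then show "\<exists>x' u' r. (x, u) = (x' \<oplus>\<^bsub>N\<^esub> r \<odot>\<^bsub>N\<^esub> z, u' \<oplus>\<^bsub>E\<^esub> r \<odot>\<^bsub>E\<^esub> e) \<and> (x', u') \<in> G \<and> r \<in> carrier R"
        using xu N.R.zero_closed by (intro exI[of _ x] exI[of _ u] exI[of _ "\<zero>\<^bsub>R\<^esub>"]) simp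
    qed
    have "good ?H"
      unfolding good_def
    proof (intro conjI allI impI)
      show "?H \<subseteq> carrier N \<times> carrier E"
      proof (rule subsetI)
        fix p assume "p \<in> ?H"
        then obtain x u r where *: "(x, u) \<in> G" "r \<in> carrier R"
          "p = (x \<oplus>\<^bsub>N\<^esub> r \<odot>\<^bsub>N\<^esub> z, u \<oplus>\<^bsub>E\<^esub> r \<odot>\<^bsub>E\<^esub> e)" by blast
        show "p \<in> carrier N \<times> carrier E"
          unfolding *(3) using goodD[OF G *(1)] *(2) z e by (intro SigmaI) simp_all
      qed
      show "(\<lambda>x. (x, f x)) ` X \<subseteq> ?H"
        using GH good_base[OF G] by blast
    next
      fix x y u v assume "(x, u) \<in> ?H" "(y, v) \<in> ?H"
      then obtain x' u' r y' v' s where *: "(x', u') \<in> G" "r \<in> carrier R" "(y', v') \<in> G" "s \<in> carrier R"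
        "x = x' \<oplus>\<^bsub>N\<^esub> r \<odot>\<^bsub>N\<^esub> z" "u = u' \<oplus>\<^bsub>E\<^esub> r \<odot>\<^bsub>E\<^esub> e"
        "y = y' \<oplus>\<^bsub>N\<^esub> s \<odot>\<^bsub>N\<^esub> z" "v = v' \<oplus>\<^bsub>E\<^esub> s \<odot>\<^bsub>E\<^esub> e" by blast
      have "x \<oplus>\<^bsub>N\<^esub> y = (x' \<oplus>\<^bsub>N\<^esub> y') \<oplus>\<^bsub>N\<^esub> (r \<oplus>\<^bsub>R\<^esub> s) \<odot>\<^bsub>N\<^esub> z"
          "u \<oplus>\<^bsub>E\<^esub> v = (u' \<oplus>\<^bsub>E\<^esub> v') \<oplus>\<^bsub>E\<^esub> (r \<oplus>\<^bsub>R\<^esub> s) \<odot>\<^bsub>E\<^esub> e"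
        using * goodD[OF G *(1)] goodD[OF G *(3)] z e
        by (simp_all add: N.smult_l_distr E.smult_l_distr N.M.a_ac E.M.a_ac)
      then show "(x \<oplus>\<^bsub>N\<^esub> y, u \<oplus>\<^bsub>E\<^esub> v) \<in> ?H"
        using memH[OF good_add[OF G *(1,3)] N.R.a_closed[OF *(2,4)]] by (simp only:)
    next
      fix t x u assume t: "t \<in> carrier R" and "(x, u) \<in> ?H"
      then obtain x' u' r where *: "(x', u') \<in> G" "r \<in> carrier R"
        "x = x' \<oplus>\<^bsub>N\<^esub> r \<odot>\<^bsub>N\<^esub> z" "u = u' \<oplus>\<^bsub>E\<^esub> r \<odot>\<^bsub>E\<^esub> e" by blast
      have "t \<odot>\<^bsub>N\<^esub> x = t \<odot>\<^bsub>N\<^esub> x' \<oplus>\<^bsub>N\<^esub> (t \<otimes>\<^bsub>R\<^esub> r) \<odot>\<^bsub>N\<^esub> z"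
          "t \<odot>\<^bsub>E\<^esub> u = t \<odot>\<^bsub>E\<^esub> u' \<oplus>\<^bsub>E\<^esub> (t \<otimes>\<^bsub>R\<^esub> r) \<odot>\<^bsub>E\<^esub> e"
        using * goodD[OF G *(1)] z e t
        by (simp_all add: N.smult_r_distr E.smult_r_distr N.smult_assoc1 E.smult_assoc1)
      then show "(t \<odot>\<^bsub>N\<^esub> x, t \<odot>\<^bsub>E\<^esub> u) \<in> ?H"
        using memH[OF good_smult[OF G t *(1)] N.R.m_closed[OF t *(2)]] by (simp only:)
    next
      \<comment> \<open>Single-valuedness of \<open>?H\<close>: if x' + r z = y' + s z, then (r - s)
        z = y' - x' is in the domain of G, so r - s is in the conductor and G takes the value (r -
        s) e there, which is also v' - u'.\<close>
      fix x u v assume "(x, u) \<in> ?H" "(x, v) \<in> ?H"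
      then obtain x' u' r y' v' s where *: "(x', u') \<in> G" "r \<in> carrier R" "(y', v') \<in> G" "s \<in> carrier R"
        "x = x' \<oplus>\<^bsub>N\<^esub> r \<odot>\<^bsub>N\<^esub> z" "u = u' \<oplus>\<^bsub>E\<^esub> r \<odot>\<^bsub>E\<^esub> e"
        "x = y' \<oplus>\<^bsub>N\<^esub> s \<odot>\<^bsub>N\<^esub> z" "v = v' \<oplus>\<^bsub>E\<^esub> s \<odot>\<^bsub>E\<^esub> e" by blast
      note C' = goodD[OF G *(1)] goodD[OF G *(3)] z e *(2,4)
      have "x \<in> carrier N" unfolding *(5) using C' by simp
      note C = C' this
      let ?m = "\<ominus>\<^bsub>R\<^esub> \<one>\<^bsub>R\<^esub>"
      have mm: "?m \<in> carrier R" by simp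
      have mN: "?m \<odot>\<^bsub>N\<^esub> a = \<ominus>\<^bsub>N\<^esub> a" if "a \<in> carrier N" for a
        using that by (simp add: N.smult_l_minus)
      have mE: "?m \<odot>\<^bsub>E\<^esub> a = \<ominus>\<^bsub>E\<^esub> a" if "a \<in> carrier E" for a
        using that by (simp add: E.smult_l_minus)
      have "(r \<ominus>\<^bsub>R\<^esub> s) \<odot>\<^bsub>N\<^esub> z = y' \<oplus>\<^bsub>N\<^esub> (\<ominus>\<^bsub>N\<^esub> x' \<oplus>\<^bsub>N\<^esub> (x' \<oplus>\<^bsub>N\<^esub> r \<odot>\<^bsub>N\<^esub> z)) \<oplus>\<^bsub>N\<^esub> \<ominus>\<^bsub>N\<^esub> (y' \<oplus>\<^bsub>N\<^esub> s \<odot>\<^bsub>N\<^esub> z)"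
        using C by (simp add: a_minus_def N.smult_l_distr N.smult_l_minus N.M.minus_add N.M.a_ac
            N.M.r_neg1 N.M.r_neg2)
      also have "\<dots> = y' \<oplus>\<^bsub>N\<^esub> \<ominus>\<^bsub>N\<^esub> x' \<oplus>\<^bsub>N\<^esub> (x \<oplus>\<^bsub>N\<^esub> \<ominus>\<^bsub>N\<^esub> x)"
        using C *(5)[symmetric] *(7)[symmetric] by (simp add: N.M.a_assoc)
      also have "\<dots> = y' \<oplus>\<^bsub>N\<^esub> \<ominus>\<^bsub>N\<^esub> x'"
        using C *(5) by (simp add: N.M.r_neg)
      finally have eq: "(r \<ominus>\<^bsub>R\<^esub> s) \<odot>\<^bsub>N\<^esub> z = y' \<oplus>\<^bsub>N\<^esub> \<ominus>\<^bsub>N\<^esub> x'" .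
      have 1: "((r \<ominus>\<^bsub>R\<^esub> s) \<odot>\<^bsub>N\<^esub> z, v' \<oplus>\<^bsub>E\<^esub> \<ominus>\<^bsub>E\<^esub> u') \<in> G"
        using good_add[OF G *(3) good_smult[OF G mm *(1)]] C by (simp add: eq mN mE)
      then have "r \<ominus>\<^bsub>R\<^esub> s \<in> ?I" using C by blast
      then have "v' \<oplus>\<^bsub>E\<^esub> \<ominus>\<^bsub>E\<^esub> u' = (r \<ominus>\<^bsub>R\<^esub> s) \<odot>\<^bsub>E\<^esub> e"
        using good_fun[OF G 1 e2] by simp
      then have "r \<odot>\<^bsub>E\<^esub> e = (v' \<oplus>\<^bsub>E\<^esub> \<ominus>\<^bsub>E\<^esub> u') \<oplus>\<^bsub>E\<^esub> s \<odot>\<^bsub>E\<^esub> e"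
        using C by (simp add: a_minus_def N.R.l_neg N.R.a_assoc flip: E.smult_l_distr)
      then show "u = v"
        unfolding *(6,8) using C
        by (simp add: E.M.a_lcomm[of u' v'] E.M.a_assoc E.M.r_neg2 E.M.r_neg1)
    qed
    then have "?H = G" by (rule mp[OF bspec[OF max' CollectI] GH])
    moreover have "z = \<zero>\<^bsub>N\<^esub> \<oplus>\<^bsub>N\<^esub> \<one>\<^bsub>R\<^esub> \<odot>\<^bsub>N\<^esub> z" using z by simp
    then have "(z, \<zero>\<^bsub>E\<^esub> \<oplus>\<^bsub>E\<^esub> \<one>\<^bsub>R\<^esub> \<odot>\<^bsub>E\<^esub> e) \<in> ?H"
      using memH[OF zero N.R.one_closed] by (simp only:)
    ultimately show ?thesis by blast
  qed
  define g where "g x = (SOME u. (x, u) \<in> G)" for x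
  have g: "(x, g x) \<in> G" if x: "x \<in> carrier N" for x
    unfolding g_def using total[OF x] by (rule someI_ex)
  have g_eq: "g x = u" if "(x, u) \<in> G" for x u
    using good_fun[OF G g[OF goodD(1)[OF G that]] that] .
  show ?thesis
  proof (intro bexI ballI)
    show "g \<in> module_hom R N E"
      using goodD(2)[OF G g] g_eq good_add[OF G g g] good_smult[OF G _ g] by (intro module_homI) auto
    show "g x = f x" if "x \<in> X" for x
      using g_eq[OF good_base[OF G that]] .
  qed
qed

text \<open>\<open>baer_extend\<close> is applied to the image of i, with f composed with the
  inverse of i as the partial map.\<close>

lemma injective_moduleI:
  assumes "baer R E" shows "injective_module R E"
  unfolding injective_module_def
proof (rule conjI)
  show "Module.module R E" using assms by (simp add: baer_def)
next
  show "\<forall>(N :: ('a, 'b) module) (N' :: ('a, 'b) module) i f.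
      Module.module R N \<and> Module.module R N' \<and>
      i \<in> module_hom R N N' \<and> inj_on i (carrier N) \<and> f \<in> module_hom R N E \<longrightarrow>
      (\<exists>g \<in> module_hom R N' E. \<forall>x \<in> carrier N. g (i x) = f x)"
  proof (intro allI impI, elim conjE)
  fix N N' :: "('a, 'b) module" and i f
  assume N: "Module.module R N" and N': "Module.module R N'"
    and i: "i \<in> module_hom R N N'" "inj_on i (carrier N)" and f: "f \<in> module_hom R N E"
  interpret N: Module.module R N by fact
  interpret N': Module.module R N' by fact
  note iD = module_homD[OF i(1)] and fD = module_homD[OF f]
  have inv: "inv_into (carrier N) i (i x) = x" if "x \<in> carrier N" for x
    using i(2) that by simp
  have "\<exists>g\<in>module_hom R N' E. \<forall>x\<in>i ` carrier N. g x = f (inv_into (carrier N) i x)"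
  proof (rule baer_extend[OF assms N', of "i ` carrier N" "\<lambda>x. f (inv_into (carrier N) i x)"])
    show "i ` carrier N \<subseteq> carrier N'" using iD by auto
    show "\<zero>\<^bsub>N'\<^esub> \<in> i ` carrier N"
      using module_hom_zero[OF i(1) N N'] by (force intro!: image_eqI[of _ _ "\<zero>\<^bsub>N\<^esub>"])
    fix x assume "x \<in> i ` carrier N"
    then obtain a where a: "a \<in> carrier N" "x = i a" by blast
    show "f (inv_into (carrier N) i x) \<in> carrier E"
      using a fD by (simp add: inv)
    show "r \<odot>\<^bsub>N'\<^esub> x \<in> i ` carrier N"
      "f (inv_into (carrier N) i (r \<odot>\<^bsub>N'\<^esub> x)) = r \<odot>\<^bsub>E\<^esub> f (inv_into (carrier N) i x)"
      if "r \<in> carrier R" for r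
      using a that iD(3)[OF that a(1), symmetric] fD by (auto simp: inv)
    fix y assume "y \<in> i ` carrier N"
    then obtain b where b: "b \<in> carrier N" "y = i b" by blast
    show "x \<oplus>\<^bsub>N'\<^esub> y \<in> i ` carrier N"
      "f (inv_into (carrier N) i (x \<oplus>\<^bsub>N'\<^esub> y)) =
        f (inv_into (carrier N) i x) \<oplus>\<^bsub>E\<^esub> f (inv_into (carrier N) i y)"
      using a b iD(2)[OF a(1) b(1), symmetric] fD by (auto simp: inv)
  qed
  then show "\<exists>g\<in>module_hom R N' E. \<forall>x\<in>carrier N. g (i x) = f x"
    by (simp add: inv)
  qed
qed

section \<open>Ideals as modules, and copying modules between types\<close>

definition ideal_module :: "'a ring \<Rightarrow> 'a set \<Rightarrow> ('a, 'a) module"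
  where "ideal_module R I = \<lparr>carrier = I, mult = mult R, one = one R, zero = zero R, add = add R,
    smult = mult R\<rparr>"

lemma self_module_eq: "self_module R = ideal_module R (carrier R)"
  by (simp add: self_module_def ideal_module_def)

lemma module_ideal_module:
  assumes "cring R" "ideal I R"
  shows "Module.module R (ideal_module R I)"
proof -
  interpret cring R by fact
  interpret I: ideal I R by fact
  have "abelian_group (ideal_module R I)"
  proof (rule abelian_groupI)
    fix x assume x: "x \<in> carrier (ideal_module R I)"
    then show "\<exists>y\<in>carrier (ideal_module R I). y \<oplus>\<^bsub>ideal_module R I\<^esub> x = \<zero>\<^bsub>ideal_module R I\<^esub>"
      using I.a_inv_closed[of x] I.Icarr[of x]
      by (intro bexI[of _ "\<ominus>\<^bsub>R\<^esub> x"]) (simp_all add: ideal_module_def l_neg)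
  qed (simp_all add: ideal_module_def I.a_closed I.Icarr a_ac)
  then show ?thesis
    by (intro moduleI is_cring)
      (simp_all add: ideal_module_def I.Icarr I.I_l_closed l_distr r_distr m_assoc)
qed

text \<open>Structure transport along an injection j. It is used twice: ideals are copied into the
  carrier type of E, where injectivity can be tested on them, and a finished resolution is copied
  into the type that \<open>finite_injective_dim\<close> prescribes.\<close>

definition transport_module :: "('b \<Rightarrow> 'c) \<Rightarrow> ('a, 'b) module \<Rightarrow> ('a, 'c) module"
  where "transport_module j M = \<lparr>carrier = j ` carrier M,
    mult = (\<lambda>x y. j (inv_into (carrier M) j x \<otimes>\<^bsub>M\<^esub> inv_into (carrier M) j y)),
    one = j \<one>\<^bsub>M\<^esub>, zero = j \<zero>\<^bsub>M\<^esub>,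
    add = (\<lambda>x y. j (inv_into (carrier M) j x \<oplus>\<^bsub>M\<^esub> inv_into (carrier M) j y)),
    smult = (\<lambda>r x. j (r \<odot>\<^bsub>M\<^esub> inv_into (carrier M) j x))\<rparr>"

context
  fixes R :: "'a ring" and M :: "('a, 'b) module" and j :: "'b \<Rightarrow> 'c"
  assumes M: "Module.module R M" and j: "inj_on j (carrier M)"
begin

interpretation M: Module.module R M by (rule M)

lemma transport_simps:
  "carrier (transport_module j M) = j ` carrier M"
  "\<zero>\<^bsub>transport_module j M\<^esub> = j \<zero>\<^bsub>M\<^esub>"
  "x \<in> carrier M \<Longrightarrow> y \<in> carrier M \<Longrightarrow> j x \<oplus>\<^bsub>transport_module j M\<^esub> j y = j (x \<oplus>\<^bsub>M\<^esub> y)"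
  "x \<in> carrier M \<Longrightarrow> r \<odot>\<^bsub>transport_module j M\<^esub> j x = j (r \<odot>\<^bsub>M\<^esub> x)"
  "x \<in> carrier M \<Longrightarrow> inv_into (carrier M) j (j x) = x"
  using j by (simp_all add: transport_module_def)

lemma module_transport: "Module.module R (transport_module j M)"
proof (rule moduleI)
  show "cring R" by (rule M.R.is_cring)
  show "abelian_group (transport_module j M)"
  proof (rule abelian_groupI)
    fix x assume "x \<in> carrier (transport_module j M)"
    then obtain a where a: "a \<in> carrier M" "x = j a" by (auto simp: transport_simps)
    then have "j (\<ominus>\<^bsub>M\<^esub> a) \<oplus>\<^bsub>transport_module j M\<^esub> x = \<zero>\<^bsub>transport_module j M\<^esub>"
      by (simp add: transport_simps M.M.l_neg)
    then show "\<exists>y\<in>carrier (transport_module j M). y \<oplus>\<^bsub>transport_module j M\<^esub> x = \<zero>\<^bsub>transport_module j M\<^esub>"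
      using a by (intro bexI[of _ "j (\<ominus>\<^bsub>M\<^esub> a)"]) (simp_all add: transport_simps)
  qed (auto simp: transport_simps M.M.a_ac)
qed (auto simp: transport_simps M.smult_l_distr M.smult_r_distr M.smult_assoc1)

lemma transport_hom: "j \<in> module_hom R M (transport_module j M)"
  by (rule module_homI) (simp_all add: transport_simps)

lemma transport_inv_hom: "inv_into (carrier M) j \<in> module_hom R (transport_module j M) M"
  by (rule module_homI) (auto simp: transport_simps)

lemma baer_transport:
  assumes "baer R M"
  shows "baer R (transport_module j M)"
  unfolding baer_def
proof (rule conjI, rule module_transport, intro allI impI, elim conjE)
  fix I f
  assume I: "ideal I R" and f: "f \<in> I \<rightarrow> carrier (transport_module j M)"
    and add: "\<forall>x\<in>I. \<forall>y\<in>I. f (x \<oplus>\<^bsub>R\<^esub> y) = f x \<oplus>\<^bsub>transport_module j M\<^esub> f y"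
    and smult: "\<forall>r\<in>carrier R. \<forall>x\<in>I. f (r \<otimes>\<^bsub>R\<^esub> x) = r \<odot>\<^bsub>transport_module j M\<^esub> f x"
  note iD = module_homD[OF transport_inv_hom]
  have fc: "f x \<in> carrier (transport_module j M)" if "x \<in> I" for x
    using f that by auto
  have "\<exists>e\<in>carrier M. \<forall>x\<in>I. inv_into (carrier M) j (f x) = x \<odot>\<^bsub>M\<^esub> e"
    by (rule baerD[OF assms I]) (use iD fc add smult in simp_all)
  then obtain e where e: "e \<in> carrier M" "\<forall>x\<in>I. inv_into (carrier M) j (f x) = x \<odot>\<^bsub>M\<^esub> e" ..
  have "f x = x \<odot>\<^bsub>transport_module j M\<^esub> j e" if x: "x \<in> I" for x
  proof -
    obtain a where a: "a \<in> carrier M" "f x = j a" using fc[OF x] by (auto simp: transport_simps)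
    then show ?thesis using e x by (auto simp: transport_simps)
  qed
  then show "\<exists>e\<in>carrier (transport_module j M). \<forall>x\<in>I. f x = x \<odot>\<^bsub>transport_module j M\<^esub> e"
    using e(1) by (intro bexI[of _ "j e"]) (simp_all add: transport_simps)
qed

end

text \<open>Injectivity is tested on the inclusion of I into R, both copied along c into the carrier
  type of E. The extended map is determined by its value at 1, and this value is the element asked
  for by Baer's condition.\<close>

lemma injective_moduleD:
  fixes E :: "('a, 'b) module" and c :: "'a \<Rightarrow> 'b"
  assumes E: "injective_module R E" and c: "inj_on c (carrier R)"
  shows "baer R E"
  unfolding baer_def
proof (rule conjI)
  show EM: "Module.module R E" using E by (simp add: injective_module_def)
  interpret E: Module.module R E by fact
  show "\<forall>I f. ideal I R \<and> f \<in> I \<rightarrow> carrier E \<and>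
    (\<forall>x\<in>I. \<forall>y\<in>I. f (x \<oplus>\<^bsub>R\<^esub> y) = f x \<oplus>\<^bsub>E\<^esub> f y) \<and>
    (\<forall>r\<in>carrier R. \<forall>x\<in>I. f (r \<otimes>\<^bsub>R\<^esub> x) = r \<odot>\<^bsub>E\<^esub> f x) \<longrightarrow>
    (\<exists>e\<in>carrier E. \<forall>x\<in>I. f x = x \<odot>\<^bsub>E\<^esub> e)"
  proof (intro allI impI, elim conjE)
    fix I f
    assume I: "ideal I R" and f: "f \<in> I \<rightarrow> carrier E"
      and add: "\<forall>x\<in>I. \<forall>y\<in>I. f (x \<oplus>\<^bsub>R\<^esub> y) = f x \<oplus>\<^bsub>E\<^esub> f y"
      and smult: "\<forall>r\<in>carrier R. \<forall>x\<in>I. f (r \<otimes>\<^bsub>R\<^esub> x) = r \<odot>\<^bsub>E\<^esub> f x"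
    let ?I = "ideal_module R I" and ?R = "self_module R"
    have Ic: "x \<in> carrier R" if "x \<in> I" for x using ideal.Icarr[OF I that] .
    have cI: "inj_on c (carrier ?I)"
      using c Ic by (auto simp: ideal_module_def intro: inj_on_subset)
    have cR: "inj_on c (carrier ?R)"
      using c by (simp add: self_module_def)
    have mI: "Module.module R ?I" by (rule module_ideal_module[OF E.R.is_cring I])
    have mR: "Module.module R ?R"
      unfolding self_module_eq by (rule module_ideal_module[OF E.R.is_cring E.R.oneideal])
    have carr: "carrier ?I = I" "carrier ?R = carrier R"
      by (simp_all add: ideal_module_def self_module_def)
    have ops: "x \<oplus>\<^bsub>?I\<^esub> y = x \<oplus>\<^bsub>R\<^esub> y" "r \<odot>\<^bsub>?I\<^esub> x = r \<otimes>\<^bsub>R\<^esub> x"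
      "x \<oplus>\<^bsub>?R\<^esub> y = x \<oplus>\<^bsub>R\<^esub> y" "r \<odot>\<^bsub>?R\<^esub> x = r \<otimes>\<^bsub>R\<^esub> x" for x y r
      by (simp_all add: ideal_module_def self_module_def)
    note tI = transport_simps[OF mI cI, unfolded carr] and tR = transport_simps[OF mR cR, unfolded carr]
    have h1: "(\<lambda>x. x) \<in> module_hom R (transport_module c ?I) (transport_module c ?R)"
      by (rule module_homI) (auto simp: tI tR Ic ops)
    have h2: "(\<lambda>x. f (inv_into I c x)) \<in> module_hom R (transport_module c ?I) E"
    proof (rule module_homI)
      fix x assume "x \<in> carrier (transport_module c ?I)"
      then obtain a where a: "a \<in> I" "x = c a" by (auto simp: tI)
      show "f (inv_into I c x) \<in> carrier E" using a f by (auto simp: tI)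
      show "f (inv_into I c (r \<odot>\<^bsub>transport_module c ?I\<^esub> x)) = r \<odot>\<^bsub>E\<^esub> f (inv_into I c x)"
        if "r \<in> carrier R" for r
        using a smult that ideal.I_l_closed[OF I a(1) that] by (simp add: tI ops)
      fix y assume "y \<in> carrier (transport_module c ?I)"
      then obtain b where b: "b \<in> I" "y = c b" by (auto simp: tI)
      show "f (inv_into I c (x \<oplus>\<^bsub>transport_module c ?I\<^esub> y)) =
          f (inv_into I c x) \<oplus>\<^bsub>E\<^esub> f (inv_into I c y)"
        using a b add additive_subgroup.a_closed[OF ideal.axioms(1)[OF I] a(1) b(1)]
        by (simp add: tI ops)
    qed
    have "\<exists>g\<in>module_hom R (transport_module c ?R) E.
        \<forall>x\<in>carrier (transport_module c ?I). g x = f (inv_into I c x)"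
      by (rule E[unfolded injective_module_def, THEN conjunct2, THEN spec, THEN spec, THEN spec,
          THEN spec, THEN mp, OF conjI[OF module_transport[OF mI cI] conjI[OF module_transport[OF mR cR]
          conjI[OF h1 conjI[OF inj_on_id2 h2]]]]])
    then obtain g where g: "g \<in> module_hom R (transport_module c ?R) E"
      and gf: "\<forall>x\<in>carrier (transport_module c ?I). g x = f (inv_into I c x)" ..
    have "f x = x \<odot>\<^bsub>E\<^esub> g (c \<one>\<^bsub>R\<^esub>)" if x: "x \<in> I" for x
    proof -
      have "f x = g (c x)" using gf x by (simp add: tI)
      also have "c x = x \<odot>\<^bsub>transport_module c ?R\<^esub> c \<one>\<^bsub>R\<^esub>"
        using Ic[OF x] by (simp add: tR ops)
      also have "g \<dots> = x \<odot>\<^bsub>E\<^esub> g (c \<one>\<^bsub>R\<^esub>)"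
        using Ic[OF x] by (intro module_homD(3)[OF g]) (simp_all add: tR)
      finally show ?thesis .
    qed
    moreover have "g (c \<one>\<^bsub>R\<^esub>) \<in> carrier E"
      by (rule module_homD(1)[OF g]) (simp add: tR)
    ultimately show "\<exists>e\<in>carrier E. \<forall>x\<in>I. f x = x \<odot>\<^bsub>E\<^esub> e" by blast
  qed
qed

lemma module_hom_comp:
  assumes "f \<in> module_hom R L M" "g \<in> module_hom R M N"
  shows "(\<lambda>x. g (f x)) \<in> module_hom R L N"
  using module_homD[OF assms(1)] module_homD[OF assms(2)] by (intro module_homI) simp_all

lemma a_kernel_eq: "a_kernel M N h = {x \<in> carrier M. h x = \<zero>\<^bsub>N\<^esub>}"
  by (rule a_kernel_def')

text \<open>A resolution may be built over any carrier type, provided that injections j place its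
  terms into the prescribed one. Exactness is given elementwise and injectivity as Baer's condition,
  the forms in which both are obtained later.\<close>

lemma finite_injective_dimI:
  fixes F :: "nat \<Rightarrow> ('a, 'e) module" and j :: "nat \<Rightarrow> 'e \<Rightarrow> nat \<Rightarrow> 'a"
  assumes baer: "\<And>i. baer R (F i)" and j: "\<And>i. inj_on (j i) (carrier (F i))"
    and eps: "\<epsilon> \<in> module_hom R M (F 0)" "inj_on \<epsilon> (carrier M)"
    and d: "\<And>i. d i \<in> module_hom R (F i) (F (Suc i))"
    and ex0: "\<And>y. y \<in> carrier (F 0) \<Longrightarrow> d 0 y = \<zero>\<^bsub>F 1\<^esub> \<longleftrightarrow> y \<in> \<epsilon> ` carrier M"
    and ex: "\<And>i y. y \<in> carrier (F (Suc i)) \<Longrightarrow> d (Suc i) y = \<zero>\<^bsub>F (Suc (Suc i))\<^esub> \<longleftrightarrow>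
      y \<in> d i ` carrier (F i)"
    and bound: "\<And>i. i > r \<Longrightarrow> carrier (F i) = {\<zero>\<^bsub>F i\<^esub>}"
  shows "finite_injective_dim R M"
proof -
  have m: "Module.module R (F i)" for i using baer by (simp add: baer_def)
  define E where "E i = transport_module (j i) (F i)" for i
  define iv where "iv i = inv_into (carrier (F i)) (j i)" for i
  note t = transport_simps[OF m j, folded E_def iv_def]
  note jh = transport_hom[OF m j, folded E_def] and ih = transport_inv_hom[OF m j, folded E_def iv_def]
  define D where "D i y = j (Suc i) (d i (iv i y))" for i y
  define \<eta> where "\<eta> x = j 0 (\<epsilon> x)" for x
  note dD = module_homD[OF d] and epsD = module_homD[OF eps(1)]
  have zero: "j i x = \<zero>\<^bsub>E i\<^esub> \<longleftrightarrow> x = \<zero>\<^bsub>F i\<^esub>" if "x \<in> carrier (F i)" for i x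
  proof -
    interpret Module.module R "F i" by (rule m)
    show ?thesis using inj_onD[OF j, of i x "\<zero>\<^bsub>F i\<^esub>"] that by (auto simp: t)
  qed
  have Dj: "D i (j i x) = j (Suc i) (d i x)" if "x \<in> carrier (F i)" for i x
    using that by (simp add: D_def t)
  show ?thesis
    unfolding finite_injective_dim_def
  proof (intro exI conjI allI impI)
    show "injective_module R (E i)" for i
      unfolding E_def by (rule injective_moduleI[OF baer_transport[OF m j baer]])
    show "\<eta> \<in> module_hom R M (E 0)"
      unfolding \<eta>_def by (rule module_hom_comp[OF eps(1) jh])
    show "inj_on \<eta> (carrier M)"
      unfolding \<eta>_def using inj_onD[OF j] inj_onD[OF eps(2)] epsD(1) by (meson inj_onI)
    show "D i \<in> module_hom R (E i) (E (Suc i))" for i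
      unfolding D_def by (rule module_hom_comp[OF module_hom_comp[OF ih d] jh])
    show "\<eta> ` carrier M = a_kernel (E 0) (E 1) (D 0)"
    proof -
      have "y \<in> \<eta> ` carrier M \<longleftrightarrow> D 0 y = \<zero>\<^bsub>E 1\<^esub>" if "y \<in> carrier (E 0)" for y
      proof -
        obtain x where x: "x \<in> carrier (F 0)" "y = j 0 x" using \<open>y \<in> carrier _\<close> unfolding t(1) by blast
        have "D 0 y = \<zero>\<^bsub>E 1\<^esub> \<longleftrightarrow> d 0 x = \<zero>\<^bsub>F 1\<^esub>"
          using zero[of "d 0 x" 1] dD(1)[of x 0] x by (simp add: Dj)
        also have "\<dots> \<longleftrightarrow> x \<in> \<epsilon> ` carrier M" by (rule ex0[OF x(1)])
        also have "\<dots> \<longleftrightarrow> y \<in> \<eta> ` carrier M"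
          using inj_onD[OF j x(2)[symmetric, unfolded x(2)]] inj_onD[OF j, of 0 x] x epsD(1)
          unfolding \<eta>_def by (auto simp: image_iff)
        finally show ?thesis by simp
      qed
      moreover have "\<eta> ` carrier M \<subseteq> carrier (E 0)"
        unfolding \<eta>_def using epsD(1) by (auto simp: t)
      ultimately show ?thesis unfolding a_kernel_eq by blast
    qed
    show "D i ` carrier (E i) = a_kernel (E (Suc i)) (E (Suc (Suc i))) (D (Suc i))" for i
    proof -
      have "y \<in> D i ` carrier (E i) \<longleftrightarrow> D (Suc i) y = \<zero>\<^bsub>E (Suc (Suc i))\<^esub>" if "y \<in> carrier (E (Suc i))" for y
      proof -
        obtain x where x: "x \<in> carrier (F (Suc i))" "y = j (Suc i) x"
          using \<open>y \<in> carrier _\<close> unfolding t(1) by blast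
        have "D (Suc i) y = \<zero>\<^bsub>E (Suc (Suc i))\<^esub> \<longleftrightarrow> d (Suc i) x = \<zero>\<^bsub>F (Suc (Suc i))\<^esub>"
          using zero[of "d (Suc i) x" "Suc (Suc i)"] dD(1)[of x "Suc i"] x by (simp add: Dj)
        also have "\<dots> \<longleftrightarrow> x \<in> d i ` carrier (F i)" by (rule ex[OF x(1)])
        also have "\<dots> \<longleftrightarrow> y \<in> D i ` carrier (E i)"
          using inj_onD[OF j, of "Suc i" x] x dD(1)[of _ i] by (auto simp: image_iff t Dj)
        finally show ?thesis by simp
      qed
      moreover have "D i ` carrier (E i) \<subseteq> carrier (E (Suc i))"
        using dD(1)[of _ i] by (auto simp: t Dj)
      ultimately show ?thesis unfolding a_kernel_eq by blast
    qed
    show "carrier (E i) = {\<zero>\<^bsub>E i\<^esub>}" if "i > r" for i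
      using bound[OF that] by (simp add: t)
  qed
qed

section \<open>Localization of injective modules\<close>

locale noetherian_prime = prime_localization I R + noetherian_ring R
  for I and R :: "'a ring" (structure)
begin

abbreviation L where "L \<equiv> localization R I"
abbreviation T where "T \<equiv> carrier R - I"

sublocale L: cring L by (rule cring_localization)
sublocale \<rho>: ring_hom_cring R L "\<lambda>a. fraction R I a \<one>" by (rule fraction_hom)

end

locale localized_module = noetherian_prime I R + E: Module.module R E
  for I and R :: "'a ring" (structure) and E :: "('a, 'b) module" +
  assumes baer: "baer R E"
begin

text \<open>Equality in the localized module: x and y have the same image in E_I. Working with this
  relation on E avoids fractions of module elements.\<close>

definition teq :: "'b \<Rightarrow> 'b \<Rightarrow> bool"  (infix \<open>\<approx>\<close> 50)
  where "x \<approx> y \<longleftrightarrow> x \<in> carrier E \<and> y \<in> carrier E \<and> (\<exists>t\<in>T. t \<odot>\<^bsub>E\<^esub> x = t \<odot>\<^bsub>E\<^esub> y)"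

lemma teqI: "x \<in> carrier E \<Longrightarrow> y \<in> carrier E \<Longrightarrow> t \<in> T \<Longrightarrow> t \<odot>\<^bsub>E\<^esub> x = t \<odot>\<^bsub>E\<^esub> y \<Longrightarrow> x \<approx> y"
  by (auto simp: teq_def)

lemma teq_carrier: "x \<approx> y \<Longrightarrow> x \<in> carrier E" "x \<approx> y \<Longrightarrow> y \<in> carrier E"
  by (simp_all add: teq_def)

lemma teq_refl: "x \<in> carrier E \<Longrightarrow> x \<approx> x"
  by (rule teqI[OF _ _ one_compl]) simp_all

lemma teq_sym: "x \<approx> y \<Longrightarrow> y \<approx> x"
  unfolding teq_def by metis

lemma teq_trans [trans]:
  assumes "x \<approx> y" "y \<approx> z" shows "x \<approx> z"
proof -
  obtain s t where st: "s \<in> T" "t \<in> T" "s \<odot>\<^bsub>E\<^esub> x = s \<odot>\<^bsub>E\<^esub> y" "t \<odot>\<^bsub>E\<^esub> y = t \<odot>\<^bsub>E\<^esub> z"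
    and C: "x \<in> carrier E" "y \<in> carrier E" "z \<in> carrier E"
    using assms unfolding teq_def by metis
  have sc: "s \<in> carrier R" "t \<in> carrier R" using st by simp_all
  have "(s \<otimes> t) \<odot>\<^bsub>E\<^esub> x = t \<odot>\<^bsub>E\<^esub> (s \<odot>\<^bsub>E\<^esub> x)"
    using C sc by (simp add: m_comm E.smult_assoc1[symmetric])
  also have "\<dots> = s \<odot>\<^bsub>E\<^esub> (t \<odot>\<^bsub>E\<^esub> y)"
    unfolding st(3) using C sc by (simp add: m_comm E.smult_assoc1[symmetric])
  also have "\<dots> = (s \<otimes> t) \<odot>\<^bsub>E\<^esub> z"
    unfolding st(4) using C sc by (simp add: E.smult_assoc1)
  finally show ?thesis
    using mult_compl[OF st(1,2)] C by (intro teqI)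
qed

lemma teq_smult:
  assumes "x \<approx> y" "r \<in> carrier R" shows "r \<odot>\<^bsub>E\<^esub> x \<approx> r \<odot>\<^bsub>E\<^esub> y"
proof -
  obtain t where t: "t \<in> T" "t \<odot>\<^bsub>E\<^esub> x = t \<odot>\<^bsub>E\<^esub> y" and C: "x \<in> carrier E" "y \<in> carrier E"
    using assms unfolding teq_def by blast
  have tc: "t \<in> carrier R" using t by simp
  have "t \<odot>\<^bsub>E\<^esub> (r \<odot>\<^bsub>E\<^esub> x) = r \<odot>\<^bsub>E\<^esub> (t \<odot>\<^bsub>E\<^esub> x)" "t \<odot>\<^bsub>E\<^esub> (r \<odot>\<^bsub>E\<^esub> y) = r \<odot>\<^bsub>E\<^esub> (t \<odot>\<^bsub>E\<^esub> y)"
    using C tc assms(2) by (simp_all add: m_comm E.smult_assoc1[symmetric])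
  then show ?thesis
    using C assms(2) t by (intro teqI[of _ _ t]) simp_all
qed

lemma teq_add:
  assumes "x \<approx> y" "x' \<approx> y'" shows "x \<oplus>\<^bsub>E\<^esub> x' \<approx> y \<oplus>\<^bsub>E\<^esub> y'"
proof -
  obtain s t where st: "s \<in> T" "t \<in> T" "s \<odot>\<^bsub>E\<^esub> x = s \<odot>\<^bsub>E\<^esub> y" "t \<odot>\<^bsub>E\<^esub> x' = t \<odot>\<^bsub>E\<^esub> y'"
    and C: "x \<in> carrier E" "y \<in> carrier E" "x' \<in> carrier E" "y' \<in> carrier E"
    using assms unfolding teq_def by metis
  have sc: "s \<in> carrier R" "t \<in> carrier R" using st by simp_all
  have "(s \<otimes> t) \<odot>\<^bsub>E\<^esub> (x \<oplus>\<^bsub>E\<^esub> x') = t \<odot>\<^bsub>E\<^esub> (s \<odot>\<^bsub>E\<^esub> x) \<oplus>\<^bsub>E\<^esub> s \<odot>\<^bsub>E\<^esub> (t \<odot>\<^bsub>E\<^esub> x')"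
    using C sc by (simp add: m_comm E.smult_r_distr E.smult_assoc1[symmetric])
  also have "\<dots> = (s \<otimes> t) \<odot>\<^bsub>E\<^esub> (y \<oplus>\<^bsub>E\<^esub> y')"
    unfolding st(3,4) using C sc by (simp add: m_comm E.smult_r_distr E.smult_assoc1[symmetric])
  finally show ?thesis
    using mult_compl[OF st(1,2)] C by (intro teqI[of _ _ "s \<otimes> t"]) simp_all
qed

lemma teq_cancel:
  assumes "t \<in> T" "x \<in> carrier E" "y \<in> carrier E" "t \<odot>\<^bsub>E\<^esub> x \<approx> t \<odot>\<^bsub>E\<^esub> y"
  shows "x \<approx> y"
proof -
  obtain s where s: "s \<in> T" "s \<odot>\<^bsub>E\<^esub> (t \<odot>\<^bsub>E\<^esub> x) = s \<odot>\<^bsub>E\<^esub> (t \<odot>\<^bsub>E\<^esub> y)"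
    using assms(4) unfolding teq_def by blast
  then show ?thesis
    using assms(1-3) mult_compl[OF s(1) assms(1)]
    by (intro teqI[of _ _ "s \<otimes> t"]) (simp_all add: E.smult_assoc1)
qed

text \<open>Over a noetherian ring an injective module is divisible modulo torsion by elements of \<open>T\<close>:
  the annihilators of the powers of \<open>t\<close> stabilize, so \<open>t\<^sup>k\<^sup>+\<^sup>1 r \<mapsto> t\<^sup>k r x\<close> is well defined.\<close>

lemma annihilator_stable:
  assumes "t \<in> carrier R"
  shows "\<exists>k::nat. \<forall>r\<in>carrier R. t [^] Suc k \<otimes> r = \<zero> \<longrightarrow> t [^] k \<otimes> r = \<zero>"
proof -
  define K where "K k = {r \<in> carrier R. t [^] (k::nat) \<otimes> r = \<zero>}" for k
  have K: "ideal (K k) R" for k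
    by (rule cring_idealI) (use assms in \<open>auto simp: K_def r_distr m_lcomm\<close>)
  have Suc: "K k \<subseteq> K (Suc k)" for k
    using assms by (auto simp: K_def m_comm[of _ t] m_assoc)
  have "subset.chain {J. ideal J R} (range K)"
    unfolding subset_chain_def
  proof (intro conjI ballI)
    show "range K \<subseteq> {J. ideal J R}" using K by auto
    fix X Y assume "X \<in> range K" "Y \<in> range K"
    then obtain a b where ab: "X = K a" "Y = K b" by blast
    have "K a \<subseteq> K b" if "a \<le> b" for a b using lift_Suc_mono_le[of K, OF Suc that] .
    then show "X \<subseteq> Y \<or> Y \<subseteq> X" unfolding ab by (metis nle_le)
  qed
  then have "\<Union>(range K) \<in> range K"
    by (intro ideal_chain_is_trivial) auto
  then obtain k where k: "\<Union>(range K) = K k" by blast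
  have "t [^] k \<otimes> r = \<zero>" if "r \<in> carrier R" "t [^] Suc k \<otimes> r = \<zero>" for r
  proof -
    have "r \<in> K (Suc k)" using that by (simp add: K_def)
    then have "r \<in> K k" using k by blast
    then show ?thesis by (simp add: K_def)
  qed
  then show ?thesis by blast
qed

lemma divisible:
  assumes t: "t \<in> T" and x: "x \<in> carrier E"
  shows "\<exists>e. t \<odot>\<^bsub>E\<^esub> e \<approx> x \<and> e \<in> carrier E"
proof -
  have tc: "t \<in> carrier R" using t by simp
  obtain k :: nat where k: "\<forall>r\<in>carrier R. t [^] Suc k \<otimes> r = \<zero> \<longrightarrow> t [^] k \<otimes> r = \<zero>"
    using annihilator_stable[OF tc] ..
  define u where "u = t [^] Suc k"
  define v where "v = t [^] k"
  have uv: "u \<in> carrier R" "v \<in> carrier R" "u = v \<otimes> t" using tc by (auto simp: u_def v_def)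
  have vT: "t [^] (n::nat) \<in> T" for n
    by (induction n) (use t mult_compl in \<open>auto simp del: Diff_iff simp: one_compl\<close>)
  define c where "c y = (SOME r. r \<in> carrier R \<and> y = r \<otimes> u)" for y
  have c: "v \<otimes> c (r \<otimes> u) = v \<otimes> r \<and> c (r \<otimes> u) \<in> carrier R" if r: "r \<in> carrier R" for r
  proof -
    define d where "d = c (r \<otimes> u)"
    have "c (r \<otimes> u) \<in> carrier R \<and> r \<otimes> u = c (r \<otimes> u) \<otimes> u"
      unfolding c_def by (rule someI[of _ r]) (use r in simp)
    then have d: "d \<in> carrier R" "d \<otimes> u = r \<otimes> u" unfolding d_def by auto
    \<comment> \<open>The chosen coefficient d may differ from r, but u (d - r) = 0 implies v (d -
      r) = 0 by the choice of k. This is why f carries the factor v.\<close>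
    have "u \<otimes> (d \<ominus> r) = d \<otimes> u \<oplus> \<ominus> (r \<otimes> u)"
      using r d(1) uv(1) by (simp add: minus_eq r_distr r_minus m_comm[of u])
    then have "u \<otimes> (d \<ominus> r) = \<zero>"
      unfolding d(2) using r uv(1) by (simp add: r_neg)
    then have "v \<otimes> (d \<ominus> r) = \<zero>"
      using bspec[OF k, of "d \<ominus> r"] r d(1) unfolding u_def v_def by simp
    then have "v \<otimes> d \<ominus> v \<otimes> r = \<zero>"
      using r uv(2) d(1) by (simp add: minus_eq r_distr r_minus)
    then have "v \<otimes> d = v \<otimes> r"
      using r uv(2) d(1) by simp
    then show ?thesis using d(1) unfolding d_def by simp
  qed
  define f where "f y = (v \<otimes> c y) \<odot>\<^bsub>E\<^esub> x" for y
  have f: "f (r \<otimes> u) = (v \<otimes> r) \<odot>\<^bsub>E\<^esub> x" if "r \<in> carrier R" for r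
    using c[OF that] by (simp add: f_def)
  have "\<exists>e\<in>carrier E. \<forall>y\<in>PIdl u. f y = y \<odot>\<^bsub>E\<^esub> e"
  proof (rule baerD[OF baer cgenideal_ideal[OF uv(1)]])
    fix y assume "y \<in> PIdl u"
    then obtain r where r: "r \<in> carrier R" "y = r \<otimes> u" by (auto simp: cgenideal_def)
    show "f y \<in> carrier E" using r f[OF r(1)] uv x by simp
    show "f (s \<otimes> y) = s \<odot>\<^bsub>E\<^esub> f y" if s: "s \<in> carrier R" for s
    proof -
      have "f (s \<otimes> y) = f ((s \<otimes> r) \<otimes> u)" using r s uv by (simp add: m_assoc)
      also have "\<dots> = (v \<otimes> (s \<otimes> r)) \<odot>\<^bsub>E\<^esub> x" using r s by (intro f) simp
      also have "\<dots> = s \<odot>\<^bsub>E\<^esub> f y"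
        using r f[OF r(1)] s uv x by (simp add: m_lcomm E.smult_assoc1)
      finally show ?thesis .
    qed
    fix z assume "z \<in> PIdl u"
    then obtain s where s: "s \<in> carrier R" "z = s \<otimes> u" by (auto simp: cgenideal_def)
    have "f (y \<oplus> z) = f ((r \<oplus> s) \<otimes> u)" using r s uv by (simp add: l_distr)
    also have "\<dots> = (v \<otimes> (r \<oplus> s)) \<odot>\<^bsub>E\<^esub> x" using r s by (intro f) simp
    also have "\<dots> = f y \<oplus>\<^bsub>E\<^esub> f z"
      using r s f[OF r(1)] f[OF s(1)] uv x by (simp add: r_distr E.smult_l_distr)
    finally show "f (y \<oplus> z) = f y \<oplus>\<^bsub>E\<^esub> f z" .
  qed
  then obtain e where e: "e \<in> carrier E" "\<forall>y\<in>PIdl u. f y = y \<odot>\<^bsub>E\<^esub> e" ..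
  \<comment> \<open>Evaluation at u = v t gives v x = v (t e), and v is a power of t, hence in
    T.\<close>
  have "u \<in> PIdl u" using uv(1) by (rule cgenideal_self)
  then have "v \<odot>\<^bsub>E\<^esub> x = v \<odot>\<^bsub>E\<^esub> (t \<odot>\<^bsub>E\<^esub> e)"
    using e f[OF one_closed] uv tc x by (simp add: E.smult_assoc1)
  then show ?thesis
    using e(1) tc x vT[of k] unfolding v_def[symmetric] by (intro exI[of _ e] conjI teqI[of _ _ v]) auto
qed

text \<open>A canonical representative: equivalent elements have the same predicate under
  \<open>SOME\<close>, so the same choice. Representatives in place of classes keep the localized
  module in the carrier type of E.\<close>

definition q :: "'b \<Rightarrow> 'b" where "q x = (SOME y. x \<approx> y)"

lemma q_teq: "x \<in> carrier E \<Longrightarrow> x \<approx> q x"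
  unfolding q_def using someI[of "\<lambda>y. x \<approx> y" x] teq_refl by blast

lemma q_closed [simp]: "x \<in> carrier E \<Longrightarrow> q x \<in> carrier E"
  using q_teq teq_carrier(2) by blast

lemma q_eq_iff:
  assumes "x \<in> carrier E" "y \<in> carrier E"
  shows "q x = q y \<longleftrightarrow> x \<approx> y"
proof
  assume "q x = q y"
  then show "x \<approx> y" using q_teq[OF assms(1)] teq_sym[OF q_teq[OF assms(2)]] teq_trans by simp
next
  assume "x \<approx> y"
  then have "(\<lambda>z. x \<approx> z) = (\<lambda>z. y \<approx> z)"
    using teq_trans[OF \<open>x \<approx> y\<close>] teq_trans[OF teq_sym[OF \<open>x \<approx> y\<close>]] by (intro ext iffI)
  then show "q x = q y" by (simp add: q_def)
qed

lemma q_eqI: "x \<approx> y \<Longrightarrow> q x = q y"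
  using q_eq_iff teq_carrier by blast

lemma q_q [simp]: "x \<in> carrier E \<Longrightarrow> q (q x) = q x"
  using q_eqI[OF q_teq] by simp

text \<open>The localization of \<open>E\<close>.  By divisibility no new elements are needed: it is \<open>E\<close> modulo torsion, and
  \<open>b/t\<close> maps the class of \<open>x\<close> to the class of any \<open>e\<close> with \<open>t e \<approx> b x\<close>.\<close>

definition F :: "(('a \<times> 'a) set, 'b) module"
  where "F = \<lparr>carrier = q ` carrier E, mult = undefined, one = undefined, zero = q \<zero>\<^bsub>E\<^esub>,
    add = (\<lambda>x y. q (x \<oplus>\<^bsub>E\<^esub> y)),
    smult = (\<lambda>z x. q (SOME e. e \<in> carrier E \<and> (\<exists>b t. b \<in> carrier R \<and> t \<in> T \<and>
      z = fraction R I b t \<and> t \<odot>\<^bsub>E\<^esub> e \<approx> b \<odot>\<^bsub>E\<^esub> x)))\<rparr>"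

lemma F_carrier: "carrier F = q ` carrier E" and F_zero: "\<zero>\<^bsub>F\<^esub> = q \<zero>\<^bsub>E\<^esub>"
  by (simp_all add: F_def)

lemma F_carrierD: "y \<in> carrier F \<Longrightarrow> y \<in> carrier E \<and> q y = y"
  by (auto simp: F_carrier)

lemma q_F [simp]: "x \<in> carrier E \<Longrightarrow> q x \<in> carrier F"
  by (simp add: F_carrier)

lemma F_add:
  assumes "x \<in> carrier E" "y \<in> carrier E"
  shows "q x \<oplus>\<^bsub>F\<^esub> q y = q (x \<oplus>\<^bsub>E\<^esub> y)"
  using teq_add[OF q_teq[OF assms(1)] q_teq[OF assms(2)]] q_eqI teq_sym
  by (simp add: F_def)

text \<open>Scalar multiplication on F is independent of the fraction, of the representative x and
  of the chosen quotient e. With u witnessing the equality of the two fractions, multiplication by u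
  s t turns e into (u b t) x and e' into (u c s) y up to torsion, and u s t can be cancelled because
  it lies in T.\<close>

lemma F_smult_unique:
  assumes b: "b \<in> carrier R" "c \<in> carrier R" "s \<in> T" "t \<in> T" "fraction R I b s = fraction R I c t"
    and x: "x \<approx> y" and e: "e \<in> carrier E" "e' \<in> carrier E"
    and 1: "s \<odot>\<^bsub>E\<^esub> e \<approx> b \<odot>\<^bsub>E\<^esub> x" and 2: "t \<odot>\<^bsub>E\<^esub> e' \<approx> c \<odot>\<^bsub>E\<^esub> y"
  shows "e \<approx> e'"
proof -
  have st: "s \<in> carrier R" "t \<in> carrier R" using b by simp_all
  note xc = teq_carrier[OF x]
  obtain u where u: "u \<in> T" "u \<otimes> (b \<otimes> t) = u \<otimes> (c \<otimes> s)"
    using b(5) unfolding fraction_eq_iff[OF b(1-4)] ..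
  have uc: "u \<in> carrier R" using u by simp
  have "(u \<otimes> (s \<otimes> t)) \<odot>\<^bsub>E\<^esub> e = (u \<otimes> t) \<odot>\<^bsub>E\<^esub> (s \<odot>\<^bsub>E\<^esub> e)"
    using uc st e by (simp add: E.smult_assoc1[symmetric] m_ac)
  also have "\<dots> \<approx> (u \<otimes> t) \<odot>\<^bsub>E\<^esub> (b \<odot>\<^bsub>E\<^esub> x)"
    using uc st by (intro teq_smult 1) simp
  also have "\<dots> = (u \<otimes> (b \<otimes> t)) \<odot>\<^bsub>E\<^esub> x"
    using uc st b xc by (simp add: E.smult_assoc1[symmetric] m_ac)
  also have "\<dots> = (u \<otimes> (c \<otimes> s)) \<odot>\<^bsub>E\<^esub> x" by (simp only: u(2))
  also have "\<dots> \<approx> (u \<otimes> (c \<otimes> s)) \<odot>\<^bsub>E\<^esub> y"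
    using uc st b by (intro teq_smult x) simp
  also have "\<dots> = (u \<otimes> s) \<odot>\<^bsub>E\<^esub> (c \<odot>\<^bsub>E\<^esub> y)"
    using uc st b xc by (simp add: E.smult_assoc1[symmetric] m_ac)
  also have "\<dots> \<approx> (u \<otimes> s) \<odot>\<^bsub>E\<^esub> (t \<odot>\<^bsub>E\<^esub> e')"
    using uc st by (intro teq_smult teq_sym[OF 2]) simp
  also have "\<dots> = (u \<otimes> (s \<otimes> t)) \<odot>\<^bsub>E\<^esub> e'"
    using uc st e by (simp add: E.smult_assoc1[symmetric] m_ac)
  finally show ?thesis
    using mult_compl[OF u(1) mult_compl[OF b(3,4)]] e by (rule teq_cancel[rotated 3])
qed

lemma F_smult:
  assumes "b \<in> carrier R" "t \<in> T" "x \<in> carrier E" "e \<in> carrier E" "t \<odot>\<^bsub>E\<^esub> e \<approx> b \<odot>\<^bsub>E\<^esub> x"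
  shows "fraction R I b t \<odot>\<^bsub>F\<^esub> q x = q e"
proof -
  let ?P = "\<lambda>e. e \<in> carrier E \<and> (\<exists>c s. c \<in> carrier R \<and> s \<in> T \<and>
      fraction R I b t = fraction R I c s \<and> s \<odot>\<^bsub>E\<^esub> e \<approx> c \<odot>\<^bsub>E\<^esub> q x)"
  have "t \<odot>\<^bsub>E\<^esub> e \<approx> b \<odot>\<^bsub>E\<^esub> q x"
    using assms(5) teq_smult[OF q_teq[OF assms(3)] assms(1)] by (rule teq_trans)
  then have "?P e" using assms(1,2,4) by blast
  then have "?P (Eps ?P)" by (rule someI)
  then obtain c s where cs: "c \<in> carrier R" "s \<in> T" "fraction R I b t = fraction R I c s"
    "s \<odot>\<^bsub>E\<^esub> Eps ?P \<approx> c \<odot>\<^bsub>E\<^esub> q x" "Eps ?P \<in> carrier E" by blast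
  have "e \<approx> Eps ?P"
    by (rule F_smult_unique[OF assms(1) cs(1) assms(2) cs(2,3) q_teq[OF assms(3)] assms(4) cs(5)
      assms(5) cs(4)])
  then show ?thesis
    using q_eqI by (simp add: F_def)
qed

lemma F_smult_ex:
  assumes "b \<in> carrier R" "t \<in> T" "x \<in> carrier E"
  obtains e where "e \<in> carrier E" "t \<odot>\<^bsub>E\<^esub> e \<approx> b \<odot>\<^bsub>E\<^esub> x" "fraction R I b t \<odot>\<^bsub>F\<^esub> q x = q e"
  using divisible[OF assms(2), of "b \<odot>\<^bsub>E\<^esub> x"] assms F_smult[OF assms] by auto

lemma F_smult_one:
  assumes "r \<in> carrier R" "x \<in> carrier E"
  shows "fraction R I r \<one> \<odot>\<^bsub>F\<^esub> q x = q (r \<odot>\<^bsub>E\<^esub> x)"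
  using assms teq_refl by (intro F_smult one_compl) simp_all

lemma module_F: "Module.module L F"
proof (rule moduleI)
  show "cring L" by (rule cring_localization)
  show "abelian_group F"
  proof (rule abelian_groupI)
    fix x assume "x \<in> carrier F"
    then obtain a where a: "a \<in> carrier E" "x = q a" by (auto simp: F_carrier)
    then have "q (\<ominus>\<^bsub>E\<^esub> a) \<oplus>\<^bsub>F\<^esub> x = \<zero>\<^bsub>F\<^esub>"
      by (simp add: F_add F_zero E.M.l_neg)
    then show "\<exists>y\<in>carrier F. y \<oplus>\<^bsub>F\<^esub> x = \<zero>\<^bsub>F\<^esub>"
      using a by (intro bexI[of _ "q (\<ominus>\<^bsub>E\<^esub> a)"]) simp_all
  qed (auto simp: F_carrier F_add F_zero E.M.a_ac)
next
  fix x assume "x \<in> carrier F"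
  then obtain a where a: "a \<in> carrier E" "x = q a" by (auto simp: F_carrier)
  show "\<one>\<^bsub>L\<^esub> \<odot>\<^bsub>F\<^esub> x = x"
    unfolding localization_one a(2) using F_smult_one[OF one_closed a(1)] a(1) by simp
next
  fix z x assume z: "z \<in> carrier L" and x: "x \<in> carrier F"
  obtain b s where b: "b \<in> carrier R" "s \<in> T" "z = fraction R I b s" using z by (rule fraction_cases)
  obtain a where a: "a \<in> carrier E" "x = q a" using x by (auto simp: F_carrier)
  obtain e where e: "e \<in> carrier E" "s \<odot>\<^bsub>E\<^esub> e \<approx> b \<odot>\<^bsub>E\<^esub> a" "z \<odot>\<^bsub>F\<^esub> x = q e"
    using F_smult_ex[OF b(1,2) a(1)] unfolding b(3) a(2) .
  have sc: "s \<in> carrier R" using b by simp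
  show "z \<odot>\<^bsub>F\<^esub> x \<in> carrier F" using e by simp
  show "z \<odot>\<^bsub>F\<^esub> (x \<oplus>\<^bsub>F\<^esub> y) = z \<odot>\<^bsub>F\<^esub> x \<oplus>\<^bsub>F\<^esub> z \<odot>\<^bsub>F\<^esub> y" if y: "y \<in> carrier F" for y
  proof -
    obtain a' where a': "a' \<in> carrier E" "y = q a'" using y by (auto simp: F_carrier)
    obtain e' where e': "e' \<in> carrier E" "s \<odot>\<^bsub>E\<^esub> e' \<approx> b \<odot>\<^bsub>E\<^esub> a'" "z \<odot>\<^bsub>F\<^esub> y = q e'"
      using F_smult_ex[OF b(1,2) a'(1)] unfolding b(3) a'(2) .
    have "s \<odot>\<^bsub>E\<^esub> (e \<oplus>\<^bsub>E\<^esub> e') \<approx> b \<odot>\<^bsub>E\<^esub> (a \<oplus>\<^bsub>E\<^esub> a')"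
      using teq_add[OF e(2) e'(2)] b sc a a' e e' by (simp add: E.smult_r_distr)
    then have "z \<odot>\<^bsub>F\<^esub> q (a \<oplus>\<^bsub>E\<^esub> a') = q (e \<oplus>\<^bsub>E\<^esub> e')"
      unfolding b(3) using a a' e e' by (intro F_smult b) simp_all
    then show ?thesis
      unfolding e(3) e'(3) using a a' e e' by (simp add: F_add)
  qed
  fix w assume w: "w \<in> carrier L"
  obtain c t where c: "c \<in> carrier R" "t \<in> T" "w = fraction R I c t" using w by (rule fraction_cases)
  have tc: "t \<in> carrier R" using c by simp
  obtain e' where e': "e' \<in> carrier E" "t \<odot>\<^bsub>E\<^esub> e' \<approx> c \<odot>\<^bsub>E\<^esub> a" "w \<odot>\<^bsub>F\<^esub> x = q e'"
    using F_smult_ex[OF c(1,2) a(1)] unfolding c(3) a(2) .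
  note stT = mult_compl[OF b(2) c(2)]
  show "(z \<oplus>\<^bsub>L\<^esub> w) \<odot>\<^bsub>F\<^esub> x = z \<odot>\<^bsub>F\<^esub> x \<oplus>\<^bsub>F\<^esub> w \<odot>\<^bsub>F\<^esub> x"
  proof -
    have "(s \<otimes> t) \<odot>\<^bsub>E\<^esub> (e \<oplus>\<^bsub>E\<^esub> e') = t \<odot>\<^bsub>E\<^esub> (s \<odot>\<^bsub>E\<^esub> e) \<oplus>\<^bsub>E\<^esub> s \<odot>\<^bsub>E\<^esub> (t \<odot>\<^bsub>E\<^esub> e')"
      using sc tc e e' by (simp add: E.smult_r_distr E.smult_assoc1[symmetric] m_comm)
    also have "\<dots> \<approx> t \<odot>\<^bsub>E\<^esub> (b \<odot>\<^bsub>E\<^esub> a) \<oplus>\<^bsub>E\<^esub> s \<odot>\<^bsub>E\<^esub> (c \<odot>\<^bsub>E\<^esub> a)"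
      by (intro teq_add teq_smult e e' sc tc)
    also have "\<dots> = (b \<otimes> t \<oplus> c \<otimes> s) \<odot>\<^bsub>E\<^esub> a"
      using sc tc b c a by (simp add: E.smult_l_distr E.smult_assoc1[symmetric] m_comm)
    finally show ?thesis
      unfolding e(3) e'(3) F_add[OF e(1) e'(1)]
      unfolding b(3) c(3) a(2) fraction_add[OF b(1) c(1) b(2) c(2)]
      using sc tc b(1) c(1) a(1) e(1) e'(1) by (intro F_smult stT) simp_all
  qed
  show "(z \<otimes>\<^bsub>L\<^esub> w) \<odot>\<^bsub>F\<^esub> x = z \<odot>\<^bsub>F\<^esub> (w \<odot>\<^bsub>F\<^esub> x)"
  proof -
    obtain e'' where e'': "e'' \<in> carrier E" "s \<odot>\<^bsub>E\<^esub> e'' \<approx> b \<odot>\<^bsub>E\<^esub> e'" "z \<odot>\<^bsub>F\<^esub> q e' = q e''"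
      using F_smult_ex[OF b(1,2) e'(1)] unfolding b(3) .
    have "(s \<otimes> t) \<odot>\<^bsub>E\<^esub> e'' = t \<odot>\<^bsub>E\<^esub> (s \<odot>\<^bsub>E\<^esub> e'')"
      using sc tc e'' by (simp add: E.smult_assoc1[symmetric] m_comm)
    also have "\<dots> \<approx> t \<odot>\<^bsub>E\<^esub> (b \<odot>\<^bsub>E\<^esub> e')" by (intro teq_smult e'' tc)
    also have "\<dots> = b \<odot>\<^bsub>E\<^esub> (t \<odot>\<^bsub>E\<^esub> e')"
      using tc b e' by (simp add: E.smult_assoc1[symmetric] m_comm)
    also have "\<dots> \<approx> b \<odot>\<^bsub>E\<^esub> (c \<odot>\<^bsub>E\<^esub> a)" by (intro teq_smult e' b)
    also have "\<dots> = (b \<otimes> c) \<odot>\<^bsub>E\<^esub> a" using b c a by (simp add: E.smult_assoc1)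
    finally show ?thesis
      unfolding e'(3) e''(3)
      unfolding b(3) c(3) a(2) fraction_mult[OF b(1) c(1) b(2) c(2)]
      using b(1) c(1) a(1) e''(1) by (intro F_smult stT) simp_all
  qed
qed

lemma q_zero_iff: "x \<in> carrier E \<Longrightarrow> q x = \<zero>\<^bsub>F\<^esub> \<longleftrightarrow> (\<exists>t\<in>T. t \<odot>\<^bsub>E\<^esub> x = \<zero>\<^bsub>E\<^esub>)"
  unfolding F_zero by (subst q_eq_iff) (auto simp: teq_def)

end

context localized_module
begin

sublocale F: Module.module L F by (rule module_F)

text \<open>C is finitely generated, a product of finitely many elements of T kills all generators
  times e, and the r with t r e = 0 form an ideal. So the denominators, which may a priori vary with
  r, can be made uniform.\<close>

lemma torsion_common:
  assumes C: "ideal C R" and e: "e \<in> carrier E"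
    and tors: "\<And>r. r \<in> C \<Longrightarrow> \<exists>t\<in>T. t \<odot>\<^bsub>E\<^esub> (r \<odot>\<^bsub>E\<^esub> e) = \<zero>\<^bsub>E\<^esub>"
  shows "\<exists>t\<in>T. \<forall>r\<in>C. t \<odot>\<^bsub>E\<^esub> (r \<odot>\<^bsub>E\<^esub> e) = \<zero>\<^bsub>E\<^esub>"
proof -
  obtain S where S: "S \<subseteq> carrier R" "finite S" "C = Idl S"
    using finetely_gen[OF C] by blast
  have SC: "S \<subseteq> C" unfolding S(3) by (rule genideal_self[OF S(1)])
  have Cc: "C \<subseteq> carrier R" using ideal.Icarr[OF C] by blast
  have "\<exists>t\<in>T. \<forall>r\<in>S'. t \<odot>\<^bsub>E\<^esub> (r \<odot>\<^bsub>E\<^esub> e) = \<zero>\<^bsub>E\<^esub>" if "finite S'" "S' \<subseteq> C" for S'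
    using that
  proof (induction S')
    case empty
    then show ?case using one_compl by blast
  next
    case (insert r S')
    obtain t where t: "t \<in> T" "\<forall>r\<in>S'. t \<odot>\<^bsub>E\<^esub> (r \<odot>\<^bsub>E\<^esub> e) = \<zero>\<^bsub>E\<^esub>"
      using insert by auto
    obtain s where s: "s \<in> T" "s \<odot>\<^bsub>E\<^esub> (r \<odot>\<^bsub>E\<^esub> e) = \<zero>\<^bsub>E\<^esub>"
      using tors[of r] insert.prems by auto
    have sc: "s \<in> carrier R" "t \<in> carrier R" using s t by simp_all
    have "(s \<otimes> t) \<odot>\<^bsub>E\<^esub> (x \<odot>\<^bsub>E\<^esub> e) = \<zero>\<^bsub>E\<^esub>" if x: "x \<in> insert r S'" for x
    proof (cases "x = r")
      case True
      have "r \<in> carrier R" using insert.prems Cc by auto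
      then have "(s \<otimes> t) \<odot>\<^bsub>E\<^esub> (r \<odot>\<^bsub>E\<^esub> e) = t \<odot>\<^bsub>E\<^esub> (s \<odot>\<^bsub>E\<^esub> (r \<odot>\<^bsub>E\<^esub> e))"
        using sc e by (subst m_comm) (simp_all add: E.smult_assoc1)
      then show ?thesis using True s sc by simp
    next
      case False
      then have "x \<in> S'" "x \<in> carrier R" using x insert.prems Cc by auto
      then show ?thesis using t(2) sc e by (simp add: E.smult_assoc1)
    qed
    then show ?case using mult_compl[OF s(1) t(1)] by blast
  qed
  from this[OF S(2) SC] obtain t where t: "t \<in> T" "\<forall>r\<in>S. t \<odot>\<^bsub>E\<^esub> (r \<odot>\<^bsub>E\<^esub> e) = \<zero>\<^bsub>E\<^esub>" ..
  have tc: "t \<in> carrier R" using t by simp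
  define K where "K = {r \<in> carrier R. t \<odot>\<^bsub>E\<^esub> (r \<odot>\<^bsub>E\<^esub> e) = \<zero>\<^bsub>E\<^esub>}"
  have "ideal K R"
  proof (rule cring_idealI)
    show "r \<otimes> x \<in> K" if "r \<in> carrier R" "x \<in> K" for r x
    proof -
      have x: "x \<in> carrier R" "t \<odot>\<^bsub>E\<^esub> (x \<odot>\<^bsub>E\<^esub> e) = \<zero>\<^bsub>E\<^esub>" using that(2) by (simp_all add: K_def)
      have "t \<odot>\<^bsub>E\<^esub> ((r \<otimes> x) \<odot>\<^bsub>E\<^esub> e) = r \<odot>\<^bsub>E\<^esub> (t \<odot>\<^bsub>E\<^esub> (x \<odot>\<^bsub>E\<^esub> e))"
        using x(1) that(1) tc e by (simp add: E.smult_assoc1[symmetric] m_lcomm)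
      then show ?thesis using x that(1) by (simp add: K_def)
    qed
  qed (use tc e in \<open>auto simp: K_def E.smult_l_distr E.smult_r_distr\<close>)
  then have "C \<subseteq> K"
    unfolding S(3) by (rule genideal_minimal) (use S(1) t(2) in \<open>auto simp: K_def\<close>)
  then show ?thesis using t(1) by (intro bexI[of _ t]) (auto simp: K_def)
qed

text \<open>Baer's argument with denominators. On K, the map t0 g is multiplication by e0; at a it
  differs from this by the defect e' = w - a e0, where w represents t0 g(a). The defect is torsion
  on all r with r a in K, so after multiplication by one t1 the rule p + r a \<mapsto> r t1 e'
  becomes a genuine linear map from K + (a) to E. The Baer property of E represents it by some
  e1.\<close>

lemma localized_extension_step:
  assumes g: "\<And>x. x \<in> J \<Longrightarrow> g x \<in> carrier F"
      "\<And>x y. x \<in> J \<Longrightarrow> y \<in> J \<Longrightarrow> g (x \<oplus> y) = g x \<oplus>\<^bsub>F\<^esub> g y"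
      "\<And>r x. r \<in> carrier R \<Longrightarrow> x \<in> J \<Longrightarrow> g (r \<otimes> x) = fraction R I r \<one> \<odot>\<^bsub>F\<^esub> g x"
    and J: "ideal J R" and K: "ideal K R" "K \<subseteq> J" and a: "a \<in> J"
    and t0: "t0 \<in> T" and e0: "e0 \<in> carrier E"
    and K0: "\<And>x. x \<in> K \<Longrightarrow> fraction R I t0 \<one> \<odot>\<^bsub>F\<^esub> g x = q (x \<odot>\<^bsub>E\<^esub> e0)"
  shows "\<exists>t\<in>T. \<exists>e\<in>carrier E. \<forall>p\<in>K. \<forall>r\<in>carrier R.
    fraction R I t \<one> \<odot>\<^bsub>F\<^esub> g (p \<oplus> r \<otimes> a) = q ((p \<oplus> r \<otimes> a) \<odot>\<^bsub>E\<^esub> e)"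
proof -
  interpret J: ideal J R by fact
  interpret K: ideal K R by fact
  let ?h = "\<lambda>r y. fraction R I r \<one> \<odot>\<^bsub>F\<^esub> y"
  have ac: "a \<in> carrier R" using a by simp
  have t0c: "t0 \<in> carrier R" using t0 by simp
  have h_mult: "?h (r \<otimes> s) y = ?h r (?h s y)" if "r \<in> carrier R" "s \<in> carrier R" "y \<in> carrier F" for r s y
    using that by (simp add: F.smult_assoc1)
  have h_comm: "?h r (?h s y) = ?h s (?h r y)" if "r \<in> carrier R" "s \<in> carrier R" "y \<in> carrier F" for r s y
    using that h_mult[of r s y] h_mult[of s r y] by (simp add: m_comm)
  obtain w where w: "w \<in> carrier E" "?h t0 (g a) = q w"
  proof -
    have "?h t0 (g a) \<in> carrier F" using t0c g(1)[OF a] by simp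
    then show ?thesis using that by (auto simp: F_carrier)
  qed
  define e' where "e' = w \<ominus>\<^bsub>E\<^esub> a \<odot>\<^bsub>E\<^esub> e0"
  have e': "e' \<in> carrier E" "w = e' \<oplus>\<^bsub>E\<^esub> a \<odot>\<^bsub>E\<^esub> e0"
    using w(1) ac e0 by (simp_all add: e'_def a_minus_def E.M.a_assoc E.M.l_neg)
  \<comment> \<open>The conductor of a into K: exactly the r for which the two descriptions of g(r
    a), through K and through a, must be compared.\<close>
  define C where "C = {r \<in> carrier R. r \<otimes> a \<in> K}"
  have C: "ideal C R"
    by (rule cring_idealI) (use ac in \<open>auto simp: C_def l_distr m_assoc intro: K.I_l_closed K.a_closed\<close>)
  have "\<exists>t\<in>T. \<forall>r\<in>C. t \<odot>\<^bsub>E\<^esub> (r \<odot>\<^bsub>E\<^esub> e') = \<zero>\<^bsub>E\<^esub>"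
  proof (rule torsion_common[OF C e'(1)])
    fix r assume "r \<in> C"
    then have r: "r \<in> carrier R" "r \<otimes> a \<in> K" by (simp_all add: C_def)
    have "q (r \<odot>\<^bsub>E\<^esub> w) = ?h r (?h t0 (g a))"
      using r w by (simp add: F_smult_one)
    also have "\<dots> = ?h t0 (g (r \<otimes> a))"
      using r t0c a g by (simp add: h_comm)
    also have "\<dots> = q ((r \<otimes> a) \<odot>\<^bsub>E\<^esub> e0)" by (rule K0[OF r(2)])
    finally have "r \<odot>\<^bsub>E\<^esub> w \<approx> (r \<otimes> a) \<odot>\<^bsub>E\<^esub> e0"
      using r w e0 ac by (subst (asm) q_eq_iff) simp_all
    then obtain s where s: "s \<in> T" "s \<odot>\<^bsub>E\<^esub> (r \<odot>\<^bsub>E\<^esub> w) = s \<odot>\<^bsub>E\<^esub> ((r \<otimes> a) \<odot>\<^bsub>E\<^esub> e0)"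
      by (auto simp: teq_def)
    have sc: "s \<in> carrier R" using s by simp
    have "s \<odot>\<^bsub>E\<^esub> (r \<odot>\<^bsub>E\<^esub> w) = s \<odot>\<^bsub>E\<^esub> (r \<odot>\<^bsub>E\<^esub> e') \<oplus>\<^bsub>E\<^esub> s \<odot>\<^bsub>E\<^esub> ((r \<otimes> a) \<odot>\<^bsub>E\<^esub> e0)"
      unfolding e'(2) using sc r e'(1) ac e0 by (simp add: E.smult_r_distr E.smult_assoc1)
    then have "s \<odot>\<^bsub>E\<^esub> (r \<odot>\<^bsub>E\<^esub> e') = \<zero>\<^bsub>E\<^esub>"
      unfolding s(2) using sc r e'(1) ac e0 by (simp add: E.M.add.r_cancel_one')
    then show "\<exists>t\<in>T. t \<odot>\<^bsub>E\<^esub> (r \<odot>\<^bsub>E\<^esub> e') = \<zero>\<^bsub>E\<^esub>" using s(1) by blast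
  qed
  then obtain t1 where t1: "t1 \<in> T" and t1C: "\<forall>r\<in>C. t1 \<odot>\<^bsub>E\<^esub> (r \<odot>\<^bsub>E\<^esub> e') = \<zero>\<^bsub>E\<^esub>" ..
  have t1c: "t1 \<in> carrier R" using t1 by simp
  define I1 where "I1 = {p \<oplus> r \<otimes> a | p r. p \<in> K \<and> r \<in> carrier R}"
  have I1: "ideal I1 R" unfolding I1_def by (rule ideal_adjoin[OF K(1) ac])
  \<comment> \<open>c picks some coefficient of a in y. Two possible coefficients differ by an
    element of C, and t1 annihilates C e', so \<open>\<phi>\<close> does not depend on the
    choice.\<close>
  define c where "c y = (SOME r. r \<in> carrier R \<and> (\<exists>p\<in>K. y = p \<oplus> r \<otimes> a))" for y
  define \<phi> where "\<phi> y = c y \<odot>\<^bsub>E\<^esub> (t1 \<odot>\<^bsub>E\<^esub> e')" for y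
  have \<phi>: "\<phi> (p \<oplus> r \<otimes> a) = r \<odot>\<^bsub>E\<^esub> (t1 \<odot>\<^bsub>E\<^esub> e')" if p: "p \<in> K" and r: "r \<in> carrier R" for p r
  proof -
    define d where "d = c (p \<oplus> r \<otimes> a)"
    have "d \<in> carrier R \<and> (\<exists>p'\<in>K. p \<oplus> r \<otimes> a = p' \<oplus> d \<otimes> a)"
      unfolding d_def c_def by (rule someI[of _ r]) (use p r in blast)
    then obtain p' where d: "d \<in> carrier R" "p' \<in> K" "p \<oplus> r \<otimes> a = p' \<oplus> d \<otimes> a" by blast
    have pc: "p \<in> carrier R" "p' \<in> carrier R" using p d(2) by simp_all
    have "(d \<ominus> r) \<otimes> a = \<ominus> p' \<oplus> (p' \<oplus> d \<otimes> a) \<oplus> \<ominus> (r \<otimes> a)"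
      using d(1) r pc ac by (simp add: minus_eq l_distr l_minus r_neg1)
    also have "\<dots> = \<ominus> p' \<oplus> p"
      unfolding d(3)[symmetric] using r pc ac by (simp add: a_assoc r_neg)
    finally have "(d \<ominus> r) \<otimes> a \<in> K" using p d(2) by simp
    then have "d \<ominus> r \<in> C" using d(1) r by (simp add: C_def)
    then have *: "t1 \<odot>\<^bsub>E\<^esub> ((d \<ominus> r) \<odot>\<^bsub>E\<^esub> e') = \<zero>\<^bsub>E\<^esub>" using t1C by blast
    have "d \<odot>\<^bsub>E\<^esub> (t1 \<odot>\<^bsub>E\<^esub> e') = ((d \<ominus> r) \<oplus> r) \<odot>\<^bsub>E\<^esub> (t1 \<odot>\<^bsub>E\<^esub> e')"
      using d(1) r by (simp add: minus_eq a_assoc l_neg)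
    also have "\<dots> = (d \<ominus> r) \<odot>\<^bsub>E\<^esub> (t1 \<odot>\<^bsub>E\<^esub> e') \<oplus>\<^bsub>E\<^esub> r \<odot>\<^bsub>E\<^esub> (t1 \<odot>\<^bsub>E\<^esub> e')"
      using d(1) r t1c e' by (intro E.smult_l_distr) simp_all
    also have "(d \<ominus> r) \<odot>\<^bsub>E\<^esub> (t1 \<odot>\<^bsub>E\<^esub> e') = \<zero>\<^bsub>E\<^esub>"
      using * d(1) r t1c e' by (simp add: m_comm E.smult_assoc1[symmetric])
    finally show ?thesis using r t1c e' by (simp add: \<phi>_def d_def)
  qed
  have "\<exists>e\<in>carrier E. \<forall>y\<in>I1. \<phi> y = y \<odot>\<^bsub>E\<^esub> e"
  proof (rule baerD[OF baer I1])
    fix y assume "y \<in> I1"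
    then obtain p r where y: "p \<in> K" "r \<in> carrier R" "y = p \<oplus> r \<otimes> a" by (auto simp: I1_def)
    have pc: "p \<in> carrier R" using y by simp
    show "\<phi> y \<in> carrier E" using y t1c e' by (simp add: \<phi>)
    show "\<phi> (s \<otimes> y) = s \<odot>\<^bsub>E\<^esub> \<phi> y" if s: "s \<in> carrier R" for s
    proof -
      have "s \<otimes> y = s \<otimes> p \<oplus> (s \<otimes> r) \<otimes> a" using y pc s ac by (simp add: r_distr m_assoc)
      then have "\<phi> (s \<otimes> y) = (s \<otimes> r) \<odot>\<^bsub>E\<^esub> (t1 \<odot>\<^bsub>E\<^esub> e')"
        using \<phi>[OF K.I_l_closed[OF y(1) s]] y(2) s by simp
      then show ?thesis using y s t1c e' by (simp add: \<phi> E.smult_assoc1)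
    qed
    fix z assume "z \<in> I1"
    then obtain p' r' where z: "p' \<in> K" "r' \<in> carrier R" "z = p' \<oplus> r' \<otimes> a" by (auto simp: I1_def)
    have pc': "p' \<in> carrier R" using z by simp
    have "y \<oplus> z = (p \<oplus> p') \<oplus> (r \<oplus> r') \<otimes> a" using y z pc pc' ac by (simp add: l_distr a_ac)
    then have "\<phi> (y \<oplus> z) = (r \<oplus> r') \<odot>\<^bsub>E\<^esub> (t1 \<odot>\<^bsub>E\<^esub> e')"
      using \<phi>[OF K.a_closed[OF y(1) z(1)]] y(2) z(2) by simp
    then show "\<phi> (y \<oplus> z) = \<phi> y \<oplus>\<^bsub>E\<^esub> \<phi> z"
      using y z t1c e' by (simp add: \<phi> E.smult_l_distr)
  qed
  then obtain e1 where e1: "e1 \<in> carrier E" "\<forall>y\<in>I1. \<phi> y = y \<odot>\<^bsub>E\<^esub> e1" ..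
  \<comment> \<open>The new denominator is t1 t0. Since t1 (p e0 + r w) equals (p + r a) t1 e0 plus
    the correction r t1 e' = (p + r a) e1, the new element is t1 e0 + e1.\<close>
  have "?h (t1 \<otimes> t0) (g (p \<oplus> r \<otimes> a)) = q ((p \<oplus> r \<otimes> a) \<odot>\<^bsub>E\<^esub> (t1 \<odot>\<^bsub>E\<^esub> e0 \<oplus>\<^bsub>E\<^esub> e1))"
    if p: "p \<in> K" and r: "r \<in> carrier R" for p r
  proof -
    have pJ: "p \<in> J" "r \<otimes> a \<in> J" using p K(2) J.I_l_closed[OF a r] by auto
    have pc: "p \<in> carrier R" using p by simp
    have mem: "p \<oplus> r \<otimes> a \<in> I1" using p r unfolding I1_def by blast
    have "?h (t1 \<otimes> t0) (g (p \<oplus> r \<otimes> a)) = ?h (t1 \<otimes> t0) (g p \<oplus>\<^bsub>F\<^esub> ?h r (g a))"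
      using g(2)[OF pJ] g(3)[OF r a] by simp
    also have "\<dots> = ?h t1 (?h t0 (g p)) \<oplus>\<^bsub>F\<^esub> ?h t1 (?h r (?h t0 (g a)))"
      using t1c t0c r g(1)[OF a] g(1)[OF pJ(1)] h_comm[OF t0c r g(1)[OF a]]
      by (simp add: F.smult_assoc1 F.smult_r_distr)
    also have "\<dots> = q (t1 \<odot>\<^bsub>E\<^esub> (p \<odot>\<^bsub>E\<^esub> e0)) \<oplus>\<^bsub>F\<^esub> q (t1 \<odot>\<^bsub>E\<^esub> (r \<odot>\<^bsub>E\<^esub> w))"
      unfolding K0[OF p] w(2) using t1c r w(1) pc e0 by (simp add: F_smult_one)
    also have "\<dots> = q (t1 \<odot>\<^bsub>E\<^esub> (p \<odot>\<^bsub>E\<^esub> e0) \<oplus>\<^bsub>E\<^esub> t1 \<odot>\<^bsub>E\<^esub> (r \<odot>\<^bsub>E\<^esub> w))"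
      using t1c r w(1) pc e0 by (intro F_add) simp_all
    also have "t1 \<odot>\<^bsub>E\<^esub> (p \<odot>\<^bsub>E\<^esub> e0) \<oplus>\<^bsub>E\<^esub> t1 \<odot>\<^bsub>E\<^esub> (r \<odot>\<^bsub>E\<^esub> w) =
        (p \<oplus> r \<otimes> a) \<odot>\<^bsub>E\<^esub> (t1 \<odot>\<^bsub>E\<^esub> e0) \<oplus>\<^bsub>E\<^esub> r \<odot>\<^bsub>E\<^esub> (t1 \<odot>\<^bsub>E\<^esub> e')"
      unfolding e'(2) using t1c r pc e0 e'(1) ac
      by (simp add: E.smult_r_distr E.smult_l_distr E.smult_assoc1[symmetric] r_distr m_ac E.M.a_ac)
    also have "r \<odot>\<^bsub>E\<^esub> (t1 \<odot>\<^bsub>E\<^esub> e') = (p \<oplus> r \<otimes> a) \<odot>\<^bsub>E\<^esub> e1"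
      using \<phi>[OF p r] bspec[OF e1(2) mem] by simp
    also have "(p \<oplus> r \<otimes> a) \<odot>\<^bsub>E\<^esub> (t1 \<odot>\<^bsub>E\<^esub> e0) \<oplus>\<^bsub>E\<^esub> (p \<oplus> r \<otimes> a) \<odot>\<^bsub>E\<^esub> e1 =
        (p \<oplus> r \<otimes> a) \<odot>\<^bsub>E\<^esub> (t1 \<odot>\<^bsub>E\<^esub> e0 \<oplus>\<^bsub>E\<^esub> e1)"
      using t1c r pc e0 e1(1) ac by (simp add: E.smult_r_distr)
    finally show ?thesis .
  qed
  then show ?thesis
    using mult_compl[OF t1 t0] t1c e0 e1(1)
    by (intro bexI[of _ "t1 \<otimes> t0"] bexI[of _ "t1 \<odot>\<^bsub>E\<^esub> e0 \<oplus>\<^bsub>E\<^esub> e1"]) simp_all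
qed

text \<open>Induction on a finite generating set of J: an R-linear map from J to the localized
  module is, up to a single denominator, multiplication by an element of E. Finite generation keeps
  the number of denominators finite.\<close>

lemma localized_extension:
  assumes g: "\<And>x. x \<in> J \<Longrightarrow> g x \<in> carrier F"
      "\<And>x y. x \<in> J \<Longrightarrow> y \<in> J \<Longrightarrow> g (x \<oplus> y) = g x \<oplus>\<^bsub>F\<^esub> g y"
      "\<And>r x. r \<in> carrier R \<Longrightarrow> x \<in> J \<Longrightarrow> g (r \<otimes> x) = fraction R I r \<one> \<odot>\<^bsub>F\<^esub> g x"
    and J: "ideal J R"
  shows "\<exists>t\<in>T. \<exists>e\<in>carrier E. \<forall>x\<in>J. fraction R I t \<one> \<odot>\<^bsub>F\<^esub> g x = q (x \<odot>\<^bsub>E\<^esub> e)"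
proof -
  interpret J: ideal J R by fact
  obtain S where S: "S \<subseteq> carrier R" "finite S" "J = Idl S"
    using finetely_gen[OF J] by blast
  have SJ: "S \<subseteq> J" unfolding S(3) by (rule genideal_self[OF S(1)])
  have "\<exists>t\<in>T. \<exists>e\<in>carrier E. \<forall>x\<in>Idl S'. fraction R I t \<one> \<odot>\<^bsub>F\<^esub> g x = q (x \<odot>\<^bsub>E\<^esub> e)"
    if "finite S'" "S' \<subseteq> J" for S'
    using that
  proof (induction S')
    case empty
    have g0: "g \<zero> = \<zero>\<^bsub>F\<^esub>"
      using g(3)[of \<zero> \<zero>] g(1)[of \<zero>] J.zero_closed \<rho>.hom_zero by simp
    have "Idl {} \<subseteq> {\<zero>}" by (rule genideal_minimal[OF zeroideal]) simp
    then have "fraction R I \<one> \<one> \<odot>\<^bsub>F\<^esub> g x = q (x \<odot>\<^bsub>E\<^esub> \<zero>\<^bsub>E\<^esub>)" if "x \<in> Idl {}" for x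
      using that g0 F_zero by auto
    then show ?case using one_compl E.M.zero_closed by blast
  next
    case (insert a S')
    have a: "a \<in> J" using insert.prems by simp
    have S'c: "S' \<subseteq> carrier R" using insert.prems J.Icarr by blast
    have KJ: "Idl S' \<subseteq> J" by (rule genideal_minimal[OF J]) (use insert.prems in simp)
    obtain t0 e0 where t0: "t0 \<in> T" "e0 \<in> carrier E"
      "\<forall>x\<in>Idl S'. fraction R I t0 \<one> \<odot>\<^bsub>F\<^esub> g x = q (x \<odot>\<^bsub>E\<^esub> e0)"
      using insert by auto
    obtain t e where te: "t \<in> T" "e \<in> carrier E" "\<forall>p\<in>Idl S'. \<forall>r\<in>carrier R.
        fraction R I t \<one> \<odot>\<^bsub>F\<^esub> g (p \<oplus> r \<otimes> a) = q ((p \<oplus> r \<otimes> a) \<odot>\<^bsub>E\<^esub> e)"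
      using localized_extension_step[of J g "Idl S'" a t0 e0, OF g J genideal_ideal[OF S'c] KJ a t0(1,2)
          bspec[OF t0(3)]] by blast
    define I1 where "I1 = {p \<oplus> r \<otimes> a | p r. p \<in> Idl S' \<and> r \<in> carrier R}"
    have I1: "ideal I1 R"
      unfolding I1_def by (rule ideal_adjoin[OF genideal_ideal[OF S'c] J.Icarr[OF a]])
    interpret K: ideal "Idl S'" R by (rule genideal_ideal[OF S'c])
    have ac: "a \<in> carrier R" using a by simp
    have mem: "p \<oplus> r \<otimes> a \<in> I1" if "p \<in> Idl S'" "r \<in> carrier R" for p r
      using that unfolding I1_def by blast
    have "S' \<subseteq> I1"
    proof
      fix p assume "p \<in> S'"
      then have "p \<in> Idl S'" "p \<in> carrier R" using genideal_self[OF S'c] S'c by auto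
      then show "p \<in> I1" using mem[of p \<zero>] ac by simp
    qed
    moreover have "a \<in> I1" using mem[of \<zero> \<one>] ac by simp
    ultimately have "Idl (insert a S') \<subseteq> I1"
      by (intro genideal_minimal[OF I1]) simp
    then have "fraction R I t \<one> \<odot>\<^bsub>F\<^esub> g x = q (x \<odot>\<^bsub>E\<^esub> e)" if "x \<in> Idl (insert a S')" for x
      using te(3) that unfolding I1_def by blast
    then show ?case using te(1,2) by blast
  qed
  from this[OF S(2) SJ] show ?thesis unfolding S(3) .
qed

text \<open>An L-linear map on J is restricted to the ideal of elements a with a/1 in J. There t f
  is multiplication by e, so on numerators f is multiplication by y = (1/t) e; linearity over the
  units 1/s carries this over to all fractions of J.\<close>

lemma baer_F: "baer L F"
  unfolding baer_def
proof (rule conjI, rule module_F, intro allI impI, elim conjE)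
  fix J f
  assume J: "ideal J L" and f: "f \<in> J \<rightarrow> carrier F"
    and add: "\<forall>x\<in>J. \<forall>y\<in>J. f (x \<oplus>\<^bsub>L\<^esub> y) = f x \<oplus>\<^bsub>F\<^esub> f y"
    and smult: "\<forall>r\<in>carrier L. \<forall>x\<in>J. f (r \<otimes>\<^bsub>L\<^esub> x) = r \<odot>\<^bsub>F\<^esub> f x"
  define J' where "J' = {a \<in> carrier R. fraction R I a \<one> \<in> J}"
  have J': "ideal J' R" unfolding J'_def by (rule \<rho>.ring.ideal_vimage[OF J])
  have J'D: "a \<in> carrier R" "fraction R I a \<one> \<in> J" if "a \<in> J'" for a
    using that by (simp_all add: J'_def)
  have "\<exists>t\<in>T. \<exists>e\<in>carrier E. \<forall>x\<in>J'.
      fraction R I t \<one> \<odot>\<^bsub>F\<^esub> f (fraction R I x \<one>) = q (x \<odot>\<^bsub>E\<^esub> e)"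
    by (rule localized_extension[OF _ _ _ J']) (use J'D f add smult in auto)
  then obtain t e where te: "t \<in> T" "e \<in> carrier E" "\<forall>x\<in>J'.
      fraction R I t \<one> \<odot>\<^bsub>F\<^esub> f (fraction R I x \<one>) = q (x \<odot>\<^bsub>E\<^esub> e)" by blast
  have tc: "t \<in> carrier R" using te by simp
  define y where "y = fraction R I \<one> t \<odot>\<^bsub>F\<^esub> q e"
  have y: "y \<in> carrier F" unfolding y_def using te by simp
  have "f x = x \<odot>\<^bsub>F\<^esub> y" if x: "x \<in> J" for x
  proof -
    obtain a s where as: "a \<in> carrier R" "s \<in> T" "x = fraction R I a s"
      using ideal.Icarr[OF J x] by (rule fraction_cases)
    have aJ: "fraction R I a \<one> \<in> J"
      using x fraction_mem_ideal_iff[OF J as(1,2)] as(3) by simp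
    then have a: "a \<in> J'" using as(1) by (simp add: J'_def)
    have fa: "f (fraction R I a \<one>) \<in> carrier F" using f aJ by auto
    have "f (fraction R I a \<one>) =
        (fraction R I \<one> t \<otimes>\<^bsub>L\<^esub> fraction R I t \<one>) \<odot>\<^bsub>F\<^esub> f (fraction R I a \<one>)"
      using fraction_inverse[OF te(1)] tc te(1) fa by (simp add: L.m_comm)
    also have "\<dots> = fraction R I \<one> t \<odot>\<^bsub>F\<^esub> q (a \<odot>\<^bsub>E\<^esub> e)"
      using te(1) tc fa bspec[OF te(3) a] by (simp add: F.smult_assoc1)
    also have "\<dots> = fraction R I \<one> t \<odot>\<^bsub>F\<^esub> (fraction R I a \<one> \<odot>\<^bsub>F\<^esub> q e)"
      using as(1) te by (simp add: F_smult_one)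
    also have "\<dots> = fraction R I a \<one> \<odot>\<^bsub>F\<^esub> y"
      unfolding y_def using as(1) te by (simp add: F.smult_assoc1[symmetric] L.m_comm)
    finally have *: "f (fraction R I a \<one>) = fraction R I a \<one> \<odot>\<^bsub>F\<^esub> y" .
    have x': "x = fraction R I \<one> s \<otimes>\<^bsub>L\<^esub> fraction R I a \<one>"
      using fraction_eq_mult[OF as(1,2)] as by (simp add: L.m_comm)
    have "f x = fraction R I \<one> s \<odot>\<^bsub>F\<^esub> (fraction R I a \<one> \<odot>\<^bsub>F\<^esub> y)"
      unfolding x' *[symmetric] using smult as aJ by simp
    also have "\<dots> = x \<odot>\<^bsub>F\<^esub> y"
      unfolding x' using as y by (simp add: F.smult_assoc1)
    finally show ?thesis .
  qed
  then show "\<exists>e\<in>carrier F. \<forall>x\<in>J. f x = x \<odot>\<^bsub>F\<^esub> e" using y by blast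
qed

lemma F_zero_carrier: "carrier E = {\<zero>\<^bsub>E\<^esub>} \<Longrightarrow> carrier F = {\<zero>\<^bsub>F\<^esub>}"
  by (simp add: F_carrier F_zero)

lemma F_divide:
  assumes "t \<in> T" "b \<in> carrier R" "x \<in> carrier E" "y \<in> carrier F" "t \<odot>\<^bsub>E\<^esub> y \<approx> b \<odot>\<^bsub>E\<^esub> x"
  shows "y = fraction R I b t \<odot>\<^bsub>F\<^esub> q x"
  using F_smult[OF assms(2,1,3) _ assms(5)] F_carrierD[OF assms(4)] by simp

end

text \<open>Elements of \<open>F\<close> are chosen representatives, so \<open>d\<close> itself can be applied to them.\<close>

locale localized_hom = M: localized_module I R E + N: localized_module I R E'
  for I and R :: "'a ring" (structure) and E :: "('a, 'b) module" and E' :: "('a, 'c) module" +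
  fixes d :: "'b \<Rightarrow> 'c"
  assumes d: "d \<in> module_hom R E E'"
begin

definition dl :: "'b \<Rightarrow> 'c" where "dl y = N.q (d y)"

lemmas dD = module_homD[OF d]

lemma d_teq: "M.teq x y \<Longrightarrow> N.teq (d x) (d y)"
  unfolding M.teq_def N.teq_def using dD by (metis DiffD1)

lemma dl_q: "x \<in> carrier E \<Longrightarrow> dl (M.q x) = N.q (d x)"
  unfolding dl_def using N.q_eqI[OF d_teq[OF M.teq_sym[OF M.q_teq]]] .

lemma dl_hom: "dl \<in> module_hom M.L M.F N.F"
proof (rule module_homI)
  fix x assume "x \<in> carrier M.F"
  then obtain a where a: "a \<in> carrier E" "x = M.q a" by (auto simp: M.F_carrier)
  show "dl x \<in> carrier N.F" using a dD by (simp add: dl_q)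
  show "dl (z \<odot>\<^bsub>M.F\<^esub> x) = z \<odot>\<^bsub>N.F\<^esub> dl x" if z: "z \<in> carrier M.L" for z
  proof -
    obtain b t where b: "b \<in> carrier R" "t \<in> M.T" "z = fraction R I b t" using z by (rule M.fraction_cases)
    obtain e where e: "e \<in> carrier E" "M.teq (t \<odot>\<^bsub>E\<^esub> e) (b \<odot>\<^bsub>E\<^esub> a)" "z \<odot>\<^bsub>M.F\<^esub> x = M.q e"
      using M.F_smult_ex[OF b(1,2) a(1)] unfolding b(3) a(2) .
    have "N.teq (t \<odot>\<^bsub>E'\<^esub> d e) (b \<odot>\<^bsub>E'\<^esub> d a)"
      using d_teq[OF e(2)] b a e(1) dD by simp
    then have "z \<odot>\<^bsub>N.F\<^esub> N.q (d a) = N.q (d e)"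
      unfolding b(3) using b a e(1) dD by (intro N.F_smult) simp_all
    then show ?thesis unfolding e(3) a(2) using a e by (simp add: dl_q)
  qed
  fix y assume "y \<in> carrier M.F"
  then obtain b where b: "b \<in> carrier E" "y = M.q b" by (auto simp: M.F_carrier)
  show "dl (x \<oplus>\<^bsub>M.F\<^esub> y) = dl x \<oplus>\<^bsub>N.F\<^esub> dl y"
    using a b dD by (simp add: M.F_add N.F_add dl_q)
qed

lemma dl_zeroD:
  assumes y: "y \<in> carrier M.F" and z: "dl y = \<zero>\<^bsub>N.F\<^esub>"
  obtains t where "t \<in> M.T" "d (t \<odot>\<^bsub>E\<^esub> y) = \<zero>\<^bsub>E'\<^esub>"
proof -
  have "y \<in> carrier E" using M.F_carrierD[OF y] by simp
  then show ?thesis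
    using z N.q_zero_iff[of "d y"] that dD unfolding dl_def by (metis DiffD1)
qed

end

text \<open>Exactness of localization: if d'(y) vanishes in the localization, then t y is in the
  kernel of d' for some t in T, so t y = d x and y is the image of x/t.\<close>

lemma localized_exact:
  assumes 1: "localized_hom I R E E' d" and 2: "localized_hom I R E' E'' d'"
    and ex: "\<And>y. y \<in> carrier E' \<Longrightarrow> d' y = \<zero>\<^bsub>E''\<^esub> \<longleftrightarrow> y \<in> d ` carrier E"
    and y: "y \<in> carrier (localized_module.F I R E')"
  shows "localized_hom.dl I R E'' d' y = \<zero>\<^bsub>localized_module.F I R E''\<^esub> \<longleftrightarrow>
    y \<in> localized_hom.dl I R E' d ` carrier (localized_module.F I R E)"
proof -
  interpret D: localized_hom I R E E' d by fact
  interpret D': localized_hom I R E' E'' d' by fact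
  have yc: "y \<in> carrier E'" "D.N.q y = y" using D.N.F_carrierD[OF y] by simp_all
  show ?thesis
  proof
    assume "D'.dl y = \<zero>\<^bsub>D'.N.F\<^esub>"
    then obtain t where t: "t \<in> D.M.T" "d' (t \<odot>\<^bsub>E'\<^esub> y) = \<zero>\<^bsub>E''\<^esub>"
      using D'.dl_zeroD[OF y] by blast
    have tc: "t \<in> carrier R" using t by simp
    have "t \<odot>\<^bsub>E'\<^esub> y \<in> d ` carrier E"
      using t tc yc ex[of "t \<odot>\<^bsub>E'\<^esub> y"] by simp
    then obtain x where x: "x \<in> carrier E" "t \<odot>\<^bsub>E'\<^esub> y = d x" by blast
    have "y = fraction R I \<one>\<^bsub>R\<^esub> t \<odot>\<^bsub>D.N.F\<^esub> D.N.q (d x)"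
      using t tc x yc D.dD D.N.teq_refl by (intro D.N.F_divide[OF t(1) _ _ y]) simp_all
    also have "\<dots> = D.dl (fraction R I \<one>\<^bsub>R\<^esub> t \<odot>\<^bsub>D.M.F\<^esub> D.M.q x)"
      using x t by (simp add: D.dl_q module_homD(3)[OF D.dl_hom])
    finally show "y \<in> D.dl ` carrier D.M.F"
      using x t by (intro image_eqI) auto
  next
    assume "y \<in> D.dl ` carrier D.M.F"
    then obtain x where x: "x \<in> carrier D.M.F" "y = D.dl x" by blast
    have xc: "x \<in> carrier E" using D.M.F_carrierD[OF x(1)] by simp
    have "D'.dl y = D'.N.q (d' (d x))"
      using x xc D.dD by (simp add: D.dl_def D'.dl_q)
    also have "d' (d x) = \<zero>\<^bsub>E''\<^esub>" using ex[of "d x"] xc D.dD by simp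
    finally show "D'.dl y = \<zero>\<^bsub>D'.N.F\<^esub>" by (simp add: D'.N.F_zero)
  qed
qed

text \<open>The augmentation \<open>L \<rightarrow> F\<close> is \<open>z \<mapsto> z e\<^sub>1\<close>; it is enough that \<open>r \<mapsto> r e\<^sub>1\<close> is exact up to
  torsion.\<close>

lemma localized_augmentation:
  assumes D: "localized_hom I R E E' d" and e1: "e1 \<in> carrier E"
    and inj: "\<And>r. r \<in> carrier R \<Longrightarrow> r \<odot>\<^bsub>E\<^esub> e1 = \<zero>\<^bsub>E\<^esub> \<Longrightarrow> \<exists>t\<in>carrier R - I. t \<otimes>\<^bsub>R\<^esub> r = \<zero>\<^bsub>R\<^esub>"
    and de1: "d e1 = \<zero>\<^bsub>E'\<^esub>"
    and ex: "\<And>y. y \<in> carrier E \<Longrightarrow> d y = \<zero>\<^bsub>E'\<^esub> \<Longrightarrow>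
      \<exists>t\<in>carrier R - I. \<exists>r\<in>carrier R. t \<odot>\<^bsub>E\<^esub> y = r \<odot>\<^bsub>E\<^esub> e1"
  shows "\<exists>\<epsilon>. \<epsilon> \<in> module_hom (localization R I) (self_module (localization R I)) (localized_module.F I R E) \<and>
    inj_on \<epsilon> (carrier (localization R I)) \<and>
    (\<forall>y\<in>carrier (localized_module.F I R E).
      localized_hom.dl I R E' d y = \<zero>\<^bsub>localized_module.F I R E'\<^esub> \<longleftrightarrow>
      y \<in> \<epsilon> ` carrier (localization R I))"
proof -
  interpret D: localized_hom I R E E' d by fact
  let ?\<epsilon> = "\<lambda>z. z \<odot>\<^bsub>D.M.F\<^esub> D.M.q e1"
  have qe: "D.M.q e1 \<in> carrier D.M.F" using e1 by simp
  have zero: "z = \<zero>\<^bsub>D.M.L\<^esub>" if z: "z \<in> carrier D.M.L" "?\<epsilon> z = \<zero>\<^bsub>D.M.F\<^esub>" for z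
  proof -
    obtain b t where b: "b \<in> carrier R" "t \<in> D.M.T" "z = fraction R I b t"
      using z(1) by (rule D.M.fraction_cases)
    have tc: "t \<in> carrier R" using b by simp
    have "D.M.q (b \<odot>\<^bsub>E\<^esub> e1) = fraction R I b \<one>\<^bsub>R\<^esub> \<odot>\<^bsub>D.M.F\<^esub> D.M.q e1"
      using b e1 by (simp add: D.M.F_smult_one)
    also have "fraction R I b \<one>\<^bsub>R\<^esub> = fraction R I t \<one>\<^bsub>R\<^esub> \<otimes>\<^bsub>D.M.L\<^esub> z"
      using b tc D.M.fraction_cancel[of b "\<one>\<^bsub>R\<^esub>" t] by (simp add: D.M.fraction_mult)
    also have "\<dots> \<odot>\<^bsub>D.M.F\<^esub> D.M.q e1 = fraction R I t \<one>\<^bsub>R\<^esub> \<odot>\<^bsub>D.M.F\<^esub> ?\<epsilon> z"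
      using z(1) tc qe by (simp add: D.M.F.smult_assoc1)
    also have "\<dots> = \<zero>\<^bsub>D.M.F\<^esub>" using z(2) tc by simp
    finally obtain s where s: "s \<in> D.M.T" "s \<odot>\<^bsub>E\<^esub> (b \<odot>\<^bsub>E\<^esub> e1) = \<zero>\<^bsub>E\<^esub>"
      using D.M.q_zero_iff[of "b \<odot>\<^bsub>E\<^esub> e1"] b e1 by auto
    then obtain u where u: "u \<in> D.M.T" "u \<otimes>\<^bsub>R\<^esub> (s \<otimes>\<^bsub>R\<^esub> b) = \<zero>\<^bsub>R\<^esub>"
      using inj[of "s \<otimes>\<^bsub>R\<^esub> b"] b e1 by (auto simp: D.M.E.smult_assoc1)
    have "u \<otimes>\<^bsub>R\<^esub> s \<in> D.M.T" by (rule D.M.mult_compl[OF u(1) s(1)])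
    moreover have "(u \<otimes>\<^bsub>R\<^esub> s) \<otimes>\<^bsub>R\<^esub> b = \<zero>\<^bsub>R\<^esub>" using u s b by (simp add: D.M.m_assoc)
    ultimately show ?thesis
      unfolding b(3) D.M.fraction_eq_zero_iff[OF b(1,2)] by blast
  qed
  have hom: "?\<epsilon> \<in> module_hom D.M.L (self_module D.M.L) D.M.F"
    by (rule module_homI) (use qe in \<open>simp_all add: self_module_def D.M.F.smult_l_distr D.M.F.smult_assoc1\<close>)
  have "inj_on ?\<epsilon> (carrier D.M.L)"
  proof (rule inj_onI)
    fix z w assume zw: "z \<in> carrier D.M.L" "w \<in> carrier D.M.L" "?\<epsilon> z = ?\<epsilon> w"
    then have "?\<epsilon> (z \<ominus>\<^bsub>D.M.L\<^esub> w) = \<zero>\<^bsub>D.M.F\<^esub>"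
      using qe by (simp add: D.M.L.minus_eq D.M.F.smult_l_distr D.M.F.smult_l_minus D.M.F.M.r_neg)
    then have "z \<ominus>\<^bsub>D.M.L\<^esub> w = \<zero>\<^bsub>D.M.L\<^esub>" using zw by (intro zero) simp_all
    then show "z = w" using zw by simp
  qed
  moreover have "D.dl y = \<zero>\<^bsub>D.N.F\<^esub> \<longleftrightarrow> y \<in> ?\<epsilon> ` carrier D.M.L" if y: "y \<in> carrier D.M.F" for y
  proof
    have yc: "y \<in> carrier E" "D.M.q y = y" using D.M.F_carrierD[OF y] by simp_all
    assume "D.dl y = \<zero>\<^bsub>D.N.F\<^esub>"
    then obtain t where t: "t \<in> D.M.T" "d (t \<odot>\<^bsub>E\<^esub> y) = \<zero>\<^bsub>E'\<^esub>"
      using D.dl_zeroD[OF y] by blast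
    have tc: "t \<in> carrier R" using t by simp
    obtain s r where sr: "s \<in> D.M.T" "r \<in> carrier R" "s \<odot>\<^bsub>E\<^esub> (t \<odot>\<^bsub>E\<^esub> y) = r \<odot>\<^bsub>E\<^esub> e1"
      using ex[OF _ t(2)] tc yc by auto
    have "(s \<otimes>\<^bsub>R\<^esub> t) \<odot>\<^bsub>E\<^esub> y = r \<odot>\<^bsub>E\<^esub> e1" using sr tc yc by (simp add: D.M.E.smult_assoc1)
    then have "y = ?\<epsilon> (fraction R I r (s \<otimes>\<^bsub>R\<^esub> t))"
      using D.M.mult_compl[OF sr(1) t(1)] sr(2) e1 D.M.teq_refl
      by (intro D.M.F_divide[OF _ _ _ y]) simp_all
    then show "y \<in> ?\<epsilon> ` carrier D.M.L"
      using sr(2) D.M.mult_compl[OF sr(1) t(1)] by (intro image_eqI) auto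
  next
    assume "y \<in> ?\<epsilon> ` carrier D.M.L"
    then obtain z where z: "z \<in> carrier D.M.L" "y = ?\<epsilon> z" by blast
    have "D.dl y = z \<odot>\<^bsub>D.N.F\<^esub> D.dl (D.M.q e1)"
      unfolding z(2) using z(1) qe by (rule module_homD(3)[OF D.dl_hom])
    also have "D.dl (D.M.q e1) = \<zero>\<^bsub>D.N.F\<^esub>" using e1 by (simp add: D.dl_q de1 D.N.F_zero)
    finally show "D.dl y = \<zero>\<^bsub>D.N.F\<^esub>" using z(1) by simp
  qed
  ultimately show ?thesis using hom by blast
qed

section \<open>Frobenius extensions\<close>

lemma (in ring_hom_cring) primeideal_vimage:
  assumes "primeideal P S"
  shows "primeideal {r \<in> carrier R. h r \<in> P} R"
proof (rule primeidealI[OF ring.ideal_vimage R.is_cring])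
  interpret P: primeideal P S by fact
  show "ideal P S" by (rule P.is_ideal)
  have "\<one>\<^bsub>S\<^esub> \<notin> P" using P.I_notcarr P.one_imp_carrier by auto
  then have "\<one>\<^bsub>R\<^esub> \<notin> {r \<in> carrier R. h r \<in> P}" by simp
  then show "carrier R \<noteq> {r \<in> carrier R. h r \<in> P}" using R.one_closed by blast
  show "a \<in> {r \<in> carrier R. h r \<in> P} \<or> b \<in> {r \<in> carrier R. h r \<in> P}"
    if "a \<in> carrier R" "b \<in> carrier R" "a \<otimes>\<^bsub>R\<^esub> b \<in> {r \<in> carrier R. h r \<in> P}" for a b
    using that P.I_prime[of "h a" "h b"] by simp
qed

lemma (in cring) finsum_mem_ideal:
  assumes "ideal J R" "\<And>i::nat. i < n \<Longrightarrow> f i \<in> J"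
  shows "finsum R f {..<n} \<in> J"
  using assms(2)
proof (induction n)
  case 0
  then show ?case using additive_subgroup.zero_closed[OF ideal.axioms(1)[OF assms(1)]] by simp
next
  case (Suc n)
  interpret J: ideal J R by fact
  have "finsum R f (insert n {..<n}) = f n \<oplus> finsum R f {..<n}"
    using Suc.prems by (intro finsum_insert) auto
  then show ?case using Suc by (simp add: lessThan_Suc)
qed

text \<open>\<open>\<pi>\<close> is a Frobenius functional with dual families \<open>u\<close> and \<open>v\<close>; the last assumption alone yields
  finiteness and \<open>Hom\<^sub>A(B, A) \<cong> B\<close>.\<close>

locale frobenius_extension = A: noetherian_ring A + hom: ring_hom_cring A B \<phi>
  for A :: "'a ring" and B :: "'b ring" and \<phi> +
  fixes n :: nat and u v :: "nat \<Rightarrow> 'b" and \<pi> :: "'b \<Rightarrow> 'a"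
  assumes u_closed: "i < n \<Longrightarrow> u i \<in> carrier B" and v_closed: "i < n \<Longrightarrow> v i \<in> carrier B"
    and pi_closed [simp]: "b \<in> carrier B \<Longrightarrow> \<pi> b \<in> carrier A"
    and pi_add: "b \<in> carrier B \<Longrightarrow> c \<in> carrier B \<Longrightarrow> \<pi> (b \<oplus>\<^bsub>B\<^esub> c) = \<pi> b \<oplus>\<^bsub>A\<^esub> \<pi> c"
    and pi_mult: "a \<in> carrier A \<Longrightarrow> b \<in> carrier B \<Longrightarrow> \<pi> (\<phi> a \<otimes>\<^bsub>B\<^esub> b) = a \<otimes>\<^bsub>A\<^esub> \<pi> b"
    and decomp: "b \<in> carrier B \<Longrightarrow>
      b = finsum B (\<lambda>i. \<phi> (\<pi> (b \<otimes>\<^bsub>B\<^esub> v i)) \<otimes>\<^bsub>B\<^esub> u i) {..<n}"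
begin

section \<open>Module-finiteness over the base: Noetherian property, integrality, contraction of
  maximal ideals\<close>

definition asub :: "'b set \<Rightarrow> bool"
  where "asub X \<longleftrightarrow> X \<subseteq> carrier B \<and> \<zero>\<^bsub>B\<^esub> \<in> X \<and> (\<forall>x\<in>X. \<forall>y\<in>X. x \<oplus>\<^bsub>B\<^esub> y \<in> X) \<and>
    (\<forall>a\<in>carrier A. \<forall>x\<in>X. \<phi> a \<otimes>\<^bsub>B\<^esub> x \<in> X)"

lemma asubI:
  assumes "\<And>x. x \<in> X \<Longrightarrow> x \<in> carrier B" "\<zero>\<^bsub>B\<^esub> \<in> X" "\<And>x y. x \<in> X \<Longrightarrow> y \<in> X \<Longrightarrow> x \<oplus>\<^bsub>B\<^esub> y \<in> X"
    "\<And>a x. a \<in> carrier A \<Longrightarrow> x \<in> X \<Longrightarrow> \<phi> a \<otimes>\<^bsub>B\<^esub> x \<in> X"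
  shows "asub X"
  using assms unfolding asub_def by blast

lemma asubD:
  assumes "asub X"
  shows "x \<in> X \<Longrightarrow> x \<in> carrier B" "\<zero>\<^bsub>B\<^esub> \<in> X" "x \<in> X \<Longrightarrow> y \<in> X \<Longrightarrow> x \<oplus>\<^bsub>B\<^esub> y \<in> X"
    "a \<in> carrier A \<Longrightarrow> x \<in> X \<Longrightarrow> \<phi> a \<otimes>\<^bsub>B\<^esub> x \<in> X"
  using assms unfolding asub_def by auto

lemma asub_minus:
  assumes "asub X" "x \<in> X" shows "\<ominus>\<^bsub>B\<^esub> x \<in> X"
  using asubD(4)[OF assms(1) _ assms(2), of "\<ominus>\<^bsub>A\<^esub> \<one>\<^bsub>A\<^esub>"] asubD(1)[OF assms] by (simp add: hom.S.l_minus)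

lemma asub_ideal: "ideal X B \<Longrightarrow> asub X"
  by (rule asubI)
    (simp_all add: ideal.Icarr additive_subgroup.zero_closed ideal.axioms(1) additive_subgroup.a_closed
      ideal.I_l_closed)

text \<open>The span of the first k elements of the family u, built one generator at a time so that
  submodules can be analysed by their last coefficient.\<close>

primrec U :: "nat \<Rightarrow> 'b set"
  where "U 0 = {\<zero>\<^bsub>B\<^esub>}"
  | "U (Suc k) = {x \<oplus>\<^bsub>B\<^esub> \<phi> c \<otimes>\<^bsub>B\<^esub> u k | x c. x \<in> U k \<and> c \<in> carrier A}"

lemma asub_U: "k \<le> n \<Longrightarrow> asub (U k)"
proof (induction k)
  case 0
  then show ?case by (intro asubI) auto
next
  case (Suc k)
  then have IH: "asub (U k)" and uk: "u k \<in> carrier B" using u_closed by simp_all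
  have mem: "x \<oplus>\<^bsub>B\<^esub> \<phi> c \<otimes>\<^bsub>B\<^esub> u k \<in> U (Suc k)" if "x \<in> U k" "c \<in> carrier A" for x c
    using that by auto
  have rep: "\<exists>x c. y = x \<oplus>\<^bsub>B\<^esub> \<phi> c \<otimes>\<^bsub>B\<^esub> u k \<and> x \<in> U k \<and> x \<in> carrier B \<and> c \<in> carrier A"
    if "y \<in> U (Suc k)" for y
    using that asubD(1)[OF IH] by auto
  show ?case
  proof (rule asubI)
    show "y \<in> carrier B" if "y \<in> U (Suc k)" for y using rep[OF that] uk by auto
    show "\<zero>\<^bsub>B\<^esub> \<in> U (Suc k)"
      using mem[OF asubD(2)[OF IH] A.zero_closed] uk by (simp del: U.simps)
    fix y assume "y \<in> U (Suc k)"
    then obtain x c where y: "y = x \<oplus>\<^bsub>B\<^esub> \<phi> c \<otimes>\<^bsub>B\<^esub> u k" "x \<in> U k" "x \<in> carrier B" "c \<in> carrier A"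
      using rep by blast
    show "\<phi> a \<otimes>\<^bsub>B\<^esub> y \<in> U (Suc k)" if a: "a \<in> carrier A" for a
    proof -
      have "\<phi> a \<otimes>\<^bsub>B\<^esub> y = \<phi> a \<otimes>\<^bsub>B\<^esub> x \<oplus>\<^bsub>B\<^esub> \<phi> (a \<otimes>\<^bsub>A\<^esub> c) \<otimes>\<^bsub>B\<^esub> u k"
        using y a uk by (simp add: hom.S.r_distr hom.S.m_assoc)
      then show ?thesis using mem[OF asubD(4)[OF IH a y(2)], of "a \<otimes>\<^bsub>A\<^esub> c"] a y(4) by simp
    qed
    fix z assume "z \<in> U (Suc k)"
    then obtain x' c' where z: "z = x' \<oplus>\<^bsub>B\<^esub> \<phi> c' \<otimes>\<^bsub>B\<^esub> u k" "x' \<in> U k" "x' \<in> carrier B" "c' \<in> carrier A"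
      using rep by blast
    have "y \<oplus>\<^bsub>B\<^esub> z = (x \<oplus>\<^bsub>B\<^esub> x') \<oplus>\<^bsub>B\<^esub> \<phi> (c \<oplus>\<^bsub>A\<^esub> c') \<otimes>\<^bsub>B\<^esub> u k"
      using y z uk by (simp add: hom.S.l_distr hom.S.a_ac)
    then show "y \<oplus>\<^bsub>B\<^esub> z \<in> U (Suc k)"
      using mem[OF asubD(3)[OF IH y(2) z(2)], of "c \<oplus>\<^bsub>A\<^esub> c'"] y(4) z(4) by simp
  qed
qed

text \<open>Finite generation without linear combinations: every submodule that contains S contains
  X. This is also the form in which it is applied, to ideals of B and to the sets
  \<open>W b k\<close>.\<close>

definition fin_gen :: "'b set \<Rightarrow> bool"
  where "fin_gen X \<longleftrightarrow> (\<exists>S. finite S \<and> S \<subseteq> X \<and> (\<forall>Y. asub Y \<longrightarrow> S \<subseteq> Y \<longrightarrow> X \<subseteq> Y))"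

lemma asub_Int: "asub X \<Longrightarrow> asub Y \<Longrightarrow> asub (X \<inter> Y)"
  unfolding asub_def by blast

lemma leading_ideal:
  assumes k: "k < n" and X: "asub X"
  shows "ideal {c \<in> carrier A. \<exists>x\<in>U k. x \<oplus>\<^bsub>B\<^esub> \<phi> c \<otimes>\<^bsub>B\<^esub> u k \<in> X} A" (is "ideal ?I A")
proof (rule hom.R.cring_idealI)
  have Uk: "asub (U k)" and uk: "u k \<in> carrier B" using asub_U u_closed k by simp_all
  show "\<zero>\<^bsub>A\<^esub> \<in> ?I" using asubD(2)[OF Uk] asubD(2)[OF X] uk by force
  fix c assume "c \<in> ?I"
  then obtain x where c: "c \<in> carrier A" "x \<in> U k" "x \<oplus>\<^bsub>B\<^esub> \<phi> c \<otimes>\<^bsub>B\<^esub> u k \<in> X" by blast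
  have xc: "x \<in> carrier B" using asubD(1)[OF Uk c(2)] .
  show "r \<otimes>\<^bsub>A\<^esub> c \<in> ?I" if r: "r \<in> carrier A" for r
  proof -
    have "\<phi> r \<otimes>\<^bsub>B\<^esub> (x \<oplus>\<^bsub>B\<^esub> \<phi> c \<otimes>\<^bsub>B\<^esub> u k) = \<phi> r \<otimes>\<^bsub>B\<^esub> x \<oplus>\<^bsub>B\<^esub> \<phi> (r \<otimes>\<^bsub>A\<^esub> c) \<otimes>\<^bsub>B\<^esub> u k"
      using r c xc uk by (simp add: hom.S.r_distr hom.S.m_assoc)
    then have "\<phi> r \<otimes>\<^bsub>B\<^esub> x \<oplus>\<^bsub>B\<^esub> \<phi> (r \<otimes>\<^bsub>A\<^esub> c) \<otimes>\<^bsub>B\<^esub> u k \<in> X" using asubD(4)[OF X r c(3)] by simp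
    moreover have "\<phi> r \<otimes>\<^bsub>B\<^esub> x \<in> U k" by (rule asubD(4)[OF Uk r c(2)])
    ultimately show ?thesis using r c(1) by blast
  qed
  fix d assume "d \<in> ?I"
  then obtain y where d: "d \<in> carrier A" "y \<in> U k" "y \<oplus>\<^bsub>B\<^esub> \<phi> d \<otimes>\<^bsub>B\<^esub> u k \<in> X" by blast
  have yc: "y \<in> carrier B" using asubD(1)[OF Uk d(2)] .
  have "(x \<oplus>\<^bsub>B\<^esub> \<phi> c \<otimes>\<^bsub>B\<^esub> u k) \<oplus>\<^bsub>B\<^esub> (y \<oplus>\<^bsub>B\<^esub> \<phi> d \<otimes>\<^bsub>B\<^esub> u k) = (x \<oplus>\<^bsub>B\<^esub> y) \<oplus>\<^bsub>B\<^esub> \<phi> (c \<oplus>\<^bsub>A\<^esub> d) \<otimes>\<^bsub>B\<^esub> u k"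
    using c d xc yc uk by (simp add: hom.S.l_distr hom.S.a_ac)
  then have "(x \<oplus>\<^bsub>B\<^esub> y) \<oplus>\<^bsub>B\<^esub> \<phi> (c \<oplus>\<^bsub>A\<^esub> d) \<otimes>\<^bsub>B\<^esub> u k \<in> X" using asubD(3)[OF X c(3) d(3)] by simp
  moreover have "x \<oplus>\<^bsub>B\<^esub> y \<in> U k" by (rule asubD(3)[OF Uk c(2) d(2)])
  ultimately show "c \<oplus>\<^bsub>A\<^esub> d \<in> ?I" using c(1) d(1) by blast
qed blast

text \<open>Lifts of generators of the leading ideal of X, together with generators of the smaller
  piece \<open>X \<inter> U k\<close>, generate X.\<close>

lemma fin_gen_U: "k \<le> n \<Longrightarrow> asub X \<Longrightarrow> X \<subseteq> U k \<Longrightarrow> fin_gen X"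
proof (induction k arbitrary: X)
  case 0
  then show ?case
    unfolding fin_gen_def by (intro exI[of _ "{}"]) (auto dest: asubD(2))
next
  case (Suc k)
  have k: "k < n" and Uk: "asub (U k)" and uk: "u k \<in> carrier B"
    using Suc.prems(1) asub_U u_closed by simp_all
  have "fin_gen (X \<inter> U k)"
    by (rule Suc.IH) (use Suc.prems Uk asub_Int in auto)
  then obtain S2 where S2: "finite S2" "S2 \<subseteq> X \<inter> U k" "\<And>Y. asub Y \<Longrightarrow> S2 \<subseteq> Y \<Longrightarrow> X \<inter> U k \<subseteq> Y"
    unfolding fin_gen_def by metis
  define I where "I Z = {c \<in> carrier A. \<exists>x\<in>U k. x \<oplus>\<^bsub>B\<^esub> \<phi> c \<otimes>\<^bsub>B\<^esub> u k \<in> Z}" for Z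
  have I: "ideal (I Z) A" if "asub Z" for Z
    unfolding I_def by (rule leading_ideal[OF k that])
  obtain C where C: "C \<subseteq> carrier A" "finite C" "I X = Idl\<^bsub>A\<^esub> C"
    using A.finetely_gen[OF I[OF Suc.prems(2)]] by blast
  have "C \<subseteq> I X" unfolding C(3) by (rule A.genideal_self[OF C(1)])
  then have "\<forall>c\<in>C. \<exists>x\<in>U k. x \<oplus>\<^bsub>B\<^esub> \<phi> c \<otimes>\<^bsub>B\<^esub> u k \<in> X" unfolding I_def by blast
  then obtain f where f: "\<And>c. c \<in> C \<Longrightarrow> f c \<in> U k" "\<And>c. c \<in> C \<Longrightarrow> f c \<oplus>\<^bsub>B\<^esub> \<phi> c \<otimes>\<^bsub>B\<^esub> u k \<in> X"
    by metis
  let ?S = "(\<lambda>c. f c \<oplus>\<^bsub>B\<^esub> \<phi> c \<otimes>\<^bsub>B\<^esub> u k) ` C \<union> S2"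
  have "X \<subseteq> Y" if Y: "asub Y" "?S \<subseteq> Y" for Y
  proof
    fix z assume z: "z \<in> X"
    then obtain x c where x: "z = x \<oplus>\<^bsub>B\<^esub> \<phi> c \<otimes>\<^bsub>B\<^esub> u k" "x \<in> U k" "c \<in> carrier A"
      using Suc.prems(3) by auto
    \<comment> \<open>The leading ideal of the intersection of X and Y already contains C, hence all
      of I X. So z has a partner in both X and Y with the same coefficient c, and their difference
      lies in X and in U k, where the induction hypothesis applies.\<close>
    have "C \<subseteq> I (X \<inter> Y)"
    proof
      fix c assume c: "c \<in> C"
      have "f c \<oplus>\<^bsub>B\<^esub> \<phi> c \<otimes>\<^bsub>B\<^esub> u k \<in> X \<inter> Y" using f(2)[OF c] Y(2) c by blast
      then show "c \<in> I (X \<inter> Y)" unfolding I_def using f(1)[OF c] C(1) c by blast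
    qed
    then have "I X \<subseteq> I (X \<inter> Y)"
      unfolding C(3) by (rule A.genideal_minimal[OF I[OF asub_Int[OF Suc.prems(2) Y(1)]]])
    moreover have "c \<in> I X" unfolding I_def using x z by blast
    ultimately obtain x' where x': "x' \<in> U k" "x' \<oplus>\<^bsub>B\<^esub> \<phi> c \<otimes>\<^bsub>B\<^esub> u k \<in> X \<inter> Y" unfolding I_def by blast
    have xc: "x \<in> carrier B" "x' \<in> carrier B" using asubD(1)[OF Uk] x x' by simp_all
    let ?w = "x' \<oplus>\<^bsub>B\<^esub> \<phi> c \<otimes>\<^bsub>B\<^esub> u k"
    have wc: "?w \<in> carrier B" using xc x uk by simp
    have eq: "z \<oplus>\<^bsub>B\<^esub> \<ominus>\<^bsub>B\<^esub> ?w = x \<oplus>\<^bsub>B\<^esub> \<ominus>\<^bsub>B\<^esub> x'"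
      unfolding x(1) using xc x(3) uk
      by (simp add: hom.S.minus_add hom.S.a_ac hom.S.r_neg hom.S.r_neg1 hom.S.r_neg2)
    have "z \<oplus>\<^bsub>B\<^esub> \<ominus>\<^bsub>B\<^esub> ?w \<in> U k"
      unfolding eq by (rule asubD(3)[OF Uk x(2) asub_minus[OF Uk x'(1)]])
    moreover have "z \<oplus>\<^bsub>B\<^esub> \<ominus>\<^bsub>B\<^esub> ?w \<in> X"
      using x'(2) by (intro asubD(3)[OF Suc.prems(2) z asub_minus[OF Suc.prems(2)]]) blast
    ultimately have "z \<oplus>\<^bsub>B\<^esub> \<ominus>\<^bsub>B\<^esub> ?w \<in> Y" using S2(3)[OF Y(1)] Y(2) by blast
    then have "(z \<oplus>\<^bsub>B\<^esub> \<ominus>\<^bsub>B\<^esub> ?w) \<oplus>\<^bsub>B\<^esub> ?w \<in> Y"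
      using x'(2) by - (rule asubD(3)[OF Y(1)], blast+)
    moreover have "(z \<oplus>\<^bsub>B\<^esub> \<ominus>\<^bsub>B\<^esub> ?w) \<oplus>\<^bsub>B\<^esub> ?w = z"
      using wc asubD(1)[OF Suc.prems(2) z] by (simp only: hom.S.a_assoc hom.S.a_inv_closed hom.S.l_neg hom.S.r_zero)
    ultimately show "z \<in> Y" by (simp only:)
  qed
  moreover have "finite ?S" "?S \<subseteq> X" using C(2) S2(1,2) f(2) by auto
  ultimately show ?case unfolding fin_gen_def by blast
qed

lemma carrier_U: "carrier B \<subseteq> U n"
proof
  fix b assume b: "b \<in> carrier B"
  let ?f = "\<lambda>i. \<phi> (\<pi> (b \<otimes>\<^bsub>B\<^esub> v i)) \<otimes>\<^bsub>B\<^esub> u i"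
  have "finsum B ?f {..<k} \<in> U k" if "k \<le> n" for k
    using that
  proof (induction k)
    case (Suc k)
    have f: "?f i \<in> carrier B" if "i \<le> k" for i
      using that Suc.prems b u_closed v_closed by simp
    have "finsum B ?f (insert k {..<k}) = ?f k \<oplus>\<^bsub>B\<^esub> finsum B ?f {..<k}"
      using f by (intro hom.S.finsum_insert) auto
    also have "\<dots> = finsum B ?f {..<k} \<oplus>\<^bsub>B\<^esub> ?f k"
      using f by (intro hom.S.a_comm hom.S.finsum_closed) auto
    finally have eq: "finsum B ?f {..<Suc k} = finsum B ?f {..<k} \<oplus>\<^bsub>B\<^esub> ?f k"
      by (simp only: lessThan_Suc)
    have "\<pi> (b \<otimes>\<^bsub>B\<^esub> v k) \<in> carrier A" using Suc.prems b v_closed by simp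
    then show ?case unfolding eq using Suc by auto
  qed simp
  from this[of n] show "b \<in> U n" unfolding decomp[OF b, symmetric] by simp
qed

lemma fin_gen: "asub X \<Longrightarrow> fin_gen X"
  using fin_gen_U[of n X] carrier_U asubD(1) by blast

lemma noetherian_B: "noetherian_ring B"
proof (rule hom.S.noetherian_ringI)
  fix X assume X: "ideal X B"
  obtain S where S: "finite S" "S \<subseteq> X" "\<And>Y. asub Y \<Longrightarrow> S \<subseteq> Y \<Longrightarrow> X \<subseteq> Y"
    using fin_gen[OF asub_ideal[OF X]] unfolding fin_gen_def by metis
  have Sc: "S \<subseteq> carrier B" using S(2) ideal.Icarr[OF X] by blast
  have "X \<subseteq> Idl\<^bsub>B\<^esub> S"
    by (rule S(3)[OF asub_ideal[OF hom.S.genideal_ideal[OF Sc]] hom.S.genideal_self[OF Sc]])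
  moreover have "Idl\<^bsub>B\<^esub> S \<subseteq> X" by (rule hom.S.genideal_minimal[OF X S(2)])
  ultimately show "\<exists>S\<subseteq>carrier B. finite S \<and> X = Idl\<^bsub>B\<^esub> S" using S(1) Sc by blast
qed

text \<open>\<open>W b k\<close> is the set of polynomials in \<open>b\<close> of degree less than \<open>k\<close>, in Horner form.\<close>

primrec W :: "'b \<Rightarrow> nat \<Rightarrow> 'b set"
  where "W b 0 = {\<zero>\<^bsub>B\<^esub>}"
  | "W b (Suc k) = {\<phi> c \<oplus>\<^bsub>B\<^esub> b \<otimes>\<^bsub>B\<^esub> w | c w. c \<in> carrier A \<and> w \<in> W b k}"

lemma asub_W:
  assumes b: "b \<in> carrier B"
  shows "asub (W b k)"
proof (induction k)
  case 0
  then show ?case by (intro asubI) auto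
next
  case (Suc k)
  have mem: "\<phi> c \<oplus>\<^bsub>B\<^esub> b \<otimes>\<^bsub>B\<^esub> w \<in> W b (Suc k)" if "w \<in> W b k" "c \<in> carrier A" for w c
    using that by auto
  have rep: "\<exists>w c. y = \<phi> c \<oplus>\<^bsub>B\<^esub> b \<otimes>\<^bsub>B\<^esub> w \<and> w \<in> W b k \<and> w \<in> carrier B \<and> c \<in> carrier A"
    if "y \<in> W b (Suc k)" for y
    using that asubD(1)[OF Suc] by auto
  show ?case
  proof (rule asubI)
    show "y \<in> carrier B" if "y \<in> W b (Suc k)" for y using rep[OF that] b by auto
    show "\<zero>\<^bsub>B\<^esub> \<in> W b (Suc k)"
      using mem[OF asubD(2)[OF Suc] A.zero_closed] b by (simp del: W.simps)
    fix y assume "y \<in> W b (Suc k)"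
    then obtain w c where y: "y = \<phi> c \<oplus>\<^bsub>B\<^esub> b \<otimes>\<^bsub>B\<^esub> w" "w \<in> W b k" "w \<in> carrier B" "c \<in> carrier A"
      using rep by blast
    show "\<phi> a \<otimes>\<^bsub>B\<^esub> y \<in> W b (Suc k)" if a: "a \<in> carrier A" for a
    proof -
      have "\<phi> a \<otimes>\<^bsub>B\<^esub> y = \<phi> (a \<otimes>\<^bsub>A\<^esub> c) \<oplus>\<^bsub>B\<^esub> b \<otimes>\<^bsub>B\<^esub> (\<phi> a \<otimes>\<^bsub>B\<^esub> w)"
        using y a b by (simp add: hom.S.r_distr hom.S.m_lcomm)
      then show ?thesis using mem[OF asubD(4)[OF Suc a y(2)], of "a \<otimes>\<^bsub>A\<^esub> c"] a y(4) by simp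
    qed
    fix z assume "z \<in> W b (Suc k)"
    then obtain w' c' where z: "z = \<phi> c' \<oplus>\<^bsub>B\<^esub> b \<otimes>\<^bsub>B\<^esub> w'" "w' \<in> W b k" "w' \<in> carrier B" "c' \<in> carrier A"
      using rep by blast
    have "y \<oplus>\<^bsub>B\<^esub> z = \<phi> (c \<oplus>\<^bsub>A\<^esub> c') \<oplus>\<^bsub>B\<^esub> b \<otimes>\<^bsub>B\<^esub> (w \<oplus>\<^bsub>B\<^esub> w')"
      using y z b by (simp add: hom.S.r_distr hom.S.a_ac)
    then show "y \<oplus>\<^bsub>B\<^esub> z \<in> W b (Suc k)"
      using mem[OF asubD(3)[OF Suc y(2) z(2)], of "c \<oplus>\<^bsub>A\<^esub> c'"] y(4) z(4) by simp
  qed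
qed

lemma W_mono:
  assumes b: "b \<in> carrier B" and "j \<le> k" shows "W b j \<subseteq> W b k"
proof -
  have "W b k \<subseteq> W b (Suc k)" for k
  proof (induction k)
    case 0
    have "\<zero>\<^bsub>B\<^esub> = \<phi> \<zero>\<^bsub>A\<^esub> \<oplus>\<^bsub>B\<^esub> b \<otimes>\<^bsub>B\<^esub> \<zero>\<^bsub>B\<^esub>" using b by simp
    then have "\<zero>\<^bsub>B\<^esub> \<in> W b (Suc 0)"
      unfolding W.simps by (intro CollectI exI[of _ "\<zero>\<^bsub>A\<^esub>"] exI[of _ "\<zero>\<^bsub>B\<^esub>"]) simp
    then show ?case by simp
  next
    case (Suc k)
    then show ?case by auto
  qed
  then show ?thesis by (rule lift_Suc_mono_le) (rule assms)
qed

lemma pow_W: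
  assumes b: "b \<in> carrier B" shows "b [^]\<^bsub>B\<^esub> k \<in> W b (Suc k)"
proof (induction k)
  case 0
  have "\<one>\<^bsub>B\<^esub> = \<phi> \<one>\<^bsub>A\<^esub> \<oplus>\<^bsub>B\<^esub> b \<otimes>\<^bsub>B\<^esub> \<zero>\<^bsub>B\<^esub>" using b by simp
  then have "\<one>\<^bsub>B\<^esub> \<in> W b (Suc 0)"
    unfolding W.simps by (intro CollectI exI[of _ "\<one>\<^bsub>A\<^esub>"] exI[of _ "\<zero>\<^bsub>B\<^esub>"]) simp
  then show ?case by simp
next
  case (Suc k)
  have "b [^]\<^bsub>B\<^esub> Suc k = \<phi> \<zero>\<^bsub>A\<^esub> \<oplus>\<^bsub>B\<^esub> b \<otimes>\<^bsub>B\<^esub> b [^]\<^bsub>B\<^esub> k" using b by (simp add: hom.S.m_comm)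
  then show ?case unfolding W.simps(2)[of b "Suc k"] using Suc A.zero_closed by blast
qed

text \<open>The union of the increasing modules \<open>W b k\<close> is a finitely generated
  A-module, so it equals one of them. That one contains the power b^k, which is a monic equation of
  degree k.\<close>

lemma integral:
  assumes b: "b \<in> carrier B"
  shows "\<exists>k w. w \<in> W b k \<and> b [^]\<^bsub>B\<^esub> k \<oplus>\<^bsub>B\<^esub> w = \<zero>\<^bsub>B\<^esub>"
proof -
  note aW = asub_W[OF b]
  have "asub (\<Union>k. W b k)"
  proof (rule asubI)
    fix x assume "x \<in> (\<Union>k. W b k)"
    then obtain i where i: "x \<in> W b i" by blast
    show "x \<in> carrier B" by (rule asubD(1)[OF aW i])
    show "\<phi> a \<otimes>\<^bsub>B\<^esub> x \<in> (\<Union>k. W b k)" if "a \<in> carrier A" for a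
      using asubD(4)[OF aW that i] by blast
    fix y assume "y \<in> (\<Union>k. W b k)"
    then obtain j where j: "y \<in> W b j" by blast
    have "x \<in> W b (max i j)" "y \<in> W b (max i j)"
      using W_mono[OF b, of i "max i j"] W_mono[OF b, of j "max i j"] i j by auto
    then show "x \<oplus>\<^bsub>B\<^esub> y \<in> (\<Union>k. W b k)" using asubD(3)[OF aW] by blast
  next
    show "\<zero>\<^bsub>B\<^esub> \<in> (\<Union>k. W b k)" using asubD(2)[OF aW] by blast
  qed
  then obtain S where S: "finite S" "S \<subseteq> (\<Union>k. W b k)" "\<And>Y. asub Y \<Longrightarrow> S \<subseteq> Y \<Longrightarrow> (\<Union>k. W b k) \<subseteq> Y"
    using fin_gen unfolding fin_gen_def by metis
  have "\<exists>k. S \<subseteq> W b k"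
    using S(1,2)
  proof (induction S)
    case (insert x S)
    then obtain i j where "S \<subseteq> W b i" "x \<in> W b j" by blast
    then have "insert x S \<subseteq> W b (max i j)"
      using W_mono[OF b, of i "max i j"] W_mono[OF b, of j "max i j"] by auto
    then show ?case ..
  qed simp
  then obtain k where "S \<subseteq> W b k" ..
  then have "b [^]\<^bsub>B\<^esub> k \<in> W b k"
    using S(3)[OF aW] pow_W[OF b, of k] by blast
  then have "\<ominus>\<^bsub>B\<^esub> (b [^]\<^bsub>B\<^esub> k) \<in> W b k" by (rule asub_minus[OF aW])
  then show ?thesis using b by (intro exI conjI) (auto simp: hom.S.r_neg)
qed

text \<open>Suppose Q contains no image of A beyond those in P, and take b in Q outside P. In a
  relation b^k + w in P the constant coefficient lies in Q, hence in P; subtracting it and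
  cancelling b lowers the degree. Starting from an integral equation of b, the descent ends with 1
  in P.\<close>

lemma incomparable:
  assumes P: "primeideal P B" and Q: "primeideal Q B" and "P \<subset> Q"
  shows "\<exists>a\<in>carrier A. \<phi> a \<in> Q - P"
proof (rule ccontr)
  interpret P: primeideal P B by fact
  interpret Q: primeideal Q B by fact
  assume "\<not> ?thesis"
  then have no: "\<phi> a \<in> P" if "a \<in> carrier A" "\<phi> a \<in> Q" for a using that by blast
  obtain b where b: "b \<in> Q" "b \<notin> P" using \<open>P \<subset> Q\<close> by blast
  have bc: "b \<in> carrier B" using b by simp
  have "False" if "w \<in> W b k" "b [^]\<^bsub>B\<^esub> k \<oplus>\<^bsub>B\<^esub> w \<in> P" for k w
    using that
  proof (induction k arbitrary: w)
    case 0
    then have "\<one>\<^bsub>B\<^esub> \<in> P" by simp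
    then show ?case using P.one_imp_carrier P.I_notcarr by simp
  next
    case (Suc k)
    obtain c w' where w: "w = \<phi> c \<oplus>\<^bsub>B\<^esub> b \<otimes>\<^bsub>B\<^esub> w'" "c \<in> carrier A" "w' \<in> W b k"
      using Suc.prems(1) by auto
    have w'c: "w' \<in> carrier B" using asubD(1)[OF asub_W[OF bc] w(3)] .
    let ?z = "b [^]\<^bsub>B\<^esub> k \<oplus>\<^bsub>B\<^esub> w'"
    have zc: "?z \<in> carrier B" using bc w'c by simp
    have eq: "b [^]\<^bsub>B\<^esub> Suc k \<oplus>\<^bsub>B\<^esub> w = \<phi> c \<oplus>\<^bsub>B\<^esub> b \<otimes>\<^bsub>B\<^esub> ?z"
      unfolding w(1) using w(2) w'c bc by (simp add: hom.S.r_distr hom.S.a_ac hom.S.m_comm)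
    have bz: "b \<otimes>\<^bsub>B\<^esub> ?z \<in> Q" "b \<otimes>\<^bsub>B\<^esub> ?z \<in> carrier B" using b zc Q.I_r_closed bc by simp_all
    have inP: "\<phi> c \<oplus>\<^bsub>B\<^esub> b \<otimes>\<^bsub>B\<^esub> ?z \<in> P" using Suc.prems(2) unfolding eq .
    then have "(\<phi> c \<oplus>\<^bsub>B\<^esub> b \<otimes>\<^bsub>B\<^esub> ?z) \<oplus>\<^bsub>B\<^esub> \<ominus>\<^bsub>B\<^esub> (b \<otimes>\<^bsub>B\<^esub> ?z) \<in> Q"
      using \<open>P \<subset> Q\<close> by (intro Q.a_closed[OF _ Q.a_inv_closed[OF bz(1)]]) blast
    then have "\<phi> c \<in> Q" using w(2) bz(2) by (simp add: hom.S.a_assoc hom.S.r_neg)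
    then have cP: "\<phi> c \<in> P" by (rule no[OF w(2)])
    then have "\<ominus>\<^bsub>B\<^esub> \<phi> c \<oplus>\<^bsub>B\<^esub> (\<phi> c \<oplus>\<^bsub>B\<^esub> b \<otimes>\<^bsub>B\<^esub> ?z) \<in> P"
      by (intro P.a_closed[OF P.a_inv_closed inP])
    then have "b \<otimes>\<^bsub>B\<^esub> ?z \<in> P" using w(2) bz(2) by (simp add: hom.S.r_neg1)
    then have "?z \<in> P" using P.I_prime[OF bc zc] b(2) by blast
    then show ?case using Suc.IH[OF w(3)] by blast
  qed
  moreover obtain k w where "w \<in> W b k" "b [^]\<^bsub>B\<^esub> k \<oplus>\<^bsub>B\<^esub> w = \<zero>\<^bsub>B\<^esub>" using integral[OF bc] by blast
  ultimately show False using P.zero_closed by metis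
qed

text \<open>If x is outside the contraction, then \<open>\<phi> x\<close> has an inverse b modulo N.
  Multiplying a monic equation of degree k for b by the k-th power of \<open>\<phi> x\<close> shows
  that 1 + x c is in the contraction for some c in A, so x is invertible modulo it already in
  A.\<close>

lemma contract_maximal:
  assumes "maximalideal N B"
  shows "maximalideal {a \<in> carrier A. \<phi> a \<in> N} A"
proof -
  interpret N: maximalideal N B by fact
  define M where "M = {a \<in> carrier A. \<phi> a \<in> N}"
  have M: "ideal M A" unfolding M_def by (rule hom.ring.ideal_vimage[OF N.is_ideal])
  have oneN: "\<one>\<^bsub>B\<^esub> \<notin> N" using N.one_imp_carrier N.I_notcarr by auto
  have inv: "\<exists>c\<in>carrier A. \<one>\<^bsub>A\<^esub> \<oplus>\<^bsub>A\<^esub> x \<otimes>\<^bsub>A\<^esub> c \<in> M" if x: "x \<in> carrier A" "x \<notin> M" for x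
  proof -
    have fx: "\<phi> x \<in> carrier B" "\<phi> x \<notin> N" using x by (simp_all add: M_def)
    define K where "K = {p \<oplus>\<^bsub>B\<^esub> r \<otimes>\<^bsub>B\<^esub> \<phi> x | p r. p \<in> N \<and> r \<in> carrier B}"
    have K: "ideal K B" unfolding K_def by (rule hom.S.ideal_adjoin[OF N.is_ideal fx(1)])
    have "N \<subseteq> K"
    proof
      fix p assume p: "p \<in> N"
      then have "p = p \<oplus>\<^bsub>B\<^esub> \<zero>\<^bsub>B\<^esub> \<otimes>\<^bsub>B\<^esub> \<phi> x" using fx by simp
      then show "p \<in> K" unfolding K_def using p hom.S.zero_closed by blast
    qed
    moreover have "\<phi> x = \<zero>\<^bsub>B\<^esub> \<oplus>\<^bsub>B\<^esub> \<one>\<^bsub>B\<^esub> \<otimes>\<^bsub>B\<^esub> \<phi> x" using fx by simp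
    then have "\<phi> x \<in> K" unfolding K_def using N.zero_closed hom.S.one_closed by blast
    moreover have "K \<subseteq> carrier B" using ideal.Icarr[OF K] by (rule subsetI)
    ultimately have "K = carrier B"
      using N.I_maximal[OF K] fx(2) by metis
    then obtain p b where pb: "p \<in> N" "b \<in> carrier B" "\<one>\<^bsub>B\<^esub> = p \<oplus>\<^bsub>B\<^esub> b \<otimes>\<^bsub>B\<^esub> \<phi> x"
      using hom.S.one_closed unfolding K_def by blast
    have pc: "p \<in> carrier B" using pb by simp
    define y where "y = \<phi> x"
    have y: "y \<in> carrier B" using fx y_def by simp
    have yb: "y \<otimes>\<^bsub>B\<^esub> b = \<one>\<^bsub>B\<^esub> \<oplus>\<^bsub>B\<^esub> \<ominus>\<^bsub>B\<^esub> p"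
      unfolding pb(3) y_def using pb fx by (simp add: hom.S.m_comm hom.S.a_ac hom.S.r_neg hom.S.r_neg2 hom.S.r_neg1)
    have 1: "\<exists>p'\<in>N. y [^]\<^bsub>B\<^esub> k \<otimes>\<^bsub>B\<^esub> b [^]\<^bsub>B\<^esub> k = \<one>\<^bsub>B\<^esub> \<oplus>\<^bsub>B\<^esub> p'" for k :: nat
    proof (induction k)
      case 0
      show ?case using N.zero_closed by (intro bexI[of _ "\<zero>\<^bsub>B\<^esub>"]) simp_all
    next
      case (Suc k)
      then obtain p' where p': "p' \<in> N" "y [^]\<^bsub>B\<^esub> k \<otimes>\<^bsub>B\<^esub> b [^]\<^bsub>B\<^esub> k = \<one>\<^bsub>B\<^esub> \<oplus>\<^bsub>B\<^esub> p'" by blast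
      have p'c: "p' \<in> carrier B" using p' by simp
      have "y [^]\<^bsub>B\<^esub> Suc k \<otimes>\<^bsub>B\<^esub> b [^]\<^bsub>B\<^esub> Suc k = (y [^]\<^bsub>B\<^esub> k \<otimes>\<^bsub>B\<^esub> b [^]\<^bsub>B\<^esub> k) \<otimes>\<^bsub>B\<^esub> (y \<otimes>\<^bsub>B\<^esub> b)"
        using y pb(2) by (simp add: hom.S.m_ac)
      also have "\<dots> = \<one>\<^bsub>B\<^esub> \<oplus>\<^bsub>B\<^esub> (p' \<oplus>\<^bsub>B\<^esub> (\<one>\<^bsub>B\<^esub> \<oplus>\<^bsub>B\<^esub> p') \<otimes>\<^bsub>B\<^esub> \<ominus>\<^bsub>B\<^esub> p)"
        unfolding p'(2) yb using pc p'c by (simp add: hom.S.r_distr hom.S.a_assoc)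
      finally show ?case
        using p' p'c pb(1) by (intro bexI[of _ "p' \<oplus>\<^bsub>B\<^esub> (\<one>\<^bsub>B\<^esub> \<oplus>\<^bsub>B\<^esub> p') \<otimes>\<^bsub>B\<^esub> \<ominus>\<^bsub>B\<^esub> p"] N.a_closed N.I_l_closed)
          simp_all
    qed
    \<comment> \<open>Every term of w has degree less than k in b, so after cancellation modulo N at
      least one factor y = \<open>\<phi> x\<close> is left over; this is the factor x on the
      right.\<close>
    have 2: "\<exists>c\<in>carrier A. \<exists>p'\<in>N. y [^]\<^bsub>B\<^esub> k \<otimes>\<^bsub>B\<^esub> w = \<phi> (x \<otimes>\<^bsub>A\<^esub> c) \<oplus>\<^bsub>B\<^esub> p'" if "w \<in> W b k" for k w
      using that
    proof (induction k arbitrary: w)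
      case 0
      then show ?case
        using N.zero_closed x by (intro bexI[of _ "\<zero>\<^bsub>A\<^esub>"] bexI[of _ "\<zero>\<^bsub>B\<^esub>"]) simp_all
    next
      case (Suc k)
      obtain c w' where w: "w = \<phi> c \<oplus>\<^bsub>B\<^esub> b \<otimes>\<^bsub>B\<^esub> w'" "c \<in> carrier A" "w' \<in> W b k"
        using Suc.prems by auto
      have w'c: "w' \<in> carrier B" using asubD(1)[OF asub_W[OF pb(2)] w(3)] .
      obtain c' p' where c': "c' \<in> carrier A" "p' \<in> N" "y [^]\<^bsub>B\<^esub> k \<otimes>\<^bsub>B\<^esub> w' = \<phi> (x \<otimes>\<^bsub>A\<^esub> c') \<oplus>\<^bsub>B\<^esub> p'"
        using Suc.IH[OF w(3)] by blast
      define z where "z = \<phi> (x \<otimes>\<^bsub>A\<^esub> c') \<oplus>\<^bsub>B\<^esub> p'"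
      have p'c: "p' \<in> carrier B" using c' by simp
      have zc: "z \<in> carrier B" unfolding z_def using x c' p'c by simp
      have fpow: "\<phi> (x [^]\<^bsub>A\<^esub> k) = y [^]\<^bsub>B\<^esub> k" using x(1) by (simp add: y_def hom.ring.hom_nat_pow)
      have "y [^]\<^bsub>B\<^esub> Suc k \<otimes>\<^bsub>B\<^esub> w = y \<otimes>\<^bsub>B\<^esub> (y [^]\<^bsub>B\<^esub> k \<otimes>\<^bsub>B\<^esub> \<phi> c) \<oplus>\<^bsub>B\<^esub> (y \<otimes>\<^bsub>B\<^esub> b) \<otimes>\<^bsub>B\<^esub> (y [^]\<^bsub>B\<^esub> k \<otimes>\<^bsub>B\<^esub> w')"
        unfolding w(1) using y pb(2) w'c w(2) by (simp add: hom.S.r_distr hom.S.m_ac)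
      also have "y \<otimes>\<^bsub>B\<^esub> (y [^]\<^bsub>B\<^esub> k \<otimes>\<^bsub>B\<^esub> \<phi> c) = \<phi> (x \<otimes>\<^bsub>A\<^esub> (x [^]\<^bsub>A\<^esub> k \<otimes>\<^bsub>A\<^esub> c))"
        using x w(2) by (simp add: y_def fpow[unfolded y_def])
      also have "(y \<otimes>\<^bsub>B\<^esub> b) \<otimes>\<^bsub>B\<^esub> (y [^]\<^bsub>B\<^esub> k \<otimes>\<^bsub>B\<^esub> w') = z \<oplus>\<^bsub>B\<^esub> (\<ominus>\<^bsub>B\<^esub> p) \<otimes>\<^bsub>B\<^esub> z"
        unfolding c'(3) yb z_def[symmetric] using zc pc by (simp add: hom.S.l_distr)
      also have "\<phi> (x \<otimes>\<^bsub>A\<^esub> (x [^]\<^bsub>A\<^esub> k \<otimes>\<^bsub>A\<^esub> c)) \<oplus>\<^bsub>B\<^esub> (z \<oplus>\<^bsub>B\<^esub> (\<ominus>\<^bsub>B\<^esub> p) \<otimes>\<^bsub>B\<^esub> z) =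
          \<phi> (x \<otimes>\<^bsub>A\<^esub> (x [^]\<^bsub>A\<^esub> k \<otimes>\<^bsub>A\<^esub> c \<oplus>\<^bsub>A\<^esub> c')) \<oplus>\<^bsub>B\<^esub> (p' \<oplus>\<^bsub>B\<^esub> (\<ominus>\<^bsub>B\<^esub> p) \<otimes>\<^bsub>B\<^esub> z)"
        unfolding z_def using x w(2) c'(1) p'c pc
        by (simp add: A.r_distr hom.S.a_assoc)
      finally have "y [^]\<^bsub>B\<^esub> Suc k \<otimes>\<^bsub>B\<^esub> w =
          \<phi> (x \<otimes>\<^bsub>A\<^esub> (x [^]\<^bsub>A\<^esub> k \<otimes>\<^bsub>A\<^esub> c \<oplus>\<^bsub>A\<^esub> c')) \<oplus>\<^bsub>B\<^esub> (p' \<oplus>\<^bsub>B\<^esub> (\<ominus>\<^bsub>B\<^esub> p) \<otimes>\<^bsub>B\<^esub> z)" .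
      moreover have "p' \<oplus>\<^bsub>B\<^esub> (\<ominus>\<^bsub>B\<^esub> p) \<otimes>\<^bsub>B\<^esub> z \<in> N"
        using c'(2) pb(1) zc by (intro N.a_closed N.I_r_closed) simp_all
      moreover have "x [^]\<^bsub>A\<^esub> k \<otimes>\<^bsub>A\<^esub> c \<oplus>\<^bsub>A\<^esub> c' \<in> carrier A" using x w(2) c'(1) by simp
      ultimately show ?case by (intro bexI)
    qed
    obtain k w where kw: "w \<in> W b k" "b [^]\<^bsub>B\<^esub> k \<oplus>\<^bsub>B\<^esub> w = \<zero>\<^bsub>B\<^esub>" using integral[OF pb(2)] by blast
    have wc: "w \<in> carrier B" using asubD(1)[OF asub_W[OF pb(2)] kw(1)] .
    obtain p1 where p1: "p1 \<in> N" "y [^]\<^bsub>B\<^esub> k \<otimes>\<^bsub>B\<^esub> b [^]\<^bsub>B\<^esub> k = \<one>\<^bsub>B\<^esub> \<oplus>\<^bsub>B\<^esub> p1" using 1 by blast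
    obtain c p2 where c: "c \<in> carrier A" "p2 \<in> N" "y [^]\<^bsub>B\<^esub> k \<otimes>\<^bsub>B\<^esub> w = \<phi> (x \<otimes>\<^bsub>A\<^esub> c) \<oplus>\<^bsub>B\<^esub> p2"
      using 2[OF kw(1)] by blast
    have pc12: "p1 \<in> carrier B" "p2 \<in> carrier B" using p1 c by simp_all
    have "\<zero>\<^bsub>B\<^esub> = y [^]\<^bsub>B\<^esub> k \<otimes>\<^bsub>B\<^esub> (b [^]\<^bsub>B\<^esub> k \<oplus>\<^bsub>B\<^esub> w)" unfolding kw(2) using y by simp
    also have "\<dots> = (\<one>\<^bsub>B\<^esub> \<oplus>\<^bsub>B\<^esub> p1) \<oplus>\<^bsub>B\<^esub> (\<phi> (x \<otimes>\<^bsub>A\<^esub> c) \<oplus>\<^bsub>B\<^esub> p2)"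
      using y pb(2) wc p1(2) c(3) by (simp add: hom.S.r_distr)
    also have "\<dots> = \<phi> (\<one>\<^bsub>A\<^esub> \<oplus>\<^bsub>A\<^esub> x \<otimes>\<^bsub>A\<^esub> c) \<oplus>\<^bsub>B\<^esub> (p1 \<oplus>\<^bsub>B\<^esub> p2)"
      using x c(1) pc12 by (simp add: hom.S.a_ac)
    finally have "\<phi> (\<one>\<^bsub>A\<^esub> \<oplus>\<^bsub>A\<^esub> x \<otimes>\<^bsub>A\<^esub> c) = \<ominus>\<^bsub>B\<^esub> (p1 \<oplus>\<^bsub>B\<^esub> p2)"
      using x c(1) pc12 by (intro hom.S.minus_equality[symmetric]) (simp_all del: hom.hom_add)
    then have "\<phi> (\<one>\<^bsub>A\<^esub> \<oplus>\<^bsub>A\<^esub> x \<otimes>\<^bsub>A\<^esub> c) \<in> N" using p1(1) c(2) by (simp del: hom.hom_add)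
    then show ?thesis using x(1) c(1) unfolding M_def by blast
  qed
  have "\<one>\<^bsub>A\<^esub> \<notin> M" using oneN by (simp add: M_def)
  moreover have "J = M \<or> J = carrier A" if J: "ideal J A" "M \<subseteq> J" for J
  proof (rule disjCI)
    interpret J: ideal J A by fact
    assume "J \<noteq> carrier A"
    show "J = M"
    proof (rule ccontr)
      assume "J \<noteq> M"
      then obtain x where x: "x \<in> J" "x \<notin> M" using J(2) by blast
      have xc: "x \<in> carrier A" using x by simp
      obtain c where c: "c \<in> carrier A" "\<one>\<^bsub>A\<^esub> \<oplus>\<^bsub>A\<^esub> x \<otimes>\<^bsub>A\<^esub> c \<in> M" using inv[OF xc x(2)] by blast
      have "(\<one>\<^bsub>A\<^esub> \<oplus>\<^bsub>A\<^esub> x \<otimes>\<^bsub>A\<^esub> c) \<oplus>\<^bsub>A\<^esub> \<ominus>\<^bsub>A\<^esub> (x \<otimes>\<^bsub>A\<^esub> c) \<in> J"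
        using c J(2) J.I_r_closed[OF x(1) c(1)] by (intro J.a_closed[OF _ J.a_inv_closed]) blast+
      then have "\<one>\<^bsub>A\<^esub> \<in> J" using xc c(1) by (simp add: A.a_assoc A.r_neg)
      then show False using J.one_imp_carrier \<open>J \<noteq> carrier A\<close> by simp
    qed
  qed
  ultimately have "maximalideal M A"
    using A.one_closed by (intro maximalidealI[OF M]) blast+
  then show ?thesis unfolding M_def .
qed

end

section \<open>Localizing a Frobenius extension at a prime: dimension and depth\<close>

locale frobenius_prime = frobenius_extension A B \<phi> n u v \<pi>
  for A :: "'a ring" and B :: "'b ring" and \<phi> n u v \<pi> +
  fixes N :: "'b set"
  assumes N: "primeideal N B"
begin

definition M where "M = {a \<in> carrier A. \<phi> a \<in> N}"

lemma M_iff: "a \<in> carrier A \<Longrightarrow> a \<in> M \<longleftrightarrow> \<phi> a \<in> N"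
  by (simp add: M_def)

lemma primeideal_M: "primeideal M A"
  unfolding M_def by (rule hom.primeideal_vimage[OF N])

sublocale LA: noetherian_prime M A
  using primeideal_M A.noetherian_ring_axioms
  by (simp add: noetherian_prime_def prime_localization_def)

sublocale LB: noetherian_prime N B
  using N noetherian_B by (simp add: noetherian_prime_def prime_localization_def)

lemma phi_T: "s \<in> LA.T \<Longrightarrow> \<phi> s \<in> LB.T"
  using M_iff by auto

definition \<psi> :: "('a \<times> 'a) set \<Rightarrow> ('b \<times> 'b) set"
  where "\<psi> X = (SOME Y. \<exists>a s. a \<in> carrier A \<and> s \<in> LA.T \<and> X = fraction A M a s \<and>
    Y = fraction B N (\<phi> a) (\<phi> s))"

lemma psi_fraction:
  assumes a: "a \<in> carrier A" and s: "s \<in> LA.T"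
  shows "\<psi> (fraction A M a s) = fraction B N (\<phi> a) (\<phi> s)"
proof -
  let ?P = "\<lambda>Y. \<exists>b t. b \<in> carrier A \<and> t \<in> LA.T \<and> fraction A M a s = fraction A M b t \<and>
    Y = fraction B N (\<phi> b) (\<phi> t)"
  have "?P (fraction B N (\<phi> a) (\<phi> s))" using assms by blast
  then have "?P (Eps ?P)" by (rule someI)
  then obtain b t where b: "b \<in> carrier A" "t \<in> LA.T" "fraction A M a s = fraction A M b t"
    "Eps ?P = fraction B N (\<phi> b) (\<phi> t)" by blast
  obtain w where w: "w \<in> LA.T" "w \<otimes>\<^bsub>A\<^esub> (a \<otimes>\<^bsub>A\<^esub> t) = w \<otimes>\<^bsub>A\<^esub> (b \<otimes>\<^bsub>A\<^esub> s)"
    using b(3) unfolding LA.fraction_eq_iff[OF a b(1) s b(2)] ..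
  have wc: "w \<in> carrier A" "s \<in> carrier A" "t \<in> carrier A" using w s b by simp_all
  have "\<phi> w \<otimes>\<^bsub>B\<^esub> (\<phi> b \<otimes>\<^bsub>B\<^esub> \<phi> s) = \<phi> w \<otimes>\<^bsub>B\<^esub> (\<phi> a \<otimes>\<^bsub>B\<^esub> \<phi> t)"
    using arg_cong[OF w(2), of \<phi>] wc a b(1) by simp
  then have "fraction B N (\<phi> b) (\<phi> t) = fraction B N (\<phi> a) (\<phi> s)"
    by (intro LB.fraction_eqI[OF phi_T[OF w(1)]])
      (use a b phi_T[OF s] phi_T[OF b(2)] in simp_all)
  then show ?thesis using b(4) by (simp add: \<psi>_def)
qed

lemma psi_hom: "ring_hom_cring LA.L LB.L \<psi>"
proof (intro ring_hom_cring.intro ring_hom_cring_axioms.intro ring_hom_memI)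
  show "cring LA.L" "cring LB.L" by (rule LA.cring_localization, rule LB.cring_localization)
  show "\<psi> \<one>\<^bsub>LA.L\<^esub> = \<one>\<^bsub>LB.L\<^esub>"
    unfolding LA.localization_one LB.localization_one
    using psi_fraction[OF A.one_closed LA.one_compl] by simp
  fix X assume "X \<in> carrier LA.L"
  then obtain a s where a: "a \<in> carrier A" "s \<in> LA.T" "X = fraction A M a s" by (rule LA.fraction_cases)
  note s' = phi_T[OF a(2)]
  have sc: "s \<in> carrier A" using a by simp
  show "\<psi> X \<in> carrier LB.L" using a s' by (simp add: psi_fraction)
  fix Y assume "Y \<in> carrier LA.L"
  then obtain b t where b: "b \<in> carrier A" "t \<in> LA.T" "Y = fraction A M b t" by (rule LA.fraction_cases)
  note t' = phi_T[OF b(2)]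
  have tc: "t \<in> carrier A" using b by simp
  note st = LA.mult_compl[OF a(2) b(2)]
  show "\<psi> (X \<otimes>\<^bsub>LA.L\<^esub> Y) = \<psi> X \<otimes>\<^bsub>LB.L\<^esub> \<psi> Y"
    unfolding a(3) b(3) LA.fraction_mult[OF a(1) b(1) a(2) b(2)]
    using a(1) b(1) sc tc psi_fraction[OF a(1,2)] psi_fraction[OF b(1,2)]
      psi_fraction[OF A.m_closed[OF a(1) b(1)] st] LB.fraction_mult[OF _ _ s' t', of "\<phi> a" "\<phi> b"] by simp
  have c: "a \<otimes>\<^bsub>A\<^esub> t \<oplus>\<^bsub>A\<^esub> b \<otimes>\<^bsub>A\<^esub> s \<in> carrier A" using a(1) b(1) sc tc by simp
  show "\<psi> (X \<oplus>\<^bsub>LA.L\<^esub> Y) = \<psi> X \<oplus>\<^bsub>LB.L\<^esub> \<psi> Y"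
    unfolding a(3) b(3) LA.fraction_add[OF a(1) b(1) a(2) b(2)]
    using a(1) b(1) sc tc psi_fraction[OF a(1,2)] psi_fraction[OF b(1,2)]
      psi_fraction[OF c st] LB.fraction_add[OF _ _ s' t', of "\<phi> a" "\<phi> b"] by simp
qed

sublocale \<psi>: ring_hom_cring LA.L LB.L \<psi> by (rule psi_hom)

text \<open>Incomparability is used in B itself, for the primes of numerators. These stay distinct
  because a prime of the localization is determined by its numerators, and an a in A that separates
  them yields the fraction a/1 that separates the contractions.\<close>

lemma contraction_less:
  assumes P: "primeideal P LB.L" and Q: "primeideal Q LB.L" and PQ: "P \<subset> Q"
  shows "{X \<in> carrier LA.L. \<psi> X \<in> P} \<subset> {X \<in> carrier LA.L. \<psi> X \<in> Q}"
proof -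
  interpret P: primeideal P LB.L by fact
  interpret Q: primeideal Q LB.L by fact
  define P' where "P' = {b \<in> carrier B. fraction B N b \<one>\<^bsub>B\<^esub> \<in> P}"
  define Q' where "Q' = {b \<in> carrier B. fraction B N b \<one>\<^bsub>B\<^esub> \<in> Q}"
  have pr: "primeideal P' B" "primeideal Q' B"
    unfolding P'_def Q'_def by (rule LB.\<rho>.primeideal_vimage, fact)+
  obtain z where z: "z \<in> Q" "z \<notin> P" using PQ by blast
  obtain b t where b: "b \<in> carrier B" "t \<in> LB.T" "z = fraction B N b t"
    using Q.Icarr[OF z(1)] by (rule LB.fraction_cases)
  have "b \<in> Q'" "b \<notin> P'"
    using z LB.fraction_mem_ideal_iff[OF P.is_ideal b(1,2)] LB.fraction_mem_ideal_iff[OF Q.is_ideal b(1,2)]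
      b(1,3) unfolding P'_def Q'_def by auto
  then have "P' \<subset> Q'" using PQ unfolding P'_def Q'_def by blast
  then obtain a where a: "a \<in> carrier A" "\<phi> a \<in> Q'" "\<phi> a \<notin> P'" using incomparable[OF pr] by blast
  have "\<psi> (fraction A M a \<one>\<^bsub>A\<^esub>) = fraction B N (\<phi> a) \<one>\<^bsub>B\<^esub>"
    using psi_fraction[OF a(1) LA.one_compl] by simp
  then have "\<psi> (fraction A M a \<one>\<^bsub>A\<^esub>) \<in> Q" "\<psi> (fraction A M a \<one>\<^bsub>A\<^esub>) \<notin> P"
    using a unfolding P'_def Q'_def by auto
  moreover have "fraction A M a \<one>\<^bsub>A\<^esub> \<in> carrier LA.L" by (rule LA.fraction_closed[OF a(1) LA.one_compl])
  ultimately show ?thesis using PQ by blast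
qed

lemma krull_dim_le: "krull_dim LB.L \<le> krull_dim LA.L"
  unfolding krull_dim_def
proof (rule Sup_least)
  fix x assume "x \<in> {enat n | n. \<exists>P :: nat \<Rightarrow> ('b \<times> 'b) set set.
    (\<forall>i\<le>n. primeideal (P i) LB.L) \<and> (\<forall>i<n. P i \<subset> P (Suc i))}"
  then obtain k P where P: "x = enat k" "\<And>i. i \<le> k \<Longrightarrow> primeideal (P i) LB.L" "\<And>i. i < k \<Longrightarrow> P i \<subset> P (Suc i)"
    by blast
  define Q where "Q i = {X \<in> carrier LA.L. \<psi> X \<in> P i}" for i
  have "primeideal (Q i) LA.L" if "i \<le> k" for i
    unfolding Q_def by (rule \<psi>.primeideal_vimage[OF P(2)[OF that]])
  moreover have "Q i \<subset> Q (Suc i)" if "i < k" for i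
    unfolding Q_def using that by (intro contraction_less P) simp_all
  ultimately show "x \<le> Sup {enat n | n. \<exists>P :: nat \<Rightarrow> ('a \<times> 'a) set set.
    (\<forall>i\<le>n. primeideal (P i) LA.L) \<and> (\<forall>i<n. P i \<subset> P (Suc i))}"
    unfolding P(1) by (intro Sup_upper CollectI exI[of _ k] exI[of _ Q]) auto
qed

text \<open>The extension of \<open>K\<close> along \<open>\<psi>\<close>, see \<open>genideal_psi\<close>: a condition on the coordinates of \<open>b\<close>, which makes
  flatness of \<open>\<psi>\<close> directly usable.\<close>

definition ext :: "('a \<times> 'a) set set \<Rightarrow> ('b \<times> 'b) set set"
  where "ext K = {fraction B N b t | b t. b \<in> carrier B \<and> t \<in> LB.T \<and>
    (\<forall>c\<in>carrier B. fraction A M (\<pi> (b \<otimes>\<^bsub>B\<^esub> c)) \<one>\<^bsub>A\<^esub> \<in> K)}"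

lemma ext_memI:
  "b \<in> carrier B \<Longrightarrow> t \<in> LB.T \<Longrightarrow>
    (\<And>c. c \<in> carrier B \<Longrightarrow> fraction A M (\<pi> (b \<otimes>\<^bsub>B\<^esub> c)) \<one>\<^bsub>A\<^esub> \<in> K) \<Longrightarrow> fraction B N b t \<in> ext K"
  unfolding ext_def by blast

lemma ext_memE:
  assumes "z \<in> ext K"
  obtains b t where "b \<in> carrier B" "t \<in> LB.T" "z = fraction B N b t"
    "\<And>c. c \<in> carrier B \<Longrightarrow> fraction A M (\<pi> (b \<otimes>\<^bsub>B\<^esub> c)) \<one>\<^bsub>A\<^esub> \<in> K"
  using assms unfolding ext_def by blast

lemma pi_zero: "\<pi> \<zero>\<^bsub>B\<^esub> = \<zero>\<^bsub>A\<^esub>"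
  using pi_mult[OF A.zero_closed hom.S.zero_closed] by simp

lemma ideal_ext:
  assumes K: "ideal K LA.L"
  shows "ideal (ext K) LB.L"
proof (rule LB.L.cring_idealI)
  interpret K: ideal K LA.L by fact
  show "ext K \<subseteq> carrier LB.L" unfolding ext_def by (auto intro: LB.fraction_closed)
  show "\<zero>\<^bsub>LB.L\<^esub> \<in> ext K"
    unfolding LB.localization_zero
    using K.zero_closed unfolding LA.localization_zero
    by (intro ext_memI hom.S.zero_closed LB.one_compl) (simp add: pi_zero)
  fix z assume "z \<in> ext K"
  then obtain b t where b: "b \<in> carrier B" "t \<in> LB.T" "z = fraction B N b t"
    and bK: "\<And>c. c \<in> carrier B \<Longrightarrow> fraction A M (\<pi> (b \<otimes>\<^bsub>B\<^esub> c)) \<one>\<^bsub>A\<^esub> \<in> K" using ext_memE by metis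
  have tc: "t \<in> carrier B" using b by simp
  show "r \<otimes>\<^bsub>LB.L\<^esub> z \<in> ext K" if r: "r \<in> carrier LB.L" for r
  proof -
    obtain c s where c: "c \<in> carrier B" "s \<in> LB.T" "r = fraction B N c s" using r by (rule LB.fraction_cases)
    show ?thesis
      unfolding c(3) b(3) LB.fraction_mult[OF c(1) b(1) c(2) b(2)]
    proof (rule ext_memI)
      fix d assume d: "d \<in> carrier B"
      have "c \<otimes>\<^bsub>B\<^esub> b \<otimes>\<^bsub>B\<^esub> d = b \<otimes>\<^bsub>B\<^esub> (c \<otimes>\<^bsub>B\<^esub> d)" using b c d by (simp add: hom.S.m_ac)
      then show "fraction A M (\<pi> (c \<otimes>\<^bsub>B\<^esub> b \<otimes>\<^bsub>B\<^esub> d)) \<one>\<^bsub>A\<^esub> \<in> K" using bK[of "c \<otimes>\<^bsub>B\<^esub> d"] c d by simp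
    qed (use b(1) c(1) LB.mult_compl[OF c(2) b(2)] in simp_all)
  qed
  fix w assume "w \<in> ext K"
  then obtain c s where c: "c \<in> carrier B" "s \<in> LB.T" "w = fraction B N c s"
    and cK: "\<And>d. d \<in> carrier B \<Longrightarrow> fraction A M (\<pi> (c \<otimes>\<^bsub>B\<^esub> d)) \<one>\<^bsub>A\<^esub> \<in> K" using ext_memE by metis
  have sc: "s \<in> carrier B" using c by simp
  show "z \<oplus>\<^bsub>LB.L\<^esub> w \<in> ext K"
    unfolding c(3) b(3) LB.fraction_add[OF b(1) c(1) b(2) c(2)]
  proof (rule ext_memI)
    fix d assume d: "d \<in> carrier B"
    have "(b \<otimes>\<^bsub>B\<^esub> s \<oplus>\<^bsub>B\<^esub> c \<otimes>\<^bsub>B\<^esub> t) \<otimes>\<^bsub>B\<^esub> d = b \<otimes>\<^bsub>B\<^esub> (s \<otimes>\<^bsub>B\<^esub> d) \<oplus>\<^bsub>B\<^esub> c \<otimes>\<^bsub>B\<^esub> (t \<otimes>\<^bsub>B\<^esub> d)"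
      using b c d sc tc by (simp add: hom.S.l_distr hom.S.m_assoc)
    then have "fraction A M (\<pi> ((b \<otimes>\<^bsub>B\<^esub> s \<oplus>\<^bsub>B\<^esub> c \<otimes>\<^bsub>B\<^esub> t) \<otimes>\<^bsub>B\<^esub> d)) \<one>\<^bsub>A\<^esub> =
        fraction A M (\<pi> (b \<otimes>\<^bsub>B\<^esub> (s \<otimes>\<^bsub>B\<^esub> d))) \<one>\<^bsub>A\<^esub> \<oplus>\<^bsub>LA.L\<^esub> fraction A M (\<pi> (c \<otimes>\<^bsub>B\<^esub> (t \<otimes>\<^bsub>B\<^esub> d))) \<one>\<^bsub>A\<^esub>"
      using b(1) c(1) d sc tc by (simp add: pi_add)
    then show "fraction A M (\<pi> ((b \<otimes>\<^bsub>B\<^esub> s \<oplus>\<^bsub>B\<^esub> c \<otimes>\<^bsub>B\<^esub> t) \<otimes>\<^bsub>B\<^esub> d)) \<one>\<^bsub>A\<^esub> \<in> K"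
      using K.a_closed[OF bK[of "s \<otimes>\<^bsub>B\<^esub> d"] cK[of "t \<otimes>\<^bsub>B\<^esub> d"]] d sc tc by simp
  qed (use b(1) c(1) sc tc LB.mult_compl[OF b(2) c(2)] in simp_all)
qed

text \<open>One inclusion holds because \<open>ext\<close> gives an ideal containing the images of
  X. For the other, the expansion in \<open>decomp\<close> writes the numerator b with coefficients
  \<open>\<pi> (b \<otimes> v i)\<close>, all of which lie in the ideal generated by X.\<close>

lemma genideal_psi:
  assumes X: "X \<subseteq> carrier LA.L"
  shows "Idl\<^bsub>LB.L\<^esub> (\<psi> ` X) = ext (Idl\<^bsub>LA.L\<^esub> X)"
proof
  define K where "K = Idl\<^bsub>LA.L\<^esub> X"
  have K: "ideal K LA.L" unfolding K_def by (rule LA.L.genideal_ideal[OF X])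
  interpret K: ideal K LA.L by fact
  have XK: "X \<subseteq> K" unfolding K_def by (rule LA.L.genideal_self[OF X])
  have "\<psi> x \<in> ext K" if x: "x \<in> X" for x
  proof -
    obtain a s where a: "a \<in> carrier A" "s \<in> LA.T" "x = fraction A M a s"
      using K.Icarr XK x by (meson LA.fraction_cases subsetD)
    have sc: "s \<in> carrier A" using a by simp
    show ?thesis
      unfolding a(3) psi_fraction[OF a(1,2)]
    proof (rule ext_memI[OF _ phi_T[OF a(2)]])
      show "\<phi> a \<in> carrier B" using a by simp
      fix c assume c: "c \<in> carrier B"
      have "fraction A M a \<one>\<^bsub>A\<^esub> \<in> K"
        using LA.fraction_mem_ideal_iff[OF K a(1,2)] XK x a(3) by auto
      then have "fraction A M a \<one>\<^bsub>A\<^esub> \<otimes>\<^bsub>LA.L\<^esub> fraction A M (\<pi> c) \<one>\<^bsub>A\<^esub> \<in> K"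
        using c by (intro K.I_r_closed) simp_all
      then show "fraction A M (\<pi> (\<phi> a \<otimes>\<^bsub>B\<^esub> c)) \<one>\<^bsub>A\<^esub> \<in> K"
        using a(1) c by (simp add: pi_mult)
    qed
  qed
  then show "Idl\<^bsub>LB.L\<^esub> (\<psi> ` X) \<subseteq> ext (Idl\<^bsub>LA.L\<^esub> X)"
    unfolding K_def by (intro LB.L.genideal_minimal ideal_ext LA.L.genideal_ideal X) blast
  define Y where "Y = Idl\<^bsub>LB.L\<^esub> (\<psi> ` X)"
  have pX: "\<psi> ` X \<subseteq> carrier LB.L" using X by auto
  have Y: "ideal Y LB.L" unfolding Y_def by (rule LB.L.genideal_ideal[OF pX])
  interpret Y: ideal Y LB.L by fact
  have "X \<subseteq> {x \<in> carrier LA.L. \<psi> x \<in> Y}"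
    using LB.L.genideal_self[OF pX] X unfolding Y_def by blast
  then have KY: "K \<subseteq> {x \<in> carrier LA.L. \<psi> x \<in> Y}"
    unfolding K_def by (rule LA.L.genideal_minimal[OF \<psi>.ring.ideal_vimage[OF Y]])
  show "ext (Idl\<^bsub>LA.L\<^esub> X) \<subseteq> Idl\<^bsub>LB.L\<^esub> (\<psi> ` X)"
    unfolding Y_def[symmetric] K_def[symmetric]
  proof
    fix z assume "z \<in> ext K"
    then obtain b t where b: "b \<in> carrier B" "t \<in> LB.T" "z = fraction B N b t"
      and bK: "\<And>c. c \<in> carrier B \<Longrightarrow> fraction A M (\<pi> (b \<otimes>\<^bsub>B\<^esub> c)) \<one>\<^bsub>A\<^esub> \<in> K" using ext_memE by metis
    define Y' where "Y' = {b \<in> carrier B. fraction B N b \<one>\<^bsub>B\<^esub> \<in> Y}"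
    have Y': "ideal Y' B" unfolding Y'_def by (rule LB.\<rho>.ring.ideal_vimage[OF Y])
    have "\<phi> (\<pi> (b \<otimes>\<^bsub>B\<^esub> v i)) \<otimes>\<^bsub>B\<^esub> u i \<in> Y'" if i: "i < n" for i
    proof (rule ideal.I_r_closed[OF Y' _ u_closed[OF i]])
      have c: "\<pi> (b \<otimes>\<^bsub>B\<^esub> v i) \<in> carrier A" using b(1) v_closed[OF i] by simp
      have "\<psi> (fraction A M (\<pi> (b \<otimes>\<^bsub>B\<^esub> v i)) \<one>\<^bsub>A\<^esub>) \<in> Y" using bK[OF v_closed[OF i]] KY by blast
      then show "\<phi> (\<pi> (b \<otimes>\<^bsub>B\<^esub> v i)) \<in> Y'"
        unfolding psi_fraction[OF c LA.one_compl] Y'_def using c by simp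
    qed
    then have "b \<in> Y'"
      using hom.S.finsum_mem_ideal[OF Y', of n "\<lambda>i. \<phi> (\<pi> (b \<otimes>\<^bsub>B\<^esub> v i)) \<otimes>\<^bsub>B\<^esub> u i"]
      unfolding decomp[OF b(1), symmetric] by blast
    then show "z \<in> Y"
      using LB.fraction_mem_ideal_iff[OF Y b(1,2)] b(3) unfolding Y'_def by simp
  qed
qed

text \<open>\<open>\<pi>\<close> is A-linear, so multiplication by an element of A acts on each
  coordinate separately. After clearing denominators, a times a coordinate of b is a coordinate of
  b1 and lies in K; regularity of x modulo K then applies to every coordinate.\<close>

lemma ext_regular:
  assumes K: "ideal K LA.L" and x: "x \<in> carrier LA.L" and z: "z \<in> carrier LB.L"
    and reg: "\<And>y. y \<in> carrier LA.L \<Longrightarrow> x \<otimes>\<^bsub>LA.L\<^esub> y \<in> K \<Longrightarrow> y \<in> K"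
    and xz: "\<psi> x \<otimes>\<^bsub>LB.L\<^esub> z \<in> ext K"
  shows "z \<in> ext K"
proof -
  interpret K: ideal K LA.L by fact
  obtain a s where a: "a \<in> carrier A" "s \<in> LA.T" "x = fraction A M a s" using x by (rule LA.fraction_cases)
  obtain b t where b: "b \<in> carrier B" "t \<in> LB.T" "z = fraction B N b t" using z by (rule LB.fraction_cases)
  note sT = phi_T[OF a(2)]
  have C: "s \<in> carrier A" "t \<in> carrier B" "\<phi> s \<in> carrier B" "\<phi> a \<in> carrier B" using a b by simp_all
  have "\<psi> x \<otimes>\<^bsub>LB.L\<^esub> z = fraction B N (\<phi> a \<otimes>\<^bsub>B\<^esub> b) (\<phi> s \<otimes>\<^bsub>B\<^esub> t)"
    unfolding a(3) b(3) psi_fraction[OF a(1,2)] by (rule LB.fraction_mult[OF C(4) b(1) sT b(2)])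
  then obtain b1 t1 where b1: "b1 \<in> carrier B" "t1 \<in> LB.T"
    "fraction B N (\<phi> a \<otimes>\<^bsub>B\<^esub> b) (\<phi> s \<otimes>\<^bsub>B\<^esub> t) = fraction B N b1 t1"
    and b1K: "\<And>c. c \<in> carrier B \<Longrightarrow> fraction A M (\<pi> (b1 \<otimes>\<^bsub>B\<^esub> c)) \<one>\<^bsub>A\<^esub> \<in> K"
    using xz ext_memE by metis
  note stT = LB.mult_compl[OF sT b(2)]
  obtain w where w: "w \<in> LB.T" "w \<otimes>\<^bsub>B\<^esub> ((\<phi> a \<otimes>\<^bsub>B\<^esub> b) \<otimes>\<^bsub>B\<^esub> t1) = w \<otimes>\<^bsub>B\<^esub> (b1 \<otimes>\<^bsub>B\<^esub> (\<phi> s \<otimes>\<^bsub>B\<^esub> t))"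
    using b1(3) unfolding LB.fraction_eq_iff[OF hom.S.m_closed[OF C(4) b(1)] b1(1) stT b1(2)] ..
  have C2: "w \<in> carrier B" "t1 \<in> carrier B" using w b1 by simp_all
  \<comment> \<open>Membership in \<open>ext\<close> only asks for some representative with
    coordinates in K. For z this is (r b)/(r t), with the factor r that makes the equation of
    fractions hold in B.\<close>
  define r where "r = w \<otimes>\<^bsub>B\<^esub> t1"
  have r: "r \<in> LB.T" "r \<in> carrier B" unfolding r_def using LB.mult_compl[OF w(1) b1(2)] by simp_all
  have mem: "fraction A M (\<pi> ((r \<otimes>\<^bsub>B\<^esub> b) \<otimes>\<^bsub>B\<^esub> c)) \<one>\<^bsub>A\<^esub> \<in> K" if c: "c \<in> carrier B" for c
  proof (rule reg)
    let ?p = "\<pi> ((r \<otimes>\<^bsub>B\<^esub> b) \<otimes>\<^bsub>B\<^esub> c)"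
    have p: "?p \<in> carrier A" using r b(1) c by simp
    then show "fraction A M ?p \<one>\<^bsub>A\<^esub> \<in> carrier LA.L" by simp
    have "a \<otimes>\<^bsub>A\<^esub> ?p = \<pi> (\<phi> a \<otimes>\<^bsub>B\<^esub> ((r \<otimes>\<^bsub>B\<^esub> b) \<otimes>\<^bsub>B\<^esub> c))"
      using r b(1) c a(1) by (simp add: pi_mult)
    also have "\<phi> a \<otimes>\<^bsub>B\<^esub> ((r \<otimes>\<^bsub>B\<^esub> b) \<otimes>\<^bsub>B\<^esub> c) = (w \<otimes>\<^bsub>B\<^esub> ((\<phi> a \<otimes>\<^bsub>B\<^esub> b) \<otimes>\<^bsub>B\<^esub> t1)) \<otimes>\<^bsub>B\<^esub> c"
      using C C2 b(1) c by (simp add: r_def hom.S.m_ac)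
    also have "\<dots> = b1 \<otimes>\<^bsub>B\<^esub> (w \<otimes>\<^bsub>B\<^esub> (\<phi> s \<otimes>\<^bsub>B\<^esub> t) \<otimes>\<^bsub>B\<^esub> c)"
      unfolding w(2) using C C2 b1(1) c by (simp add: hom.S.m_ac)
    finally have "fraction A M (a \<otimes>\<^bsub>A\<^esub> ?p) \<one>\<^bsub>A\<^esub> \<in> K"
      using b1K[of "w \<otimes>\<^bsub>B\<^esub> (\<phi> s \<otimes>\<^bsub>B\<^esub> t) \<otimes>\<^bsub>B\<^esub> c"] C C2 c by simp
    then have "fraction A M (a \<otimes>\<^bsub>A\<^esub> ?p) s \<in> K"
      using LA.fraction_mem_ideal_iff[OF K A.m_closed[OF a(1) p] a(2)] by simp
    then show "x \<otimes>\<^bsub>LA.L\<^esub> fraction A M ?p \<one>\<^bsub>A\<^esub> \<in> K"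
      unfolding a(3) using LA.fraction_mult[OF a(1) p a(2) LA.one_compl] C by simp
  qed
  have "z = fraction B N (r \<otimes>\<^bsub>B\<^esub> b) (r \<otimes>\<^bsub>B\<^esub> t)"
    unfolding b(3) using LB.fraction_cancel[OF b(1,2) r(1)] by simp
  moreover have "fraction B N (r \<otimes>\<^bsub>B\<^esub> b) (r \<otimes>\<^bsub>B\<^esub> t) \<in> ext K"
    by (rule ext_memI[OF _ LB.mult_compl[OF r(1) b(2)] mem]) (use r b(1) in simp_all)
  ultimately show ?thesis by simp
qed

lemma regular_sequence_psi:
  assumes xs: "regular_sequence LA.L xs" and max: "set xs \<subseteq> LA.loc_max"
  shows "regular_sequence LB.L (map \<psi> xs)" "set (map \<psi> xs) \<subseteq> LB.loc_max"
proof -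
  have c: "set xs \<subseteq> carrier LA.L"
    and reg: "\<And>i a. i < length xs \<Longrightarrow> a \<in> carrier LA.L \<Longrightarrow>
      xs ! i \<otimes>\<^bsub>LA.L\<^esub> a \<in> Idl\<^bsub>LA.L\<^esub> (set (take i xs)) \<Longrightarrow> a \<in> Idl\<^bsub>LA.L\<^esub> (set (take i xs))"
    using xs unfolding regular_sequence_def by auto
  have tk: "set (take i xs) \<subseteq> carrier LA.L" for i using c set_take_subset[of i xs] by blast
  show max': "set (map \<psi> xs) \<subseteq> LB.loc_max"
  proof
    fix y assume "y \<in> set (map \<psi> xs)"
    then obtain x where x: "x \<in> set xs" "y = \<psi> x" by auto
    obtain a s where a: "a \<in> carrier A" "s \<in> LA.T" "x = fraction A M a s"
      using c x(1) by (meson LA.fraction_cases subsetD)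
    have "x \<in> LA.loc_max" using max x(1) by blast
    then have "\<phi> a \<in> N"
      unfolding a(3) LA.fraction_mem_loc_max[OF a(1,2)] M_iff[OF a(1)] .
    then show "y \<in> LB.loc_max"
      unfolding x(2) a(3) psi_fraction[OF a(1,2)]
      using LB.fraction_mem_loc_max[OF hom.hom_closed[OF a(1)] phi_T[OF a(2)]] by simp
  qed
  \<comment> \<open>Properness: M is mapped into N, so the images of the sequence generate an ideal
    inside the maximal ideal of the localization.\<close>
  have "ideal LB.loc_max LB.L" by (rule LB.ideal_loc_max)
  then have "Idl\<^bsub>LB.L\<^esub> (set (map \<psi> xs)) \<subseteq> LB.loc_max" using max' by (rule LB.L.genideal_minimal)
  moreover have "\<one>\<^bsub>LB.L\<^esub> \<notin> LB.loc_max"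
    unfolding LB.localization_one LB.fraction_mem_loc_max[OF hom.S.one_closed LB.one_compl] by simp
  ultimately have proper: "Idl\<^bsub>LB.L\<^esub> (set (map \<psi> xs)) \<noteq> carrier LB.L"
    using LB.L.one_closed by blast
  show "regular_sequence LB.L (map \<psi> xs)"
    unfolding regular_sequence_def
  proof (intro conjI allI impI ballI)
    show "set (map \<psi> xs) \<subseteq> carrier LB.L" using c by auto
    show "Idl\<^bsub>LB.L\<^esub> (set (map \<psi> xs)) \<noteq> carrier LB.L" by (rule proper)
    fix i z assume i: "i < length (map \<psi> xs)" and z: "z \<in> carrier LB.L"
      and h: "map \<psi> xs ! i \<otimes>\<^bsub>LB.L\<^esub> z \<in> Idl\<^bsub>LB.L\<^esub> (set (take i (map \<psi> xs)))"
    have eq: "Idl\<^bsub>LB.L\<^esub> (set (take i (map \<psi> xs))) = ext (Idl\<^bsub>LA.L\<^esub> (set (take i xs)))"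
      using genideal_psi[OF tk[of i]] by (simp add: take_map)
    have i': "i < length xs" "xs ! i \<in> carrier LA.L" using i c nth_mem by auto
    show "z \<in> Idl\<^bsub>LB.L\<^esub> (set (take i (map \<psi> xs)))"
      unfolding eq
    proof (rule ext_regular[OF LA.L.genideal_ideal[OF tk] i'(2) z reg[OF i'(1)]])
      show "\<psi> (xs ! i) \<otimes>\<^bsub>LB.L\<^esub> z \<in> ext (Idl\<^bsub>LA.L\<^esub> (set (take i xs)))"
        using h i'(1) unfolding eq by simp
    qed
  qed
qed

lemma depth_le: "depth LA.L LA.loc_max \<le> depth LB.L LB.loc_max"
  unfolding depth_def
proof (rule Sup_least)
  fix x assume "x \<in> {enat (length xs) | xs. regular_sequence LA.L xs \<and> set xs \<subseteq> LA.loc_max}"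
  then obtain xs where xs: "x = enat (length xs)" "regular_sequence LA.L xs" "set xs \<subseteq> LA.loc_max" by blast
  show "x \<le> Sup {enat (length xs) | xs. regular_sequence LB.L xs \<and> set xs \<subseteq> LB.loc_max}"
    unfolding xs(1) using regular_sequence_psi[OF xs(2,3)]
    by (intro Sup_upper CollectI exI[of _ "map \<psi> xs"]) simp
qed

text \<open>The chain dim B_N \<le> dim A_M = depth A_M \<le> depth B_N closes up, because depth
  never exceeds dimension.\<close>

lemma cohen_macaulay_local_transfer:
  assumes "cohen_macaulay_local LA.L"
  shows "cohen_macaulay_local LB.L"
proof -
  obtain m where m: "{J. maximalideal J LA.L} = {m}" "depth LA.L m = krull_dim LA.L"
    using assms unfolding cohen_macaulay_local_def by blast
  have "m = LA.loc_max" using m(1) LA.maximalideal_localization by blast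
  then have "krull_dim LB.L \<le> depth LB.L LB.loc_max"
    using krull_dim_le depth_le m(2) by simp
  then have "depth LB.L LB.loc_max = krull_dim LB.L"
    using depth_le_krull_dim[OF LB.cring_localization] by (intro antisym)
  then show ?thesis
    unfolding cohen_macaulay_local_def
    using LB.cring_localization LB.noetherian_localization[OF noetherian_B] LB.maximalideal_localization
    by blast
qed

end

theorem (in frobenius_extension) cohen_macaulay_transfer:
  assumes "cohen_macaulay A"
  shows "cohen_macaulay B"
  unfolding cohen_macaulay_def
proof (intro conjI allI impI)
  show "cring B" "noetherian_ring B" by (rule hom.S.is_cring, rule noetherian_B)
  fix N assume N: "maximalideal N B"
  interpret N: frobenius_prime A B \<phi> n u v \<pi> N
    by (intro frobenius_prime.intro frobenius_prime_axioms.intro frobenius_extension_axioms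
      hom.S.maximalideal_prime N)
  have "maximalideal N.M A" unfolding N.M_def by (rule contract_maximal[OF N])
  then show "cohen_macaulay_local (localization B N)"
    using assms by (intro N.cohen_macaulay_local_transfer) (simp add: cohen_macaulay_def)
qed

lemma hom_finsum:
  assumes "abelian_group G" "abelian_group H"
    and g: "\<And>x. x \<in> carrier G \<Longrightarrow> g x \<in> carrier H"
      "\<And>x y. x \<in> carrier G \<Longrightarrow> y \<in> carrier G \<Longrightarrow> g (x \<oplus>\<^bsub>G\<^esub> y) = g x \<oplus>\<^bsub>H\<^esub> g y"
    and f: "\<And>i::nat. i < n \<Longrightarrow> f i \<in> carrier G"
  shows "g (finsum G f {..<n}) = finsum H (\<lambda>i. g (f i)) {..<n}"
  using f
proof (induction n)
  case 0
  interpret G: abelian_group G by fact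
  interpret H: abelian_group H by fact
  have "g \<zero>\<^bsub>G\<^esub> \<oplus>\<^bsub>H\<^esub> g \<zero>\<^bsub>G\<^esub> = g \<zero>\<^bsub>G\<^esub>"
    using g(2)[of "\<zero>\<^bsub>G\<^esub>" "\<zero>\<^bsub>G\<^esub>"] by simp
  then have "g \<zero>\<^bsub>G\<^esub> = \<zero>\<^bsub>H\<^esub>" using g(1) by (simp add: H.add.r_cancel_one')
  then show ?case by simp
next
  case (Suc n)
  interpret G: abelian_group G by fact
  interpret H: abelian_group H by fact
  have "finsum G f (insert n {..<n}) = f n \<oplus>\<^bsub>G\<^esub> finsum G f {..<n}"
    using Suc.prems by (intro G.finsum_insert) auto
  moreover have "finsum H (\<lambda>i. g (f i)) (insert n {..<n}) = g (f n) \<oplus>\<^bsub>H\<^esub> finsum H (\<lambda>i. g (f i)) {..<n}"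
    using Suc.prems g by (intro H.finsum_insert) auto
  moreover have "finsum G f {..<n} \<in> carrier G"
    using Suc.prems by (intro G.finsum_closed) auto
  ultimately show ?case using Suc g(2) by (simp add: lessThan_Suc)
qed

section \<open>Restriction of scalars from a localization\<close>

definition res :: "'a ring \<Rightarrow> 'a set \<Rightarrow> (('a \<times> 'a) set, 'c) module \<Rightarrow> ('a, 'c) module"
  where "res R I E = \<lparr>carrier = carrier E, mult = mult E, one = one E, zero = zero E, add = add E,
    smult = (\<lambda>r x. fraction R I r \<one>\<^bsub>R\<^esub> \<odot>\<^bsub>E\<^esub> x)\<rparr>"

lemma res_simps [simp]:
  "carrier (res R I E) = carrier E" "\<zero>\<^bsub>res R I E\<^esub> = \<zero>\<^bsub>E\<^esub>"
  "x \<oplus>\<^bsub>res R I E\<^esub> y = x \<oplus>\<^bsub>E\<^esub> y" "r \<odot>\<^bsub>res R I E\<^esub> x = fraction R I r \<one>\<^bsub>R\<^esub> \<odot>\<^bsub>E\<^esub> x"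
  by (simp_all add: res_def)

context noetherian_prime
begin

lemma module_res:
  assumes "Module.module L E"
  shows "Module.module R (res R I E)"
proof -
  interpret E: Module.module L E by fact
  have "abelian_group (res R I E)"
  proof (rule abelian_groupI)
    fix x assume "x \<in> carrier (res R I E)"
    then show "\<exists>y\<in>carrier (res R I E). y \<oplus>\<^bsub>res R I E\<^esub> x = \<zero>\<^bsub>res R I E\<^esub>"
      by (intro bexI[of _ "\<ominus>\<^bsub>E\<^esub> x"]) (simp_all add: E.M.l_neg)
  qed (simp_all add: E.M.a_ac)
  then show ?thesis
    by (intro moduleI is_cring) (simp_all add: E.smult_l_distr E.smult_r_distr E.smult_assoc1)
qed

text \<open>A linear map f on an ideal J of R extends to the ideal of fractions with numerators in J
  by sending a/s to (1/s) f(a). Baer's condition over L is applied to this extension.\<close>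

lemma baer_res:
  assumes "baer L E"
  shows "baer R (res R I E)"
  unfolding baer_def
proof (rule conjI)
  have mod: "Module.module L E" using assms by (simp add: baer_def)
  interpret E: Module.module L E by (rule mod)
  show "Module.module R (res R I E)" by (rule module_res[OF mod])
  show "\<forall>J f. ideal J R \<and> f \<in> J \<rightarrow> carrier (res R I E) \<and>
    (\<forall>x\<in>J. \<forall>y\<in>J. f (x \<oplus>\<^bsub>R\<^esub> y) = f x \<oplus>\<^bsub>res R I E\<^esub> f y) \<and>
    (\<forall>r\<in>carrier R. \<forall>x\<in>J. f (r \<otimes>\<^bsub>R\<^esub> x) = r \<odot>\<^bsub>res R I E\<^esub> f x) \<longrightarrow>
    (\<exists>e\<in>carrier (res R I E). \<forall>x\<in>J. f x = x \<odot>\<^bsub>res R I E\<^esub> e)"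
  proof (intro allI impI, elim conjE, unfold res_simps)
    fix J f
    assume J: "ideal J R" and f: "f \<in> J \<rightarrow> carrier E"
      and add: "\<forall>x\<in>J. \<forall>y\<in>J. f (x \<oplus>\<^bsub>R\<^esub> y) = f x \<oplus>\<^bsub>E\<^esub> f y"
      and smult: "\<forall>r\<in>carrier R. \<forall>x\<in>J. f (r \<otimes>\<^bsub>R\<^esub> x) = fraction R I r \<one> \<odot>\<^bsub>E\<^esub> f x"
    interpret J: ideal J R by fact
    have fc: "f x \<in> carrier E" if "x \<in> J" for x using f that by auto
    \<comment> \<open>If w a t = w b s, then both sides equal 1/(w s t) times the value of f at this
      common element. No cancellation of w inside R is possible, but it is invertible on E.\<close>
    have wd: "fraction R I \<one> s \<odot>\<^bsub>E\<^esub> f a = fraction R I \<one> t \<odot>\<^bsub>E\<^esub> f b"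
      if ab: "a \<in> J" "b \<in> J" and st: "s \<in> T" "t \<in> T" and eq: "fraction R I a s = fraction R I b t"
      for a b s t
    proof -
      have ac: "a \<in> carrier R" "b \<in> carrier R" using ab by simp_all
      have sc: "s \<in> carrier R" "t \<in> carrier R" using st by simp_all
      obtain w where w: "w \<in> T" "w \<otimes> (a \<otimes> t) = w \<otimes> (b \<otimes> s)"
        using eq unfolding fraction_eq_iff[OF ac st] ..
      have wc: "w \<in> carrier R" using w by simp
      have T3: "w \<otimes> (s \<otimes> t) \<in> T" by (intro mult_compl w st)
      have 1: "fraction R I \<one> (w \<otimes> (s \<otimes> t)) \<odot>\<^bsub>E\<^esub> f ((w \<otimes> t) \<otimes> a) = fraction R I \<one> s \<odot>\<^bsub>E\<^esub> f a"
      proof -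
        have "fraction R I \<one> (w \<otimes> (s \<otimes> t)) \<odot>\<^bsub>E\<^esub> f ((w \<otimes> t) \<otimes> a) =
            (fraction R I \<one> (w \<otimes> (s \<otimes> t)) \<otimes>\<^bsub>L\<^esub> fraction R I (w \<otimes> t) \<one>) \<odot>\<^bsub>E\<^esub> f a"
          using smult ab(1) wc sc T3 fc[OF ab(1)] fraction_closed[OF one_closed T3]
            fraction_closed[OF m_closed[OF wc sc(2)] one_compl] by (simp only: m_closed E.smult_assoc1)
        also have "fraction R I \<one> (w \<otimes> (s \<otimes> t)) \<otimes>\<^bsub>L\<^esub> fraction R I (w \<otimes> t) \<one> =
            fraction R I ((w \<otimes> t) \<otimes> \<one>) ((w \<otimes> t) \<otimes> s)"
          using wc sc fraction_mult[OF one_closed m_closed[OF wc sc(2)] T3 one_compl] by (simp add: m_ac)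
        also have "\<dots> = fraction R I \<one> s" by (rule fraction_cancel[OF one_closed st(1) mult_compl[OF w(1) st(2)]])
        finally show ?thesis .
      qed
      have 2: "fraction R I \<one> (w \<otimes> (s \<otimes> t)) \<odot>\<^bsub>E\<^esub> f ((w \<otimes> s) \<otimes> b) = fraction R I \<one> t \<odot>\<^bsub>E\<^esub> f b"
      proof -
        have "fraction R I \<one> (w \<otimes> (s \<otimes> t)) \<odot>\<^bsub>E\<^esub> f ((w \<otimes> s) \<otimes> b) =
            (fraction R I \<one> (w \<otimes> (s \<otimes> t)) \<otimes>\<^bsub>L\<^esub> fraction R I (w \<otimes> s) \<one>) \<odot>\<^bsub>E\<^esub> f b"
          using smult ab(2) wc sc T3 fc[OF ab(2)] fraction_closed[OF one_closed T3]
            fraction_closed[OF m_closed[OF wc sc(1)] one_compl] by (simp only: m_closed E.smult_assoc1)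
        also have "fraction R I \<one> (w \<otimes> (s \<otimes> t)) \<otimes>\<^bsub>L\<^esub> fraction R I (w \<otimes> s) \<one> =
            fraction R I ((w \<otimes> s) \<otimes> \<one>) ((w \<otimes> s) \<otimes> t)"
          using wc sc fraction_mult[OF one_closed m_closed[OF wc sc(1)] T3 one_compl] by (simp add: m_ac)
        also have "\<dots> = fraction R I \<one> t" by (rule fraction_cancel[OF one_closed st(2) mult_compl[OF w(1) st(1)]])
        finally show ?thesis .
      qed
      have "(w \<otimes> t) \<otimes> a = (w \<otimes> s) \<otimes> b" using w(2) wc sc ac by (simp add: m_ac)
      then show ?thesis using 1 2 by simp
    qed
    define J' where "J' = {fraction R I a s | a s. a \<in> J \<and> s \<in> T}"
    have J'I: "fraction R I a s \<in> J'" if "a \<in> J" "s \<in> T" for a s using that unfolding J'_def by blast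
    have J'E: "\<exists>a s. a \<in> J \<and> a \<in> carrier R \<and> s \<in> T \<and> s \<in> carrier R \<and> x = fraction R I a s" if "x \<in> J'" for x
      using that J.Icarr unfolding J'_def by blast
    define g where "g x = (SOME y. \<exists>a s. a \<in> J \<and> s \<in> T \<and> x = fraction R I a s \<and> y = fraction R I \<one> s \<odot>\<^bsub>E\<^esub> f a)" for x
    have g: "g (fraction R I a s) = fraction R I \<one> s \<odot>\<^bsub>E\<^esub> f a" if as: "a \<in> J" "s \<in> T" for a s
    proof -
      let ?P = "\<lambda>y. \<exists>b t. b \<in> J \<and> t \<in> T \<and> fraction R I a s = fraction R I b t \<and> y = fraction R I \<one> t \<odot>\<^bsub>E\<^esub> f b"
      have "?P (fraction R I \<one> s \<odot>\<^bsub>E\<^esub> f a)" using as by blast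
      then have "?P (Eps ?P)" by (rule someI)
      then obtain b t where "b \<in> J" "t \<in> T" "fraction R I a s = fraction R I b t"
        "Eps ?P = fraction R I \<one> t \<odot>\<^bsub>E\<^esub> f b" by blast
      then show ?thesis using wd[OF as(1) _ as(2)] by (simp add: g_def)
    qed
    have mult: "fraction R I c r \<otimes>\<^bsub>L\<^esub> fraction R I a s = fraction R I (c \<otimes> a) (r \<otimes> s)"
      if "a \<in> carrier R" "s \<in> T" "c \<in> carrier R" "r \<in> T" for a s c r
      using that by (intro fraction_mult)
    have gm: "g (z \<otimes>\<^bsub>L\<^esub> x) = z \<odot>\<^bsub>E\<^esub> g x" "z \<otimes>\<^bsub>L\<^esub> x \<in> J'" if x: "x \<in> J'" and z: "z \<in> carrier L" for x z
    proof -
      obtain a s where a: "a \<in> J" "a \<in> carrier R" "s \<in> T" "s \<in> carrier R" "x = fraction R I a s"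
        using J'E[OF x] by blast
      obtain c r where c: "c \<in> carrier R" "r \<in> T" "z = fraction R I c r" using z by (rule fraction_cases)
      have eq: "z \<otimes>\<^bsub>L\<^esub> x = fraction R I (c \<otimes> a) (r \<otimes> s)"
        unfolding a(5) c(3) by (rule mult[OF a(2,3) c(1,2)])
      note rs = mult_compl[OF c(2) a(3)] and ca = J.I_l_closed[OF a(1) c(1)]
      show "z \<otimes>\<^bsub>L\<^esub> x \<in> J'" unfolding eq by (rule J'I[OF ca rs])
      have "g (z \<otimes>\<^bsub>L\<^esub> x) = fraction R I \<one> (r \<otimes> s) \<odot>\<^bsub>E\<^esub> (fraction R I c \<one> \<odot>\<^bsub>E\<^esub> f a)"
        unfolding eq g[OF ca rs] using smult c(1) a(1) by simp
      also have "\<dots> = (fraction R I \<one> (r \<otimes> s) \<otimes>\<^bsub>L\<^esub> fraction R I c \<one>) \<odot>\<^bsub>E\<^esub> f a"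
        using fraction_closed[OF one_closed rs] fraction_closed[OF c(1) one_compl] fc[OF a(1)]
        by (simp only: E.smult_assoc1)
      also have "fraction R I \<one> (r \<otimes> s) \<otimes>\<^bsub>L\<^esub> fraction R I c \<one> = z \<otimes>\<^bsub>L\<^esub> fraction R I \<one> s"
        unfolding c(3) mult[OF c(1) one_compl one_closed rs] mult[OF one_closed a(3) c(1,2)]
        using c(1,2) a(4) by simp
      also have "\<dots> \<odot>\<^bsub>E\<^esub> f a = z \<odot>\<^bsub>E\<^esub> g x"
        unfolding a(5) g[OF a(1,3)]
        using z fraction_closed[OF one_closed a(3)] fc[OF a(1)] by (simp only: E.smult_assoc1)
      finally show "g (z \<otimes>\<^bsub>L\<^esub> x) = z \<odot>\<^bsub>E\<^esub> g x" .
    qed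
    have ga: "g (x \<oplus>\<^bsub>L\<^esub> y) = g x \<oplus>\<^bsub>E\<^esub> g y" "x \<oplus>\<^bsub>L\<^esub> y \<in> J'" if x: "x \<in> J'" and y: "y \<in> J'" for x y
    proof -
      obtain a s where a: "a \<in> J" "a \<in> carrier R" "s \<in> T" "s \<in> carrier R" "x = fraction R I a s"
        using J'E[OF x] by blast
      obtain b t where b: "b \<in> J" "b \<in> carrier R" "t \<in> T" "t \<in> carrier R" "y = fraction R I b t"
        using J'E[OF y] by blast
      note st = mult_compl[OF a(3) b(3)]
      have mem: "a \<otimes> t \<in> J" "b \<otimes> s \<in> J" using a b J.I_r_closed by simp_all
      have x': "x = fraction R I (a \<otimes> t) (s \<otimes> t)"
        unfolding a(5) using fraction_cancel[OF a(2,3) b(3)] a b by (simp add: m_comm)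
      have y': "y = fraction R I (b \<otimes> s) (s \<otimes> t)"
        unfolding b(5) using fraction_cancel[OF b(2,3) a(3)] a b by (simp add: m_comm)
      have eq: "x \<oplus>\<^bsub>L\<^esub> y = fraction R I (a \<otimes> t \<oplus> b \<otimes> s) (s \<otimes> t)"
        unfolding a(5) b(5) by (rule fraction_add[OF a(2) b(2) a(3) b(3)])
      show "x \<oplus>\<^bsub>L\<^esub> y \<in> J'" unfolding eq by (rule J'I[OF J.a_closed[OF mem] st])
      show "g (x \<oplus>\<^bsub>L\<^esub> y) = g x \<oplus>\<^bsub>E\<^esub> g y"
        unfolding eq g[OF J.a_closed[OF mem] st] unfolding x' y' g[OF mem(1) st] g[OF mem(2) st]
        using add mem fc[OF mem(1)] fc[OF mem(2)] fraction_closed[OF one_closed st]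
        by (simp add: E.smult_r_distr)
    qed
    have "\<exists>e\<in>carrier E. \<forall>x\<in>J'. g x = x \<odot>\<^bsub>E\<^esub> e"
    proof (rule baerD[OF assms])
      show "ideal J' L"
      proof (rule L.cring_idealI)
        show "J' \<subseteq> carrier L" using J'E fraction_closed by blast
        show "\<zero>\<^bsub>L\<^esub> \<in> J'" unfolding localization_zero by (rule J'I[OF J.zero_closed one_compl])
      qed (use ga gm in blast)+
      show "g x \<in> carrier E" if "x \<in> J'" for x
      proof -
        obtain a s where a: "a \<in> J" "s \<in> T" "x = fraction R I a s" using J'E[OF \<open>x \<in> J'\<close>] by blast
        then show ?thesis using fc[OF a(1)] by (simp add: g)
      qed
    qed (use ga gm in blast)+
    then obtain e where e: "e \<in> carrier E" "\<forall>x\<in>J'. g x = x \<odot>\<^bsub>E\<^esub> e" ..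
    have "f x = fraction R I x \<one> \<odot>\<^bsub>E\<^esub> e" if x: "x \<in> J" for x
    proof -
      have "g (fraction R I x \<one>) = \<one>\<^bsub>L\<^esub> \<odot>\<^bsub>E\<^esub> f x"
        unfolding g[OF x one_compl] localization_one ..
      then show ?thesis using e(2) J'I[OF x one_compl] fc[OF x] by simp
    qed
    then show "\<exists>e\<in>carrier E. \<forall>x\<in>J. f x = fraction R I x \<one> \<odot>\<^bsub>E\<^esub> e" using e(1) by blast
  qed
qed

end

section \<open>Coinduced modules\<close>

context frobenius_extension
begin

text \<open>Hom_A(B, E), on which B acts by precomposition with multiplication. Restricting to
  extensional functions makes equality of homomorphisms the same as equality on B.\<close>

definition coind :: "('a, 'c) module \<Rightarrow> ('b, 'b \<Rightarrow> 'c) module"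
  where "coind E = \<lparr>carrier = {h \<in> extensional (carrier B). (\<forall>b\<in>carrier B. h b \<in> carrier E) \<and>
      (\<forall>b\<in>carrier B. \<forall>c\<in>carrier B. h (b \<oplus>\<^bsub>B\<^esub> c) = h b \<oplus>\<^bsub>E\<^esub> h c) \<and>
      (\<forall>a\<in>carrier A. \<forall>b\<in>carrier B. h (\<phi> a \<otimes>\<^bsub>B\<^esub> b) = a \<odot>\<^bsub>E\<^esub> h b)},
    mult = undefined, one = undefined, zero = (\<lambda>b\<in>carrier B. \<zero>\<^bsub>E\<^esub>),
    add = (\<lambda>h k. \<lambda>b\<in>carrier B. h b \<oplus>\<^bsub>E\<^esub> k b), smult = (\<lambda>c h. \<lambda>b\<in>carrier B. h (b \<otimes>\<^bsub>B\<^esub> c))\<rparr>"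

lemma coindI:
  assumes "\<And>b. b \<in> carrier B \<Longrightarrow> h b \<in> carrier E"
    "\<And>b c. b \<in> carrier B \<Longrightarrow> c \<in> carrier B \<Longrightarrow> h (b \<oplus>\<^bsub>B\<^esub> c) = h b \<oplus>\<^bsub>E\<^esub> h c"
    "\<And>a b. a \<in> carrier A \<Longrightarrow> b \<in> carrier B \<Longrightarrow> h (\<phi> a \<otimes>\<^bsub>B\<^esub> b) = a \<odot>\<^bsub>E\<^esub> h b"
  shows "restrict h (carrier B) \<in> carrier (coind E)"
  using assms by (simp add: coind_def)

lemma coindD:
  assumes "h \<in> carrier (coind E)"
  shows "b \<in> carrier B \<Longrightarrow> h b \<in> carrier E"
    "b \<in> carrier B \<Longrightarrow> c \<in> carrier B \<Longrightarrow> h (b \<oplus>\<^bsub>B\<^esub> c) = h b \<oplus>\<^bsub>E\<^esub> h c"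
    "a \<in> carrier A \<Longrightarrow> b \<in> carrier B \<Longrightarrow> h (\<phi> a \<otimes>\<^bsub>B\<^esub> b) = a \<odot>\<^bsub>E\<^esub> h b"
    "h \<in> extensional (carrier B)"
  using assms by (auto simp: coind_def)

lemma coind_eqI:
  assumes "h \<in> carrier (coind E)" "k \<in> carrier (coind E)" "\<And>b. b \<in> carrier B \<Longrightarrow> h b = k b"
  shows "h = k"
  using coindD(4)[OF assms(1)] coindD(4)[OF assms(2)] assms(3) by (rule extensionalityI)

lemma coind_simps:
  "\<zero>\<^bsub>coind E\<^esub> = (\<lambda>b\<in>carrier B. \<zero>\<^bsub>E\<^esub>)"
  "h \<oplus>\<^bsub>coind E\<^esub> k = (\<lambda>b\<in>carrier B. h b \<oplus>\<^bsub>E\<^esub> k b)"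
  "c \<odot>\<^bsub>coind E\<^esub> h = (\<lambda>b\<in>carrier B. h (b \<otimes>\<^bsub>B\<^esub> c))"
  by (simp_all add: coind_def)

lemma module_coind:
  assumes "Module.module A E"
  shows "Module.module B (coind E)"
proof -
  interpret E: Module.module A E by fact
  have add: "h \<oplus>\<^bsub>coind E\<^esub> k \<in> carrier (coind E)" if "h \<in> carrier (coind E)" "k \<in> carrier (coind E)" for h k
    unfolding coind_simps
    by (rule coindI) (use coindD[OF that(1)] coindD[OF that(2)] in \<open>simp_all add: E.M.a_ac E.smult_r_distr\<close>)
  have zero: "\<zero>\<^bsub>coind E\<^esub> \<in> carrier (coind E)"
    unfolding coind_simps by (rule coindI) simp_all
  have sm: "c \<odot>\<^bsub>coind E\<^esub> h \<in> carrier (coind E)" if "c \<in> carrier B" "h \<in> carrier (coind E)" for c h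
    unfolding coind_simps
    by (rule coindI) (use coindD[OF that(2)] that(1) in \<open>simp_all add: hom.S.l_distr hom.S.m_assoc\<close>)
  have neg: "(\<lambda>b\<in>carrier B. \<ominus>\<^bsub>E\<^esub> h b) \<in> carrier (coind E)" if "h \<in> carrier (coind E)" for h
    by (rule coindI)
      (use coindD[OF that] in \<open>simp_all add: E.M.minus_add E.smult_r_minus\<close>)
  show ?thesis
  proof (rule moduleI)
    show "cring B" by (rule hom.S.is_cring)
    show "abelian_group (coind E)"
    proof (rule abelian_groupI)
      fix h assume h: "h \<in> carrier (coind E)"
      show "\<zero>\<^bsub>coind E\<^esub> \<oplus>\<^bsub>coind E\<^esub> h = h"
        by (rule coind_eqI[OF add[OF zero h] h]) (use coindD[OF h] in \<open>simp add: coind_simps\<close>)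
      have "(\<lambda>b\<in>carrier B. \<ominus>\<^bsub>E\<^esub> h b) \<oplus>\<^bsub>coind E\<^esub> h = \<zero>\<^bsub>coind E\<^esub>"
        by (rule coind_eqI[OF add[OF neg[OF h] h] zero])
          (use coindD[OF h] in \<open>simp add: coind_simps E.M.l_neg\<close>)
      then show "\<exists>k\<in>carrier (coind E). k \<oplus>\<^bsub>coind E\<^esub> h = \<zero>\<^bsub>coind E\<^esub>"
        using neg[OF h] by blast
      fix k assume k: "k \<in> carrier (coind E)"
      show "h \<oplus>\<^bsub>coind E\<^esub> k = k \<oplus>\<^bsub>coind E\<^esub> h"
        by (rule coind_eqI[OF add[OF h k] add[OF k h]])
          (use coindD[OF h] coindD[OF k] in \<open>simp add: coind_simps E.M.a_comm\<close>)
      fix l assume l: "l \<in> carrier (coind E)"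
      show "h \<oplus>\<^bsub>coind E\<^esub> k \<oplus>\<^bsub>coind E\<^esub> l = h \<oplus>\<^bsub>coind E\<^esub> (k \<oplus>\<^bsub>coind E\<^esub> l)"
        by (rule coind_eqI[OF add[OF add[OF h k] l] add[OF h add[OF k l]]])
          (use coindD[OF h] coindD[OF k] coindD[OF l] in \<open>simp add: coind_simps E.M.a_assoc\<close>)
    qed (use add zero in simp_all)
  next
    fix c h assume c: "c \<in> carrier B" and h: "h \<in> carrier (coind E)"
    show "c \<odot>\<^bsub>coind E\<^esub> h \<in> carrier (coind E)" by (rule sm[OF c h])
    show "c \<odot>\<^bsub>coind E\<^esub> (h \<oplus>\<^bsub>coind E\<^esub> k) = c \<odot>\<^bsub>coind E\<^esub> h \<oplus>\<^bsub>coind E\<^esub> c \<odot>\<^bsub>coind E\<^esub> k"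
      if k: "k \<in> carrier (coind E)" for k
      using c by (auto simp: coind_simps)
    fix d assume d: "d \<in> carrier B"
    show "(c \<oplus>\<^bsub>B\<^esub> d) \<odot>\<^bsub>coind E\<^esub> h = c \<odot>\<^bsub>coind E\<^esub> h \<oplus>\<^bsub>coind E\<^esub> d \<odot>\<^bsub>coind E\<^esub> h"
      using c d coindD(2)[OF h] by (auto simp: coind_simps hom.S.r_distr)
    show "(c \<otimes>\<^bsub>B\<^esub> d) \<odot>\<^bsub>coind E\<^esub> h = c \<odot>\<^bsub>coind E\<^esub> (d \<odot>\<^bsub>coind E\<^esub> h)"
      using c d by (auto simp: coind_simps hom.S.m_assoc)
  next
    fix h assume h: "h \<in> carrier (coind E)"
    show "\<one>\<^bsub>B\<^esub> \<odot>\<^bsub>coind E\<^esub> h = h"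
      using coindD(4)[OF h] by (auto simp: coind_simps extensional_def)
  qed
qed

text \<open>\<open>Hom\<^sub>B(X, Hom\<^sub>A(B, E)) = Hom\<^sub>A(X, E)\<close>, so \<open>Hom\<^sub>A(B, -)\<close> preserves injectives.\<close>

lemma baer_coind:
  assumes "baer A E"
  shows "baer B (coind E)"
  unfolding baer_def
proof (rule conjI)
  have mod: "Module.module A E" using assms by (simp add: baer_def)
  interpret E: Module.module A E by (rule mod)
  show "Module.module B (coind E)" by (rule module_coind[OF mod])
  show "\<forall>J f. ideal J B \<and> f \<in> J \<rightarrow> carrier (coind E) \<and>
    (\<forall>x\<in>J. \<forall>y\<in>J. f (x \<oplus>\<^bsub>B\<^esub> y) = f x \<oplus>\<^bsub>coind E\<^esub> f y) \<and>
    (\<forall>r\<in>carrier B. \<forall>x\<in>J. f (r \<otimes>\<^bsub>B\<^esub> x) = r \<odot>\<^bsub>coind E\<^esub> f x) \<longrightarrow>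
    (\<exists>e\<in>carrier (coind E). \<forall>x\<in>J. f x = x \<odot>\<^bsub>coind E\<^esub> e)"
  proof (intro allI impI, elim conjE)
    fix J f
    assume J: "ideal J B" and f: "f \<in> J \<rightarrow> carrier (coind E)"
      and add: "\<forall>x\<in>J. \<forall>y\<in>J. f (x \<oplus>\<^bsub>B\<^esub> y) = f x \<oplus>\<^bsub>coind E\<^esub> f y"
      and smult: "\<forall>r\<in>carrier B. \<forall>x\<in>J. f (r \<otimes>\<^bsub>B\<^esub> x) = r \<odot>\<^bsub>coind E\<^esub> f x"
    interpret J: ideal J B by fact
    have fc: "f x \<in> carrier (coind E)" if "x \<in> J" for x using f that by auto
    define BA :: "('a, 'b) module" where "BA = \<lparr>carrier = carrier B, mult = mult B, one = one B,
      zero = zero B, add = add B, smult = (\<lambda>a b. \<phi> a \<otimes>\<^bsub>B\<^esub> b)\<rparr>"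
    have BA_simps: "carrier BA = carrier B" "\<zero>\<^bsub>BA\<^esub> = \<zero>\<^bsub>B\<^esub>"
      "x \<oplus>\<^bsub>BA\<^esub> y = x \<oplus>\<^bsub>B\<^esub> y" "a \<odot>\<^bsub>BA\<^esub> x = \<phi> a \<otimes>\<^bsub>B\<^esub> x" for x y a
      by (simp_all add: BA_def)
    have "abelian_group BA"
    proof (rule abelian_groupI)
      fix x assume "x \<in> carrier BA"
      then show "\<exists>y\<in>carrier BA. y \<oplus>\<^bsub>BA\<^esub> x = \<zero>\<^bsub>BA\<^esub>"
        by (intro bexI[of _ "\<ominus>\<^bsub>B\<^esub> x"]) (simp_all add: BA_simps hom.S.l_neg)
    qed (simp_all add: BA_simps hom.S.a_ac)
    then have modBA: "Module.module A BA"
      by (intro moduleI hom.R.is_cring)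
        (simp_all add: BA_simps hom.S.l_distr hom.S.r_distr hom.S.m_assoc)
    have "\<exists>g\<in>module_hom A BA E. \<forall>x\<in>J. g x = f x \<one>\<^bsub>B\<^esub>"
    proof (rule baer_extend[OF assms modBA])
      show "J \<subseteq> carrier BA" by (auto simp: BA_simps)
      show "\<zero>\<^bsub>BA\<^esub> \<in> J" by (simp add: BA_simps)
      show "f x \<one>\<^bsub>B\<^esub> \<in> carrier E" if "x \<in> J" for x
        by (rule coindD(1)[OF fc[OF that] hom.S.one_closed])
      show "x \<oplus>\<^bsub>BA\<^esub> y \<in> J" if "x \<in> J" "y \<in> J" for x y using that by (simp add: BA_simps)
      show "f (x \<oplus>\<^bsub>BA\<^esub> y) \<one>\<^bsub>B\<^esub> = f x \<one>\<^bsub>B\<^esub> \<oplus>\<^bsub>E\<^esub> f y \<one>\<^bsub>B\<^esub>" if "x \<in> J" "y \<in> J" for x y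
        using add that by (simp add: BA_simps coind_simps)
      fix a x assume a: "a \<in> carrier A" and x: "x \<in> J"
      show "a \<odot>\<^bsub>BA\<^esub> x \<in> J" using J.I_l_closed[OF x hom.hom_closed[OF a]] by (simp add: BA_simps)
      show "f (a \<odot>\<^bsub>BA\<^esub> x) \<one>\<^bsub>B\<^esub> = a \<odot>\<^bsub>E\<^esub> f x \<one>\<^bsub>B\<^esub>"
        using smult a x coindD(3)[OF fc[OF x] a hom.S.one_closed] by (simp add: BA_simps coind_simps)
    qed
    then obtain g where g: "g \<in> module_hom A BA E" "\<forall>x\<in>J. g x = f x \<one>\<^bsub>B\<^esub>" ..
    note gD = module_homD[OF g(1), unfolded BA_simps]
    have e: "restrict g (carrier B) \<in> carrier (coind E)" by (rule coindI) (rule gD; assumption)+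
    have "f x = x \<odot>\<^bsub>coind E\<^esub> restrict g (carrier B)" if x: "x \<in> J" for x
    proof (rule coind_eqI[OF fc[OF x]])
      have xc: "x \<in> carrier B" using x by simp
      show "x \<odot>\<^bsub>coind E\<^esub> restrict g (carrier B) \<in> carrier (coind E)"
        using Module.module.smult_closed[OF module_coind[OF mod] xc e] .
      fix b assume b: "b \<in> carrier B"
      have "f x b = f (b \<otimes>\<^bsub>B\<^esub> x) \<one>\<^bsub>B\<^esub>" using smult b x by (simp add: coind_simps)
      also have "\<dots> = g (b \<otimes>\<^bsub>B\<^esub> x)" using g(2) J.I_l_closed[OF x b] by simp
      finally show "f x b = (x \<odot>\<^bsub>coind E\<^esub> restrict g (carrier B)) b"
        using b xc by (simp add: coind_simps)
    qed
    then show "\<exists>e\<in>carrier (coind E). \<forall>x\<in>J. f x = x \<odot>\<^bsub>coind E\<^esub> e" using e by blast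
  qed
qed

lemma coind_expand:
  assumes E: "Module.module A E" and h: "h \<in> carrier (coind E)" and b: "b \<in> carrier B"
  shows "h b = finsum E (\<lambda>i. \<pi> (b \<otimes>\<^bsub>B\<^esub> v i) \<odot>\<^bsub>E\<^esub> h (u i)) {..<n}"
proof -
  interpret E: Module.module A E by fact
  have C: "\<pi> (b \<otimes>\<^bsub>B\<^esub> v i) \<in> carrier A" if "i < n" for i using b v_closed[OF that] by simp
  have "h b = h (finsum B (\<lambda>i. \<phi> (\<pi> (b \<otimes>\<^bsub>B\<^esub> v i)) \<otimes>\<^bsub>B\<^esub> u i) {..<n})"
    using decomp[OF b] by simp
  also have "\<dots> = finsum E (\<lambda>i. h (\<phi> (\<pi> (b \<otimes>\<^bsub>B\<^esub> v i)) \<otimes>\<^bsub>B\<^esub> u i)) {..<n}"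
    by (rule hom_finsum[OF hom.S.abelian_group_axioms E.M.abelian_group_axioms])
      (use coindD[OF h] C u_closed in simp_all)
  also have "\<dots> = finsum E (\<lambda>i. \<pi> (b \<otimes>\<^bsub>B\<^esub> v i) \<odot>\<^bsub>E\<^esub> h (u i)) {..<n}"
    by (rule E.M.finsum_cong') (use coindD[OF h] C u_closed in auto)
  finally show ?thesis .
qed

text \<open>Expanding b by the dual families shows that h is determined by its values at the u i
  with i < n. Later this is what allows coinduced modules to be encoded in the prescribed carrier
  type.\<close>

lemma coind_eq_on_u:
  assumes E: "Module.module A E" and h: "h \<in> carrier (coind E)" and k: "k \<in> carrier (coind E)"
    and eq: "\<And>i. i < n \<Longrightarrow> h (u i) = k (u i)"
  shows "h = k"
proof (rule coind_eqI[OF h k])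
  interpret E: Module.module A E by fact
  fix b assume b: "b \<in> carrier B"
  have "finsum E (\<lambda>i. \<pi> (b \<otimes>\<^bsub>B\<^esub> v i) \<odot>\<^bsub>E\<^esub> h (u i)) {..<n} =
      finsum E (\<lambda>i. \<pi> (b \<otimes>\<^bsub>B\<^esub> v i) \<odot>\<^bsub>E\<^esub> k (u i)) {..<n}"
    by (rule E.M.finsum_cong') (use eq coindD[OF k] u_closed v_closed b in auto)
  then show "h b = k b" using coind_expand[OF E h b] coind_expand[OF E k b] by simp
qed

definition coind_map :: "('c \<Rightarrow> 'd) \<Rightarrow> ('b \<Rightarrow> 'c) \<Rightarrow> ('b \<Rightarrow> 'd)"
  where "coind_map d h = (\<lambda>b\<in>carrier B. d (h b))"

lemma coind_map_hom:
  assumes d: "d \<in> module_hom A E E'"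
  shows "coind_map d \<in> module_hom B (coind E) (coind E')"
proof (rule module_homI)
  note dD = module_homD[OF d]
  fix h assume h: "h \<in> carrier (coind E)"
  show "coind_map d h \<in> carrier (coind E')"
    unfolding coind_map_def by (rule coindI) (use coindD[OF h] dD in simp_all)
  show "coind_map d (c \<odot>\<^bsub>coind E\<^esub> h) = c \<odot>\<^bsub>coind E'\<^esub> coind_map d h" if "c \<in> carrier B" for c
    using that by (auto simp: coind_map_def coind_simps)
  fix k assume k: "k \<in> carrier (coind E)"
  show "coind_map d (h \<oplus>\<^bsub>coind E\<^esub> k) = coind_map d h \<oplus>\<^bsub>coind E'\<^esub> coind_map d k"
    using coindD(1)[OF h] coindD(1)[OF k] dD(2) by (auto simp: coind_map_def coind_simps)
qed

text \<open>Hom_A(B, -) is exact because B is a finitely generated projective A-module, the families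
  u and v forming a dual basis. A homomorphism into the kernel is lifted by lifting its values at
  the u i.\<close>

lemma coind_exact:
  assumes E: "Module.module A E" and E': "Module.module A E'"
    and d: "d \<in> module_hom A E E'"
    and ex: "\<And>y. y \<in> carrier E' \<Longrightarrow> d' y = \<zero>\<^bsub>E''\<^esub> \<longleftrightarrow> y \<in> d ` carrier E"
    and h: "h \<in> carrier (coind E')"
  shows "coind_map d' h = \<zero>\<^bsub>coind E''\<^esub> \<longleftrightarrow> h \<in> coind_map d ` carrier (coind E)"
proof
  interpret E: Module.module A E by fact
  interpret E': Module.module A E' by fact
  note dD = module_homD[OF d]
  assume z: "coind_map d' h = \<zero>\<^bsub>coind E''\<^esub>"
  have "d' (h b) = \<zero>\<^bsub>E''\<^esub>" if "b \<in> carrier B" for b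
    using fun_cong[OF z, of b] that by (simp add: coind_map_def coind_simps)
  then have "\<exists>e\<in>carrier E. h (u i) = d e" if "i < n" for i
    using ex[OF coindD(1)[OF h u_closed[OF that]]] u_closed[OF that] by blast
  then obtain e where e: "\<And>i. i < n \<Longrightarrow> e i \<in> carrier E" "\<And>i. i < n \<Longrightarrow> h (u i) = d (e i)" by metis
  \<comment> \<open>The homomorphism with coordinates e i. Its value at u i is not claimed to be e
    i; it suffices that d (k b) is the expansion of h b.\<close>
  define k where "k b = finsum E (\<lambda>i. \<pi> (b \<otimes>\<^bsub>B\<^esub> v i) \<odot>\<^bsub>E\<^esub> e i) {..<n}" for b
  have C: "\<pi> (b \<otimes>\<^bsub>B\<^esub> v i) \<in> carrier A" if "i < n" "b \<in> carrier B" for i b using that v_closed by simp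
  have t: "(\<lambda>i. \<pi> (b \<otimes>\<^bsub>B\<^esub> v i) \<odot>\<^bsub>E\<^esub> e i) \<in> {..<n} \<rightarrow> carrier E" if "b \<in> carrier B" for b
    using C e(1) that by auto
  have k: "restrict k (carrier B) \<in> carrier (coind E)"
  proof (rule coindI)
    show "k b \<in> carrier E" if "b \<in> carrier B" for b
      unfolding k_def by (rule E.M.finsum_closed[OF t[OF that]])
    show "k (b \<oplus>\<^bsub>B\<^esub> c) = k b \<oplus>\<^bsub>E\<^esub> k c" if bc: "b \<in> carrier B" "c \<in> carrier B" for b c
    proof -
      have "k (b \<oplus>\<^bsub>B\<^esub> c) = finsum E (\<lambda>i. \<pi> (b \<otimes>\<^bsub>B\<^esub> v i) \<odot>\<^bsub>E\<^esub> e i \<oplus>\<^bsub>E\<^esub> \<pi> (c \<otimes>\<^bsub>B\<^esub> v i) \<odot>\<^bsub>E\<^esub> e i) {..<n}"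
        unfolding k_def
        by (rule E.M.finsum_cong')
          (use bc C e(1) v_closed in \<open>auto simp: hom.S.l_distr pi_add E.smult_l_distr\<close>)
      then show ?thesis unfolding k_def using E.M.finsum_addf[OF t[OF bc(1)] t[OF bc(2)]] by simp
    qed
    show "k (\<phi> a \<otimes>\<^bsub>B\<^esub> b) = a \<odot>\<^bsub>E\<^esub> k b" if ab: "a \<in> carrier A" "b \<in> carrier B" for a b
    proof -
      have "k (\<phi> a \<otimes>\<^bsub>B\<^esub> b) = finsum E (\<lambda>i. a \<odot>\<^bsub>E\<^esub> (\<pi> (b \<otimes>\<^bsub>B\<^esub> v i) \<odot>\<^bsub>E\<^esub> e i)) {..<n}"
        unfolding k_def
        by (rule E.M.finsum_cong')
          (use ab C e(1) v_closed in \<open>auto simp: hom.S.m_assoc pi_mult E.smult_assoc1\<close>)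
      then show ?thesis unfolding k_def using E.finsum_smult_ldistr[OF _ ab(1) t[OF ab(2)]] by simp
    qed
  qed
  have "h = coind_map d (restrict k (carrier B))"
  proof (rule coind_eqI[OF h module_homD(1)[OF coind_map_hom[OF d] k]])
    fix b assume b: "b \<in> carrier B"
    have "d (k b) = finsum E' (\<lambda>i. d (\<pi> (b \<otimes>\<^bsub>B\<^esub> v i) \<odot>\<^bsub>E\<^esub> e i)) {..<n}"
      unfolding k_def
      by (rule hom_finsum[OF E.M.abelian_group_axioms E'.M.abelian_group_axioms]) (use dD C e(1) b in simp_all)
    also have "\<dots> = finsum E' (\<lambda>i. \<pi> (b \<otimes>\<^bsub>B\<^esub> v i) \<odot>\<^bsub>E'\<^esub> h (u i)) {..<n}"
      by (rule E'.M.finsum_cong') (use dD C e b in auto)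
    also have "\<dots> = h b" by (rule coind_expand[OF E' h b, symmetric])
    finally show "h b = coind_map d (restrict k (carrier B)) b"
      using b by (simp add: coind_map_def)
  qed
  then show "h \<in> coind_map d ` carrier (coind E)" using k by blast
next
  assume "h \<in> coind_map d ` carrier (coind E)"
  then obtain k where k: "k \<in> carrier (coind E)" "h = coind_map d k" by blast
  have "d' (d (k b)) = \<zero>\<^bsub>E''\<^esub>" if "b \<in> carrier B" for b
    using ex[of "d (k b)"] coindD(1)[OF k(1) that] module_homD(1)[OF d] by simp
  then show "coind_map d' h = \<zero>\<^bsub>coind E''\<^esub>"
    unfolding k(2) by (auto simp: coind_map_def coind_simps)
qed

end

section \<open>Common annihilators and common denominators for finite families\<close>

context noetherian_prime
begin

lemma common_annihilator:
  assumes "\<And>i::nat. i < n \<Longrightarrow> x i \<in> carrier R" "\<And>i. i < n \<Longrightarrow> \<exists>t\<in>T. t \<otimes> x i = \<zero>"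
  shows "\<exists>t\<in>T. \<forall>i<n. t \<otimes> x i = \<zero>"
  using assms
proof (induction n)
  case 0
  then show ?case using one_compl by blast
next
  case (Suc n)
  then obtain s where s: "s \<in> T" "\<forall>i<n. s \<otimes> x i = \<zero>" by auto
  obtain t where t: "t \<in> T" "t \<otimes> x n = \<zero>" using Suc.prems(2) by blast
  have sc: "s \<in> carrier R" "t \<in> carrier R" using s t by simp_all
  have "(s \<otimes> t) \<otimes> x i = \<zero>" if "i < Suc n" for i
  proof (cases "i = n")
    case True
    then show ?thesis using sc t(2) Suc.prems(1) by (simp add: m_assoc)
  next
    case False
    then have i: "i < n" using that by simp
    have "(s \<otimes> t) \<otimes> x i = t \<otimes> (s \<otimes> x i)" using sc Suc.prems(1)[OF that] by (simp add: m_ac)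
    then show ?thesis using s(2) i sc by simp
  qed
  then show ?case using mult_compl[OF s(1) t(1)] by blast
qed

lemma common_denominator:
  assumes "\<And>i::nat. i < n \<Longrightarrow> X i \<in> carrier L"
  shows "\<exists>t\<in>T. \<forall>i<n. \<exists>c\<in>carrier R. fraction R I t \<one> \<otimes>\<^bsub>L\<^esub> X i = fraction R I c \<one>"
  using assms
proof (induction n)
  case 0
  then show ?case using one_compl by blast
next
  case (Suc n)
  then obtain s where s: "s \<in> T" "\<forall>i<n. \<exists>c\<in>carrier R. fraction R I s \<one> \<otimes>\<^bsub>L\<^esub> X i = fraction R I c \<one>"
    by auto
  obtain a t where t: "a \<in> carrier R" "t \<in> T" "X n = fraction R I a t"
    using Suc.prems[of n] fraction_cases by blast
  have sc: "s \<in> carrier R" "t \<in> carrier R" using s t by simp_all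
  note st = mult_compl[OF s(1) t(2)]
  have "\<exists>c\<in>carrier R. fraction R I (s \<otimes> t) \<one> \<otimes>\<^bsub>L\<^esub> X i = fraction R I c \<one>" if i: "i < Suc n" for i
  proof (cases "i = n")
    case True
    have "fraction R I (s \<otimes> t) \<one> \<otimes>\<^bsub>L\<^esub> X n = fraction R I (t \<otimes> (s \<otimes> a)) (t \<otimes> \<one>)"
      unfolding t(3) using fraction_mult[OF m_closed[OF sc] t(1) one_compl t(2)] sc t(1) by (simp add: m_ac)
    also have "\<dots> = fraction R I (s \<otimes> a) \<one>"
      using sc t(1) by (intro fraction_cancel one_compl t) simp_all
    finally show ?thesis using True sc t(1) by blast
  next
    case False
    then have "i < n" using i by simp
    then obtain c where c: "c \<in> carrier R" "fraction R I s \<one> \<otimes>\<^bsub>L\<^esub> X i = fraction R I c \<one>" using s(2) by blast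
    have "fraction R I (s \<otimes> t) \<one> \<otimes>\<^bsub>L\<^esub> X i = fraction R I t \<one> \<otimes>\<^bsub>L\<^esub> (fraction R I s \<one> \<otimes>\<^bsub>L\<^esub> X i)"
      using sc Suc.prems[OF i] by (simp add: L.m_ac)
    also have "\<dots> = fraction R I (t \<otimes> c) \<one>" unfolding c(2) using sc c(1) by simp
    finally show ?thesis using sc c(1) by blast
  qed
  then show ?case using st by blast
qed

end

text \<open>A resolution E of A_M is restricted to A, coinduced to B and localized at N; each step
  preserves Baer's condition and exactness. The new augmentation comes from the isomorphism of B
  with Hom_A(B, A), which is needed only up to torsion outside N. A and B share an element type, so
  both localizations do too, and the prescribed carrier types agree.\<close>

lemma finite_injective_dim_transfer:
  fixes A B :: "'a ring"
  assumes "frobenius_prime A B \<phi> n u v \<pi> N"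
    and fid: "finite_injective_dim (localization A (frobenius_prime.M A \<phi> N))
      (self_module (localization A (frobenius_prime.M A \<phi> N)))"
  shows "finite_injective_dim (localization B N) (self_module (localization B N))"
proof -
  interpret P: frobenius_prime A B \<phi> n u v \<pi> N by fact
  obtain E :: "nat \<Rightarrow> (('a \<times> 'a) set, nat \<Rightarrow> ('a \<times> 'a) set) module" and \<epsilon> d r where all:
    "(\<forall>i. injective_module P.LA.L (E i)) \<and>
      \<epsilon> \<in> module_hom P.LA.L (self_module P.LA.L) (E 0) \<and> inj_on \<epsilon> (carrier (self_module P.LA.L)) \<and>
      (\<forall>i. d i \<in> module_hom P.LA.L (E i) (E (Suc i))) \<and>
      \<epsilon> ` carrier (self_module P.LA.L) = a_kernel (E 0) (E 1) (d 0) \<and>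
      (\<forall>i. d i ` carrier (E i) = a_kernel (E (Suc i)) (E (Suc (Suc i))) (d (Suc i))) \<and>
      (\<forall>i>r. carrier (E i) = {\<zero>\<^bsub>E i\<^esub>})"
    using fid unfolding finite_injective_dim_def by (elim exE) (rule that)
  have E: "\<And>i. injective_module P.LA.L (E i)"
    and eps: "\<epsilon> \<in> module_hom P.LA.L (self_module P.LA.L) (E 0)" "inj_on \<epsilon> (carrier (self_module P.LA.L))"
    and d: "\<And>i. d i \<in> module_hom P.LA.L (E i) (E (Suc i))"
    and ex0: "\<epsilon> ` carrier (self_module P.LA.L) = a_kernel (E 0) (E 1) (d 0)"
    and ex: "\<And>i. d i ` carrier (E i) = a_kernel (E (Suc i)) (E (Suc (Suc i))) (d (Suc i))"
    and bound: "\<And>i. i > r \<Longrightarrow> carrier (E i) = {\<zero>\<^bsub>E i\<^esub>}"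
    using all by (elim conjE, simp only:)+
  have carr: "carrier (self_module P.LA.L) = carrier P.LA.L" by (simp add: self_module_def)
  \<comment> \<open>The ring embeds into the carrier type of the resolution by constant functions,
    which is what makes the test for injectivity strong enough.\<close>
  have bE: "baer P.LA.L (E i)" for i
    by (rule injective_moduleD[OF E, of "\<lambda>x _. x"]) (simp add: inj_on_def fun_eq_iff)
  have mE: "Module.module P.LA.L (E i)" for i using bE by (simp add: baer_def)
  have mS: "Module.module P.LA.L (self_module P.LA.L)"
    unfolding self_module_eq by (rule module_ideal_module[OF P.LA.L.is_cring P.LA.L.oneideal])
  define E' where "E' i = res A P.M (E i)" for i
  define C where "C i = P.coind (E' i)" for i
  define D where "D i = P.coind_map (d i)" for i
  have bE': "baer A (E' i)" for i unfolding E'_def by (rule P.LA.baer_res[OF bE])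
  have mE': "Module.module A (E' i)" for i using bE' by (simp add: baer_def)
  have bC: "baer B (C i)" for i unfolding C_def by (rule P.baer_coind[OF bE'])
  have d': "d i \<in> module_hom A (E' i) (E' (Suc i))" for i
    unfolding E'_def using module_homD[OF d[of i]] by (intro module_homI) simp_all
  have D: "D i \<in> module_hom B (C i) (C (Suc i))" for i
    unfolding D_def C_def by (rule P.coind_map_hom[OF d'])
  have lm: "localized_module N B (C i)" for i
    using P.LB.noetherian_prime_axioms bC[of i]
    by (simp add: localized_module_def localized_module_axioms_def baer_def)
  have lh: "localized_hom N B (C i) (C (Suc i)) (D i)" for i
    using lm D by (simp add: localized_hom_def localized_hom_axioms_def)
  define F where "F i = localized_module.F N B (C i)" for i
  define dl where "dl i = localized_hom.dl N B (C (Suc i)) (D i)" for i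
  have exE: "d (Suc i) y = \<zero>\<^bsub>E' (Suc (Suc i))\<^esub> \<longleftrightarrow> y \<in> d i ` carrier (E' i)" if "y \<in> carrier (E' (Suc i))" for i y
    using that ex[of i] unfolding a_kernel_eq E'_def by auto
  have exC: "D (Suc i) y = \<zero>\<^bsub>C (Suc (Suc i))\<^esub> \<longleftrightarrow> y \<in> D i ` carrier (C i)" if "y \<in> carrier (C (Suc i))" for i y
    using that unfolding C_def D_def by (intro P.coind_exact[OF mE' mE' d' exE])
  have exE0: "d 0 y = \<zero>\<^bsub>E 1\<^esub> \<longleftrightarrow> y \<in> \<epsilon> ` carrier P.LA.L" if "y \<in> carrier (E 0)" for y
    using that ex0 unfolding a_kernel_eq carr by auto
  note epsD = module_homD[OF eps(1), unfolded carr]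
  have eps_add: "\<epsilon> (X \<oplus>\<^bsub>P.LA.L\<^esub> Y) = \<epsilon> X \<oplus>\<^bsub>E 0\<^esub> \<epsilon> Y" if "X \<in> carrier P.LA.L" "Y \<in> carrier P.LA.L" for X Y
    using epsD(2)[OF that] by (simp add: self_module_def)
  have eps_smult: "\<epsilon> (Z \<otimes>\<^bsub>P.LA.L\<^esub> X) = Z \<odot>\<^bsub>E 0\<^esub> \<epsilon> X" if "Z \<in> carrier P.LA.L" "X \<in> carrier P.LA.L" for X Z
    using epsD(3)[OF that] by (simp add: self_module_def)
  have eps_zero: "\<epsilon> \<zero>\<^bsub>P.LA.L\<^esub> = \<zero>\<^bsub>E 0\<^esub>"
    using module_hom_zero[OF eps(1) mS mE] by (simp add: self_module_def)
  define \<eta> where "\<eta> a = \<epsilon> (fraction A P.M a \<one>\<^bsub>A\<^esub>)" for a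
  have eta: "\<eta> a \<in> carrier (E' 0)" if "a \<in> carrier A" for a
    unfolding \<eta>_def E'_def using that epsD(1) by simp
  have eta_add: "\<eta> (a \<oplus>\<^bsub>A\<^esub> b) = \<eta> a \<oplus>\<^bsub>E' 0\<^esub> \<eta> b" if "a \<in> carrier A" "b \<in> carrier A" for a b
    unfolding \<eta>_def E'_def using that eps_add by simp
  have eta_smult: "\<eta> (a \<otimes>\<^bsub>A\<^esub> b) = a \<odot>\<^bsub>E' 0\<^esub> \<eta> b" if "a \<in> carrier A" "b \<in> carrier A" for a b
    unfolding \<eta>_def E'_def using that eps_smult by simp
  have eta_zero: "\<exists>t\<in>P.LA.T. t \<otimes>\<^bsub>A\<^esub> a = \<zero>\<^bsub>A\<^esub>" if a: "a \<in> carrier A" and z: "\<eta> a = \<zero>\<^bsub>E' 0\<^esub>" for a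
  proof -
    have "\<epsilon> (fraction A P.M a \<one>\<^bsub>A\<^esub>) = \<epsilon> \<zero>\<^bsub>P.LA.L\<^esub>"
      using z unfolding \<eta>_def E'_def eps_zero by simp
    then have "fraction A P.M a \<one>\<^bsub>A\<^esub> = \<zero>\<^bsub>P.LA.L\<^esub>"
      using inj_onD[OF eps(2)] a unfolding carr by simp
    then show ?thesis unfolding P.LA.fraction_eq_zero_iff[OF a P.LA.one_compl] .
  qed
  \<comment> \<open>The functional \<open>\<pi>\<close> followed by the map from A through A_M to E
    0. It corresponds to 1 under the isomorphism of B with Hom_A(B, A), and x times it is the
    functional sending b to the image of \<open>\<pi> (b \<otimes> x)\<close>.\<close>
  define e1 where "e1 = restrict (\<lambda>b. \<eta> (\<pi> b)) (carrier B)"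
  have e1: "e1 \<in> carrier (C 0)"
    unfolding e1_def C_def by (rule P.coindI) (simp_all add: eta eta_add eta_smult P.pi_add P.pi_mult)
  have re1: "(x \<odot>\<^bsub>C 0\<^esub> e1) b = \<eta> (\<pi> (b \<otimes>\<^bsub>B\<^esub> x))" if "x \<in> carrier B" "b \<in> carrier B" for x b
    unfolding C_def e1_def P.coind_simps using that by simp
  \<comment> \<open>If x annihilates e1, then each coordinate \<open>\<pi> (x \<otimes> v i)\<close>
    dies in A_M. One t outside M kills all of them, and the expansion of
    \<open>\<phi> t \<otimes> x\<close> is then zero.\<close>
  have aug_inj: "\<exists>t\<in>P.LB.T. t \<otimes>\<^bsub>B\<^esub> x = \<zero>\<^bsub>B\<^esub>"
    if x: "x \<in> carrier B" and z: "x \<odot>\<^bsub>C 0\<^esub> e1 = \<zero>\<^bsub>C 0\<^esub>" for x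
  proof -
    have "\<eta> (\<pi> (x \<otimes>\<^bsub>B\<^esub> v i)) = \<zero>\<^bsub>E' 0\<^esub>" if i: "i < n" for i
    proof -
      have "\<eta> (\<pi> (v i \<otimes>\<^bsub>B\<^esub> x)) = \<zero>\<^bsub>E' 0\<^esub>"
        using re1[OF x P.v_closed[OF i]] P.v_closed[OF i] unfolding z by (simp add: C_def P.coind_simps)
      then show ?thesis using x P.v_closed[OF i] by (simp add: P.hom.S.m_comm)
    qed
    then obtain t where t: "t \<in> P.LA.T" "\<forall>i<n. t \<otimes>\<^bsub>A\<^esub> \<pi> (x \<otimes>\<^bsub>B\<^esub> v i) = \<zero>\<^bsub>A\<^esub>"
      using P.LA.common_annihilator[of n "\<lambda>i. \<pi> (x \<otimes>\<^bsub>B\<^esub> v i)"] eta_zero x P.v_closed by auto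
    have tc: "t \<in> carrier A" using t by simp
    have "\<phi> t \<otimes>\<^bsub>B\<^esub> x = finsum B (\<lambda>i. \<phi> (\<pi> ((\<phi> t \<otimes>\<^bsub>B\<^esub> x) \<otimes>\<^bsub>B\<^esub> v i)) \<otimes>\<^bsub>B\<^esub> u i) {..<n}"
      using tc x by (intro P.decomp) simp
    also have "\<dots> = finsum B (\<lambda>i. \<zero>\<^bsub>B\<^esub>) {..<n}"
      by (rule P.hom.S.finsum_cong')
        (use tc x t(2) P.v_closed P.u_closed in \<open>simp_all add: P.hom.S.m_assoc P.pi_mult\<close>)
    finally have "\<phi> t \<otimes>\<^bsub>B\<^esub> x = \<zero>\<^bsub>B\<^esub>" by simp
    then show ?thesis using P.phi_T[OF t(1)] by blast
  qed
  have de1: "D 0 e1 = \<zero>\<^bsub>C (Suc 0)\<^esub>"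
  proof -
    have "d 0 (\<eta> a) = \<zero>\<^bsub>E' 1\<^esub>" if "a \<in> carrier A" for a
      using exE0[of "\<eta> a"] eta[OF that] that unfolding \<eta>_def E'_def by auto
    then show ?thesis
      unfolding D_def C_def e1_def P.coind_map_def P.coind_simps by (auto simp: fun_eq_iff)
  qed
  have aug_ex: "\<exists>t\<in>P.LB.T. \<exists>x\<in>carrier B. t \<odot>\<^bsub>C 0\<^esub> h = x \<odot>\<^bsub>C 0\<^esub> e1"
    if h: "h \<in> carrier (C 0)" and z: "D 0 h = \<zero>\<^bsub>C (Suc 0)\<^esub>" for h
  proof -
    have hC: "h \<in> carrier (P.coind (E' 0))" using h unfolding C_def .
    note hD = P.coindD[OF hC]
    have "\<exists>X\<in>carrier P.LA.L. h (u i) = \<epsilon> X" if i: "i < n" for i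
    proof -
      have "d 0 (h (u i)) = \<zero>\<^bsub>E 1\<^esub>"
        using fun_cong[OF z, of "u i"] P.u_closed[OF i]
        by (simp add: D_def C_def P.coind_map_def P.coind_simps E'_def)
      then show ?thesis
        using exE0[of "h (u i)"] hD(1)[OF P.u_closed[OF i]] by (auto simp: E'_def)
    qed
    then obtain X where X: "\<And>i. i < n \<Longrightarrow> X i \<in> carrier P.LA.L" "\<And>i. i < n \<Longrightarrow> h (u i) = \<epsilon> (X i)"
      by metis
    obtain t where t: "t \<in> P.LA.T"
      "\<forall>i<n. \<exists>c\<in>carrier A. fraction A P.M t \<one>\<^bsub>A\<^esub> \<otimes>\<^bsub>P.LA.L\<^esub> X i = fraction A P.M c \<one>\<^bsub>A\<^esub>"
      using P.LA.common_denominator[of n X, OF X(1)] by blast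
    then obtain c where c: "\<And>i. i < n \<Longrightarrow> c i \<in> carrier A"
      "\<And>i. i < n \<Longrightarrow> fraction A P.M t \<one>\<^bsub>A\<^esub> \<otimes>\<^bsub>P.LA.L\<^esub> X i = fraction A P.M (c i) \<one>\<^bsub>A\<^esub>" by metis
    have tc: "t \<in> carrier A" using t by simp
    have thu: "t \<odot>\<^bsub>E' 0\<^esub> h (u i) = \<eta> (c i)" if i: "i < n" for i
      unfolding \<eta>_def E'_def using eps_smult[of "fraction A P.M t \<one>\<^bsub>A\<^esub>" "X i"] tc X[OF i] c(2)[OF i] by simp
    \<comment> \<open>The element that represents t h. By A-linearity
      \<open>\<pi> (b \<otimes> x)\<close> is the sum of the
      \<open>\<pi> (b \<otimes> v i) \<otimes> c i\<close>, and this is the expansion of t h b since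
      t h (u i) is the image of c i.\<close>
    define x where "x = finsum B (\<lambda>i. \<phi> (c i) \<otimes>\<^bsub>B\<^esub> v i) {..<n}"
    have xc: "x \<in> carrier B"
      unfolding x_def using c(1) P.v_closed by (intro P.hom.S.finsum_closed) auto
    have tB: "\<phi> t \<in> carrier B" using tc by simp
    interpret E0: Module.module A "E' 0" by (rule mE')
    have mC: "Module.module B (C 0)" using bC by (simp add: baer_def)
    have "\<phi> t \<odot>\<^bsub>C 0\<^esub> h = x \<odot>\<^bsub>C 0\<^esub> e1"
    proof (rule P.coind_eqI)
      show "\<phi> t \<odot>\<^bsub>C 0\<^esub> h \<in> carrier (P.coind (E' 0))" "x \<odot>\<^bsub>C 0\<^esub> e1 \<in> carrier (P.coind (E' 0))"
        using Module.module.smult_closed[OF mC tB h] Module.module.smult_closed[OF mC xc e1]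
        unfolding C_def .
      fix b assume b: "b \<in> carrier B"
      have bv: "\<pi> (b \<otimes>\<^bsub>B\<^esub> v i) \<in> carrier A" if "i < n" for i using b P.v_closed[OF that] by simp
      have "(\<phi> t \<odot>\<^bsub>C 0\<^esub> h) b = t \<odot>\<^bsub>E' 0\<^esub> h b"
        using b tB tc hD(3)[OF tc b] by (simp add: C_def P.coind_simps P.hom.S.m_comm)
      also have "h b = finsum (E' 0) (\<lambda>i. \<pi> (b \<otimes>\<^bsub>B\<^esub> v i) \<odot>\<^bsub>E' 0\<^esub> h (u i)) {..<n}"
        by (rule P.coind_expand[OF mE' hC b])
      also have "t \<odot>\<^bsub>E' 0\<^esub> \<dots> =
          finsum (E' 0) (\<lambda>i. t \<odot>\<^bsub>E' 0\<^esub> (\<pi> (b \<otimes>\<^bsub>B\<^esub> v i) \<odot>\<^bsub>E' 0\<^esub> h (u i))) {..<n}"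
        using bv hD(1)[OF P.u_closed] by (intro E0.finsum_smult_ldistr tc) auto
      also have "\<dots> = finsum (E' 0) (\<lambda>i. \<eta> (\<pi> (b \<otimes>\<^bsub>B\<^esub> v i) \<otimes>\<^bsub>A\<^esub> c i)) {..<n}"
      proof (rule E0.M.finsum_cong'[OF refl])
        show "(\<lambda>i. \<eta> (\<pi> (b \<otimes>\<^bsub>B\<^esub> v i) \<otimes>\<^bsub>A\<^esub> c i)) \<in> {..<n} \<rightarrow> carrier (E' 0)"
          using bv c(1) eta by auto
        fix i assume "i \<in> {..<n}"
        then have i: "i < n" by simp
        have "t \<odot>\<^bsub>E' 0\<^esub> (\<pi> (b \<otimes>\<^bsub>B\<^esub> v i) \<odot>\<^bsub>E' 0\<^esub> h (u i)) = \<pi> (b \<otimes>\<^bsub>B\<^esub> v i) \<odot>\<^bsub>E' 0\<^esub> (t \<odot>\<^bsub>E' 0\<^esub> h (u i))"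
          using E0.smult_assoc1[OF tc bv[OF i] hD(1)[OF P.u_closed[OF i]]]
            E0.smult_assoc1[OF bv[OF i] tc hD(1)[OF P.u_closed[OF i]]]
            P.hom.R.m_comm[OF tc bv[OF i]] by simp
        then show "t \<odot>\<^bsub>E' 0\<^esub> (\<pi> (b \<otimes>\<^bsub>B\<^esub> v i) \<odot>\<^bsub>E' 0\<^esub> h (u i)) = \<eta> (\<pi> (b \<otimes>\<^bsub>B\<^esub> v i) \<otimes>\<^bsub>A\<^esub> c i)"
          using thu[OF i] eta_smult[OF bv[OF i] c(1)[OF i]] by simp
      qed
      also have "\<dots> = \<eta> (finsum A (\<lambda>i. \<pi> (b \<otimes>\<^bsub>B\<^esub> v i) \<otimes>\<^bsub>A\<^esub> c i) {..<n})"
        by (rule hom_finsum[OF P.A.abelian_group_axioms E0.M.abelian_group_axioms, symmetric])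
          (use eta eta_add bv c(1) in simp_all)
      also have "finsum A (\<lambda>i. \<pi> (b \<otimes>\<^bsub>B\<^esub> v i) \<otimes>\<^bsub>A\<^esub> c i) {..<n} = \<pi> (b \<otimes>\<^bsub>B\<^esub> x)"
      proof -
        have "\<pi> (b \<otimes>\<^bsub>B\<^esub> x) = finsum A (\<lambda>i. \<pi> (b \<otimes>\<^bsub>B\<^esub> (\<phi> (c i) \<otimes>\<^bsub>B\<^esub> v i))) {..<n}"
          unfolding x_def
          by (rule hom_finsum[where g = "\<lambda>y. \<pi> (b \<otimes>\<^bsub>B\<^esub> y)", OF P.hom.S.abelian_group_axioms P.A.abelian_group_axioms])
            (use b c(1) P.v_closed in \<open>simp_all add: P.hom.S.r_distr P.pi_add\<close>)
        also have "\<dots> = finsum A (\<lambda>i. \<pi> (b \<otimes>\<^bsub>B\<^esub> v i) \<otimes>\<^bsub>A\<^esub> c i) {..<n}"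
        proof (rule P.A.finsum_cong'[OF refl])
          show "(\<lambda>i. \<pi> (b \<otimes>\<^bsub>B\<^esub> v i) \<otimes>\<^bsub>A\<^esub> c i) \<in> {..<n} \<rightarrow> carrier A" using bv c(1) by auto
          fix i assume "i \<in> {..<n}"
          then have i: "i < n" by simp
          have "b \<otimes>\<^bsub>B\<^esub> (\<phi> (c i) \<otimes>\<^bsub>B\<^esub> v i) = \<phi> (c i) \<otimes>\<^bsub>B\<^esub> (b \<otimes>\<^bsub>B\<^esub> v i)"
            using b c(1)[OF i] P.v_closed[OF i] by (intro P.hom.S.m_lcomm) simp_all
          then show "\<pi> (b \<otimes>\<^bsub>B\<^esub> (\<phi> (c i) \<otimes>\<^bsub>B\<^esub> v i)) = \<pi> (b \<otimes>\<^bsub>B\<^esub> v i) \<otimes>\<^bsub>A\<^esub> c i"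
            using b c(1)[OF i] P.v_closed[OF i] bv[OF i] by (simp add: P.pi_mult P.hom.R.m_comm)
        qed
        finally show ?thesis by simp
      qed
      also have "\<eta> (\<pi> (b \<otimes>\<^bsub>B\<^esub> x)) = (x \<odot>\<^bsub>C 0\<^esub> e1) b" by (rule re1[OF xc b, symmetric])
      finally show "(\<phi> t \<odot>\<^bsub>C 0\<^esub> h) b = (x \<odot>\<^bsub>C 0\<^esub> e1) b" .
    qed
    then show ?thesis using P.phi_T[OF t(1)] xc by blast
  qed
  obtain \<delta> where delta: "\<delta> \<in> module_hom P.LB.L (self_module P.LB.L) (F 0)"
    "inj_on \<delta> (carrier P.LB.L)"
    "\<forall>y\<in>carrier (F 0). dl 0 y = \<zero>\<^bsub>F (Suc 0)\<^esub> \<longleftrightarrow> y \<in> \<delta> ` carrier P.LB.L"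
    using localized_augmentation[OF lh[of 0] e1 aug_inj de1 aug_ex] unfolding F_def dl_def by blast
  have carrB: "carrier (self_module P.LB.L) = carrier P.LB.L" by (simp add: self_module_def)
  \<comment> \<open>A function h on B is recorded by its values at the u a, and each value is itself
    a function of a natural number b; the pair (a, b) is coded as one number m.\<close>
  define j :: "nat \<Rightarrow> ('a \<Rightarrow> nat \<Rightarrow> ('a \<times> 'a) set) \<Rightarrow> nat \<Rightarrow> ('a \<times> 'a) set"
    where "j i h = (\<lambda>m. h (u (fst (prod_decode m))) (snd (prod_decode m)))" for i h
  have FC: "carrier (F i) \<subseteq> carrier (C i)" for i
    using localized_module.F_carrierD[OF lm] unfolding F_def by blast
  show ?thesis
  proof (rule finite_injective_dimI[where F = F and j = j and \<epsilon> = \<delta> and d = dl and r = r])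
    show "baer P.LB.L (F i)" for i unfolding F_def by (rule localized_module.baer_F[OF lm])
    show "inj_on (j i) (carrier (F i))" for i
    proof (rule inj_onI)
      fix h k assume hk: "h \<in> carrier (F i)" "k \<in> carrier (F i)" "j i h = j i k"
      have "h (u a) = k (u a)" for a
      proof
        fix b
        show "h (u a) b = k (u a) b" using fun_cong[OF hk(3), of "prod_encode (a, b)"] by (simp add: j_def)
      qed
      then show "h = k"
        using hk(1,2) FC[of i] unfolding C_def by (intro P.coind_eq_on_u[OF mE']) blast+
    qed
    show "\<delta> \<in> module_hom P.LB.L (self_module P.LB.L) (F 0)" by (rule delta(1))
    show "inj_on \<delta> (carrier (self_module P.LB.L))" unfolding carrB by (rule delta(2))
    show "dl i \<in> module_hom P.LB.L (F i) (F (Suc i))" for i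
      unfolding dl_def F_def by (rule localized_hom.dl_hom[OF lh])
    show "dl 0 y = \<zero>\<^bsub>F 1\<^esub> \<longleftrightarrow> y \<in> \<delta> ` carrier (self_module P.LB.L)" if "y \<in> carrier (F 0)" for y
      unfolding carrB using delta(3) that by simp
    show "dl (Suc i) y = \<zero>\<^bsub>F (Suc (Suc i))\<^esub> \<longleftrightarrow> y \<in> dl i ` carrier (F i)" if "y \<in> carrier (F (Suc i))" for i y
      using that unfolding dl_def F_def by (intro localized_exact[OF lh lh exC])
    show "carrier (F i) = {\<zero>\<^bsub>F i\<^esub>}" if "i > r" for i
    proof -
      have "carrier (E' i) = {\<zero>\<^bsub>E' i\<^esub>}" using bound[OF that] by (simp add: E'_def)
      then have "h = \<zero>\<^bsub>C i\<^esub>" if "h \<in> carrier (C i)" for h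
        using P.coindD(1,4)[OF that[unfolded C_def]] unfolding C_def P.coind_simps
        by (auto simp: extensional_def fun_eq_iff restrict_def)
      moreover have "\<zero>\<^bsub>C i\<^esub> \<in> carrier (C i)"
      proof -
        interpret Module.module B "C i" using bC by (simp add: baer_def)
        show ?thesis by simp
      qed
      ultimately have "carrier (C i) = {\<zero>\<^bsub>C i\<^esub>}" by blast
      then show ?thesis unfolding F_def by (rule localized_module.F_zero_carrier[OF lm])
    qed
  qed
qed

theorem gorenstein_transfer:
  fixes A B :: "'a ring"
  assumes "frobenius_extension A B \<phi> n u v \<pi>" "gorenstein A"
  shows "gorenstein B"
  unfolding gorenstein_def
proof (intro conjI allI impI)
  interpret P: frobenius_extension A B \<phi> n u v \<pi> by fact
  show "cring B" "noetherian_ring B" by (rule P.hom.S.is_cring, rule P.noetherian_B)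
  fix N assume N: "maximalideal N B"
  interpret N: frobenius_prime A B \<phi> n u v \<pi> N
    by (intro frobenius_prime.intro frobenius_prime_axioms.intro P.frobenius_extension_axioms
      P.hom.S.maximalideal_prime N)
  have "maximalideal N.M A" unfolding N.M_def by (rule P.contract_maximal[OF N])
  then have "gorenstein_local N.LA.L" using assms(2) by (simp add: gorenstein_def)
  then have "finite_injective_dim N.LB.L (self_module N.LB.L)"
    unfolding gorenstein_local_def by (blast intro: finite_injective_dim_transfer[OF N.frobenius_prime_axioms])
  then show "gorenstein_local N.LB.L"
    unfolding gorenstein_local_def
    using N.LB.cring_localization N.LB.noetherian_localization[OF P.noetherian_B]
      N.LB.maximalideal_localization by blast
qed

section \<open>Monomials and polynomials\<close>

lemma keys_sum_subset: "Poly_Mapping.keys (sum f X) \<subseteq> (\<Union>i\<in>X. Poly_Mapping.keys (f i))"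
proof (cases "finite X")
  case True
  then show ?thesis
  proof (induction X)
    case (insert x X)
    then show ?case using keys_add[of "f x" "sum f X"] by auto
  qed simp
qed simp

lemma poly_mapping_expand: "f = (\<Sum>a\<in>Poly_Mapping.keys f. Poly_Mapping.single a (Poly_Mapping.lookup f a))"
  by (rule poly_mapping_eqI)
    (simp add: lookup_sum lookup_single when_def in_keys_iff sum.delta)

lemma sum_keys_plus:
  assumes "\<And>a. g a 0 = 0" "\<And>a c d. g a (c + d) = g a c + g a d"
  shows "(\<Sum>a\<in>Poly_Mapping.keys (p + q). g a (Poly_Mapping.lookup (p + q) a)) =
    (\<Sum>a\<in>Poly_Mapping.keys p. g a (Poly_Mapping.lookup p a)) + (\<Sum>a\<in>Poly_Mapping.keys q. g a (Poly_Mapping.lookup q a))"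
  by (rule setsum_keys_plus_distrib) (simp_all add: assms)

lemma poly_induct:
  fixes p :: "'a \<Rightarrow>\<^sub>0 'b::comm_monoid_add"
  assumes "Poly_Mapping.keys p \<subseteq> S" "P 0" "\<And>f g. P f \<Longrightarrow> P g \<Longrightarrow> P (f + g)" "\<And>a c. a \<in> S \<Longrightarrow> P (Poly_Mapping.single a c)"
  shows "P p"
proof -
  have "P (\<Sum>a\<in>X. Poly_Mapping.single a (Poly_Mapping.lookup p a))" if "finite X" "X \<subseteq> S" for X
    using that by (induction X) (use assms in auto)
  from this[of "Poly_Mapping.keys p"] assms(1) show ?thesis by (simp flip: poly_mapping_expand)
qed

lemma monomials_0 [simp]: "0 \<in> monomials n"
  by (simp add: monomials_def)

lemma monomials_add [simp]: "a \<in> monomials n \<Longrightarrow> b \<in> monomials n \<Longrightarrow> a + b \<in> monomials n"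
  using keys_add[of a b] by (auto simp: monomials_def)

lemma monomials_lookup: "a \<in> monomials n \<Longrightarrow> n \<le> i \<Longrightarrow> Poly_Mapping.lookup a i = 0"
  by (force simp: monomials_def in_keys_iff)

lemma monomialsI:
  assumes "\<And>i. n \<le> i \<Longrightarrow> Poly_Mapping.lookup a i = 0" shows "a \<in> monomials n"
  unfolding monomials_def using assms by (auto simp: in_keys_iff not_less[symmetric])

lemma monomials_Suc: "a \<in> monomials n \<Longrightarrow> a \<in> monomials (Suc n)"
  by (auto simp: monomials_def)

lemma total_deg_eq:
  assumes "a \<in> monomials n"
  shows "total_deg a = (\<Sum>i<n. Poly_Mapping.lookup a i)"
  unfolding total_deg_def
  by (rule sum.mono_neutral_left) (use assms in \<open>auto simp: monomials_def in_keys_iff\<close>)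

lemma monomials_ex: "\<exists>n. a \<in> monomials n"
proof -
  have "Poly_Mapping.keys a \<subseteq> {..<Suc (Max (Poly_Mapping.keys a))}"
    by (auto simp: less_Suc_eq_le)
  then show ?thesis unfolding monomials_def by blast
qed

lemma monomials_mono: "a \<in> monomials n \<Longrightarrow> n \<le> k \<Longrightarrow> a \<in> monomials k"
  by (auto simp: monomials_def)

lemma total_deg_add: "total_deg (a + b) = total_deg a + total_deg b"
proof -
  obtain n k where "a \<in> monomials n" "b \<in> monomials k" using monomials_ex by blast
  then have "a \<in> monomials (max n k)" "b \<in> monomials (max n k)"
    by (auto intro: monomials_mono)
  then show ?thesis by (simp add: total_deg_eq[of _ "max n k"] lookup_add sum.distrib)
qed

lemma total_deg_single [simp]: "total_deg (Poly_Mapping.single i k) = k"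
  by (simp add: total_deg_def)

lemma total_deg_0 [simp]: "total_deg 0 = 0"
  by (simp add: total_deg_def)

definition low :: "nat \<Rightarrow> (nat \<Rightarrow>\<^sub>0 nat) \<Rightarrow> (nat \<Rightarrow>\<^sub>0 nat)"
  where "low n a = a - Poly_Mapping.single n (Poly_Mapping.lookup a n)"

lemma lookup_low: "Poly_Mapping.lookup (low n a) i = (if i = n then 0 else Poly_Mapping.lookup a i)"
  by (simp add: low_def lookup_minus lookup_single when_def)

lemma low_split: "a = low n a + Poly_Mapping.single n (Poly_Mapping.lookup a n)"
  by (rule poly_mapping_eqI) (simp add: lookup_add lookup_low lookup_single when_def)

lemma low_monomials [simp]: "a \<in> monomials (Suc n) \<Longrightarrow> low n a \<in> monomials n"
  by (rule monomialsI) (simp add: lookup_low monomials_lookup[of a "Suc n"])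

lemma low_add:
  assumes "b \<in> monomials n" shows "low n (b + a) = b + low n a" "Poly_Mapping.lookup (b + a) n = Poly_Mapping.lookup a n"
proof -
  have b: "Poly_Mapping.lookup b n = 0" using monomials_lookup[OF assms] by simp
  show "low n (b + a) = b + low n a"
    by (rule poly_mapping_eqI) (simp add: b lookup_low lookup_add)
  show "Poly_Mapping.lookup (b + a) n = Poly_Mapping.lookup a n" by (simp add: b lookup_add)
qed

lemma low_single: "low n (Poly_Mapping.single n k + a) = low n a"
  by (rule poly_mapping_eqI) (simp add: lookup_low lookup_add lookup_single when_def)

lemma total_deg_low: "total_deg a = total_deg (low n a) + Poly_Mapping.lookup a n"
  using total_deg_add[of "low n a" "Poly_Mapping.single n (Poly_Mapping.lookup a n)"] by (simp flip: low_split)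

definition mscale :: "nat \<Rightarrow> (nat \<Rightarrow>\<^sub>0 nat) \<Rightarrow> (nat \<Rightarrow>\<^sub>0 nat)"
  where "mscale q a = (((+) a) ^^ q) 0"

lemma mscale_simps [simp]: "mscale 0 a = 0" "mscale (Suc q) a = a + mscale q a"
  by (simp_all add: mscale_def)

lemma lookup_mscale: "Poly_Mapping.lookup (mscale q a) i = q * Poly_Mapping.lookup a i"
  by (induction q) (simp_all add: lookup_add)

lemma monomials_mscale [simp]: "a \<in> monomials n \<Longrightarrow> mscale q a \<in> monomials n"
  by (induction q) simp_all

lemma total_deg_mscale: "total_deg (mscale q a) = q * total_deg a"
  by (induction q) (simp_all add: total_deg_add)

lemma single_power: "Poly_Mapping.single a 1 ^ q = Poly_Mapping.single (mscale q a) (1::'k::comm_ring_1)"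
  by (induction q) (simp_all add: mult_single)

lemma mpoly_ring_simps:
  "p \<in> carrier (mpoly_ring n) \<longleftrightarrow> Poly_Mapping.keys p \<subseteq> monomials n"
  "p \<otimes>\<^bsub>mpoly_ring n\<^esub> q = p * q" "p \<oplus>\<^bsub>mpoly_ring n\<^esub> q = p + q"
  "\<one>\<^bsub>mpoly_ring n\<^esub> = 1" "\<zero>\<^bsub>mpoly_ring n\<^esub> = 0"
  by (simp_all add: mpoly_ring_def)

abbreviation PR where "PR n \<equiv> carrier (mpoly_ring n)"

lemma PR_add [simp]: "p \<in> PR n \<Longrightarrow> q \<in> PR n \<Longrightarrow> p + q \<in> PR n"
  using keys_add[of p q] by (auto simp: mpoly_ring_simps)

lemma PR_mult [simp]: "p \<in> PR n \<Longrightarrow> q \<in> PR n \<Longrightarrow> p * q \<in> PR n"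
  using keys_mult[of p q] by (fastforce simp: mpoly_ring_simps)

lemma PR_uminus [simp]: "p \<in> PR n \<Longrightarrow> - p \<in> PR n"
  by (auto simp: mpoly_ring_simps in_keys_iff)

lemma PR_minus [simp]: "p \<in> PR n \<Longrightarrow> q \<in> PR n \<Longrightarrow> p - q \<in> PR n"
  using PR_add[of p n "- q"] by simp

lemma PR_0 [simp]: "0 \<in> PR n" and PR_1 [simp]: "1 \<in> PR n"
  by (simp_all add: mpoly_ring_simps)

lemma PR_sum [simp]: "(\<And>i. i \<in> X \<Longrightarrow> f i \<in> PR n) \<Longrightarrow> sum f X \<in> PR n"
  by (induction X rule: infinite_finite_induct) simp_all

lemma PR_power [simp]: "p \<in> PR n \<Longrightarrow> p ^ k \<in> PR n"
  by (induction k) simp_all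

lemma PR_single [simp]: "a \<in> monomials n \<Longrightarrow> Poly_Mapping.single a c \<in> PR n"
  by (simp add: mpoly_ring_simps)

lemma PR_Suc: "p \<in> PR n \<Longrightarrow> p \<in> PR (Suc n)"
  using monomials_Suc by (auto simp: mpoly_ring_simps)

lemma PR_induct:
  assumes "p \<in> PR n" "P 0" "\<And>f g. P f \<Longrightarrow> P g \<Longrightarrow> P (f + g)" "\<And>a c. a \<in> monomials n \<Longrightarrow> P (Poly_Mapping.single a c)"
  shows "P p"
  by (rule poly_induct[of p "monomials n"]) (use assms in \<open>auto simp: mpoly_ring_simps\<close>)

lemma cring_mpoly_ring: "cring (mpoly_ring n :: 'k::comm_ring_1 mpoly ring)"
proof (rule cringI)
  show "abelian_group (mpoly_ring n :: 'k mpoly ring)"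
  proof (rule abelian_groupI)
    fix x :: "'k mpoly" assume "x \<in> PR n"
    then show "\<exists>y\<in>PR n. y \<oplus>\<^bsub>mpoly_ring n\<^esub> x = \<zero>\<^bsub>mpoly_ring n\<^esub>"
      by (intro bexI[of _ "- x"]) (simp_all add: mpoly_ring_simps(2-))
  qed (simp_all add: mpoly_ring_simps(2-) ac_simps)
  show "comm_monoid (mpoly_ring n :: 'k mpoly ring)"
    by (rule comm_monoidI) (simp_all add: mpoly_ring_simps(2-) ac_simps)
qed (simp add: mpoly_ring_simps(2-) distrib_right)

lemma mpoly_ring_minus:
  fixes p :: "'k::comm_ring_1 mpoly"
  assumes "p \<in> PR n" shows "\<ominus>\<^bsub>mpoly_ring n\<^esub> p = - p"
proof -
  interpret R: cring "mpoly_ring n :: 'k mpoly ring" by (rule cring_mpoly_ring)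
  show ?thesis using assms by (intro R.minus_equality) (simp_all add: mpoly_ring_simps(2-))
qed

lemma mpoly_idealI:
  fixes J :: "'k::comm_ring_1 mpoly set"
  assumes "J \<subseteq> PR n" "0 \<in> J" "\<And>x y. x \<in> J \<Longrightarrow> y \<in> J \<Longrightarrow> x + y \<in> J"
    "\<And>r x. r \<in> PR n \<Longrightarrow> x \<in> J \<Longrightarrow> r * x \<in> J"
  shows "ideal J (mpoly_ring n)"
  by (rule cring.cring_idealI[OF cring_mpoly_ring]) (use assms in \<open>simp_all add: mpoly_ring_simps(2-)\<close>)

lemma mpoly_idealD:
  fixes J :: "'k::comm_ring_1 mpoly set"
  assumes "ideal J (mpoly_ring n)"
  shows "x \<in> J \<Longrightarrow> x \<in> PR n" "0 \<in> J" "x \<in> J \<Longrightarrow> y \<in> J \<Longrightarrow> x + y \<in> J"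
    "x \<in> J \<Longrightarrow> - x \<in> J" "x \<in> J \<Longrightarrow> y \<in> J \<Longrightarrow> x - y \<in> J" "r \<in> PR n \<Longrightarrow> x \<in> J \<Longrightarrow> r * x \<in> J"
proof -
  note sub = ideal.axioms(1)[OF assms]
  show c: "x \<in> PR n" if "x \<in> J" for x using ideal.Icarr[OF assms that] .
  show "0 \<in> J" using additive_subgroup.zero_closed[OF sub] unfolding mpoly_ring_simps(5) .
  show a: "x + y \<in> J" if "x \<in> J" "y \<in> J" for x y using additive_subgroup.a_closed[OF sub that] unfolding mpoly_ring_simps(3) .
  show m: "- x \<in> J" if "x \<in> J" for x using additive_subgroup.a_inv_closed[OF sub that] unfolding mpoly_ring_minus[OF c[OF that]] .
  show "x \<in> J \<Longrightarrow> y \<in> J \<Longrightarrow> x - y \<in> J" using a[OF _ m, of x y] by simp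
  show "r \<in> PR n \<Longrightarrow> x \<in> J \<Longrightarrow> r * x \<in> J" using ideal.I_l_closed[OF assms, of x r] unfolding mpoly_ring_simps(2) .
qed

section \<open>Reduction modulo a monic binomial\<close>

text \<open>\<open>slice n l p r f\<close> is the coefficient of \<open>y\<^sup>r\<close> in the remainder of \<open>f\<close> modulo \<open>y\<^sup>l - p\<close>, where
  \<open>y\<close> is the variable number \<open>n\<close>.\<close>

definition slice_term :: "nat \<Rightarrow> nat \<Rightarrow> 'k::comm_ring_1 mpoly \<Rightarrow> nat \<Rightarrow> (nat \<Rightarrow>\<^sub>0 nat) \<Rightarrow> 'k \<Rightarrow> 'k mpoly"
  where "slice_term n l p r a c =
    (if Poly_Mapping.lookup a n mod l = r then Poly_Mapping.single (low n a) c * p ^ (Poly_Mapping.lookup a n div l) else 0)"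

definition slice :: "nat \<Rightarrow> nat \<Rightarrow> 'k::comm_ring_1 mpoly \<Rightarrow> nat \<Rightarrow> 'k mpoly \<Rightarrow> 'k mpoly"
  where "slice n l p r f = (\<Sum>a\<in>Poly_Mapping.keys f. slice_term n l p r a (Poly_Mapping.lookup f a))"

lemma slice_term_0 [simp]: "slice_term n l p r a 0 = 0"
  by (simp add: slice_term_def)

lemma slice_add: "slice n l p r (f + g) = slice n l p r f + slice n l p r g"
  unfolding slice_def by (rule sum_keys_plus) (simp_all add: slice_term_def single_add distrib_right)

lemma slice_0 [simp]: "slice n l p r 0 = 0"
  by (simp add: slice_def)

lemma slice_single: "slice n l p r (Poly_Mapping.single a c) = slice_term n l p r a c"
  by (cases "c = 0") (simp_all add: slice_def)

lemma slice_sum: "slice n l p r (sum f X) = (\<Sum>i\<in>X. slice n l p r (f i))"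
  by (induction X rule: infinite_finite_induct) (simp_all add: slice_add)

lemma slice_minus: "slice n l p r (f - g) = slice n l p r f - slice n l p r g"
  using slice_add[of n l p r "f - g" g] by (simp add: algebra_simps)

lemma slice_PR [simp]:
  assumes "f \<in> PR (Suc n)" "p \<in> PR n"
  shows "slice n l p r f \<in> PR n"
  unfolding slice_def by (rule PR_sum) (use assms in \<open>auto simp: slice_term_def mpoly_ring_simps(1)[of f]\<close>)

lemma slice_mult:
  assumes "g \<in> PR n"
  shows "slice n l p r (g * f) = g * slice n l p r f"
proof (rule PR_induct[OF assms])
  fix b c assume b: "b \<in> monomials n"
  show "slice n l p r (Poly_Mapping.single b c * f) = Poly_Mapping.single b c * slice n l p r f"
  proof (rule poly_induct[of f UNIV])
    fix a d
    show "slice n l p r (Poly_Mapping.single b c * Poly_Mapping.single a d) = Poly_Mapping.single b c * slice n l p r (Poly_Mapping.single a d)"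
      using low_add[OF b] by (simp add: mult_single slice_single slice_term_def flip: mult.assoc)
  qed (simp_all add: slice_add distrib_left)
qed (simp_all add: slice_add distrib_right)

definition yvar :: "nat \<Rightarrow> 'k::comm_ring_1 mpoly" where "yvar n = Poly_Mapping.single (Poly_Mapping.single n 1) 1"

lemma yvar_mult: "yvar n * Poly_Mapping.single a c = Poly_Mapping.single (Poly_Mapping.single n 1 + a) c"
  by (simp add: yvar_def mult_single)

lemma yvar_power: "yvar n ^ k = Poly_Mapping.single (Poly_Mapping.single n k) (1::'k::comm_ring_1)"
  by (induction k) (simp_all add: yvar_mult flip: single_add)

lemma monomials_single [simp]: "Poly_Mapping.single n k \<in> monomials (Suc n)"
  by (auto simp: monomials_def)

lemma PR_yvar [simp]: "yvar n \<in> PR (Suc n)"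
  by (simp add: yvar_def)

lemma single_low: "Poly_Mapping.single a c = Poly_Mapping.single (low n a) c * yvar n ^ (Poly_Mapping.lookup a n)"
proof -
  have "Poly_Mapping.single a c = Poly_Mapping.single (low n a + Poly_Mapping.single n (Poly_Mapping.lookup a n)) c" by (simp flip: low_split)
  then show ?thesis by (simp add: yvar_power mult_single)
qed

lemma slice_yvar_Suc:
  assumes "Suc r < l"
  shows "slice n l p (Suc r) (yvar n * f) = slice n l p r f"
proof (rule poly_induct[of f UNIV])
  fix a d
  have "Suc (Poly_Mapping.lookup a n) mod l = Suc r \<longleftrightarrow> Poly_Mapping.lookup a n mod l = r"
    using assms by (auto simp: mod_Suc)
  moreover have "Suc (Poly_Mapping.lookup a n) div l = Poly_Mapping.lookup a n div l" if "Poly_Mapping.lookup a n mod l = r"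
    using assms that by (simp add: div_Suc mod_Suc)
  ultimately show "slice n l p (Suc r) (yvar n * Poly_Mapping.single a d) = slice n l p r (Poly_Mapping.single a d)"
    by (simp add: yvar_mult slice_single slice_term_def low_single lookup_add)
qed (simp_all add: slice_add distrib_left)

text \<open>Multiplication by y carries the coefficient of y^(l-1) to y^l, which is replaced by p;
  this is the only place where a shift by one wraps around.\<close>

lemma slice_yvar_0:
  assumes "0 < l"
  shows "slice n l p 0 (yvar n * f) = p * slice n l p (l - 1) f"
proof (rule poly_induct[of f UNIV])
  fix a d
  have "Suc (Poly_Mapping.lookup a n) mod l = 0 \<longleftrightarrow> Poly_Mapping.lookup a n mod l = l - 1"
    using assms mod_less_divisor[OF assms, of "Poly_Mapping.lookup a n"] by (auto simp: mod_Suc)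
  moreover have "Suc (Poly_Mapping.lookup a n) div l = Suc (Poly_Mapping.lookup a n div l)" if "Poly_Mapping.lookup a n mod l = l - 1"
    using assms that by (simp add: div_Suc mod_Suc)
  ultimately show "slice n l p 0 (yvar n * Poly_Mapping.single a d) = p * slice n l p (l - 1) (Poly_Mapping.single a d)"
    by (simp add: yvar_mult slice_single slice_term_def low_single lookup_add mult_ac)
qed (simp_all add: slice_add distrib_left)

text \<open>A shift that stays below l does not wrap around. With k = l - 1 - r it moves the
  coefficient of y^r to the top, where the Frobenius functional reads it.\<close>

lemma slice_yvar_power:
  assumes "r + k < l"
  shows "slice n l p (r + k) (yvar n ^ k * f) = slice n l p r f"
  using assms
proof (induction k arbitrary: f)
  case (Suc k)
  have "slice n l p (r + Suc k) (yvar n ^ Suc k * f) = slice n l p (Suc (r + k)) (yvar n * (yvar n ^ k * f))"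
    by (simp add: mult.assoc)
  also have "\<dots> = slice n l p r f"
    using Suc by (subst slice_yvar_Suc) simp_all
  finally show ?case .
qed simp

text \<open>This set is the ideal generated by J and y^l - p. It serves as an upper bound: an ideal
  of the larger ring lies in it as soon as its generators have all slices in J. Closure under
  multiplication reduces to multiplication by y, where the slices are only shifted or wrapped
  around.\<close>

lemma ideal_slices:
  fixes J :: "'k::comm_ring_1 mpoly set"
  assumes J: "ideal J (mpoly_ring n)" and p: "p \<in> PR n" and l: "0 < l"
  shows "ideal {f \<in> PR (Suc n). \<forall>r<l. slice n l p r f \<in> J} (mpoly_ring (Suc n))" (is "ideal ?K _")
proof (rule mpoly_idealI)
  note JD = mpoly_idealD[OF J]
  have y: "yvar n ^ k * f \<in> ?K" if f: "f \<in> ?K" for k and f :: "'k mpoly"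
  proof (induction k)
    case (Suc k)
    have "slice n l p r (yvar n * (yvar n ^ k * f)) \<in> J" if r: "r < l" for r
    proof (cases r)
      case 0
      then show ?thesis using Suc l p by (simp add: slice_yvar_0 JD)
    next
      case (Suc r')
      then show ?thesis using \<open>yvar n ^ k * f \<in> ?K\<close> r by (simp add: slice_yvar_Suc)
    qed
    moreover have "yvar n * (yvar n ^ k * f) \<in> PR (Suc n)" using Suc by - (rule PR_mult, simp_all)
    ultimately show ?case by (simp add: mult.assoc)
  qed (use f in simp)
  fix g f :: "'k mpoly" assume g: "g \<in> PR (Suc n)" and f: "f \<in> ?K"
  have "slice n l p r (g * f) \<in> J" if r: "r < l" for r
  proof (rule PR_induct[OF g])
    fix a c assume a: "a \<in> monomials (Suc n)"
    have "slice n l p r (Poly_Mapping.single a c * f) = Poly_Mapping.single (low n a) c * slice n l p r (yvar n ^ (Poly_Mapping.lookup a n) * f)"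
      using a by (subst single_low[of a c n]) (simp add: mult.assoc slice_mult)
    then show "slice n l p r (Poly_Mapping.single a c * f) \<in> J" using y[OF f, of "Poly_Mapping.lookup a n"] r a by (simp add: JD)
  qed (simp_all add: distrib_right slice_add JD)
  then show "g * f \<in> ?K" using f g by simp
qed (use mpoly_idealD[OF J] in \<open>auto simp: slice_add\<close>)

text \<open>Division with remainder, read modulo any ideal that contains y^l - p. By linearity only
  monomials matter, where y^(l q + s) is replaced by p^q y^s.\<close>

lemma slice_remainder:
  fixes J :: "'k::comm_ring_1 mpoly set"
  assumes J: "ideal J (mpoly_ring (Suc n))" and p: "p \<in> PR n" and l: "0 < l"
    and y: "yvar n ^ l - p \<in> J" and f: "f \<in> PR (Suc n)"
  shows "f - (\<Sum>r<l. slice n l p r f * yvar n ^ r) \<in> J"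
proof (rule PR_induct[OF f])
  note JD = mpoly_idealD[OF J]
  show "f + g - (\<Sum>r<l. slice n l p r (f + g) * yvar n ^ r) \<in> J"
    if "f - (\<Sum>r<l. slice n l p r f * yvar n ^ r) \<in> J" "g - (\<Sum>r<l. slice n l p r g * yvar n ^ r) \<in> J" for f g
    using JD(3)[OF that] by (simp add: slice_add distrib_right sum.distrib algebra_simps)
  fix a c assume a: "a \<in> monomials (Suc n)"
  define q where "q = Poly_Mapping.lookup a n div l"
  define s where "s = Poly_Mapping.lookup a n mod l"
  have s: "s < l" using l by (simp add: s_def)
  have "(\<Sum>r<l. slice n l p r (Poly_Mapping.single a c) * yvar n ^ r) =
      (\<Sum>r<l. if r = s then Poly_Mapping.single (low n a) c * p ^ q * yvar n ^ s else 0)"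
    by (rule sum.cong) (auto simp: slice_single slice_term_def s_def q_def)
  also have "\<dots> = Poly_Mapping.single (low n a) c * p ^ q * yvar n ^ s" using s by simp
  finally have 1: "(\<Sum>r<l. slice n l p r (Poly_Mapping.single a c) * yvar n ^ r) = Poly_Mapping.single (low n a) c * p ^ q * yvar n ^ s" .
  \<comment> \<open>y^l and p agree modulo J, hence so do their powers.\<close>
  have pow: "(yvar n ^ l) ^ k - p ^ k \<in> J" for k
  proof (induction k)
    case (Suc k)
    have "(yvar n ^ l) ^ Suc k - p ^ Suc k =
        yvar n ^ l * ((yvar n ^ l) ^ k - p ^ k) + p ^ k * (yvar n ^ l - p)"
      by (simp add: algebra_simps)
    moreover have "yvar n ^ l * ((yvar n ^ l) ^ k - p ^ k) \<in> J" by (rule JD(6)[OF _ Suc]) simp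
    moreover have "p ^ k * (yvar n ^ l - p) \<in> J" by (rule JD(6)[OF _ y]) (simp add: p PR_Suc)
    ultimately show ?case by (simp add: JD(3))
  qed (simp add: JD)
  have "Poly_Mapping.single a c = Poly_Mapping.single (low n a) c * yvar n ^ (Poly_Mapping.lookup a n)" by (rule single_low)
  also have "Poly_Mapping.lookup a n = l * q + s" by (simp add: q_def s_def)
  finally have "Poly_Mapping.single a c - Poly_Mapping.single (low n a) c * p ^ q * yvar n ^ s =
      (Poly_Mapping.single (low n a) c * yvar n ^ s) * ((yvar n ^ l) ^ q - p ^ q)"
    by (simp add: power_add power_mult algebra_simps)
  also have "\<dots> \<in> J"
    by (rule JD(6)[OF _ pow]) (use a in \<open>simp add: PR_Suc\<close>)
  finally show "Poly_Mapping.single a c - (\<Sum>r<l. slice n l p r (Poly_Mapping.single a c) * yvar n ^ r) \<in> J" unfolding 1 .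
qed (simp add: mpoly_idealD[OF J])

section \<open>Homogeneous components\<close>

definition hc :: "nat \<Rightarrow> 'k::comm_ring_1 mpoly \<Rightarrow> 'k mpoly"
  where "hc d f = (\<Sum>a\<in>Poly_Mapping.keys f. if total_deg a = d then Poly_Mapping.single a (Poly_Mapping.lookup f a) else 0)"

lemma hc_add: "hc d (f + g) = hc d f + hc d g"
  unfolding hc_def by (rule sum_keys_plus) (simp_all add: single_add)

lemma hc_0 [simp]: "hc d 0 = 0"
  by (simp add: hc_def)

lemma hc_single: "hc d (Poly_Mapping.single a c) = (if total_deg a = d then Poly_Mapping.single a c else 0)"
  by (cases "c = 0") (simp_all add: hc_def)

lemma hc_sum: "hc d (sum f X) = (\<Sum>i\<in>X. hc d (f i))"
  by (induction X rule: infinite_finite_induct) (simp_all add: hc_add)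

lemma initial_form_eq_hc: "initial_form f = hc (Min (total_deg ` Poly_Mapping.keys f)) f"
  unfolding initial_form_def hc_def by (simp add: sum.inter_filter)

text \<open>When no term of g has degree below e, the component of degree e is either the initial
  form of g or zero. This treats a component uniformly without knowing the exact order of g.\<close>

lemma hc_mem_ideal:
  fixes J :: "'k::comm_ring_1 mpoly set"
  assumes J: "ideal J (mpoly_ring n)" and init: "\<And>g. g \<in> I \<Longrightarrow> g \<noteq> 0 \<Longrightarrow> initial_form g \<in> J"
    and g: "g \<in> I" and ge: "\<And>a. a \<in> Poly_Mapping.keys g \<Longrightarrow> e \<le> total_deg a"
  shows "hc e g \<in> J"
proof (cases "\<exists>a\<in>Poly_Mapping.keys g. total_deg a = e")
  case True
  then have "Min (total_deg ` Poly_Mapping.keys g) = e"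
    using ge by (intro Min_eqI) auto
  moreover have "g \<noteq> 0" using True by auto
  ultimately show ?thesis using init[OF g] by (simp add: initial_form_eq_hc)
next
  case False
  then have "hc e g = 0" unfolding hc_def by (intro sum.neutral) auto
  then show ?thesis using mpoly_idealD(2)[OF J] by simp
qed

section \<open>Quotients by a monic binomial are Frobenius extensions\<close>

text \<open>The inclusion of J in J' makes \<open>\<phi>\<close> well defined, and the condition on
  slices does the same for \<open>\<pi>\<close>, the top coefficient of the remainder. Multiplying f
  by y^(l-1-i) brings its coefficient of y^i to the top, so the expansion required of a Frobenius
  extension is division with remainder by y^l - p.\<close>

lemma frobenius_quotient:
  fixes J J' :: "'k::comm_ring_1 mpoly set"
  assumes J: "ideal J (mpoly_ring n)" and J': "ideal J' (mpoly_ring (Suc n))"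
    and p: "p \<in> PR n" and l: "0 < l" and sub: "J \<subseteq> J'" and y: "yvar n ^ l - p \<in> J'"
    and slices: "\<And>f r. f \<in> J' \<Longrightarrow> r < l \<Longrightarrow> slice n l p r f \<in> J"
    and noeth: "noetherian_ring (mpoly_ring n Quot J)"
  shows "\<exists>\<phi> u v \<pi>. frobenius_extension (mpoly_ring n Quot J) (mpoly_ring (Suc n) Quot J') \<phi> l u v \<pi>"
proof -
  let ?P = "mpoly_ring n :: 'k mpoly ring" and ?P' = "mpoly_ring (Suc n) :: 'k mpoly ring"
  let ?A = "?P Quot J" and ?B = "?P' Quot J'"
  define cA where "cA f = J +>\<^bsub>?P\<^esub> f" for f
  define cB where "cB f = J' +>\<^bsub>?P'\<^esub> f" for f
  interpret hA: ring_hom_cring ?P ?A cA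
    unfolding cA_def by (rule ideal.rcos_ring_hom_cring[OF J cring_mpoly_ring])
  interpret hB: ring_hom_cring ?P' ?B cB
    unfolding cB_def by (rule ideal.rcos_ring_hom_cring[OF J' cring_mpoly_ring])
  note hA = hA.hom_mult[unfolded mpoly_ring_simps(2-)] hA.hom_add[unfolded mpoly_ring_simps(2-)]
    hA.hom_one[unfolded mpoly_ring_simps(2-)]
  note hB = hB.hom_mult[unfolded mpoly_ring_simps(2-)] hB.hom_add[unfolded mpoly_ring_simps(2-)]
    hB.hom_one[unfolded mpoly_ring_simps(2-)]
  have eqA: "cA f = cA g \<longleftrightarrow> f - g \<in> J" if "f \<in> PR n" "g \<in> PR n" for f g
    using hA.R.quotient_eq_iff_same_a_r_cos[OF J that] that mpoly_ring_minus[OF that(2)]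
    by (simp add: cA_def a_minus_def mpoly_ring_simps(3))
  have eqB: "cB f = cB g \<longleftrightarrow> f - g \<in> J'" if "f \<in> PR (Suc n)" "g \<in> PR (Suc n)" for f g
    using hB.R.quotient_eq_iff_same_a_r_cos[OF J' that] that mpoly_ring_minus[OF that(2)]
    by (simp add: cB_def a_minus_def mpoly_ring_simps(3))
  define rA where "rA X = (SOME f. f \<in> PR n \<and> cA f = X)" for X
  define rB where "rB X = (SOME f. f \<in> PR (Suc n) \<and> cB f = X)" for X
  have exA: "\<exists>f. f \<in> PR n \<and> cA f = X" if "X \<in> carrier ?A" for X
    using that unfolding cA_def FactRing_simps by auto
  have exB: "\<exists>f. f \<in> PR (Suc n) \<and> cB f = X" if "X \<in> carrier ?B" for X
    using that unfolding cB_def FactRing_simps by auto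
  define \<phi> where "\<phi> X = cB (rA X)" for X
  define \<pi> where "\<pi> Y = cA (slice n l p (l - 1) (rB Y))" for Y
  have phi: "\<phi> (cA f) = cB f" if f: "f \<in> PR n" for f
  proof -
    have "rA (cA f) \<in> PR n \<and> cA (rA (cA f)) = cA f"
      unfolding rA_def by (rule someI[of _ f]) (use f in simp)
    then show ?thesis
      using f eqA[of "rA (cA f)" f] eqB[of "rA (cA f)" f] sub by (auto simp: \<phi>_def PR_Suc)
  qed
  \<comment> \<open>Two representatives of a class differ by an element of J', whose top slice lies
    in J.\<close>
  have pi: "\<pi> (cB f) = cA (slice n l p (l - 1) f)" if f: "f \<in> PR (Suc n)" for f
  proof -
    have r: "rB (cB f) \<in> PR (Suc n) \<and> cB (rB (cB f)) = cB f"
      unfolding rB_def by (rule someI[of _ f]) (use f in simp)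
    then have "rB (cB f) - f \<in> J'" using f eqB[of "rB (cB f)" f] by simp
    then have "slice n l p (l - 1) (rB (cB f) - f) \<in> J" using l by (intro slices) simp_all
    then show ?thesis
      using r f p eqA[of "slice n l p (l - 1) (rB (cB f))" "slice n l p (l - 1) f"]
      by (simp add: \<pi>_def slice_minus)
  qed
  have finsum_eq: "finsum ?P' f {..<k} = sum f {..<k}" if "\<And>i. i < k \<Longrightarrow> f i \<in> PR (Suc n)"
    for f :: "nat \<Rightarrow> 'k mpoly" and k
    using that
  proof (induction k)
    case 0
    show ?case by (simp add: mpoly_ring_simps)
  next
    case (Suc k)
    have "finsum ?P' f (insert k {..<k}) = f k \<oplus>\<^bsub>?P'\<^esub> finsum ?P' f {..<k}"
      using Suc.prems by (intro hB.R.finsum_insert) auto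
    then show ?case using Suc by (simp add: lessThan_Suc mpoly_ring_simps(3))
  qed
  \<comment> \<open>The dual families: powers of y in increasing and in decreasing order.\<close>
  define u where "u i = cB (yvar n ^ i)" for i
  define v where "v i = cB (yvar n ^ (l - 1 - i))" for i
  have "frobenius_extension ?A ?B \<phi> l u v \<pi>"
  proof (intro frobenius_extension.intro frobenius_extension_axioms.intro ring_hom_cring.intro
      ring_hom_cring_axioms.intro ring_hom_memI noeth hA.S.is_cring hB.S.is_cring)
    fix X assume "X \<in> carrier ?A"
    then obtain f where f: "f \<in> PR n" "X = cA f" using exA by blast
    show "\<phi> X \<in> carrier ?B" using f by (simp add: phi PR_Suc)
    fix Y assume "Y \<in> carrier ?A"
    then obtain g where g: "g \<in> PR n" "Y = cA g" using exA by blast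
    show "\<phi> (X \<otimes>\<^bsub>?A\<^esub> Y) = \<phi> X \<otimes>\<^bsub>?B\<^esub> \<phi> Y"
      using f g by (simp add: phi PR_Suc flip: hA hB)
    show "\<phi> (X \<oplus>\<^bsub>?A\<^esub> Y) = \<phi> X \<oplus>\<^bsub>?B\<^esub> \<phi> Y"
      using f g by (simp add: phi PR_Suc flip: hA hB)
  next
    show "\<phi> \<one>\<^bsub>?A\<^esub> = \<one>\<^bsub>?B\<^esub>" using phi[of 1] by (simp flip: hA(3) hB(3))
  next
    fix i assume "i < l"
    show "u i \<in> carrier ?B" "v i \<in> carrier ?B" by (simp_all add: u_def v_def)
  next
    fix X assume "X \<in> carrier ?B"
    then obtain f where f: "f \<in> PR (Suc n)" "X = cB f" using exB by blast
    show "\<pi> X \<in> carrier ?A" using f p by (simp add: pi)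
    show "\<pi> (X \<oplus>\<^bsub>?B\<^esub> Y) = \<pi> X \<oplus>\<^bsub>?A\<^esub> \<pi> Y" if Y: "Y \<in> carrier ?B" for Y
    proof -
      obtain g where g: "g \<in> PR (Suc n)" "Y = cB g" using Y exB by blast
      show ?thesis using f g p by (simp add: pi slice_add flip: hA hB)
    qed
    show "\<pi> (\<phi> a \<otimes>\<^bsub>?B\<^esub> X) = a \<otimes>\<^bsub>?A\<^esub> \<pi> X" if a: "a \<in> carrier ?A" for a
    proof -
      obtain g where g: "g \<in> PR n" "a = cA g" using a exA by blast
      show ?thesis using f g p by (simp add: phi pi PR_Suc slice_mult flip: hA hB)
    qed
    have coord: "\<phi> (\<pi> (X \<otimes>\<^bsub>?B\<^esub> v i)) \<otimes>\<^bsub>?B\<^esub> u i = cB (slice n l p i f * yvar n ^ i)" if i: "i < l" for i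
    proof -
      have "X \<otimes>\<^bsub>?B\<^esub> v i = cB (f * yvar n ^ (l - 1 - i))"
        using f by (simp add: v_def flip: hB)
      then have "\<pi> (X \<otimes>\<^bsub>?B\<^esub> v i) = cA (slice n l p (l - 1) (f * yvar n ^ (l - 1 - i)))"
        using f by (simp add: pi)
      also have "slice n l p (l - 1) (f * yvar n ^ (l - 1 - i)) = slice n l p i f"
        using slice_yvar_power[of i "l - 1 - i" l n p f] i by (simp add: mult.commute)
      finally show ?thesis using f p by (simp add: phi u_def PR_Suc flip: hB)
    qed
    have C: "slice n l p i f * yvar n ^ i \<in> PR (Suc n)" for i
      using f(1) p by (intro PR_mult) (simp_all add: PR_Suc)
    have "finsum ?B (\<lambda>i. \<phi> (\<pi> (X \<otimes>\<^bsub>?B\<^esub> v i)) \<otimes>\<^bsub>?B\<^esub> u i) {..<l} =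
        finsum ?B (\<lambda>i. cB (slice n l p i f * yvar n ^ i)) {..<l}"
      by (rule hB.S.finsum_cong') (use coord C in auto)
    also have "\<dots> = cB (finsum ?P' (\<lambda>i. slice n l p i f * yvar n ^ i) {..<l})"
      by (rule hom_finsum[OF hB.R.abelian_group_axioms hB.S.abelian_group_axioms, symmetric])
        (use C in simp_all)
    also have "\<dots> = cB (\<Sum>i<l. slice n l p i f * yvar n ^ i)"
      using C by (simp add: finsum_eq)
    also have "\<dots> = X"
    proof -
      have "(\<Sum>i<l. slice n l p i f * yvar n ^ i) \<in> PR (Suc n)" using C by (rule PR_sum)
      then show ?thesis using slice_remainder[OF J' p l y f(1)] eqB[OF f(1)] f(2) by blast
    qed
    finally show "X = finsum ?B (\<lambda>i. \<phi> (\<pi> (X \<otimes>\<^bsub>?B\<^esub> v i)) \<otimes>\<^bsub>?B\<^esub> u i) {..<l}" by simp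
  qed
  then show ?thesis by blast
qed

section \<open>Toric ideals and tangent cones\<close>

lemma semigroup_deg_nth: "semigroup_deg ms a $ j = (\<Sum>i<length ms. Poly_Mapping.lookup a i * (ms ! i) $ j)"
  by (simp add: semigroup_deg_def sum_component vector_scalar_mult_def)

lemma semigroup_deg_add: "semigroup_deg ms (a + b) = semigroup_deg ms a + semigroup_deg ms b"
  by (simp add: vec_eq_iff semigroup_deg_nth lookup_add distrib_right sum.distrib)

lemma semigroup_deg_mscale: "semigroup_deg ms (mscale q a) $ j = q * semigroup_deg ms a $ j"
  by (simp add: semigroup_deg_nth lookup_mscale sum_distrib_left mult.assoc)

lemma semigroup_deg_extension:
  "semigroup_deg (extension_gens l m ms) a $ j =
    l * semigroup_deg ms (low (length ms) a) $ j + Poly_Mapping.lookup a (length ms) * m $ j"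
proof -
  have "(\<Sum>i<length ms. Poly_Mapping.lookup a i * (map ((*s) l) ms @ [m]) ! i $ j) =
      (\<Sum>i<length ms. l * (Poly_Mapping.lookup (low (length ms) a) i * ms ! i $ j))"
    by (rule sum.cong) (simp_all add: nth_append lookup_low vector_scalar_mult_def)
  then show ?thesis
    by (simp add: semigroup_deg_nth extension_gens_def nth_append sum_distrib_left)
qed

lemma length_extension_gens [simp]: "length (extension_gens l m ms) = Suc (length ms)"
  by (simp add: extension_gens_def)

definition binomials :: "(nat ^ 'd) list \<Rightarrow> 'k::comm_ring_1 mpoly set"
  where "binomials ms = {Poly_Mapping.single a 1 - Poly_Mapping.single b 1 | a b. a \<in> monomials (length ms) \<and>
    b \<in> monomials (length ms) \<and> semigroup_deg ms a = semigroup_deg ms b}"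

lemma binomials_subset: "binomials ms \<subseteq> PR (length ms)"
  by (auto simp: binomials_def)

lemma toric_ideal_eq: "toric_ideal ms = Idl\<^bsub>mpoly_ring (length ms)\<^esub> (binomials ms)"
  unfolding toric_ideal_def binomials_def ..

lemma ideal_toric_ideal: "ideal (toric_ideal ms :: 'k::comm_ring_1 mpoly set) (mpoly_ring (length ms))"
  unfolding toric_ideal_eq
  by (rule ring.genideal_ideal[OF cring.axioms(1)[OF cring_mpoly_ring] binomials_subset])

lemma toric_ideal_binomial:
  assumes "a \<in> monomials (length ms)" "b \<in> monomials (length ms)" "semigroup_deg ms a = semigroup_deg ms b"
  shows "Poly_Mapping.single a 1 - Poly_Mapping.single b 1 \<in> (toric_ideal ms :: 'k::comm_ring_1 mpoly set)"
  unfolding toric_ideal_eq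
  using ring.genideal_self[OF cring.axioms(1)[OF cring_mpoly_ring] binomials_subset[of ms]] assms
  unfolding binomials_def by blast

lemma toric_ideal_minimal:
  fixes J :: "'k::comm_ring_1 mpoly set"
  assumes "ideal J (mpoly_ring (length ms))"
    "\<And>a b. a \<in> monomials (length ms) \<Longrightarrow> b \<in> monomials (length ms) \<Longrightarrow>
      semigroup_deg ms a = semigroup_deg ms b \<Longrightarrow> Poly_Mapping.single a 1 - Poly_Mapping.single b 1 \<in> J"
  shows "toric_ideal ms \<subseteq> J"
  unfolding toric_ideal_eq
  by (rule ring.genideal_minimal[OF cring.axioms(1)[OF cring_mpoly_ring] assms(1)])
    (use assms(2) in \<open>auto simp: binomials_def\<close>)

lemma PR_initial_form:
  assumes "f \<in> PR n" shows "initial_form f \<in> PR n"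
  unfolding initial_form_eq_hc hc_def by (rule PR_sum) (use assms in \<open>auto simp: mpoly_ring_simps(1)[of f]\<close>)

lemma initial_forms_subset: "{initial_form f | f. f \<in> toric_ideal ms \<and> f \<noteq> 0} \<subseteq> PR (length ms)"
  using PR_initial_form mpoly_idealD(1)[OF ideal_toric_ideal] by blast

lemma ideal_tangent_cone:
  "ideal (tangent_cone_ideal ms :: 'k::comm_ring_1 mpoly set) (mpoly_ring (length ms))"
  unfolding tangent_cone_ideal_def
  by (rule ring.genideal_ideal[OF cring.axioms(1)[OF cring_mpoly_ring] initial_forms_subset])

lemma tangent_cone_initial_form:
  fixes f :: "'k::comm_ring_1 mpoly"
  assumes "f \<in> toric_ideal ms" "f \<noteq> 0"
  shows "initial_form f \<in> tangent_cone_ideal ms"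
  unfolding tangent_cone_ideal_def
  using ring.genideal_self[OF cring.axioms(1)[OF cring_mpoly_ring] initial_forms_subset[of ms]] assms
  by blast

lemma tangent_cone_minimal:
  fixes J :: "'k::comm_ring_1 mpoly set"
  assumes "ideal J (mpoly_ring (length ms))"
    "\<And>f. f \<in> toric_ideal ms \<Longrightarrow> f \<noteq> 0 \<Longrightarrow> initial_form f \<in> J"
  shows "tangent_cone_ideal ms \<subseteq> J"
  unfolding tangent_cone_ideal_def
  by (rule ring.genideal_minimal[OF cring.axioms(1)[OF cring_mpoly_ring] assms(1)])
    (use assms(2) in auto)

text \<open>Contraction to one variable less. Inclusions between the ideals of S and those of its
  extension are proved by minimality, which requires an ideal of the smaller ring as an upper
  bound.\<close>

lemma ideal_Int_PR:
  fixes J :: "'k::comm_ring_1 mpoly set"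
  assumes "ideal J (mpoly_ring (Suc n))"
  shows "ideal (J \<inter> PR n) (mpoly_ring n)"
proof (rule mpoly_idealI)
  note D = mpoly_idealD[OF assms]
  show "r * x \<in> J \<inter> PR n" if "r \<in> PR n" "x \<in> J \<inter> PR n" for r x
    using D(6)[OF PR_Suc[OF that(1)]] that by simp
qed (use mpoly_idealD[OF assms] in auto)

section \<open>The toric ideal and the tangent cone of an extension\<close>

locale tangent_cone_extension =
  fixes ms :: "(nat ^ 'd) list" and m :: "nat ^ 'd" and l :: nat and s :: "nat \<Rightarrow>\<^sub>0 nat" and j0 :: 'd
  assumes s: "s \<in> monomials (length ms)" "semigroup_deg ms s = m"
    and l: "0 < l" "l \<le> total_deg s" and coprime: "coprime l (m $ j0)"
begin

abbreviation n where "n \<equiv> length ms"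
abbreviation ext where "ext \<equiv> extension_gens l m ms"

text \<open>For monomials free of y, the degree in the extension is l times the degree in S, so
  every binomial of S is one of the extension.\<close>

lemma toric_ideal_subset: "toric_ideal ms \<subseteq> (toric_ideal ext :: 'k::comm_ring_1 mpoly set)"
proof -
  have "toric_ideal ms \<subseteq> (toric_ideal ext \<inter> PR n :: 'k mpoly set)"
  proof (rule toric_ideal_minimal)
    show "ideal (toric_ideal ext \<inter> PR n :: 'k mpoly set) (mpoly_ring (length ms))"
      using ideal_toric_ideal[of ext] by (intro ideal_Int_PR) simp
    fix a b assume ab: "a \<in> monomials n" "b \<in> monomials n" "semigroup_deg ms a = semigroup_deg ms b"
    have low: "low n c = c" if "c \<in> monomials n" for c
      using low_split[of c n] monomials_lookup[OF that, of n] by simp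
    have "semigroup_deg ext a = semigroup_deg ext b"
      unfolding vec_eq_iff semigroup_deg_extension
      using ab low monomials_lookup[of _ n n] by simp
    then have "Poly_Mapping.single a 1 - Poly_Mapping.single b 1 \<in> (toric_ideal ext :: 'k mpoly set)"
      using ab monomials_Suc by (intro toric_ideal_binomial) auto
    then show "Poly_Mapping.single a 1 - Poly_Mapping.single b 1 \<in> (toric_ideal ext \<inter> PR n :: 'k mpoly set)" using ab by simp
  qed
  then show ?thesis by blast
qed

lemma tangent_cone_subset: "tangent_cone_ideal ms \<subseteq> (tangent_cone_ideal ext :: 'k::comm_ring_1 mpoly set)"
proof -
  have "tangent_cone_ideal ms \<subseteq> (tangent_cone_ideal ext \<inter> PR n :: 'k mpoly set)"
  proof (rule tangent_cone_minimal)
    show "ideal (tangent_cone_ideal ext \<inter> PR n :: 'k mpoly set) (mpoly_ring (length ms))"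
      using ideal_tangent_cone[of ext] by (intro ideal_Int_PR) simp
    fix f :: "'k mpoly" assume f: "f \<in> toric_ideal ms" "f \<noteq> 0"
    then show "initial_form f \<in> tangent_cone_ideal ext \<inter> PR n"
      using toric_ideal_subset PR_initial_form[OF mpoly_idealD(1)[OF ideal_toric_ideal f(1)]]
      by (auto intro: tangent_cone_initial_form)
  qed
  then show ?thesis by blast
qed

text \<open>It suffices to treat binomials. Coprimality forces the two exponents of y to agree
  modulo l, so both monomials contribute to the same slice; after replacing y^l by x^s that slice is
  again a binomial, and its two monomials have equal degree in S.\<close>

lemma slice_toric:
  assumes "f \<in> toric_ideal ext" "r < l"
  shows "slice n l (Poly_Mapping.single s 1) r f \<in> (toric_ideal ms :: 'k::comm_ring_1 mpoly set)"
proof -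
  let ?K = "{f \<in> PR (Suc n). \<forall>r<l. slice n l (Poly_Mapping.single s 1) r f \<in> (toric_ideal ms :: 'k mpoly set)}"
  have "toric_ideal ext \<subseteq> ?K"
  proof (rule toric_ideal_minimal)
    show "ideal ?K (mpoly_ring (length ext))"
      unfolding length_extension_gens by (rule ideal_slices[OF ideal_toric_ideal _ l(1)]) (simp add: s)
    fix a b assume ab: "a \<in> monomials (length ext)" "b \<in> monomials (length ext)"
      "semigroup_deg ext a = semigroup_deg ext b"
    define a' where "a' = Poly_Mapping.lookup a n"
    define b' where "b' = Poly_Mapping.lookup b n"
    have eq: "l * semigroup_deg ms (low n a) $ j + a' * m $ j = l * semigroup_deg ms (low n b) $ j + b' * m $ j" for j
      using ab(3) unfolding vec_eq_iff semigroup_deg_extension a'_def b'_def by blast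
    \<comment> \<open>In the component j0 the contributions of the generators multiplied by l vanish
      modulo l, and \<open>m $ j0\<close> is invertible modulo l.\<close>
    have mod: "a' mod l = b' mod l"
    proof -
      have "(a' * m $ j0) mod l = (b' * m $ j0) mod l"
        using arg_cong[OF eq[of j0], of "\<lambda>x. x mod l"] by simp
      then have "[a' * m $ j0 = b' * m $ j0] (mod l)" by (simp add: cong_def)
      then have "[a' = b'] (mod l)"
        using coprime by (simp add: cong_mult_rcancel_nat coprime_commute)
      then show ?thesis by (simp add: cong_def)
    qed
    have "slice n l (Poly_Mapping.single s 1) r (Poly_Mapping.single a 1 - Poly_Mapping.single b 1) \<in> (toric_ideal ms :: 'k mpoly set)" for r
    proof (cases "a' mod l = r")
      case False
      then show ?thesis
        using mod mpoly_idealD(2)[OF ideal_toric_ideal[of ms]]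
        by (simp add: slice_minus slice_single slice_term_def a'_def b'_def)
    next
      case True
      let ?a = "low n a + mscale (a' div l) s" and ?b = "low n b + mscale (b' div l) s"
      have "slice n l (Poly_Mapping.single s 1) r (Poly_Mapping.single a 1 - Poly_Mapping.single b 1) = Poly_Mapping.single ?a 1 - (Poly_Mapping.single ?b 1 :: 'k mpoly)"
        using True mod by (simp add: slice_minus slice_single slice_term_def a'_def b'_def single_power mult_single)
      moreover have "Poly_Mapping.single ?a 1 - Poly_Mapping.single ?b 1 \<in> (toric_ideal ms :: 'k mpoly set)"
      proof (rule toric_ideal_binomial)
        show "?a \<in> monomials n" "?b \<in> monomials n" using ab s by simp_all
        have "semigroup_deg ms ?a $ j = semigroup_deg ms ?b $ j" for j
        proof -
          have split: "l * (semigroup_deg ms (low n c) $ j + k div l * m $ j) + (k mod l) * m $ j =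
              l * semigroup_deg ms (low n c) $ j + k * m $ j" for c k
          proof -
            have "k * m $ j = (l * (k div l) + k mod l) * m $ j" by simp
            then show ?thesis by (simp only: distrib_left distrib_right mult.assoc)
          qed
          \<comment> \<open>The equal remainders modulo l cancel. What is left on both sides is
            divisible by l, and l > 0 can be cancelled to obtain equality of degrees in S.\<close>
          have "l * (semigroup_deg ms (low n a) $ j + a' div l * m $ j) =
              l * (semigroup_deg ms (low n b) $ j + b' div l * m $ j)"
            using split[of a a'] split[of b b'] eq[of j] unfolding mod by linarith
          then show ?thesis using l(1) s(2) by (simp add: semigroup_deg_add semigroup_deg_mscale)
        qed
        then show "semigroup_deg ms ?a = semigroup_deg ms ?b" by (simp add: vec_eq_iff)
      qed
      ultimately show ?thesis by simp
    qed
    then show "Poly_Mapping.single a 1 - Poly_Mapping.single b 1 \<in> ?K" using ab by simp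
  qed
  then show ?thesis using assms by blast
qed

definition a0 :: "'k::comm_ring_1 mpoly"
  where "a0 = (if total_deg s = l then Poly_Mapping.single s 1 else 0)"

text \<open>Replacing \<open>y\<^sup>l\<close> by \<open>x\<^sup>s\<close> raises degrees by \<open>|s| - l\<close>, so modulo higher order terms reduction by
  \<open>y\<^sup>l - x\<^sup>s\<close> is reduction by its initial form.\<close>

lemma slice_hc:
  fixes f :: "'k::comm_ring_1 mpoly"
  assumes ge: "\<And>a. a \<in> Poly_Mapping.keys f \<Longrightarrow> d \<le> total_deg a" and r: "r \<le> d" "r < l"
  shows "slice n l a0 r (hc d f) = hc (d - r) (slice n l (Poly_Mapping.single s 1) r f)"
proof -
  have "slice n l a0 r (if total_deg a = d then Poly_Mapping.single a c else 0) =
      hc (d - r) (slice_term n l (Poly_Mapping.single s 1) r a c)" if "d \<le> total_deg a" for a and c :: 'k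
  proof (cases "Poly_Mapping.lookup a n mod l = r")
    case False
    then show ?thesis by (simp add: slice_single slice_term_def)
  next
    case True
    define q where "q = Poly_Mapping.lookup a n div l"
    define e where "e = total_deg (low n a)"
    have q: "Poly_Mapping.lookup a n = q * l + r" using True div_mult_mod_eq[of "Poly_Mapping.lookup a n" l] by (simp add: q_def)
    have deg: "total_deg a = e + (q * l + r)" using total_deg_low[of a n] q by (simp add: e_def)
    have le: "q * l \<le> q * total_deg s" using l by simp
    have rhs: "hc (d - r) (slice_term n l (Poly_Mapping.single s 1) r a c) =
        (if e + q * total_deg s = d - r then Poly_Mapping.single (low n a + mscale q s) c else 0)"
      using True by (simp add: slice_term_def single_power mult_single hc_single total_deg_add
          total_deg_mscale q_def e_def)
    show ?thesis
    proof (cases "total_deg a = d \<and> (q = 0 \<or> total_deg s = l)")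
      case T: True
      then have "e + q * total_deg s = d - r" using deg by auto
      moreover have "slice n l a0 r (if total_deg a = d then Poly_Mapping.single a c else 0) = Poly_Mapping.single (low n a + mscale q s) c"
        using T True by (auto simp: slice_single slice_term_def a0_def single_power mult_single
            simp flip: q_def)
      ultimately show ?thesis using rhs by simp
    next
      case F: False
      have "e + q * total_deg s \<noteq> d - r"
      proof
        assume h: "e + q * total_deg s = d - r"
        then have "e + q * total_deg s + r = d" using r by simp
        \<comment> \<open>Since l \<le> |s|, a term of degree at least d can land in degree d - r
          only if nothing is gained by the replacement: either no y^l was replaced, or |s| =
          l.\<close>
        then have "q * total_deg s \<le> q * l" using that deg by linarith
        then have "q * total_deg s = q * l" using le by (rule antisym)
        then have "total_deg a = d" "q = 0 \<or> total_deg s = l"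
          using \<open>e + q * total_deg s + r = d\<close> deg by auto
        then show False using F by simp
      qed
      moreover have "slice n l a0 r (if total_deg a = d then Poly_Mapping.single a c else 0) = 0"
        using F True by (auto simp: slice_single slice_term_def a0_def zero_power simp flip: q_def)
      ultimately show ?thesis using rhs by simp
    qed
  qed
  then show ?thesis
    using ge unfolding hc_def[of d] slice_sum slice_def[of _ _ "Poly_Mapping.single s 1"] hc_sum by (intro sum.cong) auto
qed

text \<open>With d the order of f, the slice of the initial form is the component of degree d - r of
  the slice of f modulo y^l - x^s. That slice is in the toric ideal of S and has no terms below
  degree d - r, because removing y^r costs r and replacing y^l by x^s loses nothing. So the
  component is zero or an initial form.\<close>

lemma slice_initial_form:
  fixes f :: "'k::comm_ring_1 mpoly"
  assumes f: "f \<in> toric_ideal ext" "f \<noteq> 0" and r: "r < l"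
  shows "slice n l a0 r (initial_form f) \<in> tangent_cone_ideal ms"
proof -
  define d where "d = Min (total_deg ` Poly_Mapping.keys f)"
  have ge: "d \<le> total_deg a" if "a \<in> Poly_Mapping.keys f" for a using that by (simp add: d_def)
  have init: "initial_form f = hc d f" by (simp add: initial_form_eq_hc d_def)
  show ?thesis
  proof (cases "r \<le> d")
    case True
    have "hc (d - r) (slice n l (Poly_Mapping.single s 1) r f) \<in> tangent_cone_ideal ms"
    proof (rule hc_mem_ideal[OF ideal_tangent_cone tangent_cone_initial_form slice_toric[OF f(1) r]])
      fix b assume "b \<in> Poly_Mapping.keys (slice n l (Poly_Mapping.single s 1) r f)"
      then obtain a where a: "a \<in> Poly_Mapping.keys f" "b \<in> Poly_Mapping.keys (slice_term n l (Poly_Mapping.single s 1) r a (Poly_Mapping.lookup f a))"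
        using keys_sum_subset[of "\<lambda>a. slice_term n l (Poly_Mapping.single s 1) r a (Poly_Mapping.lookup f a)" "Poly_Mapping.keys f"]
        unfolding slice_def by blast
      then have q: "Poly_Mapping.lookup a n mod l = r" and b: "b = low n a + mscale (Poly_Mapping.lookup a n div l) s"
        by (auto simp: slice_term_def single_power mult_single split: if_splits)
      have "Poly_Mapping.lookup a n div l * l \<le> Poly_Mapping.lookup a n div l * total_deg s" using l by simp
      moreover have "Poly_Mapping.lookup a n = Poly_Mapping.lookup a n div l * l + r" using q div_mult_mod_eq[of "Poly_Mapping.lookup a n" l] by simp
      ultimately show "d - r \<le> total_deg b"
        using ge[OF a(1)] total_deg_low[of a n] unfolding b total_deg_add total_deg_mscale by linarith
    qed
    then show ?thesis using slice_hc[of f d r, OF ge True r] init by simp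
  next
    case False
    \<comment> \<open>For r > d, a monomial of degree d has an exponent of y less than r, so its
      remainder modulo l cannot be r.\<close>
    have "slice n l a0 r (if total_deg a = d then Poly_Mapping.single a (Poly_Mapping.lookup f a) else 0) = 0" for a
    proof -
      have "Poly_Mapping.lookup a n mod l \<noteq> r" if "total_deg a = d"
      proof
        assume "Poly_Mapping.lookup a n mod l = r"
        moreover have "Poly_Mapping.lookup a n mod l \<le> Poly_Mapping.lookup a n" by simp
        ultimately show False using that total_deg_low[of a n] False by linarith
      qed
      then show ?thesis by (simp add: slice_single slice_term_def)
    qed
    then have "slice n l a0 r (hc d f) = 0" unfolding hc_def slice_sum by (intro sum.neutral) blast
    then show ?thesis unfolding init using mpoly_idealD(2)[OF ideal_tangent_cone[of ms]] by simp
  qed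
qed

lemma a0_PR [simp]: "a0 \<in> PR n"
  using s by (simp add: a0_def)

lemma slice_tangent_cone:
  fixes f :: "'k::comm_ring_1 mpoly"
  assumes "f \<in> tangent_cone_ideal ext" "r < l"
  shows "slice n l a0 r f \<in> tangent_cone_ideal ms"
proof -
  let ?K = "{f \<in> PR (Suc n). \<forall>r<l. slice n l a0 r f \<in> (tangent_cone_ideal ms :: 'k mpoly set)}"
  have "tangent_cone_ideal ext \<subseteq> ?K"
  proof (rule tangent_cone_minimal)
    show "ideal ?K (mpoly_ring (length ext))"
      unfolding length_extension_gens by (rule ideal_slices[OF ideal_tangent_cone a0_PR l(1)])
    fix f :: "'k mpoly" assume f: "f \<in> toric_ideal ext" "f \<noteq> 0"
    have "f \<in> PR (Suc n)" using mpoly_idealD(1)[OF ideal_toric_ideal f(1)] by simp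
    then show "initial_form f \<in> ?K" using slice_initial_form[OF f] PR_initial_form by blast
  qed
  then show ?thesis using assms by blast
qed

text \<open>y^l and x^s both have degree l m in the extension, so their difference is in the toric
  ideal; y^l - a0 is its initial form.\<close>

lemma yvar_tangent_cone: "yvar n ^ l - a0 \<in> (tangent_cone_ideal ext :: 'k::comm_ring_1 mpoly set)"
proof -
  let ?f = "Poly_Mapping.single (Poly_Mapping.single n l) 1 - Poly_Mapping.single s 1 :: 'k mpoly"
  have low: "low n s = s" "Poly_Mapping.lookup s n = 0"
    using low_split[of s n] monomials_lookup[OF s(1), of n] by simp_all
  have low': "low n (Poly_Mapping.single n l) = 0" using low_single[of n l 0] by (simp add: low_def)
  have ne: "Poly_Mapping.single n l \<noteq> s" using low(2) l(1) by (metis lookup_single_eq not_less0)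
  have "semigroup_deg ext (Poly_Mapping.single n l) = semigroup_deg ext s"
    unfolding vec_eq_iff semigroup_deg_extension using s(2) low low' by (simp add: semigroup_deg_nth)
  then have f: "?f \<in> toric_ideal ext" using s monomials_Suc by (intro toric_ideal_binomial) auto
  have keys: "Poly_Mapping.keys ?f = {Poly_Mapping.single n l, s}"
    using ne by (auto simp: in_keys_iff lookup_minus lookup_single when_def split: if_splits)
  then have ne0: "?f \<noteq> 0" by auto
  \<comment> \<open>Here l \<le> |s| decides that y^l belongs to the initial form.\<close>
  have "Min (total_deg ` Poly_Mapping.keys ?f) = l" unfolding keys using l by simp
  then have "initial_form ?f = hc l ?f" by (simp add: initial_form_eq_hc)
  also have "\<dots> = hc l (Poly_Mapping.single (Poly_Mapping.single n l) 1) - hc l (Poly_Mapping.single s 1)"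
    using hc_add[of l ?f "Poly_Mapping.single s 1"] by (simp add: algebra_simps)
  also have "\<dots> = yvar n ^ l - a0" by (simp add: hc_single a0_def yvar_power)
  finally show ?thesis using tangent_cone_initial_form[OF f ne0] by simp
qed

lemma frobenius_tangent_cone:
  assumes "noetherian_ring (tangent_cone_ring ms :: 'k::comm_ring_1 mpoly set ring)"
  shows "\<exists>\<phi> u v \<pi>. frobenius_extension (tangent_cone_ring ms :: 'k mpoly set ring)
    (tangent_cone_ring ext :: 'k mpoly set ring) \<phi> l u v \<pi>"
  unfolding tangent_cone_ring_def length_extension_gens
  by (rule frobenius_quotient[OF ideal_tangent_cone _ a0_PR l(1) tangent_cone_subset yvar_tangent_cone
      slice_tangent_cone assms[unfolded tangent_cone_ring_def]])
    (use ideal_tangent_cone[of ext] in simp)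

end

text \<open>Every nonzero generator has component sum at least 1. This bounds the length of all
  factorizations of a given element, so that the maximum defining \<open>max_length\<close> is taken
  over a finite set.\<close>

lemma total_deg_le_semigroup_deg:
  assumes "\<forall>v\<in>set ms. v \<noteq> 0" "a \<in> monomials (length ms)"
  shows "total_deg a \<le> (\<Sum>j\<in>UNIV. semigroup_deg ms a $ j)"
proof -
  have "total_deg a = (\<Sum>i<length ms. Poly_Mapping.lookup a i * 1)" using total_deg_eq[OF assms(2)] by simp
  also have "\<dots> \<le> (\<Sum>i<length ms. Poly_Mapping.lookup a i * (\<Sum>j\<in>UNIV. (ms ! i) $ j))"
  proof (rule sum_mono)
    fix i assume "i \<in> {..<length ms}"
    then have "ms ! i \<noteq> 0" using assms(1) nth_mem by blast
    then obtain j where "(ms ! i) $ j \<noteq> 0" by (auto simp: vec_eq_iff)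
    moreover have "(ms ! i) $ j \<le> (\<Sum>j\<in>UNIV. (ms ! i) $ j)" by (rule member_le_sum) simp_all
    ultimately show "Poly_Mapping.lookup a i * 1 \<le> Poly_Mapping.lookup a i * (\<Sum>j\<in>UNIV. (ms ! i) $ j)" by simp
  qed
  also have "\<dots> = (\<Sum>j\<in>UNIV. semigroup_deg ms a $ j)"
    unfolding semigroup_deg_nth sum_distrib_left by (rule sum.swap)
  finally show ?thesis .
qed

theorem theorem3p2:
  fixes ms :: "(nat ^ 'd) list" and m :: "nat ^ 'd" and l :: nat
  assumes nonzero: "\<forall>v \<in> set ms. v \<noteq> 0"
    and extension: "is_extension l m ms"
    and l_le: "l \<le> max_length ms m"
  shows "(cohen_macaulay (tangent_cone_ring ms :: 'k::alg_closed_field mpoly set ring) \<longrightarrow>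
      cohen_macaulay (tangent_cone_ring (extension_gens l m ms) :: 'k mpoly set ring)) \<and>
    (gorenstein (tangent_cone_ring ms :: 'k mpoly set ring) \<longrightarrow>
      gorenstein (tangent_cone_ring (extension_gens l m ms) :: 'k mpoly set ring))"
proof -
  let ?X = "{total_deg s | s. s \<in> monomials (length ms) \<and> semigroup_deg ms s = m}"
  obtain j0 where l: "0 < l" "coprime l (m $ j0)" and m: "m \<in> affine_semigroup ms"
    using extension unfolding is_extension_def by blast
  \<comment> \<open>\<open>Max\<close> is meaningful only on a finite nonempty set; once both are
    known it is attained, and s is a factorization of m of maximal length, hence of length at least
    l.\<close>
  have "?X \<subseteq> {..(\<Sum>j\<in>UNIV. m $ j)}" using total_deg_le_semigroup_deg[OF nonzero] by auto
  then have "finite ?X" by (rule finite_subset) simp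
  moreover have "?X \<noteq> {}" using m unfolding affine_semigroup_def by blast
  ultimately have "Max ?X \<in> ?X" by (rule Max_in)
  then obtain s where s: "s \<in> monomials (length ms)" "semigroup_deg ms s = m" "total_deg s = max_length ms m"
    unfolding max_length_def by auto
  interpret tangent_cone_extension ms m l s j0
    by unfold_locales (use s l l_le in simp_all)
  have "cohen_macaulay (tangent_cone_ring ext :: 'k mpoly set ring)"
    if CM: "cohen_macaulay (tangent_cone_ring ms :: 'k mpoly set ring)"
  proof -
    have "noetherian_ring (tangent_cone_ring ms :: 'k mpoly set ring)"
      using CM by (simp add: cohen_macaulay_def)
    then obtain \<phi> u v \<pi> where "frobenius_extension (tangent_cone_ring ms :: 'k mpoly set ring)
        (tangent_cone_ring ext :: 'k mpoly set ring) \<phi> l u v \<pi>"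
      using frobenius_tangent_cone by blast
    then show ?thesis using CM by (rule frobenius_extension.cohen_macaulay_transfer)
  qed
  moreover have "gorenstein (tangent_cone_ring ext :: 'k mpoly set ring)"
    if G: "gorenstein (tangent_cone_ring ms :: 'k mpoly set ring)"
  proof -
    have "noetherian_ring (tangent_cone_ring ms :: 'k mpoly set ring)"
      using G by (simp add: gorenstein_def)
    then obtain \<phi> u v \<pi> where "frobenius_extension (tangent_cone_ring ms :: 'k mpoly set ring)
        (tangent_cone_ring ext :: 'k mpoly set ring) \<phi> l u v \<pi>"
      using frobenius_tangent_cone by blast
    then show ?thesis using G by (rule gorenstein_transfer)
  qed
  ultimately show ?thesis by blast
qed

end
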